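(* The following holds for rotational Beltrami $(-\alpha)$-homogeneous solutions of the stationary incompressible Euler equations. (i) For $1\leq \alpha\leq 2$, no such solutions $(u,p)\in C^{1}(\mathbb{R}^{3}\setminus\{0\})$ exist. (ii) For $\alpha<1$, no such solutions $(u,p)\in C^{2}(\mathbb{R}^{3}\setminus\{0\})$ exist. (iii) For every $\alpha>2$, there exist such solutions $(u,p)\in C^{1}(\mathbb{R}^{3}\setminus\{0\})$ which are axisymmetric and satisfy $u^{P},p\in C^{2}(\mathbb{R}^{3}\setminus\{0\})$ and $u^{\phi}e_{\phi}\in C^{1}(\mathbb{R}^{3}\setminus\{0\})$. (iv) For every $\alpha<0$, there exist such solutions $(u,p)\in C(\mathbb{R}^{3})$ (in the distributional sense in $\mathbb{R}^3$) which are axisymmetric and satisfy $u^{P},p\in C^{1}(\mathbb{R}^{3}\setminus\{r=0\})\cap C(\mathbb{R}^{3})$ and $u^{\phi}e_{\phi}\in C(\mathbb{R}^{3})$.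
   Context: The stationary Euler equations are $u\cdot\nabla u+\nabla p=0$, $\nabla\cdot u=0$ for $u=(u^1,u^2,u^3)$ and scalar $p$. A pair $(u,p)$ is a $(-\alpha)$-homogeneous solution ($\alpha\in\mathbb{R}$) if it solves these equations and, for all $\lambda>0$, $u(x)=\lambda^{\alpha}u(\lambda x)$ and $p(x)=\lambda^{2\alpha}p(\lambda x)$. Solutions $(u,p)\in C^1(\mathbb{R}^3\setminus\{0\})$ or $C^2(\mathbb{R}^3\setminus\{0\})$ satisfy the equations classically in $\mathbb{R}^3\setminus\{0\}$ (no continuity at $0$ is assumed). Solutions $(u,p)\in C(\mathbb{R}^3)$, considered for $\alpha<0$, satisfy the equations in $\mathbb{R}^3$ in the distributional sense (with $u\cdot\nabla u=\nabla\cdot(u\otimes u)$). The Bernoulli function is $\Pi=p+|u|^2/2$. A solution in $C^1(\mathbb{R}^3\setminus\{0\})$ is Beltrami if $(\nabla\times u)\times u=0$; a $(-\alpha)$-homogeneous solution $(u,p)\in C(\mathbb{R}^3)$ with $\alpha<0$ is called Beltrami if $\Pi\equiv 0$. A solution is irrotational if $\nabla\times u=0$, and rotational if it is not irrotational. Cylindrical coordinates: $x_1=r\cos\phi$, $x_2=r\sin\phi$, $x_3=z$, with the frame $e_r=(\cos\phi,\sin\phi,0)$, $e_\phi=(-\sin\phi,\cos\phi,0)$, $e_z=(0,0,1)$. A solution is axisymmetric if $u=u^re_r+u^\phi e_\phi+u^ze_z$ with $u^r,u^\phi,u^z,p$ independent of $\phi$; its poloidal part is $u^P=u^re_r+u^ze_z$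 and its toroidal part is $u^\phi e_\phi$. *)

theory Defs
  imports "HOL-Analysis.Analysis" "HOL-Analysis.Cross3"
begin

section \<open>Regularity classes and differential operators\<close>

text \<open>The class \<open>C\<^sup>k\<close> on an open set \<open>S\<close>: all iterated directional derivatives of order at
  most \<open>k\<close> exist and are continuous. The derivative is taken with respect to the full
  neighbourhood filter, so \<open>S\<close> should be open.\<close>

primrec Ck_on :: "nat \<Rightarrow> ('a::real_normed_vector \<Rightarrow> 'b::real_normed_vector) \<Rightarrow> 'a set \<Rightarrow> bool"
where
  "Ck_on 0 f S \<longleftrightarrow> continuous_on S f"
| "Ck_on (Suc k) f S \<longleftrightarrow>
     (\<forall>x\<in>S. f differentiable (at x)) \<and> (\<forall>v. Ck_on k (\<lambda>x. frechet_derivative f (at x) v) S)"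

definition partial :: "3 \<Rightarrow> (real^3 \<Rightarrow> 'b::real_normed_vector) \<Rightarrow> real^3 \<Rightarrow> 'b" where
  "partial i f x = frechet_derivative f (at x) (axis i 1)"

definition grad :: "(real^3 \<Rightarrow> real) \<Rightarrow> real^3 \<Rightarrow> real^3" where
  "grad f x = (\<chi> i. partial i f x)"

definition divg :: "(real^3 \<Rightarrow> real^3) \<Rightarrow> real^3 \<Rightarrow> real" where
  "divg u x = (\<Sum>i\<in>UNIV. partial i u x $ i)"

definition curl :: "(real^3 \<Rightarrow> real^3) \<Rightarrow> real^3 \<Rightarrow> real^3" where
  "curl u x = vector [partial 2 u x $ 3 - partial 3 u x $ 2,
                      partial 3 u x $ 1 - partial 1 u x $ 3,
                      partial 1 u x $ 2 - partial 2 u x $ 1]"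

definition advection :: "(real^3 \<Rightarrow> real^3) \<Rightarrow> real^3 \<Rightarrow> real^3" where
  "advection u x = (\<Sum>j\<in>UNIV. u x $ j *\<^sub>R partial j u x)"

definition test_function :: "(real^3 \<Rightarrow> 'b::real_normed_vector) \<Rightarrow> bool" where
  "test_function \<phi> \<longleftrightarrow> (\<forall>k. Ck_on k \<phi> UNIV) \<and> compact (closure {x. \<phi> x \<noteq> 0})"


section \<open>Homogeneous solutions of the stationary Euler equations\<close>

text \<open>Fields are total functions on \<open>\<real>\<^sup>3\<close>. For solutions in \<open>\<real>\<^sup>3 - {0}\<close> the value at the origin
  is irrelevant: every condition below is restricted to the set \<open>S\<close> passed to it, or to
  \<open>- {0}\<close>.\<close>

definition homogeneous_on :: "(real^3) set \<Rightarrow> real \<Rightarrow> (real^3 \<Rightarrow> real^3) \<Rightarrow> (real^3 \<Rightarrow> real) \<Rightarrow> bool"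
where
  "homogeneous_on S \<alpha> u p \<longleftrightarrow>
     (\<forall>x\<in>S. \<forall>l>0. u x = (l powr \<alpha>) *\<^sub>R u (l *\<^sub>R x) \<and> p x = (l powr (2 * \<alpha>)) * p (l *\<^sub>R x))"

definition euler_classical :: "(real^3 \<Rightarrow> real^3) \<Rightarrow> (real^3 \<Rightarrow> real) \<Rightarrow> bool" where
  "euler_classical u p \<longleftrightarrow> (\<forall>x\<in>-{0}. advection u x + grad p x = 0 \<and> divg u x = 0)"

text \<open>Distributional form in \<open>\<real>\<^sup>3\<close> of \<open>\<nabla>\<cdot>(u \<otimes> u) + \<nabla>p = 0\<close> and \<open>\<nabla>\<cdot>u = 0\<close>: the equations
  are tested against vector fields and scalar functions respectively, with all derivatives moved
  to the test function. It is meant for continuous \<open>u\<close> and \<open>p\<close>, for which the integrands are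
  continuous with compact support.\<close>

definition euler_weak :: "(real^3 \<Rightarrow> real^3) \<Rightarrow> (real^3 \<Rightarrow> real) \<Rightarrow> bool" where
  "euler_weak u p \<longleftrightarrow>
     (\<forall>\<phi>::real^3 \<Rightarrow> real^3. test_function \<phi> \<longrightarrow>
        (LINT x|lborel. (\<Sum>i\<in>UNIV. \<Sum>j\<in>UNIV. u x $ i * u x $ j * partial j \<phi> x $ i)
                        + p x * divg \<phi> x) = 0) \<and>
     (\<forall>\<psi>::real^3 \<Rightarrow> real. test_function \<psi> \<longrightarrow> (LINT x|lborel. u x \<bullet> grad \<psi> x) = 0)"

definition classical_solution :: "nat \<Rightarrow> real \<Rightarrow> (real^3 \<Rightarrow> real^3) \<Rightarrow> (real^3 \<Rightarrow> real) \<Rightarrow> bool" where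
  "classical_solution k \<alpha> u p \<longleftrightarrow>
     Ck_on k u (-{0}) \<and> Ck_on k p (-{0}) \<and> euler_classical u p \<and> homogeneous_on (-{0}) \<alpha> u p"

definition weak_solution :: "real \<Rightarrow> (real^3 \<Rightarrow> real^3) \<Rightarrow> (real^3 \<Rightarrow> real) \<Rightarrow> bool" where
  "weak_solution \<alpha> u p \<longleftrightarrow>
     continuous_on UNIV u \<and> continuous_on UNIV p \<and> euler_weak u p \<and> homogeneous_on UNIV \<alpha> u p"


section \<open>Beltrami and rotational solutions\<close>

definition bernoulli :: "(real^3 \<Rightarrow> real^3) \<Rightarrow> (real^3 \<Rightarrow> real) \<Rightarrow> real^3 \<Rightarrow> real" where
  "bernoulli u p x = p x + (norm (u x))\<^sup>2 / 2"

definition beltrami_classical :: "(real^3 \<Rightarrow> real^3) \<Rightarrow> bool" where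
  "beltrami_classical u \<longleftrightarrow> (\<forall>x\<in>-{0}. cross3 (curl u x) (u x) = 0)"

definition beltrami_weak :: "(real^3 \<Rightarrow> real^3) \<Rightarrow> (real^3 \<Rightarrow> real) \<Rightarrow> bool" where
  "beltrami_weak u p \<longleftrightarrow> (\<forall>x. bernoulli u p x = 0)"

definition irrotational_classical :: "(real^3 \<Rightarrow> real^3) \<Rightarrow> bool" where
  "irrotational_classical u \<longleftrightarrow> (\<forall>x\<in>-{0}. curl u x = 0)"

text \<open>For a merely continuous field, \<open>\<nabla>\<times>u = 0\<close> is understood in the sense of distributions.\<close>

definition irrotational_weak :: "(real^3 \<Rightarrow> real^3) \<Rightarrow> bool" where
  "irrotational_weak u \<longleftrightarrow>
     (\<forall>\<phi>::real^3 \<Rightarrow> real^3. test_function \<phi> \<longrightarrow> (LINT x|lborel. u x \<bullet> curl \<phi> x) = 0)"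


section \<open>Axisymmetry\<close>

definition e_r :: "real \<Rightarrow> real^3" where
  "e_r \<phi> = vector [cos \<phi>, sin \<phi>, 0]"

definition e_phi :: "real \<Rightarrow> real^3" where
  "e_phi \<phi> = vector [- sin \<phi>, cos \<phi>, 0]"

definition e_z :: "real^3" where
  "e_z = vector [0, 0, 1]"

definition cyl :: "real \<Rightarrow> real \<Rightarrow> real \<Rightarrow> real^3" where
  "cyl r \<phi> z = vector [r * cos \<phi>, r * sin \<phi>, z]"

definition z_axis :: "(real^3) set" where
  "z_axis = {x. x $ 1 = 0 \<and> x $ 2 = 0}"

text \<open>Including \<open>r = 0\<close> forces \<open>u\<close> to be parallel to the axis on the axis, as holds
  automatically for continuous \<open>u\<close>.\<close>

definition axisymmetric_on :: "(real^3) set \<Rightarrow> (real^3 \<Rightarrow> real^3) \<Rightarrow> (real^3 \<Rightarrow> real) \<Rightarrow> bool"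
where
  "axisymmetric_on S u p \<longleftrightarrow>
     (\<exists>ur uphi uz q :: real \<Rightarrow> real \<Rightarrow> real. \<forall>r\<ge>0. \<forall>\<phi> z. cyl r \<phi> z \<in> S \<longrightarrow>
        u (cyl r \<phi> z) = ur r z *\<^sub>R e_r \<phi> + uphi r z *\<^sub>R e_phi \<phi> + uz r z *\<^sub>R e_z \<and>
        p (cyl r \<phi> z) = q r z)"

text \<open>On the axis, where \<open>\<phi>\<close> is not determined by \<open>x\<close>, the choice \<open>azimuth x = 0\<close> is harmless:
  there an axisymmetric field is parallel to \<open>e_z\<close>, so it is equal to its poloidal part for
  every choice of \<open>\<phi>\<close>.\<close>

definition azimuth :: "real^3 \<Rightarrow> real" where
  "azimuth x = Arg2pi (Complex (x $ 1) (x $ 2))"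

definition poloidal :: "(real^3 \<Rightarrow> real^3) \<Rightarrow> real^3 \<Rightarrow> real^3" where
  "poloidal u x = (u x \<bullet> e_r (azimuth x)) *\<^sub>R e_r (azimuth x) + (u x \<bullet> e_z) *\<^sub>R e_z"

definition toroidal :: "(real^3 \<Rightarrow> real^3) \<Rightarrow> real^3 \<Rightarrow> real^3" where
  "toroidal u x = (u x \<bullet> e_phi (azimuth x)) *\<^sub>R e_phi (azimuth x)"

end

theory Submission
  imports Defs
begin

text \<open>A Beltrami field satisfies \<open>u \<sqdot> \<nabla>u = \<nabla>\<bar>u\<bar>\<^sup>2 / 2\<close>, so with homogeneity the radial component
  \<open>F = x \<sqdot> u\<close> obeys \<open>u \<sqdot> \<nabla>F = (1 - \<alpha>) \<bar>u\<bar>\<^sup>2\<close>. Multiplying by a power of \<open>\<bar>x\<bar>\<close> and integrating over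
  shells gives a sign-definite integral identity when \<open>1 \<le> \<alpha> \<le> 2\<close>, which forces \<open>u\<close> to be tangential,
  radial or zero, hence irrotational. For \<open>\<alpha> < 1\<close> the degree \<open>0\<close> function \<open>f = \<bar>x\<bar> powr (\<alpha> - 1) * F\<close>
  increases along the flow, while the proportionality factor \<open>\<psi>\<close> in \<open>curl u = \<psi> u\<close> is transported; the
  function \<open>(\<bar>x\<bar> \<psi>)\<^sup>2\<close>, also of degree \<open>0\<close>, grows along the flow where \<open>F > 0\<close> and so cannot attain a positive
  maximum over \<open>{f \<ge> c}\<close> on the sphere.

  Axisymmetric Beltrami fields come from a stream function \<open>\<bar>x\<bar> powr (- \<beta>) * w (x\<^sub>3 / \<bar>x\<bar>)\<close> with
  \<open>\<beta> = \<alpha> - 2\<close>; the Grad-Shafranov equation becomes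
  \<open>(1 - t\<^sup>2) w'' + \<beta> (\<beta> + 1) w + \<kappa> w \<bar>w\<bar> powr (2 / \<beta>) = 0\<close> on \<open>[-1, 1]\<close> with zero boundary values. The
  constant \<open>\<kappa>\<close> may differ from one nodal interval of \<open>w\<close> to the next: this turns the boundary value
  problem into one for positive solutions on short intervals, which are rescaled and glued at their zeros.
  The equation is superlinear for \<open>\<beta> > 0\<close> (shooting in \<open>\<kappa>\<close>) and sublinear for \<open>\<beta> < -2\<close> (monotone
  iteration with the Green function). In the latter case \<open>r u\<^sup>\<phi>\<close>, as a function of the stream function, is
  not Lipschitz at the nodal set and the axis is singular; both are removed by cutoffs in the
  distributional equations.\<close>

section \<open>Differential calculus and integration by parts\<close>

text \<open>The factor \<kappa> can jump because \<open>r u^phi\<close> is a function of the stream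
  function; homogeneity fixes that function up to a factor on each component of the set where the
  stream function is nonzero, and it vanishes at the nodes, so the factors are independent. The
  freedom is needed: with \<kappa> > 0, multiplying the equation by
  \<open>(1 - t^2) / (1 - t^2)\<close> and integrating by parts against the first eigenfunction
  \<open>1 - t^2\<close> shows that a positive profile on all of [-1, 1] would force \<beta>
  (\<beta> + 1) < 2, which fails for \<beta> \<ge> 1 and for \<beta> < -2. Sign changes are
  therefore unavoidable, and multiplying a piece by a constant to match slopes changes its \<kappa>.

  The other obstacle is the pair of poles t = 1 and t = -1. The equation degenerates there, and
  smoothness in x of a function of the polar angle is governed by
  \<open>r^2 = \<bar>x\<bar>^2 (1 - t^2)\<close>; quotients by \<open>1 - t^2\<close> are therefore
  extended to the poles by their limits.

  In the weak equations, \<open>u \<otimes> u\<close> splits into terms even in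
  \<open>u^phi\<close>, which are C^1 off the axis, and terms linear in it; only the latter need a
  cutoff at the nodes.\<close>

lemma Ck_on_cong:
  assumes "open S" "\<And>x. x \<in> S \<Longrightarrow> f x = g x" "Ck_on k f S"
  shows "Ck_on k g S"
  using assms(2,3)
proof (induction k arbitrary: f g)
  case 0
  then show ?case by (simp cong: continuous_on_cong)
next
  case (Suc k)
  have D: "(g has_derivative frechet_derivative f (at x)) (at x)" if "x \<in> S" for x
  proof (rule has_derivative_transform_within_open[OF _ assms(1) that Suc.prems(1)])
    show "(f has_derivative frechet_derivative f (at x)) (at x)"
      using Suc.prems(2) that by (simp add: frechet_derivative_works)
  qed
  have E: "frechet_derivative f (at x) v = frechet_derivative g (at x) v" if "x \<in> S" for x v
    using frechet_derivative_at[OF D[OF that]] by simp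
  have "Ck_on k (\<lambda>x. frechet_derivative f (at x) v) S" for v
    using Suc.prems(2) by simp
  from Suc.IH[OF E this] have "Ck_on k (\<lambda>x. frechet_derivative g (at x) v) S" for v .
  then show ?case using D unfolding Ck_on.simps differentiable_def by blast
qed

lemma Ck_on_SucI:
  assumes "open S" "\<And>x. x \<in> S \<Longrightarrow> (f has_derivative f' x) (at x)" "\<And>v. Ck_on k (\<lambda>x. f' x v) S"
  shows "Ck_on (Suc k) f S"
proof -
  have E: "f' x v = frechet_derivative f (at x) v" if "x \<in> S" for x v
    using frechet_derivative_at[OF assms(2)[OF that]] by simp
  have "Ck_on k (\<lambda>x. frechet_derivative f (at x) v) S" for v
    using Ck_on_cong[OF assms(1) E assms(3)] .
  then show ?thesis using assms(2) unfolding Ck_on.simps differentiable_def by blast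
qed

lemma Ck_on_SucD:
  assumes "Ck_on (Suc k) f S"
  shows "x \<in> S \<Longrightarrow> (f has_derivative frechet_derivative f (at x)) (at x)"
    and "Ck_on k (\<lambda>x. frechet_derivative f (at x) v) S"
  using assms by (auto simp: frechet_derivative_works)

lemma Ck_on_imp_continuous_on: "Ck_on k f S \<Longrightarrow> continuous_on S f"
  by (cases k) (auto intro!: differentiable_imp_continuous_on differentiable_at_imp_differentiable_on)

lemma Ck_on_weaken: "Ck_on (Suc k) f S \<Longrightarrow> Ck_on k f S"
proof (induction k arbitrary: f)
  case 0
  then show ?case using Ck_on_imp_continuous_on by (metis Ck_on.simps(1))
qed simp

lemma Ck_on_antimono: "Ck_on m f S \<Longrightarrow> k \<le> m \<Longrightarrow> Ck_on k f S"
proof (induction m)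
  case (Suc m)
  show ?case
  proof (cases "k = Suc m")
    case False
    then have "k \<le> m" using Suc.prems by linarith
    from Suc.IH[OF Ck_on_weaken[OF Suc.prems(1)] this] show ?thesis .
  qed (use Suc.prems in blast)
qed simp

lemma Ck_on_subset: "Ck_on k f S \<Longrightarrow> T \<subseteq> S \<Longrightarrow> Ck_on k f T"
  by (induction k arbitrary: f) (auto intro: continuous_on_subset)

lemma Ck_on_Un:
  assumes "open S" "open T"
  shows "Ck_on k f S \<Longrightarrow> Ck_on k f T \<Longrightarrow> Ck_on k f (S \<union> T)"
  by (induction k arbitrary: f) (use assms in \<open>auto intro: continuous_on_open_Un\<close>)

lemma Ck_on_const [simp]: "open S \<Longrightarrow> Ck_on k (\<lambda>x. c) S"
proof (induction k arbitrary: c)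
  case (Suc k)
  then show ?case by (intro Ck_on_SucI[where f'="\<lambda>x v. 0"]) auto
qed simp

lemma Ck_on_bounded_linear:
  assumes "open S" "bounded_linear f"
  shows "Ck_on k f S"
proof (cases k)
  case 0
  then show ?thesis using assms by (simp add: linear_continuous_on)
next
  case (Suc m)
  then show ?thesis using assms
    by (auto intro!: Ck_on_SucI[where f'="\<lambda>x. f"] simp del: Ck_on.simps
        intro: bounded_linear_imp_has_derivative)
qed

lemma Ck_on_linear_compose:
  assumes "open S" "bounded_linear L"
  shows "Ck_on k f S \<Longrightarrow> Ck_on k (\<lambda>x. L (f x)) S"
proof (induction k arbitrary: f)
  case 0
  then show ?case using assms bounded_linear.continuous_on by auto
next
  case (Suc k)
  show ?case
  proof (rule Ck_on_SucI[OF assms(1)])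
    show "((\<lambda>x. L (f x)) has_derivative (\<lambda>v. L (frechet_derivative f (at x) v))) (at x)"
      if "x \<in> S" for x
      using Ck_on_SucD(1)[OF Suc.prems that] bounded_linear.has_derivative[OF assms(2)] by blast
    show "Ck_on k (\<lambda>x. L (frechet_derivative f (at x) v)) S" for v
      using Suc.IH Ck_on_SucD(2)[OF Suc.prems] by blast
  qed
qed

lemma Ck_on_add:
  assumes "open S"
  shows "Ck_on k f S \<Longrightarrow> Ck_on k g S \<Longrightarrow> Ck_on k (\<lambda>x. f x + g x) S"
proof (induction k arbitrary: f g)
  case (Suc k)
  show ?case
  proof (rule Ck_on_SucI[OF assms])
    show "((\<lambda>x. f x + g x) has_derivative
        (\<lambda>v. frechet_derivative f (at x) v + frechet_derivative g (at x) v)) (at x)" if "x \<in> S" for x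
      using that by (intro has_derivative_add Ck_on_SucD(1)[OF Suc.prems(1)] Ck_on_SucD(1)[OF Suc.prems(2)])
    show "Ck_on k (\<lambda>x. frechet_derivative f (at x) v + frechet_derivative g (at x) v) S" for v
      by (intro Suc.IH Ck_on_SucD(2)[OF Suc.prems(1)] Ck_on_SucD(2)[OF Suc.prems(2)])
  qed
qed (auto intro: continuous_on_add)

lemma Ck_on_uminus:
  assumes "open S" "Ck_on k f S" shows "Ck_on k (\<lambda>x. - f x) S"
  using Ck_on_linear_compose[OF assms(1) bounded_linear_minus[OF bounded_linear_ident] assms(2)] .

lemma Ck_on_diff:
  assumes "open S" "Ck_on k f S" "Ck_on k g S" shows "Ck_on k (\<lambda>x. f x - g x) S"
  using Ck_on_add[OF assms(1,2) Ck_on_uminus[OF assms(1,3)]] by simp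

lemma Ck_on_bilinear:
  assumes "open S" "bounded_bilinear B"
  shows "Ck_on k f S \<Longrightarrow> Ck_on k g S \<Longrightarrow> Ck_on k (\<lambda>x. B (f x) (g x)) S"
proof (induction k arbitrary: f g)
  case 0
  then show ?case using bounded_bilinear.continuous_on[OF assms(2)] by auto
next
  case (Suc k)
  show ?case
  proof (rule Ck_on_SucI[OF assms(1)])
    show "((\<lambda>x. B (f x) (g x)) has_derivative
        (\<lambda>v. B (f x) (frechet_derivative g (at x) v) + B (frechet_derivative f (at x) v) (g x))) (at x)"
      if "x \<in> S" for x
      using that by (intro bounded_bilinear.FDERIV[OF assms(2)] Ck_on_SucD(1)[OF Suc.prems(1)]
          Ck_on_SucD(1)[OF Suc.prems(2)])
    show "Ck_on k (\<lambda>x. B (f x) (frechet_derivative g (at x) v) + B (frechet_derivative f (at x) v) (g x)) S" for v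
      by (intro Ck_on_add assms(1) Suc.IH Ck_on_SucD(2)[OF Suc.prems(1)] Ck_on_SucD(2)[OF Suc.prems(2)]
          Suc.prems[THEN Ck_on_weaken])
  qed
qed

lemmas Ck_on_mult = Ck_on_bilinear[OF _ bounded_bilinear_mult]
lemmas Ck_on_scaleR = Ck_on_bilinear[OF _ bounded_bilinear_scaleR]
lemmas Ck_on_inner = Ck_on_bilinear[OF _ bounded_bilinear_inner]

lemma Ck_on_nth:
  fixes f :: "'a::real_normed_vector \<Rightarrow> real^'n"
  assumes "open S" "Ck_on k f S" shows "Ck_on k (\<lambda>x. f x $ i) S"
  using Ck_on_linear_compose[OF assms(1) bounded_linear_vec_nth assms(2)] .

lemma Ck_on_nth_ident: "open S \<Longrightarrow> Ck_on k (\<lambda>x::real^'n. x $ i) S"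
  by (intro Ck_on_bounded_linear bounded_linear_vec_nth)

lemma vec3_eq: "(x::real^3) = vector [x$1, x$2, x$3]"
  by (simp add: vec_eq_iff forall_3)

lemma vector3_eq_sum:
  "(vector [a, b, c] :: real^3) = a *\<^sub>R axis 1 1 + b *\<^sub>R axis 2 1 + c *\<^sub>R axis 3 1"
  unfolding vec_eq_iff forall_3 by (simp add: axis_def)

lemma Ck_on_vector3:
  assumes "open S" "Ck_on k a S" "Ck_on k b S" "Ck_on k c S"
  shows "Ck_on k (\<lambda>x. vector [a x, b x, c x] :: real^3) S"
  unfolding vector3_eq_sum
  by (intro Ck_on_add Ck_on_scaleR assms Ck_on_const)

text \<open>Differentiating replaces \<open>F n\<close> by \<open>F (Suc n)\<close>, so the
  induction on the order must cover all members of the sequence of outer derivatives at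
  once.\<close>

lemma Ck_on_tower:
  fixes f :: "'a::real_normed_vector \<Rightarrow> real"
  assumes "open S" "\<And>n t. t \<in> T \<Longrightarrow> (F n has_real_derivative F (Suc n) t) (at t)" "f ` S \<subseteq> T"
  shows "Ck_on k f S \<Longrightarrow> Ck_on k (\<lambda>x. F n (f x) :: real) S"
proof (induction k arbitrary: n)
  case 0
  have "continuous_on T (F n)"
    using assms(2) DERIV_isCont continuous_at_imp_continuous_on by blast
  then show ?case using 0 assms(3) continuous_on_compose2 by (metis Ck_on.simps(1))
next
  case (Suc k)
  show ?case
  proof (rule Ck_on_SucI[OF assms(1)])
    show "((\<lambda>x. F n (f x)) has_derivative (\<lambda>v. F (Suc n) (f x) * frechet_derivative f (at x) v)) (at x)"
      if "x \<in> S" for x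
      using has_derivative_compose[OF Ck_on_SucD(1)[OF Suc.prems that]
          has_field_derivative_imp_has_derivative[OF assms(2)[of "f x" n]]] assms(3) that by auto
    show "Ck_on k (\<lambda>x. F (Suc n) (f x) * frechet_derivative f (at x) v) S" for v
      by (intro Ck_on_mult assms(1) Suc.IH Ck_on_weaken[OF Suc.prems] Ck_on_SucD(2)[OF Suc.prems])
  qed
qed

lemma C1I:
  assumes "open S" "\<And>x. x \<in> S \<Longrightarrow> (f has_derivative f' x) (at x)"
    "\<And>v. continuous_on S (\<lambda>x. f' x v)"
  shows "Ck_on 1 f S"
  unfolding One_nat_def using assms by (intro Ck_on_SucI[where f'=f']) auto

lemma C1D:
  assumes "Ck_on 1 f S"
  shows "x \<in> S \<Longrightarrow> (f has_derivative frechet_derivative f (at x)) (at x)"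
    "continuous_on S (\<lambda>x. frechet_derivative f (at x) v)"
  using assms by (auto simp: One_nat_def frechet_derivative_works)

text \<open>Derivatives within \<open>T\<close> suffice, because \<open>f\<close> maps the open set
  \<open>S\<close> into \<open>T\<close>.\<close>

lemma C1_compose:
  fixes f :: "'a::real_normed_vector \<Rightarrow> real"
  assumes "open S" "\<And>t. t \<in> T \<Longrightarrow> (g has_real_derivative g' t) (at t within T)"
    "continuous_on T g'" "f ` S \<subseteq> T" "Ck_on 1 f S"
  shows "Ck_on 1 (\<lambda>x. g (f x) :: real) S"
proof (rule C1I[OF assms(1)])
  have "(f has_derivative frechet_derivative f (at x)) (at x within S)" if "x \<in> S" for x
    using C1D(1)[OF assms(5) that] has_derivative_at_withinI by blast
  then show "((\<lambda>x. g (f x)) has_derivative (\<lambda>v. g' (f x) * frechet_derivative f (at x) v)) (at x)"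
    if "x \<in> S" for x
    using has_derivative_in_compose2[of T g "\<lambda>t. (*) (g' t)" f S x] assms(2,4) that
    by (fastforce simp: has_field_derivative_def at_within_open[OF that assms(1)])
  have "continuous_on S (\<lambda>x. g' (f x))"
    using continuous_on_compose2[OF assms(3) Ck_on_imp_continuous_on[OF assms(5)] assms(4)] .
  then show "continuous_on S (\<lambda>x. g' (f x) * frechet_derivative f (at x) v)" for v
    by (intro continuous_on_mult C1D(2)[OF assms(5)])
qed

lemma powr_tower:
  assumes "t > (0::real)"
  shows "((\<lambda>t. (\<Prod>i<n. s - real i) * t powr (s - real n)) has_real_derivative
     (\<Prod>i<Suc n. s - real i) * t powr (s - real (Suc n))) (at t)"
proof -
  have "((\<lambda>t. (\<Prod>i<n. s - real i) * t powr (s - real n)) has_real_derivative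
     (\<Prod>i<n. s - real i) * ((s - real n) * t powr (s - real n - 1))) (at t)"
    by (intro DERIV_cmult has_real_derivative_powr assms)
  then show ?thesis by (simp add: mult.assoc diff_diff_eq add.commute)
qed

text \<open>Powers of the norm are handled through the polynomial \<open>x \<bullet> x\<close>,
  which is smooth and positive off the origin.\<close>

lemma norm_powr_eq: "norm x powr s = (x \<bullet> x) powr (s/2)" for x :: "'a::real_inner"
proof (cases "x = 0")
  case False
  then have "norm x powr s = (norm x powr 2) powr (s/2)" by (simp only: powr_powr) simp
  also have "norm x powr 2 = x \<bullet> x" using False by (simp add: dot_square_norm)
  finally show ?thesis .
qed simp

lemma Ck_on_norm_powr:
  "Ck_on k (\<lambda>x::'a::real_inner. norm x powr s) (-{0})"
proof -
  have "Ck_on k (\<lambda>x::'a. (\<Prod>i<0. s/2 - real i) * (x \<bullet> x) powr (s/2 - real 0)) (-{0})"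
  proof (rule Ck_on_tower[where T="{0<..}" and F="\<lambda>n t. (\<Prod>i<n. s/2 - real i) * t powr (s/2 - real n)"])
    show "Ck_on k (\<lambda>x::'a. x \<bullet> x) (-{0})"
      by (intro Ck_on_inner Ck_on_bounded_linear bounded_linear_ident) auto
  qed (use powr_tower in auto)
  then show ?thesis by (simp add: norm_powr_eq)
qed

lemma has_derivative_norm_powr:
  fixes x :: "'a::real_inner"
  assumes "x \<noteq> 0"
  shows "((\<lambda>x. norm x powr s) has_derivative (\<lambda>v. s * norm x powr (s - 2) * (x \<bullet> v))) (at x)"
proof -
  have "((\<lambda>x. x \<bullet> x) has_derivative (\<lambda>v. x \<bullet> v + v \<bullet> x)) (at x)"
    by (intro has_derivative_inner has_derivative_ident)
  moreover have "((\<lambda>t. t powr (s/2)) has_derivative (*) (s/2 * (x \<bullet> x) powr (s/2 - 1))) (at (x \<bullet> x))"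
    using assms by (intro has_field_derivative_imp_has_derivative has_real_derivative_powr) auto
  ultimately have "((\<lambda>x. (x \<bullet> x) powr (s/2)) has_derivative
      (\<lambda>v. s/2 * (x \<bullet> x) powr (s/2 - 1) * (x \<bullet> v + v \<bullet> x))) (at x)"
    by (rule has_derivative_compose)
  moreover have "(x \<bullet> x) powr (s/2 - 1) = norm x powr (s - 2)"
    by (simp add: norm_powr_eq diff_divide_distrib)
  ultimately show ?thesis
    by (simp add: norm_powr_eq inner_commute mult.assoc)
qed


section \<open>Integration by parts for compactly supported functions\<close>

lemma lborel_integral_shift:
  fixes f :: "'a::euclidean_space \<Rightarrow> real"
  assumes "f \<in> borel_measurable borel"
  shows "(LINT x|lborel. f (w + x)) = (LINT x|lborel. f x)"
proof -
  have "(LINT x|lborel. f x) = (LINT x|distr lborel borel ((+) w). f x)"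
    by (simp add: lborel_distr_plus)
  also have "\<dots> = (LINT x|lborel. f (w + x))"
    using assms by (intro integral_distr) auto
  finally show ?thesis by simp
qed

lemma integrable_continuous_compact_support:
  fixes f :: "'a::euclidean_space \<Rightarrow> real"
  assumes "continuous_on UNIV f" "compact K" "\<And>x. x \<notin> K \<Longrightarrow> f x = 0"
  shows "integrable lborel f"
proof -
  have int: "integrable lborel (\<lambda>x. indicator K x *\<^sub>R f x)"
    using assms(1,2) by (intro borel_integrable_compact) (auto intro: continuous_on_subset)
  have "indicator K x *\<^sub>R f x = f x" for x
    using assms(3) by (cases "x \<in> K") auto
  then have "(\<lambda>x. indicator K x *\<^sub>R f x) = f" by (rule ext)
  with int show ?thesis by (simp only:)
qed

lemma frechet_derivative_eq_0:
  assumes "open T" "x \<in> T" "\<And>y. y \<in> T \<Longrightarrow> f y = 0"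
  shows "frechet_derivative f (at x) = (\<lambda>v. 0)"
proof -
  have "(f has_derivative (\<lambda>v. 0)) (at x)"
    by (rule has_derivative_transform_within_open[OF has_derivative_const assms(1,2)]) (use assms(3) in auto)
  from frechet_derivative_at[OF this] show ?thesis by simp
qed

text \<open>By translation invariance every difference quotient of \<open>f\<close> has integral 0;
  the quotients converge to the derivative, and dominated convergence passes to the limit.\<close>

lemma integral_directional_derivative:
  fixes f :: "'a::euclidean_space \<Rightarrow> real"
  assumes C: "Ck_on 1 f UNIV" and K: "compact K" and f0: "\<And>x. x \<notin> K \<Longrightarrow> f x = 0"
  shows "integrable lborel (\<lambda>x. frechet_derivative f (at x) v)"
    and "(LINT x|lborel. frechet_derivative f (at x) v) = 0"
proof -
  define D where "D x = frechet_derivative f (at x) v" for x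
  have contD: "continuous_on UNIV D" unfolding D_def using C1D(2)[OF C] .
  have der: "(f has_derivative frechet_derivative f (at x)) (at x)" for x
    using C1D(1)[OF C] by simp
  have contf: "continuous_on UNIV f" using Ck_on_imp_continuous_on[OF C] .
  have fm[measurable]: "f \<in> borel_measurable borel" using contf by (rule borel_measurable_continuous_onI)
  have D0: "D x = 0" if "x \<notin> K" for x
    unfolding D_def using frechet_derivative_eq_0[of "-K" x f] that f0 K
    by (simp add: compact_imp_closed open_Compl)
  have intD: "integrable lborel D"
    using integrable_continuous_compact_support[OF contD K D0] .
  then show "integrable lborel (\<lambda>x. frechet_derivative f (at x) v)" by (simp add: D_def[abs_def])
  have "bounded (D ` K)"
    by (intro compact_imp_bounded compact_continuous_image K continuous_on_subset[OF contD]) auto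
  then obtain B where B: "\<forall>x\<in>K. norm (D x) \<le> B" by (auto simp: bounded_iff)
  have B': "norm (D x) \<le> max B 0" for x using B D0[of x] by (cases "x \<in> K") force+
  obtain R where R: "\<forall>x\<in>K. norm x \<le> R" using compact_imp_bounded[OF K] by (auto simp: bounded_iff)
  have intf: "integrable lborel f" using integrable_continuous_compact_support[OF contf K f0] .
  define t where "t n = inverse (real (Suc n))" for n
  have t: "0 < t n" "t n \<le> 1" for n by (auto simp: t_def inverse_le_1_iff)
  have tl: "t \<longlonglongrightarrow> 0" unfolding t_def by (rule LIMSEQ_inverse_real_of_nat)
  define q where "q n x = (f (t n *\<^sub>R v + x) - f x) / t n" for n x
  \<comment> \<open>The mean value theorem bounds the quotients by the maximum of the derivative.
    Since \<open>t n \<le> 1\<close>, they all vanish outside the ball of radius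
    \<open>R + norm v\<close>, which gives one integrable majorant.\<close>
  have mono: "norm (q n x) \<le> max B 0 * indicator (cball 0 (R + norm v)) x" for n x
  proof -
    have "\<exists>s\<in>{0<..<t n}. f (x + t n *\<^sub>R v) - f (x + 0 *\<^sub>R v) = t n * D (x + s *\<^sub>R v)"
    proof -
      have d: "((\<lambda>s. f (x + s *\<^sub>R v)) has_derivative (\<lambda>h. h * D (x + s *\<^sub>R v))) (at s within A)" for s A
      proof -
        have "((\<lambda>s. x + s *\<^sub>R v) has_derivative (\<lambda>h. h *\<^sub>R v)) (at s within A)"
          by (auto intro!: derivative_eq_intros)
        from has_derivative_compose[OF this der]
        show ?thesis using linear_cmul[OF has_derivative_linear[OF der], of "x + s *\<^sub>R v" _ v]
          by (simp add: D_def)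
      qed
      show ?thesis using mvt_simple[of 0 "t n" "\<lambda>s. f (x + s *\<^sub>R v)" "\<lambda>s h. h * D (x + s *\<^sub>R v)"] d t(1)
        by auto
    qed
    then obtain s where s: "q n x = D (x + s *\<^sub>R v)"
      using t(1)[of n] by (auto simp: q_def add.commute)
    have "q n x = 0" if "x \<notin> cball 0 (R + norm v)"
    proof -
      have "norm x > R + norm v" using that by auto
      moreover have "norm x \<le> norm (t n *\<^sub>R v + x) + norm (t n *\<^sub>R v)"
        using norm_triangle_ineq4[of "t n *\<^sub>R v + x" "t n *\<^sub>R v"] by simp
      moreover have "norm (t n *\<^sub>R v) \<le> norm v" using t[of n] mult_right_mono[of "t n" 1 "norm v"] by simp
      moreover have "0 \<le> norm v" by simp
      ultimately have "norm x > R" "norm (t n *\<^sub>R v + x) > R" by linarith+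
      then have "x \<notin> K" "t n *\<^sub>R v + x \<notin> K" using R by force+
      then show ?thesis using f0 by (simp add: q_def)
    qed
    then show ?thesis using s B' by (auto simp: indicator_def)
  qed
  have lim: "(\<lambda>n. q n x) \<longlonglongrightarrow> D x" for x
  proof -
    have "((\<lambda>s. f (x + s *\<^sub>R v)) has_derivative (\<lambda>h. h * D x)) (at 0)"
    proof -
      have "((\<lambda>s. x + s *\<^sub>R v) has_derivative (\<lambda>h. h *\<^sub>R v)) (at 0)"
        by (auto intro!: derivative_eq_intros)
      from has_derivative_compose[OF this der]
      show ?thesis using linear_cmul[OF has_derivative_linear[OF der], of x _ v]
        by (simp add: D_def)
    qed
    then have "((\<lambda>s. f (x + s *\<^sub>R v)) has_real_derivative D x) (at 0)"
      unfolding has_field_derivative_def by (rule has_derivative_eq_rhs) (simp add: mult.commute fun_eq_iff)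
    then have "((\<lambda>h. (f (x + h *\<^sub>R v) - f x) / h) \<longlongrightarrow> D x) (at 0)"
      by (simp add: DERIV_def)
    moreover have "filterlim t (at 0) sequentially"
      using tl t(1)[THEN less_imp_neq, THEN not_sym] by (simp add: filterlim_at)
    ultimately show ?thesis unfolding q_def
      by (auto dest: filterlim_compose simp: add.commute)
  qed
  have "(\<lambda>n. LINT x|lborel. q n x) \<longlonglongrightarrow> (LINT x|lborel. D x)"
  proof (rule integral_dominated_convergence)
    show "integrable lborel (\<lambda>x. max B 0 * indicator (cball 0 (R + norm v)) x :: real)"
      using emeasure_bounded_finite[OF bounded_cball]
      by (intro integrable_mult_right integrable_real_indicator) auto
    show "D \<in> borel_measurable lborel" using intD by auto
    show "q n \<in> borel_measurable lborel" for n unfolding q_def by measurable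
  qed (use lim mono in auto)
  moreover have "(LINT x|lborel. q n x) = 0" for n
  proof -
    have "integrable lborel (\<lambda>x. f (t n *\<^sub>R v + x))"
    proof -
      have "integrable (distr lborel borel ((+) (t n *\<^sub>R v))) f"
        using intf by (simp add: lborel_distr_plus)
      then show ?thesis by (subst (asm) integrable_distr_eq) auto
    qed
    then show ?thesis using intf lborel_integral_shift[OF fm, of "t n *\<^sub>R v"]
      by (simp add: q_def)
  qed
  ultimately have "(LINT x|lborel. D x) = 0" by (simp add: LIMSEQ_const_iff)
  then show "(LINT x|lborel. frechet_derivative f (at x) v) = 0" by (simp add: D_def)
qed

lemma frechet_derivative_nth:
  fixes f :: "'a::real_normed_vector \<Rightarrow> real^'n"
  assumes "f differentiable (at x)"
  shows "frechet_derivative (\<lambda>y. f y $ i) (at x) v = frechet_derivative f (at x) v $ i"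
proof -
  have "((\<lambda>y. f y $ i) has_derivative (\<lambda>v. frechet_derivative f (at x) v $ i)) (at x)"
    using assms frechet_derivative_works bounded_linear.has_derivative[OF bounded_linear_vec_nth] by blast
  from frechet_derivative_at[OF this] show ?thesis by (rule fun_cong[OF sym])
qed

text \<open>The field may be singular outside \<open>S\<close>: as \<eta> is supported in the
  compact set \<open>K\<close> inside \<open>S\<close>, each product \<eta> V_i extended by zero is
  C^1 on the whole space.\<close>

lemma integral_by_parts_divg:
  fixes V :: "real^3 \<Rightarrow> real^3" and \<eta> :: "real^3 \<Rightarrow> real"
  assumes S: "open S" "Ck_on 1 V S" and \<eta>: "Ck_on 1 \<eta> UNIV"
    and K: "compact K" "K \<subseteq> S" "\<And>x. x \<notin> K \<Longrightarrow> \<eta> x = 0"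
  shows "(LINT x|lborel. grad \<eta> x \<bullet> V x + \<eta> x * divg V x) = 0"
proof -
  have oK: "open (- K)" using K(1) by (simp add: compact_imp_closed open_Compl)
  define f where "f i x = \<eta> x * V x $ i" for i x
  have f0: "f i x = 0" if "x \<notin> K" for i x using K(3)[OF that] by (simp add: f_def)
  have C: "Ck_on 1 (f i) UNIV" for i
  proof -
    have 1: "Ck_on 1 (f i) S" unfolding f_def
      by (intro Ck_on_mult Ck_on_nth S Ck_on_subset[OF \<eta>]) auto
    have 2: "Ck_on 1 (f i) (-K)"
      by (rule Ck_on_cong[OF oK _ Ck_on_const[OF oK, of 1 0]]) (use f0 in auto)
    have "S \<union> -K = UNIV" using K(2) by auto
    then show ?thesis using Ck_on_Un[OF S(1) oK 1 2] by simp
  qed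
  have eq: "grad \<eta> x \<bullet> V x + \<eta> x * divg V x = (\<Sum>i\<in>UNIV. frechet_derivative (f i) (at x) (axis i 1))" for x
  proof (cases "x \<in> K")
    case True
    then have xS: "x \<in> S" using K(2) by auto
    have "(f i has_derivative (\<lambda>v. \<eta> x * frechet_derivative V (at x) v $ i + frechet_derivative \<eta> (at x) v * V x $ i)) (at x)" for i
      unfolding f_def
      by (intro has_derivative_mult bounded_linear.has_derivative[OF bounded_linear_vec_nth]
          C1D(1)[OF S(2) xS] C1D(1)[OF \<eta>]) auto
    then have e: "frechet_derivative (f i) (at x) = (\<lambda>v. \<eta> x * frechet_derivative V (at x) v $ i + frechet_derivative \<eta> (at x) v * V x $ i)" for i
      by (rule frechet_derivative_at[symmetric])
    show ?thesis unfolding e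
      by (simp add: grad_def divg_def partial_def inner_vec_def sum_3 algebra_simps)
  next
    case False
    then have "frechet_derivative (f i) (at x) = (\<lambda>v. 0)" "frechet_derivative \<eta> (at x) = (\<lambda>v. 0)" for i
      using f0 K(3) by (auto intro!: frechet_derivative_eq_0[OF oK])
    then show ?thesis using K(3)[OF False] by (simp add: grad_def partial_def inner_vec_def)
  qed
  have "(LINT x|lborel. (\<Sum>i\<in>UNIV. frechet_derivative (f i) (at x) (axis i 1))) = 0"
    using integral_directional_derivative[OF C K(1) f0] by (subst Bochner_Integration.integral_sum) auto
  then show ?thesis by (simp add: eq)
qed

lemma line_DERIV:
  fixes F :: "'a::real_normed_vector \<Rightarrow> real"
  assumes "(F has_derivative F') (at (y + s *\<^sub>R a))"
  shows "((\<lambda>s. F (y + s *\<^sub>R a)) has_real_derivative F' a) (at s within A)"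
proof -
  have "((\<lambda>s. y + s *\<^sub>R a) has_derivative (\<lambda>h. h *\<^sub>R a)) (at s within A)"
    by (auto intro!: derivative_eq_intros)
  from has_derivative_compose[OF this assms]
  show ?thesis using linear_cmul[OF has_derivative_linear[OF assms], of _ a]
    by (simp add: has_field_derivative_def mult.commute[of _ "F' a"])
qed

section \<open>Symmetry of second derivatives\<close>

text \<open>Two applications of the mean value theorem: in direction \<open>v\<close> to the
  increment of \<open>f\<close> in direction \<open>w\<close>, then in direction \<open>w\<close> to
  the derivative of \<open>f\<close> along \<open>v\<close>.\<close>

lemma second_difference_mvt:
  fixes f :: "'a::real_normed_vector \<Rightarrow> real"
  assumes C: "Ck_on 2 f (ball x r)" and h: "h > 0" "h * (norm v + norm w) < r"
  shows "\<exists>y. dist y x \<le> h * (norm v + norm w) \<and>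
    f (x + h *\<^sub>R v + h *\<^sub>R w) - f (x + h *\<^sub>R v) - f (x + h *\<^sub>R w) + f x =
      h * h * frechet_derivative (\<lambda>y. frechet_derivative f (at y) v) (at y) w"
proof -
  let ?g = "\<lambda>y. frechet_derivative f (at y) v"
  have C1: "Ck_on (Suc 0) ?g (ball x r)" and d1: "y \<in> ball x r \<Longrightarrow> (f has_derivative frechet_derivative f (at y)) (at y)" for y
    using Ck_on_SucD[of 1 f] C by (auto simp: numeral_2_eq_2)
  have d2: "y \<in> ball x r \<Longrightarrow> (?g has_derivative frechet_derivative ?g (at y)) (at y)" for y
    using Ck_on_SucD(1)[OF C1] by blast
  have inb: "x + s *\<^sub>R v + t *\<^sub>R w \<in> ball x r \<and> dist (x + s *\<^sub>R v + t *\<^sub>R w) x \<le> h * (norm v + norm w)"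
    if "0 \<le> s" "s \<le> h" "0 \<le> t" "t \<le> h" for s t
  proof -
    have "norm (s *\<^sub>R v + t *\<^sub>R w) \<le> s * norm v + t * norm w"
      using norm_triangle_ineq[of "s *\<^sub>R v" "t *\<^sub>R w"] that by simp
    also have "\<dots> \<le> h * norm v + h * norm w"
      using that by (intro add_mono mult_right_mono) auto
    finally have "norm (s *\<^sub>R v + t *\<^sub>R w) \<le> h * (norm v + norm w)" by (simp add: algebra_simps)
    moreover have "dist (x + s *\<^sub>R v + t *\<^sub>R w) x = norm (s *\<^sub>R v + t *\<^sub>R w)"
      by (simp add: dist_norm add.assoc)
    ultimately show ?thesis using h by (simp add: dist_commute)
  qed
  have "\<exists>s>0. s < h \<and> (f (x + h *\<^sub>R w + h *\<^sub>R v) - f (x + h *\<^sub>R v)) - (f (x + h *\<^sub>R w + 0 *\<^sub>R v) - f (x + 0 *\<^sub>R v)) =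
      (h - 0) * (?g (x + h *\<^sub>R w + s *\<^sub>R v) - ?g (x + s *\<^sub>R v))"
  proof (rule MVT2[OF h(1)])
    fix s assume s: "0 \<le> s" "s \<le> h"
    have "x + h *\<^sub>R w + s *\<^sub>R v \<in> ball x r" "x + s *\<^sub>R v \<in> ball x r"
      using inb[OF s, of h] inb[OF s, of 0] h by (auto simp: algebra_simps)
    then show "((\<lambda>s. f (x + h *\<^sub>R w + s *\<^sub>R v) - f (x + s *\<^sub>R v)) has_real_derivative
       ?g (x + h *\<^sub>R w + s *\<^sub>R v) - ?g (x + s *\<^sub>R v)) (at s)"
      by (intro DERIV_diff line_DERIV d1)
  qed
  then obtain s where s: "0 < s" "s < h" and 1: "(f (x + h *\<^sub>R w + h *\<^sub>R v) - f (x + h *\<^sub>R v)) - (f (x + h *\<^sub>R w) - f x) =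
      h * (?g (x + h *\<^sub>R w + s *\<^sub>R v) - ?g (x + s *\<^sub>R v))" by auto
  have "\<exists>t>0. t < h \<and> ?g (x + s *\<^sub>R v + h *\<^sub>R w) - ?g (x + s *\<^sub>R v + 0 *\<^sub>R w) =
     (h - 0) * frechet_derivative ?g (at (x + s *\<^sub>R v + t *\<^sub>R w)) w"
  proof (rule MVT2[OF h(1)])
    fix t assume t: "0 \<le> t" "t \<le> h"
    have "x + s *\<^sub>R v + t *\<^sub>R w \<in> ball x r" using inb[of s t] s t by auto
    then show "((\<lambda>t. ?g (x + s *\<^sub>R v + t *\<^sub>R w)) has_real_derivative
       frechet_derivative ?g (at (x + s *\<^sub>R v + t *\<^sub>R w)) w) (at t)"
      by (intro line_DERIV d2)
  qed
  then obtain t where t: "0 < t" "t < h" and 2: "?g (x + s *\<^sub>R v + h *\<^sub>R w) - ?g (x + s *\<^sub>R v) =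
     h * frechet_derivative ?g (at (x + s *\<^sub>R v + t *\<^sub>R w)) w" by auto
  show ?thesis
  proof (intro exI conjI)
    show "dist (x + s *\<^sub>R v + t *\<^sub>R w) x \<le> h * (norm v + norm w)" using inb[of s t] s t by auto
    show "f (x + h *\<^sub>R v + h *\<^sub>R w) - f (x + h *\<^sub>R v) - f (x + h *\<^sub>R w) + f x =
      h * h * frechet_derivative ?g (at (x + s *\<^sub>R v + t *\<^sub>R w)) w"
    proof -
      have e: "x + h *\<^sub>R w + c *\<^sub>R v = x + c *\<^sub>R v + h *\<^sub>R w" for c by (simp add: add.assoc add.commute)
      have "h * h * frechet_derivative ?g (at (x + s *\<^sub>R v + t *\<^sub>R w)) w =
          f (x + h *\<^sub>R v + h *\<^sub>R w) - f (x + h *\<^sub>R v) - (f (x + h *\<^sub>R w) - f x)"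
        using 1 unfolding e 2 by (simp only: mult.assoc)
      then show ?thesis by linarith
    qed
  qed
qed

text \<open>The second difference is symmetric in \<open>v\<close> and \<open>w\<close>, so it
  equals both mixed derivatives at two points near \<open>x\<close>; continuity excludes a gap
  between them.\<close>

lemma symmetric_second_derivative:
  fixes f :: "'a::real_normed_vector \<Rightarrow> real"
  assumes "open S" "x \<in> S" and C: "Ck_on 2 f S"
  shows "frechet_derivative (\<lambda>y. frechet_derivative f (at y) v) (at x) w =
    frechet_derivative (\<lambda>y. frechet_derivative f (at y) w) (at x) v" (is "?A x = ?B x")
proof (rule ccontr)
  assume ne: "?A x \<noteq> ?B x"
  define e0 where "e0 = \<bar>?A x - ?B x\<bar> / 2"
  have e: "e0 > 0" using ne by (simp add: e0_def)
  have cont: "continuous_on S (\<lambda>y. frechet_derivative (\<lambda>y. frechet_derivative f (at y) a) (at y) b)" for a b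
    using Ck_on_SucD(2)[OF Ck_on_SucD(2)[of 1 f S a, unfolded One_nat_def]] C by (simp add: numeral_2_eq_2)
  obtain d1 where d1: "d1 > 0" "\<forall>y\<in>S. dist y x < d1 \<longrightarrow> dist (?A y) (?A x) < e0"
    using cont[of v w] assms(2) e unfolding continuous_on_iff by metis
  obtain d2 where d2: "d2 > 0" "\<forall>y\<in>S. dist y x < d2 \<longrightarrow> dist (?B y) (?B x) < e0"
    using cont[of w v] assms(2) e unfolding continuous_on_iff by metis
  obtain r where r: "r > 0" "ball x r \<subseteq> S" using assms openE by blast
  define d where "d = Min {d1, d2, r}"
  have d: "d > 0" "d \<le> d1" "d \<le> d2" "d \<le> r" using d1 d2 r by (auto simp: d_def)
  \<comment> \<open>The summand 1 keeps the denominator positive even for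
    \<open>v = w = 0\<close>.\<close>
  define h where "h = d / (2 * (norm v + norm w + 1))"
  have nn: "0 \<le> norm v" "0 \<le> norm w" by auto
  have h: "h > 0" "h * (norm v + norm w) < d"
  proof -
    have N: "0 < norm v + norm w + 1" using nn by linarith
    show "h > 0" unfolding h_def using d N by simp
    then have "h * (norm v + norm w) < 2 * (h * (norm v + norm w + 1))"
      using mult_strict_left_mono[of "norm v + norm w" "2 * (norm v + norm w + 1)" h] nn N
      by (simp add: mult.left_commute[of h 2] del: mult_less_cancel_left_pos mult_less_cancel_left)
    also have "\<dots> = d" unfolding h_def using N by (simp add: field_simps)
    finally show "h * (norm v + norm w) < d" .
  qed
  have Cb: "Ck_on 2 f (ball x r)" using Ck_on_subset[OF C r(2)] .
  obtain y where y: "dist y x \<le> h * (norm v + norm w)"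
    "f (x + h *\<^sub>R v + h *\<^sub>R w) - f (x + h *\<^sub>R v) - f (x + h *\<^sub>R w) + f x = h * h * ?A y"
    using second_difference_mvt[OF Cb h(1), of v w] h d by auto
  obtain z where z: "dist z x \<le> h * (norm w + norm v)"
    "f (x + h *\<^sub>R w + h *\<^sub>R v) - f (x + h *\<^sub>R w) - f (x + h *\<^sub>R v) + f x = h * h * ?B z"
    using second_difference_mvt[OF Cb h(1), of w v] h d by (auto simp: add.commute)
  have e: "x + h *\<^sub>R w + h *\<^sub>R v = x + h *\<^sub>R v + h *\<^sub>R w" by simp
  have "h * h * ?A y = h * h * ?B z" using y(2) z(2) unfolding e by linarith
  then have AB: "?A y = ?B z" using h by simp
  have "y \<in> S" "z \<in> S" using y(1) z(1) h d r by (auto simp: dist_commute add.commute subset_iff)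
  then have "dist (?A y) (?A x) < e0" "dist (?B z) (?B x) < e0"
    using d1 d2 y(1) z(1) h d by (auto simp: add.commute)
  then have "\<bar>?A y - ?A x\<bar> < e0" "\<bar>?B z - ?B x\<bar> < e0" by (simp_all only: dist_real_def)
  moreover have "\<bar>a - b\<bar> \<le> \<bar>p - a\<bar> + \<bar>p - b\<bar>" for a b p :: real
    using abs_triangle_ineq4[of "p - b" "p - a"] by simp
  from this[of "?A x" "?B x" "?A y"] have "\<bar>?A x - ?B x\<bar> \<le> \<bar>?A y - ?A x\<bar> + \<bar>?B z - ?B x\<bar>"
    unfolding AB .
  moreover have "\<bar>?A x - ?B x\<bar> = e0 + e0" by (simp add: e0_def)
  ultimately show False by linarith
qed

lemma frechet_derivative_cong:
  assumes "open S" "x \<in> S" "\<And>y. y \<in> S \<Longrightarrow> f y = g y" "f differentiable (at x)"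
  shows "frechet_derivative f (at x) = frechet_derivative g (at x)"
proof -
  have "(f has_derivative frechet_derivative f (at x)) (at x)"
    using assms(4) frechet_derivative_works by blast
  from has_derivative_transform_within_open[OF this assms(1,2,3)]
  show ?thesis by (rule frechet_derivative_at)
qed

lemma symmetric_second_derivative_vec:
  fixes f :: "'a::real_normed_vector \<Rightarrow> real^'n"
  assumes S: "open S" "x \<in> S" and C: "Ck_on 2 f S"
  shows "frechet_derivative (\<lambda>y. frechet_derivative f (at y) v) (at x) w =
    frechet_derivative (\<lambda>y. frechet_derivative f (at y) w) (at x) v"
proof -
  have C1: "Ck_on 1 (\<lambda>y. frechet_derivative f (at y) v) S" for v
    using Ck_on_SucD(2)[of 1 f S] C by (simp add: numeral_2_eq_2)
  have d: "y \<in> S \<Longrightarrow> f differentiable (at y)" for y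
    using Ck_on_SucD(1)[of 1 f S] C by (auto simp: numeral_2_eq_2)
  have e: "frechet_derivative f (at y) v $ i = frechet_derivative (\<lambda>z. f z $ i) (at y) v" if "y \<in> S" for y v i
    using frechet_derivative_nth[OF d[OF that]] by simp
  have "frechet_derivative (\<lambda>y. frechet_derivative f (at y) v) (at x) w $ i =
     frechet_derivative (\<lambda>y. frechet_derivative (\<lambda>z. f z $ i) (at y) v) (at x) w" for v w i
  proof -
    have "(\<lambda>y. frechet_derivative f (at y) v) differentiable (at x)"
      using C1D(1)[OF C1 S(2)] differentiable_def by blast
    moreover have "(\<lambda>y. frechet_derivative f (at y) v $ i) differentiable (at x)"
      unfolding differentiable_def by (rule exI) (rule C1D(1)[OF Ck_on_nth[OF S(1) C1] S(2)])
    ultimately show ?thesis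
      using frechet_derivative_cong[of S x "\<lambda>y. frechet_derivative f (at y) v $ i"
          "\<lambda>y. frechet_derivative (\<lambda>z. f z $ i) (at y) v"] S e
        frechet_derivative_nth[of "\<lambda>y. frechet_derivative f (at y) v" x i w] by simp
  qed
  then show ?thesis
    using symmetric_second_derivative[OF S Ck_on_nth[OF S(1) C]] by (simp add: vec_eq_iff)
qed

lemma integral_eq_0_imp_eq_0:
  fixes f :: "'a::euclidean_space \<Rightarrow> real"
  assumes f: "continuous_on UNIV f" "compact K" "\<And>x. x \<notin> K \<Longrightarrow> f x = 0" "\<And>x. 0 \<le> f x"
    and i: "(LINT x|lborel. f x) = 0"
  shows "f x = 0"
proof -
  have "integrable lborel f" using integrable_continuous_compact_support[OF f(1-3)] .
  then have "AE x in lborel. f x = 0"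
    using integral_nonneg_eq_0_iff_AE[of lborel f] f(4) i by simp
  then have "{x. f x \<noteq> 0} \<in> null_sets lborel"
    using f(1) by (subst (asm) AE_iff_null) (auto intro!: borel_open open_Collect_neq)
  then have "negligible {x. f x \<noteq> 0}"
    by (simp add: negligible_iff_null_sets null_sets_completionI)
  moreover have "open {x. f x \<noteq> 0}"
    using f(1) by (intro open_Collect_neq) auto
  ultimately show ?thesis using open_not_negligible by blast
qed

section \<open>Nonexistence\<close>

lemma has_derivative_axis_expand:
  fixes J :: "real^3 \<Rightarrow> real^3"
  assumes "linear J"
  shows "J a = a$1 *\<^sub>R J (axis 1 1) + a$2 *\<^sub>R J (axis 2 1) + a$3 *\<^sub>R J (axis 3 1)"
proof -
  have "a = a$1 *\<^sub>R axis 1 1 + a$2 *\<^sub>R axis 2 1 + a$3 *\<^sub>R axis 3 1"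
    using vector3_eq_sum[of "a$1" "a$2" "a$3"] vec3_eq[of a] by simp
  then have "J a = J (a$1 *\<^sub>R axis 1 1 + a$2 *\<^sub>R axis 2 1 + a$3 *\<^sub>R axis 3 1)" by simp
  then show ?thesis using assms by (simp add: linear_add linear_cmul)
qed

lemma inner_vec3: "(a::real^3) \<bullet> b = a$1 * b$1 + a$2 * b$2 + a$3 * b$3"
  by (simp add: inner_vec_def sum_3)

text \<open>The curl is the antisymmetric part of the Jacobian. In this form, statements about the
  curl become statements about the bilinear form of the derivative, without coordinates.\<close>

lemma cross_curl:
  assumes "u differentiable (at x)"
  shows "cross3 (curl u x) a \<bullet> b = frechet_derivative u (at x) a \<bullet> b - frechet_derivative u (at x) b \<bullet> a"
proof -
  have "linear (frechet_derivative u (at x))"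
    using assms frechet_derivative_works has_derivative_linear by blast
  note e = has_derivative_axis_expand[OF this]
  show ?thesis
    unfolding inner_vec3 e[of a] e[of b] cross3_def curl_def partial_def
    by (simp add: algebra_simps)
qed

lemma cross3_lagrange: "cross3 w a = 0 \<Longrightarrow> (a \<bullet> a) *\<^sub>R w = (a \<bullet> w) *\<^sub>R a"
proof -
  assume "cross3 w a = 0"
  then have "cross3 a (cross3 w a) = 0" by (simp add: cross3_def vec_eq_iff forall_3)
  moreover have "cross3 a (cross3 w a) = (a \<bullet> a) *\<^sub>R w - (a \<bullet> w) *\<^sub>R a"
    unfolding vec_eq_iff forall_3 cross3_def inner_vec3 by (simp add: algebra_simps)
  ultimately show ?thesis by simp
qed

lemma cross3_all_eq_0: "(\<And>a. cross3 w a = 0) \<Longrightarrow> w = 0"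
proof -
  assume w: "\<And>a. cross3 w a = 0"
  have "cross3 w (vector [1,0,0]) = 0" "cross3 w (vector [0,1,0]) = 0" by (rule w)+
  then have "w $ 1 = 0 \<and> w $ 2 = 0 \<and> w $ 3 = 0"
    unfolding vec_eq_iff forall_3 cross3_def by simp
  then show "w = 0" unfolding vec_eq_iff forall_3 by simp
qed

lemma continuous_on_curl:
  assumes "Ck_on 1 u S"
  shows "continuous_on S (curl u)"
proof -
  have "continuous_on S (\<lambda>x. partial i u x $ j)" for i j
    unfolding partial_def by (intro continuous_on_component C1D(2)[OF assms])
  then show ?thesis
    unfolding curl_def vector3_eq_sum by (intro continuous_on_add continuous_on_scaleR continuous_on_diff continuous_on_const)
qed

lemma curl_eq_0_of_local_zero:
  assumes "open T" "x \<in> T" "\<And>y. y \<in> T \<Longrightarrow> u y = 0"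
  shows "curl u x = 0"
  using frechet_derivative_eq_0[OF assms]
  unfolding curl_def partial_def vec_eq_iff forall_3 by simp

text \<open>On the open set where the curl is nonzero the field would vanish identically, and so
  would its curl. Later arguments may thus assume \<open>u x \<noteq> 0\<close>.\<close>

lemma curl_eq_0_by_density:
  assumes S: "open S" and C: "Ck_on 1 u S" and x: "x \<in> S"
    and z: "\<And>y. y \<in> S \<Longrightarrow> u y \<noteq> 0 \<Longrightarrow> curl u y = 0"
  shows "curl u x = 0"
proof (rule ccontr)
  assume ne: "curl u x \<noteq> 0"
  define T where "T = {y \<in> S. curl u y \<noteq> 0}"
  have "open T"
    unfolding T_def using continuous_on_curl[OF C] S
    using continuous_open_preimage[OF _ S, of "curl u" "- {0}"] by (auto simp: vimage_def Int_def)
  moreover have "x \<in> T" using ne x by (simp add: T_def)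
  moreover have "u y = 0" if "y \<in> T" for y using that z by (auto simp: T_def)
  ultimately show False using curl_eq_0_of_local_zero ne by blast
qed

section \<open>Homogeneous Beltrami flows\<close>

locale beltrami_flow =
  fixes \<alpha> :: real and u :: "real^3 \<Rightarrow> real^3"
  assumes C1: "Ck_on 1 u (-{0})"
    and div0: "x \<noteq> 0 \<Longrightarrow> divg u x = 0"
    and bel: "x \<noteq> 0 \<Longrightarrow> cross3 (curl u x) (u x) = 0"
    and hom: "x \<noteq> 0 \<Longrightarrow> l > 0 \<Longrightarrow> u x = (l powr \<alpha>) *\<^sub>R u (l *\<^sub>R x)"
begin

definition "J x = frechet_derivative u (at x)"
definition "F x = x \<bullet> u x"

lemma der: "x \<noteq> 0 \<Longrightarrow> (u has_derivative J x) (at x)"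
  unfolding J_def using C1D(1)[OF C1] by simp

lemma dif: "x \<noteq> 0 \<Longrightarrow> u differentiable (at x)"
  using der differentiable_def by blast

lemma linJ: "x \<noteq> 0 \<Longrightarrow> linear (J x)"
  using der has_derivative_linear by blast

text \<open>This is the Beltrami condition as
  \<open>u \<sqdot> \<nabla>u = \<nabla>\<bar>u\<bar>^2 / 2\<close>, tested against
  \<open>a\<close>.\<close>

lemma J_bel: "x \<noteq> 0 \<Longrightarrow> J x (u x) \<bullet> a = J x a \<bullet> u x"
  using cross_curl[OF dif, of x "u x" a] bel[of x] by (simp add: J_def)

lemma curl_0_iff:
  assumes "x \<noteq> 0" "\<And>a b. J x a \<bullet> b = J x b \<bullet> a"
  shows "curl u x = 0"
proof (rule cross3_all_eq_0)
  fix a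
  have "cross3 (curl u x) a \<bullet> b = 0" for b
    using cross_curl[OF dif[OF assms(1)], of a b] assms(2)[of a b] by (simp add: J_def)
  then show "cross3 (curl u x) a = 0" by (metis inner_eq_zero_iff)
qed

text \<open>Euler's relation for degree -\<alpha>: both sides are the derivative of
  \<open>u (l *\<^sub>R x)\<close> in \<open>l\<close> at 1.\<close>

lemma J_hom:
  assumes x: "x \<noteq> 0" shows "J x x = (- \<alpha>) *\<^sub>R u x"
proof -
  have "((\<lambda>l. l *\<^sub>R x) has_derivative (\<lambda>h. h *\<^sub>R x)) (at (1::real))"
    by (auto intro!: derivative_eq_intros)
  then have "((\<lambda>l. u (l *\<^sub>R x)) has_derivative (\<lambda>h. J x (h *\<^sub>R x))) (at (1::real))"
    using has_derivative_compose[of "\<lambda>l. l *\<^sub>R x" "\<lambda>h. h *\<^sub>R x" "1::real" UNIV u "J x"] der[OF x] by simp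
  then have 1: "((\<lambda>l. u (l *\<^sub>R x)) has_vector_derivative J x x) (at (1::real))"
    unfolding has_vector_derivative_def using linJ[OF x] by (simp add: linear_cmul)
  have "((\<lambda>l. l powr (-\<alpha>)) has_real_derivative (-\<alpha>) * 1 powr (-\<alpha> - 1)) (at (1::real))"
    by (rule has_real_derivative_powr) simp
  then have "((\<lambda>l. l powr (-\<alpha>) *\<^sub>R u x) has_vector_derivative (-\<alpha>) *\<^sub>R u x) (at (1::real))"
    by (intro has_vector_derivative_scaleR[where g="\<lambda>_. u x" and g'=0, THEN has_vector_derivative_eq_rhs])
       (auto simp: has_real_derivative_iff_has_vector_derivative)
  then have 2: "((\<lambda>l. u (l *\<^sub>R x)) has_vector_derivative (-\<alpha>) *\<^sub>R u x) (at (1::real))"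
  proof (rule has_vector_derivative_transform_within_open[of _ _ _ "{0<..}"])
    fix l :: real assume "l \<in> {0<..}"
    then have l: "l > 0" by simp
    have "u x = (l powr \<alpha>) *\<^sub>R u (l *\<^sub>R x)" using hom[OF x l] .
    then have "l powr (-\<alpha>) *\<^sub>R u x = (l powr (-\<alpha>) * l powr \<alpha>) *\<^sub>R u (l *\<^sub>R x)"
      by (metis scaleR_scaleR)
    then show "l powr (-\<alpha>) *\<^sub>R u x = u (l *\<^sub>R x)" using l by (simp flip: powr_add)
  qed auto
  show ?thesis using vector_derivative_unique_at[OF 1 2] .
qed

lemma F_der:
  assumes "x \<noteq> 0" shows "(F has_derivative (\<lambda>v. x \<bullet> J x v + v \<bullet> u x)) (at x)"
  unfolding F_def by (intro has_derivative_inner has_derivative_ident der assms)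

lemma DF_u: "x \<noteq> 0 \<Longrightarrow> x \<bullet> J x (u x) + u x \<bullet> u x = (1 - \<alpha>) * (u x \<bullet> u x)"
  using J_bel[of x x] J_hom[of x] by (simp add: inner_commute algebra_simps)

lemma F_C1: "Ck_on 1 F (-{0})"
  unfolding F_def by (intro Ck_on_inner Ck_on_bounded_linear bounded_linear_ident C1) auto

end

section \<open>The range from 1 to 2: an integral identity\<close>

text \<open>Squared positive part: cutoffs built from it are C^1 and elementary, which is all that
  integration by parts requires.\<close>

definition "sqp t = (max 0 t)\<^sup>2" for t :: real

lemma sqp_DERIV: "(sqp has_real_derivative 2 * max 0 t) (at t)"
proof -
  consider "t > 0" | "t < 0" | "t = 0" by linarith
  then show ?thesis
  proof cases
    case 1
    have "((\<lambda>t::real. t\<^sup>2) has_real_derivative 2 * max 0 t) (at t)"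
      using 1 by (auto intro!: derivative_eq_intros)
    then show ?thesis
      by (rule DERIV_cong_ev[THEN iffD1, rotated -1])
         (use 1 eventually_gt_at_top in \<open>auto simp: sqp_def eventually_nhds intro!: exI[of _ "{0<..}"]\<close>)
  next
    case 2
    have "((\<lambda>t::real. 0) has_real_derivative 2 * max 0 t) (at t)"
      using 2 by (auto intro!: derivative_eq_intros)
    then show ?thesis
      by (rule DERIV_cong_ev[THEN iffD1, rotated -1])
         (use 2 in \<open>auto simp: sqp_def eventually_nhds intro!: exI[of _ "{..<0}"]\<close>)
  next
    case 3
    have "((\<lambda>h. sqp h / h) \<longlongrightarrow> 0) (at 0)"
    proof (rule Lim_null_comparison)
      show "\<forall>\<^sub>F h in at 0. norm (sqp h / h) \<le> \<bar>h\<bar>"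
        by (intro always_eventually allI) (auto simp: sqp_def max_def power2_eq_square)
      show "((\<lambda>h::real. \<bar>h\<bar>) \<longlongrightarrow> 0) (at 0)" by (auto intro!: tendsto_eq_intros)
    qed
    then show ?thesis using 3 by (simp add: DERIV_def sqp_def)
  qed
qed

lemma sqp_C1:
  assumes "open S" "Ck_on 1 f S" shows "Ck_on 1 (\<lambda>x. sqp (f x)) S"
  by (rule C1_compose[OF assms(1) _ _ subset_UNIV assms(2), where g'="\<lambda>t. 2 * max 0 t"])
     (auto intro!: sqp_DERIV continuous_intros)

lemma sqp_nonneg [simp]: "0 \<le> sqp t" by (simp add: sqp_def)

lemma sqp_eq_0_iff [simp]: "sqp t = 0 \<longleftrightarrow> t \<le> 0" by (auto simp: sqp_def max_def)

context beltrami_flow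
begin

text \<open>Two divergence identities are tested with the same radial cutoff and subtracted. The
  remaining integrand is nonnegative by Cauchy-Schwarz, so it vanishes at every point of the
  shell.\<close>

lemma integral_constraint:
  assumes \<alpha>: "1 \<le> \<alpha>" "\<alpha> \<le> 2" and x0: "x0 \<noteq> 0"
  shows "(\<alpha> - 1) * (u x0 \<bullet> u x0 - (F x0)\<^sup>2 / (x0 \<bullet> x0)) + (2 - \<alpha>) * ((F x0)\<^sup>2 / (x0 \<bullet> x0)) = 0"
proof -
  define c where "c = x0 \<bullet> x0"
  have c: "c > 0" using x0 by (simp add: c_def)
  \<comment> \<open>Positive exactly on the shell \<open>c/2 < y \<bullet> y < 2 c\<close> around
    \<open>x0\<close>, so \<open>sqp (m y)\<close> is supported away from the origin.\<close>
  define m where "m y = (y \<bullet> y - c/2) * (2*c - y \<bullet> y)" for y :: "real^3"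
  define g where "g y = sqp (m y)" for y
  define K where "K = {y::real^3. c/2 \<le> y \<bullet> y \<and> y \<bullet> y \<le> 2*c}"
  have g0: "g y = 0" if "y \<notin> K" for y
  proof -
    have "y \<bullet> y < c/2 \<or> y \<bullet> y > 2*c" using that by (auto simp: K_def)
    then have "m y \<le> 0" unfolding m_def using c by (auto intro: mult_nonpos_nonneg mult_nonneg_nonpos)
    then show ?thesis by (simp add: g_def)
  qed
  have K: "compact K"
  proof -
    have "closed K" unfolding K_def
      by (intro closed_Collect_conj closed_Collect_le continuous_intros)
    moreover have "bounded K"
      unfolding bounded_iff
      by (rule exI[of _ "sqrt (2*c)"]) (auto simp: K_def norm_eq_sqrt_inner)
    ultimately show ?thesis by (simp add: compact_eq_bounded_closed)
  qed
  have K0: "K \<subseteq> -{0}" using c by (auto simp: K_def)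
  have mC: "Ck_on k m UNIV" for k unfolding m_def
    by (intro Ck_on_mult Ck_on_diff Ck_on_inner Ck_on_const Ck_on_bounded_linear bounded_linear_ident) auto
  have gC: "Ck_on 1 g UNIV" unfolding g_def by (intro sqp_C1 mC) auto
  define g1 where "g1 y = 2 * max 0 (m y) * (5*c/2 - 2 * (y \<bullet> y)) * 2" for y
  have gd: "(g has_derivative (\<lambda>v. g1 y * (y \<bullet> v))) (at y)" for y
  proof -
    have "(m has_derivative (\<lambda>v. (y \<bullet> y - c/2) * (- (y \<bullet> v + v \<bullet> y)) + (y \<bullet> v + v \<bullet> y) * (2*c - y \<bullet> y))) (at y)"
      unfolding m_def by (auto intro!: derivative_eq_intros)
    from has_derivative_compose[OF this has_field_derivative_imp_has_derivative[OF sqp_DERIV]]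
    show ?thesis unfolding g_def
      by (rule has_derivative_eq_rhs) (auto simp: g1_def inner_commute algebra_simps fun_eq_iff)
  qed
  have grad_g: "grad g y \<bullet> v = g1 y * (y \<bullet> v)" for y v
  proof -
    have "frechet_derivative g (at y) = (\<lambda>v. g1 y * (y \<bullet> v))"
      using frechet_derivative_at[OF gd] by simp
    then show ?thesis by (simp add: grad_def partial_def inner_vec3 axis_def algebra_simps)
  qed
  define H where "H y = (F y)\<^sup>2 * norm y powr (-2)" for y
  have HC: "Ck_on 1 H (-{0})" unfolding H_def power2_eq_square
    by (intro Ck_on_mult F_C1 Ck_on_norm_powr) auto
  have H: "H y = (F y)\<^sup>2 / (y \<bullet> y)" if "y \<noteq> 0" for y
    using that by (simp add: H_def powr_minus divide_simps dot_square_norm)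
  \<comment> \<open>Since the gradient of the cutoff is \<open>g1 y *\<^sub>R y\<close>, both fields
    contribute the same term \<open>g1 F^2\<close>. Subtracting the identities removes it, although
    \<open>g1\<close> has no sign.\<close>
  define V where "V y = F y *\<^sub>R u y" for y
  define W where "W y = H y *\<^sub>R y" for y
  have VC: "Ck_on 1 V (-{0})" unfolding V_def by (intro Ck_on_scaleR F_C1 C1) auto
  have WC: "Ck_on 1 W (-{0})" unfolding W_def
    by (intro Ck_on_scaleR HC Ck_on_bounded_linear bounded_linear_ident) auto
  have divV: "divg V y = (1 - \<alpha>) * (u y \<bullet> u y)" if y: "y \<noteq> 0" for y
  proof -
    have "(V has_derivative (\<lambda>v. F y *\<^sub>R J y v + (y \<bullet> J y v + v \<bullet> u y) *\<^sub>R u y)) (at y)"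
      unfolding V_def by (intro has_derivative_scaleR F_der der y)
    then have e: "frechet_derivative V (at y) = (\<lambda>v. F y *\<^sub>R J y v + (y \<bullet> J y v + v \<bullet> u y) *\<^sub>R u y)"
      by (rule frechet_derivative_at[symmetric])
    have "divg V y = F y * divg u y + (y \<bullet> J y (u y) + u y \<bullet> u y)"
      unfolding divg_def partial_def e has_derivative_axis_expand[OF linJ[OF y], of "u y"] sum_3
      by (simp add: J_def inner_vec3 axis_def algebra_simps)
    then show ?thesis using DF_u[OF y] div0[OF y] by simp
  qed
  have divW: "divg W y = (3 - 2*\<alpha>) * H y" if y: "y \<noteq> 0" for y
  proof -
    define DH where "DH v = (F y)\<^sup>2 * (-2 * norm y powr (-2-2) * (y \<bullet> v)) + (2 * F y * (y \<bullet> J y v + v \<bullet> u y)) * norm y powr (-2)" for v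
    have dF: "((\<lambda>y. (F y)\<^sup>2) has_derivative (\<lambda>v. 2 * F y * (y \<bullet> J y v + v \<bullet> u y))) (at y)"
      using has_derivative_power[OF F_der[OF y], of 2] by (rule has_derivative_eq_rhs) (simp add: fun_eq_iff)
    have dH: "(H has_derivative DH) (at y)" unfolding H_def DH_def
      by (intro has_derivative_mult has_derivative_norm_powr y dF)
    have "(W has_derivative (\<lambda>v. H y *\<^sub>R v + DH v *\<^sub>R y)) (at y)"
      unfolding W_def by (intro has_derivative_scaleR dH has_derivative_ident)
    then have e: "frechet_derivative W (at y) = (\<lambda>v. H y *\<^sub>R v + DH v *\<^sub>R y)"
      by (rule frechet_derivative_at[symmetric])
    have lin: "linear DH" using dH has_derivative_linear by blast
    have "DH y = DH (y$1 *\<^sub>R axis 1 1 + y$2 *\<^sub>R axis 2 1 + y$3 *\<^sub>R axis 3 1)"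
      using vector3_eq_sum[of "y$1" "y$2" "y$3"] vec3_eq[of y] by simp
    also have "\<dots> = y$1 * DH (axis 1 1) + y$2 * DH (axis 2 1) + y$3 * DH (axis 3 1)"
      using lin by (simp add: linear_add linear_cmul)
    finally have "divg W y = 3 * H y + DH y"
      unfolding divg_def partial_def e sum_3 by (simp add: axis_def algebra_simps)
    moreover have "DH y = - 2 * \<alpha> * H y"
    proof -
      have e1: "norm y powr (-2-2) * (y \<bullet> y) = norm y powr (-2)"
        using y powr_add[of "norm y" "-4" 2] by (simp add: dot_square_norm)
      have e2: "y \<bullet> J y y + y \<bullet> u y = (1 - \<alpha>) * F y"
        using J_hom[OF y] by (simp add: F_def algebra_simps)
      show ?thesis
        unfolding DH_def H_def e2 mult.assoc[of "-2::real"] e1 by (simp add: power2_eq_square algebra_simps)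
    qed
    ultimately show ?thesis by (simp add: algebra_simps)
  qed
  have i1: "(LINT y|lborel. grad g y \<bullet> V y + g y * divg V y) = 0"
    by (rule integral_by_parts_divg[OF _ VC gC K K0 g0]) auto
  have i2: "(LINT y|lborel. grad g y \<bullet> W y + g y * divg W y) = 0"
    by (rule integral_by_parts_divg[OF _ WC gC K K0 g0]) auto
  define A where "A y = g y * (u y \<bullet> u y)" for y
  define B where "B y = g y * H y" for y
  define G where "G y = g1 y * (F y)\<^sup>2" for y
  have g10: "g1 y = 0" if "y \<notin> K" for y
    using g0[OF that] by (simp add: g1_def g_def)
  have ext: "continuous_on UNIV q" if "continuous_on (-{0}) q" "\<And>y. y \<notin> K \<Longrightarrow> q y = 0" for q :: "real^3 \<Rightarrow> real"
  proof -
    have "continuous_on (-K) q \<longleftrightarrow> continuous_on (-K) (\<lambda>y. 0::real)"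
      using that(2) by (intro continuous_on_cong) auto
    then have "continuous_on (-{0} \<union> -K) q"
      using that(1) K by (intro continuous_on_open_Un) (auto simp: compact_imp_closed open_Compl)
    moreover have "-{0} \<union> -K = UNIV" using K0 by auto
    ultimately show ?thesis by simp
  qed
  have cu: "continuous_on (-{0}) u" "continuous_on (-{0}) F" "continuous_on (-{0}) H"
    using C1 F_C1 HC Ck_on_imp_continuous_on by blast+
  have cg: "continuous_on S g" "continuous_on S m" for S
    using Ck_on_imp_continuous_on[OF gC] Ck_on_imp_continuous_on[OF mC] continuous_on_subset by blast+
  have cA: "continuous_on UNIV A"
  proof (rule ext)
    show "continuous_on (-{0}) A" unfolding A_def by (intro continuous_intros cu cg)
  qed (simp add: A_def g0)
  have cB: "continuous_on UNIV B"
  proof (rule ext)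
    show "continuous_on (-{0}) B" unfolding B_def by (intro continuous_intros cu cg)
  qed (simp add: B_def g0)
  have cG: "continuous_on UNIV G"
  proof (rule ext)
    show "continuous_on (-{0}) G" unfolding G_def g1_def by (intro continuous_intros cu cg)
  qed (simp add: G_def g10)
  have "integrable lborel A" "integrable lborel B" "integrable lborel G"
    using cA cB cG g0 g10 by (auto intro!: integrable_continuous_compact_support[OF _ K] simp: A_def B_def G_def)
  note int = this
  have e1: "grad g y \<bullet> V y + g y * divg V y = G y + (1 - \<alpha>) * A y" for y
  proof (cases "y = 0")
    case True
    then have "y \<notin> K" using K0 by auto
    then show ?thesis using g0 g10 by (simp add: grad_g G_def A_def)
  qed (simp add: grad_g divV V_def G_def A_def F_def power2_eq_square)
  have e2: "grad g y \<bullet> W y + g y * divg W y = G y + (3 - 2*\<alpha>) * B y" for y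
  proof (cases "y = 0")
    case True
    then have "y \<notin> K" using K0 by auto
    then show ?thesis using g0 g10 by (simp add: grad_g G_def B_def)
  qed (simp add: grad_g divW W_def G_def B_def H)
  \<comment> \<open>The difference of the two identities; splitting \<open>3 - 2 \<alpha>\<close> as
    \<open>(2 - \<alpha>) - (\<alpha> - 1)\<close> then exhibits the two nonnegative terms.\<close>
  have "(LINT y|lborel. (\<alpha> - 1) * A y + (3 - 2*\<alpha>) * B y) = 0"
    using i1 i2 int unfolding e1 e2 by (simp add: algebra_simps)
  then have i: "(LINT y|lborel. g y * ((\<alpha> - 1) * (u y \<bullet> u y - H y) + (2 - \<alpha>) * H y)) = 0"
    by (simp add: A_def B_def algebra_simps)
  define q where "q y = g y * ((\<alpha> - 1) * (u y \<bullet> u y - H y) + (2 - \<alpha>) * H y)" for y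
  have cs: "H y \<le> u y \<bullet> u y" if "y \<noteq> 0" for y
    using Cauchy_Schwarz_ineq[of y "u y"] that by (simp add: H F_def field_simps)
  have "q x0 = 0"
  proof (rule integral_eq_0_imp_eq_0[of q K])
    show "continuous_on UNIV q"
    proof (rule ext)
      show "continuous_on (-{0}) q" unfolding q_def by (intro continuous_intros cu cg)
    qed (simp add: q_def g0)
    show "0 \<le> q y" for y
    proof (cases "y = 0")
      case True
      then have "y \<notin> K" using K0 by auto
      then show ?thesis using g0 by (simp add: q_def)
    next
      case False
      have "0 \<le> H y" by (simp add: H_def)
      then show ?thesis unfolding q_def using cs[OF False] \<alpha>
        by (intro mult_nonneg_nonneg add_nonneg_nonneg) (auto simp: g_def)
    qed
    show "(LINT y|lborel. q y) = 0" using i by (simp add: q_def)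
  qed (use K g0 in \<open>auto simp: q_def\<close>)
  moreover have "g x0 \<noteq> 0" using c by (simp add: g_def m_def c_def[symmetric] not_le)
  ultimately show ?thesis unfolding q_def H[OF x0] by simp
qed

lemma irrotational_low:
  assumes \<alpha>: "1 \<le> \<alpha>" "\<alpha> \<le> 2" and x0: "x0 \<noteq> 0"
  shows "curl u x0 = 0"
proof (rule curl_eq_0_by_density[OF _ C1])
  fix x assume "x \<in> - {0}" and u0: "u x \<noteq> 0"
  then have x: "x \<noteq> 0" by simp
  have cs: "(F y)\<^sup>2 / (y \<bullet> y) \<le> u y \<bullet> u y" if "y \<noteq> 0" for y
    using Cauchy_Schwarz_ineq[of y "u y"] that by (simp add: F_def field_simps)
  have c: "(\<alpha> - 1) * (u y \<bullet> u y - (F y)\<^sup>2 / (y \<bullet> y)) = 0 \<and> (2 - \<alpha>) * ((F y)\<^sup>2 / (y \<bullet> y)) = 0" if "y \<noteq> 0" for y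
  proof -
    have "0 \<le> (\<alpha> - 1) * (u y \<bullet> u y - (F y)\<^sup>2 / (y \<bullet> y))" using cs[OF that] \<alpha> by simp
    moreover have "0 \<le> (2 - \<alpha>) * ((F y)\<^sup>2 / (y \<bullet> y))" using \<alpha> by simp
    ultimately show ?thesis using integral_constraint[OF \<alpha> that] by linarith
  qed
  consider "\<alpha> = 1" | "\<alpha> = 2" | "\<alpha> \<noteq> 1" "\<alpha> \<noteq> 2" by blast
  then show "curl u x = 0"
  proof cases
    case 1
    \<comment> \<open>Tangential case. Differentiating F = 0 makes \<open>curl u\<close> parallel to
      \<open>x\<close>; the Beltrami condition makes it parallel to \<open>u\<close>, which is
      orthogonal to \<open>x\<close>.\<close>
    have F0: "F y = 0" if "y \<noteq> 0" for y using c[OF that] that 1 by simp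
    have "(F has_derivative (\<lambda>v. 0)) (at x)"
      by (rule has_derivative_transform_within_open[OF has_derivative_const, of "-{0}"]) (use x F0 in auto)
    from has_derivative_unique[OF F_der[OF x] this]
    have D: "x \<bullet> J x v + v \<bullet> u x = 0" for v by (rule fun_cong)
    let ?w = "curl u x"
    have "cross3 ?w x \<bullet> b = 0" for b
      using cross_curl[OF dif[OF x], of x b] J_hom[OF x] D[of b] 1 by (simp add: J_def inner_commute)
    then have "cross3 ?w x = 0" by (metis inner_eq_zero_iff)
    from cross3_lagrange[OF this] have "((x \<bullet> x) *\<^sub>R ?w) \<bullet> u x = ((x \<bullet> ?w) *\<^sub>R x) \<bullet> u x" by simp
    then have "?w \<bullet> u x = 0" using F0[OF x] x by (simp add: F_def)
    then have "(u x \<bullet> u x) *\<^sub>R ?w = 0"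
      using cross3_lagrange[OF bel[OF x]] by (simp add: inner_commute)
    then show ?thesis using u0 by simp
  next
    case 2
    \<comment> \<open>Radial case, u = h x. The Beltrami condition makes the gradient of
      \<open>h\<close> parallel to \<open>x\<close>, and then the Jacobian is symmetric.\<close>
    define h where "h y = F y / (y \<bullet> y)" for y
    have uh: "u y = h y *\<^sub>R y" if "y \<noteq> 0" for y
    proof -
      have "u y \<bullet> u y = (F y)\<^sup>2 / (y \<bullet> y)" using c[OF that] 2 by simp
      moreover have "(u y - h y *\<^sub>R y) \<bullet> (u y - h y *\<^sub>R y) = u y \<bullet> u y - 2 * h y * F y + (h y)\<^sup>2 * (y \<bullet> y)"
        by (simp add: F_def inner_diff_left inner_diff_right inner_commute algebra_simps power2_eq_square)
      ultimately have "(u y - h y *\<^sub>R y) \<bullet> (u y - h y *\<^sub>R y) = 0"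
        using that by (simp add: h_def field_simps power2_eq_square)
      then show ?thesis by simp
    qed
    have "h differentiable (at x)"
      unfolding h_def using x F_der[OF x]
      by (intro differentiable_divide differentiable_inner differentiable_ident) (auto simp: differentiable_def)
    then obtain Dh where Dh: "(h has_derivative Dh) (at x)" by (auto simp: differentiable_def)
    have "((\<lambda>y. h y *\<^sub>R y) has_derivative (\<lambda>v. h x *\<^sub>R v + Dh v *\<^sub>R x)) (at x)"
      by (intro has_derivative_scaleR Dh has_derivative_ident)
    then have "(u has_derivative (\<lambda>v. h x *\<^sub>R v + Dh v *\<^sub>R x)) (at x)"
      by (rule has_derivative_transform_within_open[of _ _ _ _ "-{0}"]) (use x uh in auto)
    then have "J x = (\<lambda>v. h x *\<^sub>R v + Dh v *\<^sub>R x)"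
      using has_derivative_unique der[OF x] by blast
    note Jh = fun_cong[OF this]
    have h0: "h x \<noteq> 0" using u0 uh[OF x] by auto
    have lin: "linear Dh" using Dh has_derivative_linear by blast
    have "Dh a * (x \<bullet> x) = Dh x * (x \<bullet> a)" for a
      using J_bel[OF x, of a] h0 lin
      unfolding Jh uh[OF x] by (simp add: linear_cmul algebra_simps inner_commute)
    then have Dha: "Dh a = Dh x * (x \<bullet> a) / (x \<bullet> x)" for a using x by (simp add: field_simps)
    show ?thesis
    proof (rule curl_0_iff[OF x])
      show "J x a \<bullet> b = J x b \<bullet> a" for a b
        unfolding Jh by (subst (1 2) Dha) (simp add: algebra_simps inner_commute)
    qed
  next
    case 3
    then have "u x \<bullet> u x = 0" using c[OF x] by auto
    then show ?thesis using u0 by simp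
  qed
qed (use x0 in auto)

end


section \<open>Exponents below 1: a maximum argument on the sphere\<close>

lemma curl_C1:
  assumes S: "open S" and C: "Ck_on 2 u S"
  shows "Ck_on 1 (curl u) S"
proof -
  have P: "Ck_on 1 (\<lambda>x. partial i u x $ k) S" for i k
    unfolding partial_def using Ck_on_SucD(2)[of 1 u S] C
    by (intro Ck_on_nth S) (simp add: numeral_2_eq_2)
  show ?thesis unfolding curl_def
    by (intro Ck_on_vector3 Ck_on_diff P S)
qed

lemma divg_curl:
  assumes S: "open S" "x \<in> S" and C: "Ck_on 2 u S"
  shows "divg (curl u) x = 0"
proof -
  have P: "Ck_on 1 (\<lambda>y. partial i u y) S" for i
    unfolding partial_def using Ck_on_SucD(2)[of 1 u S] C by (simp add: numeral_2_eq_2)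
  have dP: "(\<lambda>y. partial i u y) differentiable (at x)" for i
    unfolding differentiable_def by (rule exI) (rule C1D(1)[OF P S(2)])
  define Q where "Q i k v = frechet_derivative (\<lambda>y. partial i u y $ k) (at x) v" for i k v
  have Q: "((\<lambda>y. partial i u y $ k) has_derivative Q i k) (at x)" for i k
    unfolding Q_def by (rule C1D(1)[OF Ck_on_nth[OF S(1) P] S(2)])
  have sym: "Q i k (axis j 1) = Q j k (axis i 1)" for i j k
  proof -
    have "frechet_derivative (\<lambda>y. partial i u y) (at x) (axis j 1) = frechet_derivative (\<lambda>y. partial j u y) (at x) (axis i 1)"
      unfolding partial_def by (rule symmetric_second_derivative_vec[OF S C])
    then show ?thesis unfolding Q_def by (simp only: frechet_derivative_nth[OF dP])
  qed
  have "(curl u has_derivative (\<lambda>v. (Q 2 3 v - Q 3 2 v) *\<^sub>R axis 1 1 + (Q 3 1 v - Q 1 3 v) *\<^sub>R axis 2 1 +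
      (Q 1 2 v - Q 2 1 v) *\<^sub>R axis 3 1)) (at x)"
    unfolding curl_def vector3_eq_sum
    by (intro has_derivative_add has_derivative_scaleR_left has_derivative_diff Q)
  then have e: "frechet_derivative (curl u) (at x) = (\<lambda>v. (Q 2 3 v - Q 3 2 v) *\<^sub>R axis 1 1 + (Q 3 1 v - Q 1 3 v) *\<^sub>R axis 2 1 +
      (Q 1 2 v - Q 2 1 v) *\<^sub>R axis 3 1)"
    by (rule frechet_derivative_at[symmetric])
  show ?thesis
    unfolding divg_def partial_def e sum_3
    using sym[of 2 3 1] sym[of 3 2 1] sym[of 3 1 2] sym[of 1 3 2] sym[of 1 2 3] sym[of 2 1 3]
    by (simp add: axis_def)
qed

context beltrami_flow
begin

lemma J_scale:
  assumes x: "x \<noteq> 0" and l: "l > 0"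
  shows "J x v = (l powr \<alpha> * l) *\<^sub>R J (l *\<^sub>R x) v"
proof -
  have "((\<lambda>y. l *\<^sub>R y) has_derivative (\<lambda>v. l *\<^sub>R v)) (at x)"
    by (auto intro!: derivative_eq_intros)
  moreover have "(u has_derivative J (l *\<^sub>R x)) (at (l *\<^sub>R x))"
    using x l by (intro der) simp
  ultimately have "((\<lambda>y. u (l *\<^sub>R y)) has_derivative (\<lambda>v. J (l *\<^sub>R x) (l *\<^sub>R v))) (at x)"
    by (rule has_derivative_compose)
  then have "((\<lambda>y. l powr \<alpha> *\<^sub>R u (l *\<^sub>R y)) has_derivative (\<lambda>v. l powr \<alpha> *\<^sub>R J (l *\<^sub>R x) (l *\<^sub>R v))) (at x)"
    by (rule has_derivative_scaleR_right)
  then have "(u has_derivative (\<lambda>v. l powr \<alpha> *\<^sub>R J (l *\<^sub>R x) (l *\<^sub>R v))) (at x)"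
  proof (rule has_derivative_transform_within_open[of _ _ _ _ "-{0}"])
    show "l powr \<alpha> *\<^sub>R u (l *\<^sub>R y) = u y" if "y \<in> -{0}" for y
      using that by (intro hom[symmetric] l) simp
  qed (use x in auto)
  then have "J x = (\<lambda>v. l powr \<alpha> *\<^sub>R J (l *\<^sub>R x) (l *\<^sub>R v))"
    using der[OF x] has_derivative_unique by blast
  moreover have "linear (J (l *\<^sub>R x))" using x l by (intro linJ) simp
  ultimately show ?thesis by (simp add: linear_cmul)
qed

lemma curl_scale:
  assumes x: "x \<noteq> 0" and l: "l > 0"
  shows "curl u x = (l powr \<alpha> * l) *\<^sub>R curl u (l *\<^sub>R x)"
  using J_scale[OF x l] unfolding curl_def partial_def J_def vec_eq_iff forall_3
  by (simp add: right_diff_distrib)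

lemma u_unscale: "x \<noteq> 0 \<Longrightarrow> l > 0 \<Longrightarrow> u (l *\<^sub>R x) = (l powr (-\<alpha>)) *\<^sub>R u x"
  using hom[of x l] by (simp flip: powr_add)

definition "f x = norm x powr (\<alpha> - 1) * F x"
definition "\<psi> x = (curl u x \<bullet> u x) / (u x \<bullet> u x)"
text \<open>\<psi> has degree -1, and the factor makes the degree 0. It is written with
  \<open>powr 1\<close> so that \<open>has_derivative_norm_powr\<close> applies.\<close>

definition "\<phi> x = norm x powr 1 * \<psi> x"

lemma f_scale: "x \<noteq> 0 \<Longrightarrow> l > 0 \<Longrightarrow> f (l *\<^sub>R x) = f x"
proof -
  assume x: "x \<noteq> 0" and l: "l > 0"
  have "l * l powr (-\<alpha>) = l powr (1 - \<alpha>)" using powr_add[of l 1 "-\<alpha>"] l by simp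
  moreover have "l powr (\<alpha> - 1) * l powr (1 - \<alpha>) = 1" using l by (simp flip: powr_add)
  ultimately have "l powr (\<alpha> - 1) * (l * l powr (-\<alpha>)) = 1" by simp
  then show ?thesis
    unfolding f_def F_def u_unscale[OF x l] using l x by (simp add: powr_mult algebra_simps)
qed

lemma \<phi>_scale: "x \<noteq> 0 \<Longrightarrow> l > 0 \<Longrightarrow> \<phi> (l *\<^sub>R x) = \<phi> x"
proof -
  assume x: "x \<noteq> 0" and l: "l > 0"
  define c w v where "c = l powr \<alpha>" and "w = curl u (l *\<^sub>R x)" and "v = u (l *\<^sub>R x)"
  have c: "c > 0" using l by (simp add: c_def)
  have "\<psi> x = ((c * l) *\<^sub>R w \<bullet> c *\<^sub>R v) / (c *\<^sub>R v \<bullet> c *\<^sub>R v)"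
    unfolding \<psi>_def using curl_scale[OF x l] hom[OF x l] by (simp only: c_def w_def v_def)
  also have "\<dots> = l * ((w \<bullet> v) / (v \<bullet> v))" using c by (cases "v = 0") (auto simp: field_simps)
  finally have "\<psi> x = l * \<psi> (l *\<^sub>R x)" by (simp add: \<psi>_def w_def v_def)
  then show ?thesis using l x by (simp add: \<phi>_def)
qed

lemma curl_eq_\<psi>: "x \<noteq> 0 \<Longrightarrow> u x \<noteq> 0 \<Longrightarrow> curl u x = \<psi> x *\<^sub>R u x"
proof -
  assume x: "x \<noteq> 0" "u x \<noteq> 0"
  have "(u x \<bullet> u x) *\<^sub>R curl u x = (u x \<bullet> curl u x) *\<^sub>R u x"
    by (rule cross3_lagrange[OF bel[OF x(1)]])
  then have "curl u x = (1 / (u x \<bullet> u x)) *\<^sub>R ((u x \<bullet> curl u x) *\<^sub>R u x)"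
    using x by (metis inner_eq_zero_iff real_vector.scale_one nonzero_divide_eq_eq scaleR_scaleR)
  then show ?thesis by (simp add: \<psi>_def inner_commute)
qed

text \<open>The bracket is the deficit in Cauchy-Schwarz for \<open>x\<close> and
  \<open>u x\<close>: for \<alpha> < 1 the derivative is nonnegative and vanishes only where
  \<open>u\<close> is radial or zero.\<close>

lemma Df_u:
  assumes x: "x \<noteq> 0"
  shows "((\<lambda>t. f (x + t *\<^sub>R u x)) has_real_derivative
     (1 - \<alpha>) * norm x powr (\<alpha> - 1) * (u x \<bullet> u x - (F x)\<^sup>2 * norm x powr (-2))) (at 0)"
proof -
  define G where "G v = norm x powr (\<alpha> - 1) * (x \<bullet> J x v + v \<bullet> u x) + ((\<alpha> - 1) * norm x powr (\<alpha> - 1 - 2) * (x \<bullet> v)) * F x" for v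
  have "(f has_derivative G) (at x)"
    unfolding f_def G_def by (intro has_derivative_mult has_derivative_norm_powr F_der x)
  then have "(f has_derivative G) (at (x + 0 *\<^sub>R u x))" by simp
  from line_DERIV[OF this] have "((\<lambda>t. f (x + t *\<^sub>R u x)) has_real_derivative G (u x)) (at 0)" .
  moreover have "norm x powr (\<alpha> - 1 - 2) = norm x powr (\<alpha> - 1) * norm x powr (-2)"
    using x powr_add[of "norm x" "\<alpha> - 1" "-2"] by simp
  ultimately show ?thesis
    unfolding G_def DF_u[OF x] by (simp add: F_def power2_eq_square algebra_simps)
qed

lemma cauchy_F: "x \<noteq> 0 \<Longrightarrow> (F x)\<^sup>2 * norm x powr (-2) \<le> u x \<bullet> u x"
  using Cauchy_Schwarz_ineq[of x "u x"] by (simp add: F_def powr_minus field_simps dot_square_norm)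

lemma curl_0_pos:
  assumes C2: "Ck_on 2 u (-{0})" and \<alpha>: "\<alpha> < 1" and x: "x \<noteq> 0" and Fx: "F x > 0"
  shows "curl u x = 0"
proof -
  define c where "c = f x"
  have c: "c > 0" using x Fx by (simp add: c_def f_def)
  \<comment> \<open>Degree 0 reduces the superlevel set of \<open>f\<close> to a compact part of the
    sphere. As c > 0, both \<open>u\<close> and \<open>F\<close> are nonzero there, so \<phi> is
    continuous on it.\<close>
  define \<Sigma> where "\<Sigma> = {y \<in> sphere 0 1. f y \<in> {c..}}"
  have S0: "y \<in> \<Sigma> \<Longrightarrow> y \<noteq> 0" for y by (auto simp: \<Sigma>_def)
  have Su: "y \<in> \<Sigma> \<Longrightarrow> u y \<noteq> 0 \<and> F y > 0" for y
    using c by (auto simp: \<Sigma>_def f_def F_def)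
  have cf: "continuous_on (-{0}) f" unfolding f_def
    using Ck_on_imp_continuous_on[OF F_C1] Ck_on_imp_continuous_on[OF Ck_on_norm_powr[of 0]]
    by (intro continuous_on_mult) auto
  have cc: "continuous_on (-{0}) (curl u)" and cu: "continuous_on (-{0}) u"
    using continuous_on_curl[OF C1] Ck_on_imp_continuous_on[OF C1] by auto
  have "compact \<Sigma>"
  proof -
    have "closed (sphere 0 1 \<inter> f -` {c..})"
      by (intro continuous_closed_preimage continuous_on_subset[OF cf]) auto
    moreover have "sphere 0 1 \<inter> f -` {c..} = \<Sigma>" by (auto simp: \<Sigma>_def)
    ultimately show ?thesis
      by (metis bounded_subset bounded_sphere compact_eq_bounded_closed inf_le1)
  qed
  moreover have x1: "(1 / norm x) *\<^sub>R x \<in> \<Sigma>"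
    using x f_scale[OF x, of "1 / norm x"] by (simp add: \<Sigma>_def c_def)
  moreover have "continuous_on \<Sigma> (\<lambda>y. (\<phi> y)\<^sup>2)"
  proof -
    have "\<Sigma> \<subseteq> -{0}" using S0 by auto
    then show ?thesis unfolding \<phi>_def \<psi>_def
      using Su S0 by (intro continuous_intros continuous_on_subset[OF cc] continuous_on_subset[OF cu]) auto
  qed
  ultimately obtain y where y: "y \<in> \<Sigma>" and max: "\<And>z. z \<in> \<Sigma> \<Longrightarrow> (\<phi> z)\<^sup>2 \<le> (\<phi> y)\<^sup>2"
    using continuous_attains_sup[of \<Sigma> "\<lambda>y. (\<phi> y)\<^sup>2"] by blast
  have y0: "y \<noteq> 0" "u y \<noteq> 0" "F y > 0" "norm y = 1" using S0 Su y by (auto simp: \<Sigma>_def)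
  have "\<phi> y = 0"
  proof (rule ccontr)
    assume ne: "\<phi> y \<noteq> 0"
    have "curl u differentiable (at y)" "u differentiable (at y)"
      using C1D(1)[OF curl_C1[OF _ C2]] dif y0 unfolding differentiable_def by blast+
    then have "\<psi> differentiable (at y)"
      unfolding \<psi>_def using y0 by (intro differentiable_divide differentiable_inner) auto
    then obtain D where D: "(\<psi> has_derivative D) (at y)" by (auto simp: differentiable_def)
    \<comment> \<open>Divergence of \<open>curl u = \<psi> u\<close>: the left side and
      \<open>divg u\<close> vanish, which leaves the derivative of \<psi> along
      \<open>u\<close>.\<close>
    have Du: "D (u y) = 0"
    proof -
      define T where "T = {z \<in> -{0}. u z \<in> -{0}}"
      have oT: "open T"
      proof -
        have "open (-{0} \<inter> u -` (-{0}))" by (intro continuous_open_preimage cu) auto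
        moreover have "-{0} \<inter> u -` (-{0}) = T" by (auto simp: T_def)
        ultimately show ?thesis by simp
      qed
      have "((\<lambda>z. \<psi> z *\<^sub>R u z) has_derivative (\<lambda>v. \<psi> y *\<^sub>R J y v + D v *\<^sub>R u y)) (at y)"
        by (intro has_derivative_scaleR D der y0)
      then have "(curl u has_derivative (\<lambda>v. \<psi> y *\<^sub>R J y v + D v *\<^sub>R u y)) (at y)"
        by (rule has_derivative_transform_within_open[OF _ oT]) (use y0 curl_eq_\<psi> in \<open>auto simp: T_def\<close>)
      then have e: "frechet_derivative (curl u) (at y) = (\<lambda>v. \<psi> y *\<^sub>R J y v + D v *\<^sub>R u y)"
        by (rule frechet_derivative_at[symmetric])
      have "u y = u y$1 *\<^sub>R axis 1 1 + u y$2 *\<^sub>R axis 2 1 + u y$3 *\<^sub>R axis 3 1"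
        using vector3_eq_sum[of "u y$1" "u y$2" "u y$3"] vec3_eq[of "u y"] by simp
      then have "D (u y) = D (u y$1 *\<^sub>R axis 1 1 + u y$2 *\<^sub>R axis 2 1 + u y$3 *\<^sub>R axis 3 1)" by simp
      also have "\<dots> = u y$1 * D (axis 1 1) + u y$2 * D (axis 2 1) + u y$3 * D (axis 3 1)"
        using has_derivative_linear[OF D] by (simp add: linear_add linear_cmul)
      finally have "divg (curl u) y = \<psi> y * divg u y + D (u y)"
        unfolding divg_def partial_def e sum_3 by (simp add: J_def algebra_simps)
      then show ?thesis using divg_curl[OF open_Compl[OF closed_singleton] _ C2, of y] div0[OF y0(1)] y0(1) by simp
    qed
    define E where "E v = norm y powr 1 * D v + (1 * norm y powr (1 - 2) * (y \<bullet> v)) * \<psi> y" for v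
    have "(\<phi> has_derivative E) (at y)"
      unfolding \<phi>_def E_def by (intro has_derivative_mult has_derivative_norm_powr D y0)
    then have E: "(\<phi> has_derivative E) (at (y + 0 *\<^sub>R v))" for v by simp
    have phi: "\<phi> y = \<psi> y" using y0 by (simp add: \<phi>_def)
    have Eu: "E (u y) = F y * \<phi> y" using y0 Du by (simp add: E_def F_def phi)
    have lin: "linear E" using E[of 0] has_derivative_linear by auto
    \<comment> \<open>\<phi> is constant on the ray through \<open>y\<close>.\<close>
    have Ey: "E y = 0"
    proof -
      have 1: "((\<lambda>t. \<phi> (y + t *\<^sub>R y)) has_real_derivative E y) (at 0)" by (rule line_DERIV[OF E])
      have "((\<lambda>t. \<phi> (y + t *\<^sub>R y)) has_real_derivative 0) (at 0)"
      proof (rule has_field_derivative_transform_within_open[of "\<lambda>t. \<phi> y" 0 0 "{-1<..}"])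
        fix t :: real assume "t \<in> {-1<..}"
        then have "0 < 1 + t" by simp
        from \<phi>_scale[OF y0(1) this] show "\<phi> y = \<phi> (y + t *\<^sub>R y)" by (simp add: algebra_simps)
      qed auto
      then show ?thesis using 1 DERIV_unique by blast
    qed
    \<comment> \<open>If \<open>u y\<close> were radial, \<phi> would have derivative 0 along it,
      whereas that derivative is F \<phi>, which is nonzero. Hence \<open>f\<close> increases
      strictly along \<open>u\<close>.\<close>
    have "u y \<bullet> u y \<noteq> (F y)\<^sup>2"
    proof
      assume "u y \<bullet> u y = (F y)\<^sup>2"
      moreover have "y \<bullet> y = 1" using y0 by (simp add: dot_square_norm)
      ultimately have "(u y - F y *\<^sub>R y) \<bullet> (u y - F y *\<^sub>R y) = 0"
        by (simp add: F_def inner_diff_left inner_diff_right inner_commute algebra_simps power2_eq_square)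
      then have "u y = F y *\<^sub>R y" by simp
      then have "E (u y) = F y * E y" using lin by (metis linear_cmul real_scaleR_def)
      then show False using Eu Ey ne y0 by simp
    qed
    then have "(1 - \<alpha>) * norm y powr (\<alpha> - 1) * (u y \<bullet> u y - (F y)\<^sup>2 * norm y powr (-2)) > 0"
      using cauchy_F[OF y0(1)] \<alpha> y0 by simp
    from DERIV_pos_inc_right[OF Df_u[OF y0(1)] this]
    obtain d1 where d1: "d1 > 0" "\<And>h. h > 0 \<Longrightarrow> h < d1 \<Longrightarrow> f y < f (y + h *\<^sub>R u y)" by auto
    have "((\<lambda>t. (\<phi> (y + t *\<^sub>R u y))\<^sup>2) has_real_derivative 2 * \<phi> y * E (u y)) (at 0)"
      by (rule DERIV_cong[OF DERIV_power[OF line_DERIV[OF E]]]) simp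
    moreover have "2 * \<phi> y * E (u y) > 0"
    proof -
      have "2 * \<phi> y * E (u y) = 2 * F y * (\<phi> y)\<^sup>2" by (simp add: Eu power2_eq_square)
      moreover have "0 < 2 * F y * (\<phi> y)\<^sup>2" using ne y0 by simp
      ultimately show ?thesis by (simp only:)
    qed
    ultimately obtain d2 where d2: "d2 > 0" "\<And>h. h > 0 \<Longrightarrow> h < d2 \<Longrightarrow> (\<phi> y)\<^sup>2 < (\<phi> (y + h *\<^sub>R u y))\<^sup>2"
      using DERIV_pos_inc_right by fastforce
    \<comment> \<open>A short step along \<open>u\<close> increases both \<open>f\<close> and
      \<open>\<phi>\<^sup>2\<close>. Projected back to the sphere it stays in \<Sigma> and exceeds
      the maximum.\<close>
    define h where "h = min d1 d2 / 2"
    have h: "h > 0" "h < d1" "h < d2" using d1(1) d2(1) by (auto simp: h_def)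
    define z where "z = y + h *\<^sub>R u y"
    have z: "f y < f z" "(\<phi> y)\<^sup>2 < (\<phi> z)\<^sup>2" using d1(2) d2(2) h by (auto simp: z_def)
    have z0: "z \<noteq> 0" using z(2) by (auto simp: \<phi>_def)
    have "(1 / norm z) *\<^sub>R z \<in> \<Sigma>"
      using z0 z(1) y f_scale[OF z0, of "1 / norm z"] by (simp add: \<Sigma>_def)
    from max[OF this] show False using \<phi>_scale[OF z0, of "1 / norm z"] z0 z(2) by simp
  qed
  then have "(\<phi> ((1 / norm x) *\<^sub>R x))\<^sup>2 = 0" using max[OF x1] by simp
  then have "\<phi> x = 0" using \<phi>_scale[OF x, of "1 / norm x"] x by simp
  then have "\<psi> x = 0" using x by (simp add: \<phi>_def)
  moreover have "u x \<noteq> 0" using Fx by (auto simp: F_def)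
  ultimately show ?thesis using curl_eq_\<psi>[OF x] by simp
qed

end

lemma curl_uminus:
  assumes "u differentiable (at x)"
  shows "curl (\<lambda>y. - u y) x = - curl u x"
proof -
  have "((\<lambda>y. - u y) has_derivative (\<lambda>v. - frechet_derivative u (at x) v)) (at x)"
    using assms frechet_derivative_works has_derivative_minus by blast
  then have "frechet_derivative (\<lambda>y. - u y) (at x) = (\<lambda>v. - frechet_derivative u (at x) v)"
    by (rule frechet_derivative_at[symmetric])
  then show ?thesis unfolding curl_def partial_def vec_eq_iff forall_3 by simp
qed

context beltrami_flow
begin

lemma beltrami_flow_uminus: "beltrami_flow \<alpha> (\<lambda>y. - u y)"
proof
  show "Ck_on 1 (\<lambda>y. - u y) (-{0})" by (intro Ck_on_uminus C1) auto
  fix x :: "real^3" assume x: "x \<noteq> 0"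
  have "((\<lambda>y. - u y) has_derivative (\<lambda>v. - J x v)) (at x)"
    by (rule has_derivative_minus[OF der[OF x]])
  then have e: "frechet_derivative (\<lambda>y. - u y) (at x) = (\<lambda>v. - J x v)"
    by (rule frechet_derivative_at[symmetric])
  show "divg (\<lambda>y. - u y) x = 0"
    using div0[OF x] unfolding divg_def partial_def e by (simp add: J_def sum_negf)
  show "cross3 (curl (\<lambda>y. - u y) x) (- u x) = 0"
    using bel[OF x] unfolding curl_uminus[OF dif[OF x]] by (simp add: cross3_def vec_eq_iff forall_3)
  fix l :: real assume "l > 0"
  then show "- u x = l powr \<alpha> *\<^sub>R - u (l *\<^sub>R x)" using hom[OF x] by simp
qed

lemma irrotational_C2:
  assumes C2: "Ck_on 2 u (-{0})" and \<alpha>: "\<alpha> < 1" and x0: "x0 \<noteq> 0"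
  shows "curl u x0 = 0"
proof (rule curl_eq_0_by_density[OF _ C1])
  fix x assume "x \<in> - {0}" and u0: "u x \<noteq> 0"
  then have x: "x \<noteq> 0" by simp
  consider "F x > 0" | "F x < 0" | "F x = 0" by linarith
  then show "curl u x = 0"
  proof cases
    case 1
    then show ?thesis using curl_0_pos[OF C2 \<alpha> x] by simp
  next
    case 2
    \<comment> \<open>Reversing the flow changes the sign of F and keeps the Beltrami
      condition.\<close>
    interpret m: beltrami_flow \<alpha> "\<lambda>y. - u y" by (rule beltrami_flow_uminus)
    have "curl (\<lambda>y. - u y) x = 0"
      using 2 by (intro m.curl_0_pos Ck_on_uminus C2 \<alpha> x) (auto simp: m.F_def F_def)
    then show ?thesis using curl_uminus[OF dif[OF x]] by simp
  next
    case 3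
    \<comment> \<open>Where F = 0 and u is nonzero, \<open>f\<close> increases strictly along
      \<open>u\<close>, so \<open>x\<close> is a limit of points with F > 0; there the curl is
      already known to vanish, and it is continuous.\<close>
    have "(1 - \<alpha>) * norm x powr (\<alpha> - 1) * (u x \<bullet> u x - (F x)\<^sup>2 * norm x powr (-2)) > 0"
      using 3 \<alpha> x u0 by simp
    from DERIV_pos_inc_right[OF Df_u[OF x] this]
    obtain d where d: "d > 0" "\<And>h. h > 0 \<Longrightarrow> h < d \<Longrightarrow> f x < f (x + h *\<^sub>R u x)" by auto
    have c0: "curl u (x + h *\<^sub>R u x) = 0" if h: "h > 0" "h < d" for h
    proof -
      have "f (x + h *\<^sub>R u x) > 0" using d(2)[OF h] 3 by (simp add: f_def)
      then have "x + h *\<^sub>R u x \<noteq> 0" "F (x + h *\<^sub>R u x) > 0"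
        by (auto simp: f_def zero_less_mult_iff)
      then show ?thesis by (rule curl_0_pos[OF C2 \<alpha>])
    qed
    have "isCont (curl u) x"
      using continuous_on_curl[OF C1] x
      by (simp add: continuous_on_eq_continuous_at[OF open_Compl[OF closed_singleton]])
    moreover have "((\<lambda>h. x + h *\<^sub>R u x) \<longlongrightarrow> x) (at_right 0)"
      by (auto intro!: tendsto_eq_intros)
    ultimately have "((\<lambda>h. curl u (x + h *\<^sub>R u x)) \<longlongrightarrow> curl u x) (at_right 0)"
      by (rule isCont_tendsto_compose)
    moreover have "eventually (\<lambda>h. curl u (x + h *\<^sub>R u x) = 0) (at_right 0)"
      using c0 d(1) by (auto simp: eventually_at_right_field)
    ultimately have "((\<lambda>h. 0) \<longlongrightarrow> curl u x) (at_right (0::real))"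
      using tendsto_cong by force
    then show ?thesis by (simp add: tendsto_const_iff)
  qed
qed (use x0 in auto)

end

lemma beltrami_flow_of_solution:
  assumes "classical_solution k \<alpha> u p" "1 \<le> k" "beltrami_classical u"
  shows "beltrami_flow \<alpha> u"
proof
  show "Ck_on 1 u (-{0})"
    using assms Ck_on_antimono unfolding classical_solution_def by blast
  fix x :: "real^3" assume x: "x \<noteq> 0"
  show "divg u x = 0"
    using assms(1) x by (simp add: classical_solution_def euler_classical_def)
  show "cross3 (curl u x) (u x) = 0"
    using assms(3) x by (simp add: beltrami_classical_def)
  fix l :: real assume "l > 0"
  then show "u x = (l powr \<alpha>) *\<^sub>R u (l *\<^sub>R x)"
    using assms(1) x unfolding classical_solution_def homogeneous_on_def by blast
qed

lemma nonexistence_low: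
  assumes "1 \<le> \<alpha>" "\<alpha> \<le> 2" "classical_solution 1 \<alpha> u p" "beltrami_classical u"
  shows "irrotational_classical u"
proof -
  interpret beltrami_flow \<alpha> u using beltrami_flow_of_solution assms by blast
  show ?thesis using irrotational_low[OF assms(1,2)] by (auto simp: irrotational_classical_def)
qed

lemma nonexistence_C2:
  assumes "\<alpha> < 1" "classical_solution 2 \<alpha> u p" "beltrami_classical u"
  shows "irrotational_classical u"
proof -
  interpret beltrami_flow \<alpha> u using beltrami_flow_of_solution[OF assms(2) _ assms(3)] by simp
  show ?thesis using irrotational_C2 assms(1,2)
    by (auto simp: irrotational_classical_def classical_solution_def)
qed

section \<open>The boundary value problem for the profile\<close>

text \<open>Solution kernel of \<open>w'' = - g / (1 - t^2)\<close> with data at the left endpoint.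
  The positive part keeps the domain of integration fixed. It is bounded despite the singular weight
  because t - s \<le> 1 - s; at s = 1 division by zero gives the value 0.\<close>

definition kern :: "real \<Rightarrow> real \<Rightarrow> real" where
  "kern t s = max 0 (t - s) / (1 - s\<^sup>2)"

lemma one_minus_sq: "1 - s\<^sup>2 = (1 - s) * (1 + s)" for s :: real
  by (simp add: power2_eq_square algebra_simps)

lemma kern_bounds:
  assumes "0 \<le> s" "s \<le> 1" "t \<le> 1"
  shows "0 \<le> kern t s" "kern t s \<le> 1"
proof -
  have "s\<^sup>2 \<le> 1" using assms by (simp add: power_le_one)
  then show "0 \<le> kern t s" by (simp add: kern_def)
  show "kern t s \<le> 1"
  proof (cases "s = 1")
    case False
    then have s: "0 < 1 - s" using assms by simp
    have "max 0 (t - s) \<le> (1 - s) * (1 + s)"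
      using assms mult_left_mono[of 1 "1 + s" "1 - s"] by auto
    moreover have "0 < (1 - s) * (1 + s)" using s assms by simp
    ultimately show ?thesis by (simp add: kern_def one_minus_sq)
  qed (use assms in \<open>simp add: kern_def\<close>)
qed

lemma kern_eq_0: "t \<le> s \<Longrightarrow> kern t s = 0" by (simp add: kern_def)

lemma kern_measurable [measurable]: "kern t \<in> borel_measurable borel"
  unfolding kern_def by measurable

lemma kern_continuous: "continuous_on A (\<lambda>t. kern t s)"
  unfolding kern_def divide_inverse by (intro continuous_intros)

lemma dominated_measurable_integrable_on:
  fixes f :: "real \<Rightarrow> real"
  assumes "f \<in> borel_measurable borel" "\<And>s. s \<in> {a..b} \<Longrightarrow> \<bar>f s\<bar> \<le> D s" "D integrable_on {a..b}"
  shows "f integrable_on {a..b}"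
proof (rule measurable_bounded_by_integrable_imp_integrable[OF _ assms(3)])
  show "f \<in> borel_measurable (lebesgue_on {a..b})"
    using assms(1) by (intro measurable_restrict_space1 measurable_completion) auto
qed (use assms(2) in auto)

lemma bounded_measurable_integrable_on:
  fixes f :: "real \<Rightarrow> real"
  assumes "f \<in> borel_measurable borel" "\<And>s. s \<in> {a..b} \<Longrightarrow> \<bar>f s\<bar> \<le> B"
  shows "f integrable_on {a..b}"
  using dominated_measurable_integrable_on[OF assms] by (simp add: integrable_const_ivl)

lemma continuous_on_parametric_integral:
  fixes h :: "'x::metric_space \<Rightarrow> real \<Rightarrow> real"
  assumes m: "\<And>x. x \<in> X \<Longrightarrow> h x \<in> borel_measurable borel"
    and B: "\<And>x s. x \<in> X \<Longrightarrow> s \<in> {a..b} \<Longrightarrow> \<bar>h x s\<bar> \<le> B"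
    and c: "\<And>s. s \<in> {a..b} \<Longrightarrow> continuous_on X (\<lambda>x. h x s)"
  shows "continuous_on X (\<lambda>x. integral {a..b} (h x))"
  unfolding continuous_on_sequentially
proof (intro allI ballI impI)
  fix x l assume xl: "l \<in> X" "(\<forall>n. x n \<in> X) \<and> x \<longlonglongrightarrow> l"
  have "(\<lambda>n. integral {a..b} (h (x n))) \<longlonglongrightarrow> integral {a..b} (h l)"
  proof (rule dominated_convergence(2)[where h="\<lambda>_. B"])
    show "h (x n) integrable_on {a..b}" for n
      using xl m B by (intro bounded_measurable_integrable_on[where B=B]) auto
    show "norm (h (x n) s) \<le> B" if "s \<in> {a..b}" for n s using B xl that by auto
    show "(\<lambda>n. h (x n) s) \<longlonglongrightarrow> h l s" if "s \<in> {a..b}" for s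
      using c[OF that] xl unfolding continuous_on_sequentially by (auto simp: o_def)
  qed (rule integrable_const_ivl)
  then show "((\<lambda>x. integral {a..b} (h x)) \<circ> x) \<longlonglongrightarrow> integral {a..b} (h l)" by (simp add: o_def)
qed

lemma kern_mult_integrable:
  assumes "0 \<le> a" "b \<le> 1" "t \<le> 1" "g \<in> borel_measurable borel" "\<And>s. s \<in> {a..b} \<Longrightarrow> \<bar>g s\<bar> \<le> B"
  shows "(\<lambda>s. kern t s * g s) integrable_on {a..b}"
proof (rule bounded_measurable_integrable_on)
  show "(\<lambda>s. kern t s * g s) \<in> borel_measurable borel" using assms(4) by measurable
  show "\<bar>kern t s * g s\<bar> \<le> B" if "s \<in> {a..b}" for s
  proof -
    have "\<bar>kern t s * g s\<bar> = kern t s * \<bar>g s\<bar>" using kern_bounds[of s t] assms that by (simp add: abs_mult)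
    also have "\<dots> \<le> 1 * B" using kern_bounds[of s t] assms(1-3) assms(5)[OF that] that by (intro mult_mono) auto
    finally show ?thesis by simp
  qed
qed

text \<open>\<open>f\<close> differs by a constant from the primitive of its continuous derivative
  \<open>g\<close>, and the primitive has one-sided derivatives at the endpoints.\<close>

lemma has_derivative_at_endpoints:
  fixes f g :: "real \<Rightarrow> real"
  assumes f: "continuous_on {a..b} f" and d: "\<And>x. x \<in> {a<..<b} \<Longrightarrow> (f has_real_derivative g x) (at x)"
    and g: "continuous_on {a..b} g" and x: "x \<in> {a..b}"
  shows "(f has_real_derivative g x) (at x within {a..b})"
proof -
  have A: "((\<lambda>y. f a + integral {a..y} g) has_real_derivative g x) (at x within {a..b})"
    using integral_has_real_derivative[OF g x] by (auto intro!: derivative_eq_intros)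
  have E: "f a + integral {a..y} g = f y" if "y \<in> {a..b}" for y
  proof -
    have "(g has_integral (f y - f a)) {a..y}"
      using that f d by (intro fundamental_theorem_of_calculus_interior)
        (auto intro: continuous_on_subset simp flip: has_real_derivative_iff_has_vector_derivative)
    then show ?thesis by (simp add: integral_unique)
  qed
  show ?thesis
    by (rule has_field_derivative_transform_within[OF A zero_less_one x E])
qed

lemma one_minus_powr_integrable:
  fixes a b \<eta> :: real
  assumes "a \<le> b" "b \<le> 1" "\<eta> > 0"
  shows "(\<lambda>s. (1 - s) powr (\<eta> - 1)) integrable_on {a..b}"
proof -
  have "((\<lambda>s. (1 - s) powr (\<eta> - 1)) has_integral (- ((1 - b) powr \<eta>) / \<eta> - (- ((1 - a) powr \<eta>) / \<eta>))) {a..b}"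
  proof (rule fundamental_theorem_of_calculus_interior)
    show "continuous_on {a..b} (\<lambda>s. - ((1 - s) powr \<eta>) / \<eta>)"
      using assms by (intro continuous_intros continuous_on_powr') auto
    fix s assume s: "s \<in> {a<..<b}"
    then have "((\<lambda>s. - ((1 - s) powr \<eta>) / \<eta>) has_real_derivative (1 - s) powr (\<eta> - 1)) (at s)"
      using assms by (auto intro!: derivative_eq_intros simp: powr_diff field_simps)
    then show "((\<lambda>s. - ((1 - s) powr \<eta>) / \<eta>) has_vector_derivative (1 - s) powr (\<eta> - 1)) (at s)"
      by (simp add: has_real_derivative_iff_has_vector_derivative)
  qed (use assms in auto)
  then show ?thesis by blast
qed

text \<open>The decay with exponent \<eta> > 0 makes \<open>g / (1 - s^2)\<close> integrable up to
  the singular point 1, so the derivative of \<open>w\<close> remains continuous there. The equation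
  itself is only claimed for t < 1.\<close>

lemma volterra_regularity:
  fixes g :: "real \<Rightarrow> real"
  assumes ab: "0 \<le> a" "a < b" "b \<le> 1" and g: "continuous_on {a..b} g"
    and gm[measurable]: "g \<in> borel_measurable borel" and \<eta>: "\<eta> > 0" "\<And>s. s \<in> {a..b} \<Longrightarrow> \<bar>g s\<bar> \<le> C * (1 - s) powr \<eta>"
    and w: "\<And>t. t \<in> {a..b} \<Longrightarrow> w t = \<sigma> * (t - a) - integral {a..b} (\<lambda>s. kern t s * g s)"
  obtains w1 where "continuous_on {a..b} w1"
    "\<And>t. t \<in> {a..b} \<Longrightarrow> (w has_real_derivative w1 t) (at t within {a..b})"
    "\<And>t. t \<in> {a..b} \<Longrightarrow> t < 1 \<Longrightarrow> (w1 has_real_derivative - (g t / (1 - t\<^sup>2))) (at t within {a..b})"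
    "w1 a = \<sigma>"
proof -
  define R where "R s = g s / (1 - s\<^sup>2)" for s
  have contR: "continuous (at s within {a..b}) R" if "s \<in> {a..b}" "s < 1" for s
  proof -
    have "s\<^sup>2 \<noteq> 1" using that ab by (auto simp: power2_eq_1_iff)
    then show ?thesis unfolding R_def using g that
      by (intro continuous_intros) (auto simp: continuous_on_eq_continuous_within)
  qed
  define D where "D s = C * (1 - s) powr (\<eta> - 1)" for s
  have Db: "\<bar>R s\<bar> \<le> D s" if "s \<in> {a..b}" for s
  proof (cases "s = 1")
    case False
    then have s: "0 < 1 - s" "0 \<le> s" using that ab by auto
    have "\<bar>R s\<bar> = \<bar>g s\<bar> / ((1 - s) * (1 + s))"
      using s by (simp add: R_def one_minus_sq abs_mult)
    also have "\<dots> \<le> \<bar>g s\<bar> / ((1 - s) * 1)"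
      using s by (intro divide_left_mono mult_left_mono mult_pos_pos) auto
    also have "\<dots> \<le> C * (1 - s) powr \<eta> / (1 - s)"
      using \<eta>(2)[OF that] s by (simp add: divide_right_mono)
    also have "\<dots> = D s" using s by (simp add: D_def powr_diff)
    finally show ?thesis .
  qed (simp add: R_def D_def)
  have Rm[measurable]: "R \<in> borel_measurable borel" unfolding R_def by measurable
  have Dint: "D integrable_on {a..b}"
    unfolding D_def using ab \<eta>(1) by (intro integrable_on_mult_right one_minus_powr_integrable) auto
  have Rint: "R integrable_on {a..b}"
    by (rule dominated_measurable_integrable_on[OF Rm Db Dint])
  have sRint: "(\<lambda>s. s * R s) integrable_on {a..b}"
  proof (rule dominated_measurable_integrable_on[OF _ _ Dint])
    show "\<bar>s * R s\<bar> \<le> D s" if "s \<in> {a..b}" for s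
      using Db[OF that] mult_mono[of "\<bar>s\<bar>" 1 "\<bar>R s\<bar>" "D s"] that ab by (simp add: abs_mult)
  qed measurable
  define w1 where "w1 t = \<sigma> - integral {a..t} R" for t
  have c1: "continuous_on {a..b} w1" unfolding w1_def
    by (intro continuous_intros indefinite_integral_continuous_1 Rint)
  have IR: "((\<lambda>t. integral {a..t} R) has_real_derivative R t) (at t within {a..b})" if "t \<in> {a..b}" "t < 1" for t
    using integral_has_vector_derivative_continuous_at[OF Rint, of t "{}"] that contR[OF that]
    by (simp add: has_real_derivative_iff_has_vector_derivative)
  have IsR: "((\<lambda>t. integral {a..t} (\<lambda>s. s * R s)) has_real_derivative t * R t) (at t within {a..b})" if "t \<in> {a..b}" "t < 1" for t
    using integral_has_vector_derivative_continuous_at[OF sRint, of t "{}"] that contR[OF that]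
    by (simp add: has_real_derivative_iff_has_vector_derivative continuous_intros)
  \<comment> \<open>Writing \<open>(t - s) R s\<close> as \<open>t R s - s R s\<close> removes the
    parameter from the integrands, so the fundamental theorem of calculus applies.\<close>
  have weq: "w t = \<sigma> * (t - a) - t * integral {a..t} R + integral {a..t} (\<lambda>s. s * R s)" if t: "t \<in> {a..b}" for t
  proof -
    have 1: "((\<lambda>s. (t - s) * R s) has_integral (t * integral {a..t} R - integral {a..t} (\<lambda>s. s * R s))) {a..t}"
    proof -
      have "R integrable_on {a..t}" "(\<lambda>s. s * R s) integrable_on {a..t}"
        using Rint sRint t by (auto intro: integrable_on_subinterval)
      then have "((\<lambda>s. t * R s - s * R s) has_integral (t * integral {a..t} R - integral {a..t} (\<lambda>s. s * R s))) {a..t}"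
        by (intro has_integral_diff has_integral_mult_right integrable_integral)
      then show ?thesis by (simp add: left_diff_distrib)
    qed
    have "((\<lambda>s. kern t s * g s) has_integral (t * integral {a..t} R - integral {a..t} (\<lambda>s. s * R s))) {a..t}"
      by (rule has_integral_eq[OF _ 1]) (auto simp: kern_def R_def)
    moreover have "((\<lambda>s. kern t s * g s) has_integral 0) {t..b}"
      by (rule has_integral_is_0) (auto simp: kern_eq_0)
    ultimately have "((\<lambda>s. kern t s * g s) has_integral (t * integral {a..t} R - integral {a..t} (\<lambda>s. s * R s)) + 0) {a..b}"
      using t by (intro has_integral_combine) auto
    then show ?thesis using w[OF t] by (simp add: integral_unique)
  qed
  have wd: "(w has_real_derivative w1 t) (at t within {a..b})" if t: "t \<in> {a..b}" for t
  proof (rule has_derivative_at_endpoints[OF _ _ c1 t])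
    have "continuous_on {a..b} (\<lambda>t. \<sigma> * (t - a) - t * integral {a..t} R + integral {a..t} (\<lambda>s. s * R s))"
      by (intro continuous_intros indefinite_integral_continuous_1 Rint sRint)
    then show "continuous_on {a..b} w" by (rule continuous_on_eq) (use weq in auto)
    fix x assume x: "x \<in> {a<..<b}"
    then have x1: "x \<in> {a..b}" "x < 1" using ab by auto
    have "((\<lambda>t. \<sigma> * (t - a) - t * integral {a..t} R + integral {a..t} (\<lambda>s. s * R s)) has_real_derivative
      \<sigma> - (integral {a..x} R + R x * x) + x * R x) (at x within {a..b})"
      by (rule derivative_eq_intros IR[OF x1] IsR[OF x1] refl | simp)+
    then have "((\<lambda>t. \<sigma> * (t - a) - t * integral {a..t} R + integral {a..t} (\<lambda>s. s * R s)) has_real_derivative w1 x) (at x)"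
      using x by (simp add: w1_def at_within_Icc_at mult.commute)
    then show "(w has_real_derivative w1 x) (at x)"
      by (rule has_field_derivative_transform_within_open[of _ _ _ "{a<..<b}"]) (use x weq in auto)
  qed
  have w1d: "(w1 has_real_derivative - (g t / (1 - t\<^sup>2))) (at t within {a..b})" if "t \<in> {a..b}" "t < 1" for t
    unfolding w1_def using IR[OF that] by (auto intro!: derivative_eq_intros simp: R_def)
  show thesis
    by (rule that[OF c1 wd w1d]) (auto simp: w1_def)
qed


lemma abs_integral_bound:
  fixes f :: "real \<Rightarrow> real"
  assumes "f integrable_on {a..b}" "a \<le> b" "\<And>s. s \<in> {a..b} \<Longrightarrow> \<bar>f s\<bar> \<le> B"
  shows "\<bar>integral {a..b} f\<bar> \<le> B * (b - a)"
  using integral_norm_bound_integral[OF assms(1) integrable_const_ivl, of B] assms(2,3) by (simp add: mult.commute)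

lemma integral_split_vanishing:
  fixes f :: "real \<Rightarrow> real"
  assumes "f integrable_on {a..b}" "a \<le> t" "t \<le> b" "\<And>s. t \<le> s \<Longrightarrow> f s = 0"
  shows "integral {a..b} f = integral {a..t} f"
proof -
  have "integral {a..t} f + integral {t..b} f = integral {a..b} f"
    by (rule Henstock_Kurzweil_Integration.integral_combine[OF assms(2,3,1)])
  moreover have "integral {t..b} f = 0"
    using assms(4) by (intro integral_unique has_integral_is_0) auto
  ultimately show ?thesis by simp
qed

section \<open>Superlinear pieces: shooting in the coefficient\<close>

definition clamp01 :: "real \<Rightarrow> real" where "clamp01 y = min 1 (max 0 y)"

lemma clamp01: "0 \<le> clamp01 y" "clamp01 y \<le> 1" "\<bar>clamp01 y - clamp01 z\<bar> \<le> \<bar>y - z\<bar>"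
  by (auto simp: clamp01_def)

lemma clamp01_id: "0 \<le> y \<Longrightarrow> y \<le> 1 \<Longrightarrow> clamp01 y = y" by (simp add: clamp01_def)

text \<open>The nonlinearity truncated to [0, 1], hence bounded and, for p \<ge> 1, Lipschitz. The
  pieces constructed below take values in [0, 1], where the truncation has no effect.\<close>

definition Fc :: "real \<Rightarrow> real \<Rightarrow> real \<Rightarrow> real \<Rightarrow> real" where
  "Fc \<mu> p c y = \<mu> * clamp01 y + c * clamp01 y powr p"

lemma powr_lipschitz:
  fixes p x y :: real
  assumes "1 \<le> p" "0 \<le> x" "x \<le> 1" "0 \<le> y" "y \<le> 1"
  shows "\<bar>x powr p - y powr p\<bar> \<le> p * \<bar>x - y\<bar>"
proof -
  have *: "\<bar>x powr p - y powr p\<bar> \<le> p * \<bar>x - y\<bar>" if "0 \<le> x" "x < y" "y \<le> 1" for x y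
  proof -
    have c: "continuous_on {x..y} (\<lambda>x. x powr p)"
      using that assms(1) by (intro continuous_on_powr' continuous_intros) auto
    have d: "((\<lambda>x. x powr p) has_derivative (\<lambda>h. (p * \<xi> powr (p - 1)) * h)) (at \<xi>)"
      if "x < \<xi>" "\<xi> < y" for \<xi>
      using that \<open>0 \<le> x\<close> by (intro has_field_derivative_imp_has_derivative has_real_derivative_powr) auto
    from mvt[OF that(2) c d]
    obtain \<xi> where \<xi>: "x < \<xi>" "\<xi> < y" "y powr p - x powr p = (p * \<xi> powr (p - 1)) * (y - x)" .
    have "\<xi> powr (p - 1) \<le> 1" using \<xi> that assms(1) powr_le_one_le by (simp add: powr_le1)
    then have "(p * \<xi> powr (p - 1)) * (y - x) \<le> (p * 1) * (y - x)"
      using that assms(1) by (intro mult_right_mono mult_left_mono) auto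
    moreover have "0 \<le> (p * \<xi> powr (p - 1)) * (y - x)" using that assms(1) by simp
    ultimately show ?thesis using \<xi>(3) that by (simp add: abs_if)
  qed
  show ?thesis using *[of x y] *[of y x] assms by (cases x y rule: linorder_cases) (auto simp: abs_minus_commute)
qed

lemma Fc_lipschitz:
  assumes "0 \<le> \<mu>" "1 \<le> p" "0 \<le> c" "c \<le> cm"
  shows "\<bar>Fc \<mu> p c y - Fc \<mu> p c z\<bar> \<le> (\<mu> + cm * p) * \<bar>y - z\<bar>"
proof -
  let ?d = "\<bar>clamp01 y - clamp01 z\<bar>"
  have "Fc \<mu> p c y - Fc \<mu> p c z = \<mu> * (clamp01 y - clamp01 z) + c * (clamp01 y powr p - clamp01 z powr p)"
    by (simp add: Fc_def algebra_simps)
  then have "\<bar>Fc \<mu> p c y - Fc \<mu> p c z\<bar> \<le> \<mu> * ?d + c * \<bar>clamp01 y powr p - clamp01 z powr p\<bar>"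
    using abs_triangle_ineq[of "\<mu> * (clamp01 y - clamp01 z)" "c * (clamp01 y powr p - clamp01 z powr p)"] assms
    by (simp add: abs_mult)
  also have "\<dots> \<le> \<mu> * ?d + cm * (p * ?d)"
    using assms powr_lipschitz[OF assms(2), of "clamp01 y" "clamp01 z"]
    by (intro add_left_mono mult_mono) (auto simp: clamp01)
  also have "\<dots> = (\<mu> + cm * p) * ?d" by (simp add: algebra_simps)
  also have "\<dots> \<le> (\<mu> + cm * p) * \<bar>y - z\<bar>"
    using assms by (intro mult_left_mono clamp01) auto
  finally show ?thesis .
qed

lemma Fc_bounds:
  assumes "0 \<le> \<mu>" "0 \<le> p" "0 \<le> c"
  shows "0 \<le> Fc \<mu> p c y" "Fc \<mu> p c y \<le> \<mu> + c" "\<bar>Fc \<mu> p c y\<bar> \<le> \<mu> + c"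
proof -
  have "clamp01 y powr p \<le> 1" using clamp01[of y] assms by (simp add: powr_le1)
  then have "\<mu> * clamp01 y + c * clamp01 y powr p \<le> \<mu> * 1 + c * 1"
    using assms clamp01[of y] by (intro add_mono mult_left_mono) auto
  then show "0 \<le> Fc \<mu> p c y" "Fc \<mu> p c y \<le> \<mu> + c"
    using assms clamp01[of y] by (auto simp: Fc_def)
  then show "\<bar>Fc \<mu> p c y\<bar> \<le> \<mu> + c" by simp
qed

lemma Fc_measurable [measurable]: "Fc \<mu> p c \<in> borel_measurable borel"
  unfolding Fc_def clamp01_def by measurable

lemma continuous_on_Fc [continuous_intros]:
  assumes "continuous_on A c" "continuous_on A y" "p > 0"
  shows "continuous_on A (\<lambda>x. Fc \<mu> p (c x) (y x))"
proof -
  have cl: "continuous_on A (\<lambda>x. clamp01 (y x))"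
    unfolding clamp01_def by (intro continuous_intros assms)
  have "continuous_on A (\<lambda>x. clamp01 (y x) powr p)"
    by (rule continuous_on_powr'[OF cl continuous_on_const]) (use assms clamp01 in auto)
  then show ?thesis unfolding Fc_def
    by (intro continuous_on_add continuous_on_mult continuous_on_const assms cl)
qed

text \<open>The contraction acts on bounded continuous functions of the pair (c, t), so the fixed
  point is jointly continuous in the parameter and the time. \<open>ca\<close> and \<open>cc\<close>
  clamp the arguments so that the operator is defined on the whole plane.\<close>

lemma shooting_family:
  assumes ab: "0 \<le> a" "a < b" "b \<le> 1" and \<mu>: "\<mu> > 0" and p: "1 \<le> p" and cm: "0 \<le> cm"
  obtains W :: "real \<Rightarrow> real \<Rightarrow> real" where
    "continuous_on UNIV (\<lambda>x. W (fst x) (snd x))"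
    "\<And>c t. c \<in> {0..cm} \<Longrightarrow> t \<in> {a..b} \<Longrightarrow>
       W c t = (t - a) - integral {a..b} (\<lambda>s. kern t s * Fc \<mu> p c (W c s))"
proof -
  define L where "L = \<mu> + cm * p"
  have L: "L > 0" using \<mu> p cm by (simp add: L_def add_pos_nonneg)
  \<comment> \<open>The unknown is \<open>W\<close> multiplied by \<open>exp (- M t)\<close>.
    Integrating \<open>L exp (M s)\<close> costs at most \<open>L / M = 1/2\<close> of the weight,
    whatever the interval, and this is the contraction factor.\<close>
  define M where "M = 2 * L"
  define ca where "ca t = min b (max a t)" for t
  define cc where "cc c = min cm (max 0 c)" for c
  have ca: "a \<le> ca t" "ca t \<le> b" "ca t \<le> 1" "0 \<le> ca t" for t using ab by (auto simp: ca_def)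
  have cc: "0 \<le> cc c" "cc c \<le> cm" for c using cm by (auto simp: cc_def)
  define h where "h y x s = kern (ca (snd x)) s * Fc \<mu> p (cc (fst x)) (exp (M * s) * apply_bcontfun y (cc (fst x), s))"
    for y :: "(real \<times> real) \<Rightarrow>\<^sub>C real" and x :: "real \<times> real" and s :: real
  define T0 where "T0 y x = exp (- M * ca (snd x)) * ((ca (snd x) - a) - integral {a..b} (h y x))"
    for y :: "(real \<times> real) \<Rightarrow>\<^sub>C real" and x :: "real \<times> real"
  have ym: "(\<lambda>s. apply_bcontfun y (c, s)) \<in> borel_measurable borel" for y :: "(real \<times> real) \<Rightarrow>\<^sub>C real" and c
    by (intro borel_measurable_continuous_onI continuous_on_compose2[OF continuous_on_apply_bcontfun[of UNIV y]]
        continuous_intros) auto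
  have Fm: "(\<lambda>s. Fc \<mu> p (cc c) (exp (M * s) * apply_bcontfun y (cc c, s))) \<in> borel_measurable borel" for y c
    using ym[of y "cc c"] by measurable
  have hm: "h y x \<in> borel_measurable borel" for y x
    unfolding h_def using Fm[of "fst x" y] by measurable
  have Fb: "\<bar>Fc \<mu> p (cc c) z\<bar> \<le> \<mu> + cm" for c z
    using Fc_bounds(3)[of \<mu> p "cc c" z] \<mu> p cc[of c] by simp
  have hb: "\<bar>h y x s\<bar> \<le> \<mu> + cm" if "s \<in> {a..b}" for y x s
  proof -
    have k: "0 \<le> kern (ca (snd x)) s" "kern (ca (snd x)) s \<le> 1" using that ab ca by (auto intro!: kern_bounds)
    then have "\<bar>h y x s\<bar> \<le> 1 * (\<mu> + cm)"
      unfolding h_def abs_mult using Fb by (intro mult_mono) auto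
    then show ?thesis by simp
  qed
  have hint: "h y x integrable_on {a..b}" for y x
    using hm hb by (rule bounded_measurable_integrable_on)
  have Tc: "continuous_on UNIV (T0 y)" for y
  proof -
    have "continuous_on UNIV (\<lambda>x. integral {a..b} (h y x))"
    proof (rule continuous_on_parametric_integral[where B="\<mu> + cm"])
      fix s assume "s \<in> {a..b}"
      have 1: "continuous_on UNIV (\<lambda>x. kern (ca (snd x)) s)"
        by (rule continuous_on_compose2[OF kern_continuous[of UNIV s]])
          (auto simp: ca_def intro!: continuous_intros)
      have 2: "continuous_on UNIV (\<lambda>x. apply_bcontfun y (cc (fst x), s))"
        by (rule continuous_on_compose2[OF continuous_on_apply_bcontfun[of UNIV y]])
          (auto simp: cc_def intro!: continuous_intros)
      have 3: "continuous_on UNIV (\<lambda>x. cc (fst x))" unfolding cc_def by (intro continuous_intros)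
      show "continuous_on UNIV (\<lambda>x. h y x s)" unfolding h_def
        using p by (intro continuous_intros 1 2 3) auto
    qed (use hm hb in auto)
    moreover have "continuous_on UNIV (\<lambda>x::real \<times> real. ca (snd x))" unfolding ca_def by (intro continuous_intros)
    ultimately show ?thesis unfolding T0_def by (intro continuous_intros)
  qed
  have Tb: "norm (T0 y x) \<le> 1 * (1 + (\<mu> + cm) * 1)" for y x
  proof -
    have "\<bar>integral {a..b} (h y x)\<bar> \<le> (\<mu> + cm) * (b - a)"
      using ab by (intro abs_integral_bound hint hb) auto
    also have "\<dots> \<le> (\<mu> + cm) * 1" using ab \<mu> cm by (intro mult_left_mono) auto
    finally have 1: "\<bar>(ca (snd x) - a) - integral {a..b} (h y x)\<bar> \<le> 1 + (\<mu> + cm) * 1"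
      using ca[of "snd x"] ab by linarith
    have "M * ca (snd x) \<ge> 0" using ca L by (simp add: M_def)
    then have "exp (- M * ca (snd x)) \<le> 1" by simp
    then show ?thesis unfolding T0_def real_norm_def abs_mult using 1 by (intro mult_mono) auto
  qed
  define T where "T y = Bcontfun (T0 y)" for y
  have T: "apply_bcontfun (T y) x = T0 y x" for y x
    unfolding T_def by (subst Bcontfun_inverse) (auto intro!: bcontfun_normI[OF Tc Tb])
  have contr: "dist (T y) (T z) \<le> (1/2) * dist y z" for y z
  proof (rule dist_bound)
    fix x :: "real \<times> real"
    define t where "t = ca (snd x)"
    have t: "a \<le> t" "t \<le> b" using ca by (auto simp: t_def)
    have dint: "(\<lambda>s. h y x s - h z x s) integrable_on {a..b}" by (intro integrable_diff hint)
    have dsub: "(\<lambda>s. h y x s - h z x s) integrable_on {a..t}"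
      using dint t by (auto intro: integrable_on_subinterval)
    have E: "((\<lambda>s. L * dist y z * exp (M * s)) has_integral L * dist y z * exp (M * t) / M - L * dist y z * exp (M * a) / M) {a..t}"
      using t L by (intro fundamental_theorem_of_calculus)
        (auto intro!: derivative_eq_intros simp: M_def simp flip: has_real_derivative_iff_has_vector_derivative)
    have "integral {a..b} (h y x) - integral {a..b} (h z x) = integral {a..b} (\<lambda>s. h y x s - h z x s)"
      by (rule integral_diff[OF hint hint, symmetric])
    also have "\<dots> = integral {a..t} (\<lambda>s. h y x s - h z x s)"
      using t by (intro integral_split_vanishing dint) (auto simp: h_def kern_eq_0 t_def)
    finally have "\<bar>integral {a..b} (h y x) - integral {a..b} (h z x)\<bar> = norm (integral {a..t} (\<lambda>s. h y x s - h z x s))"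
      by simp
    also have "\<dots> \<le> integral {a..t} (\<lambda>s. L * dist y z * exp (M * s))"
    proof (rule integral_norm_bound_integral[OF dsub])
      show "(\<lambda>s. L * dist y z * exp (M * s)) integrable_on {a..t}" using E by blast
      fix s assume "s \<in> {a..t}"
      then have s: "0 \<le> s" "s \<le> 1" using t ab by auto
      let ?y = "apply_bcontfun y (cc (fst x), s)" and ?z = "apply_bcontfun z (cc (fst x), s)"
      have "norm (h y x s - h z x s) = kern t s * \<bar>Fc \<mu> p (cc (fst x)) (exp (M * s) * ?y) - Fc \<mu> p (cc (fst x)) (exp (M * s) * ?z)\<bar>"
        unfolding h_def t_def[symmetric] right_diff_distrib[symmetric] real_norm_def abs_mult
        using kern_bounds(1)[of s t] s t ab by simp
      also have "\<dots> \<le> 1 * (L * \<bar>exp (M * s) * ?y - exp (M * s) * ?z\<bar>)"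
        unfolding L_def using kern_bounds[of s t] s t ab \<mu> p cc by (intro mult_mono Fc_lipschitz) auto
      also have "\<dots> = L * (exp (M * s) * \<bar>?y - ?z\<bar>)"
        by (simp add: abs_mult flip: right_diff_distrib)
      also have "\<dots> \<le> L * (exp (M * s) * dist y z)"
        using L dist_bounded[of y "(cc (fst x), s)" z] by (intro mult_left_mono) (auto simp: dist_real_def)
      finally show "norm (h y x s - h z x s) \<le> L * dist y z * exp (M * s)" by (simp add: mult_ac)
    qed
    also have "\<dots> \<le> L * dist y z * exp (M * t) / M"
      unfolding integral_unique[OF E] using L by (simp add: M_def)
    also have "\<dots> = dist y z / 2 * exp (M * t)" using L by (simp add: M_def)
    finally have I: "\<bar>integral {a..b} (h y x) - integral {a..b} (h z x)\<bar> \<le> dist y z / 2 * exp (M * t)" .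
    have "dist (T0 y x) (T0 z x) = exp (- M * t) * \<bar>integral {a..b} (h y x) - integral {a..b} (h z x)\<bar>"
      unfolding T0_def t_def[symmetric] dist_real_def right_diff_distrib[symmetric] abs_mult
      by (simp add: abs_minus_commute)
    also have "\<dots> \<le> exp (- M * t) * (dist y z / 2 * exp (M * t))"
      using I by (intro mult_left_mono) auto
    also have "\<dots> = (1/2) * dist y z" by (simp add: exp_minus field_simps)
    finally show "dist (apply_bcontfun (T y) x) (apply_bcontfun (T z) x) \<le> (1/2) * dist y z"
      by (simp add: T)
  qed
  have "\<exists>!y. T y = y"
    by (rule banach_fix_type[of "1/2"]) (use contr in auto)
  then obtain y where y: "T y = y" by blast
  define W where "W c t = exp (M * t) * apply_bcontfun y (c, t)" for c t
  show thesis
  proof (rule that[of W])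
    show "continuous_on UNIV (\<lambda>x. W (fst x) (snd x))"
      unfolding W_def by (intro continuous_intros) auto
    fix c t assume ct: "c \<in> {0..cm}" "t \<in> {a..b}"
    then have [simp]: "ca t = t" "cc c = c" by (auto simp: ca_def cc_def)
    have "apply_bcontfun y (c, t) = exp (- M * t) * ((t - a) - integral {a..b} (h y (c, t)))"
      using T[of y "(c, t)"] y by (simp add: T0_def)
    moreover have "h y (c, t) = (\<lambda>s. kern t s * Fc \<mu> p c (W c s))" by (simp add: h_def W_def fun_eq_iff)
    ultimately show "W c t = (t - a) - integral {a..b} (\<lambda>s. kern t s * Fc \<mu> p c (W c s))"
      by (simp add: W_def exp_minus field_simps)
  qed
qed

lemma kern_convex:
  assumes "0 \<le> s" "s \<le> 1" "0 \<le> u" "u \<le> 1"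
  shows "kern ((1 - u) * x + u * z) s \<le> (1 - u) * kern x s + u * kern z s"
proof -
  have "s\<^sup>2 \<le> 1" using assms by (simp add: power_le_one)
  moreover have "max 0 ((1 - u) * x + u * z - s) \<le> (1 - u) * max 0 (x - s) + u * max 0 (z - s)"
  proof -
    have "(1 - u) * x + u * z - s = (1 - u) * (x - s) + u * (z - s)" by (simp add: algebra_simps)
    also have "\<dots> \<le> (1 - u) * max 0 (x - s) + u * max 0 (z - s)"
      using assms by (intro add_mono mult_left_mono) auto
    finally show ?thesis using assms by simp
  qed
  ultimately have "max 0 ((1 - u) * x + u * z - s) / (1 - s\<^sup>2) \<le> ((1 - u) * max 0 (x - s) + u * max 0 (z - s)) / (1 - s\<^sup>2)"
    by (intro divide_right_mono) auto
  then show ?thesis by (simp add: kern_def add_divide_distrib)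
qed

text \<open>The kernel is convex in \<open>t\<close> and \<open>g\<close> is nonnegative; stated
  through integrals, concavity does not require second derivatives at the singular endpoint.\<close>

lemma volterra_concave:
  assumes ab: "0 \<le> a" "a < b" "b \<le> 1" and g: "g \<in> borel_measurable borel"
    "\<And>s. s \<in> {a..b} \<Longrightarrow> 0 \<le> g s \<and> g s \<le> B"
    and w: "\<And>t. t \<in> {a..b} \<Longrightarrow> w t = \<sigma> * (t - a) - integral {a..b} (\<lambda>s. kern t s * g s)"
    and xz: "x \<in> {a..b}" "z \<in> {a..b}" "0 \<le> u" "u \<le> 1"
  shows "(1 - u) * w x + u * w z \<le> w ((1 - u) * x + u * z)"
proof -
  have int: "(\<lambda>s. kern t s * g s) integrable_on {a..b}" if "t \<in> {a..b}" for t
    using that ab g(2) by (intro kern_mult_integrable g(1)) (auto simp: abs_le_iff intro: order_trans[of _ 0])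
  define y where "y = (1 - u) * x + u * z"
  have y: "y \<in> {a..b}"
    using convexD_alt[OF convex_real_interval(5), of x a b z u] xz by (simp add: y_def)
  have "integral {a..b} (\<lambda>s. kern y s * g s) \<le> integral {a..b} (\<lambda>s. (1 - u) * (kern x s * g s) + u * (kern z s * g s))"
  proof (rule integral_le[OF int[OF y]])
    show "(\<lambda>s. (1 - u) * (kern x s * g s) + u * (kern z s * g s)) integrable_on {a..b}"
      by (intro integrable_add integrable_on_mult_right int xz)
    fix s assume s: "s \<in> {a..b}"
    have "kern y s * g s \<le> ((1 - u) * kern x s + u * kern z s) * g s"
      unfolding y_def using s ab xz g(2)[OF s] by (intro mult_right_mono kern_convex) auto
    then show "kern y s * g s \<le> (1 - u) * (kern x s * g s) + u * (kern z s * g s)"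
      by (simp add: algebra_simps)
  qed
  also have "\<dots> = (1 - u) * integral {a..b} (\<lambda>s. kern x s * g s) + u * integral {a..b} (\<lambda>s. kern z s * g s)"
    using int xz by (subst integral_add) (auto intro!: integrable_on_mult_right)
  finally have I: "integral {a..b} (\<lambda>s. kern y s * g s) \<le> (1 - u) * integral {a..b} (\<lambda>s. kern x s * g s) + u * integral {a..b} (\<lambda>s. kern z s * g s)" .
  have "(1 - u) * w x + u * w z = \<sigma> * (y - a) - ((1 - u) * integral {a..b} (\<lambda>s. kern x s * g s) + u * integral {a..b} (\<lambda>s. kern z s * g s))"
    unfolding w[OF xz(1)] w[OF xz(2)] y_def by (simp add: algebra_simps)
  also have "\<dots> \<le> w y" unfolding w[OF y] using I by simp
  finally show ?thesis unfolding y_def .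
qed


text \<open>The initial slope is fixed at 1 and the coefficient \<open>c\<close> is the shooting
  parameter: the value at \<open>b\<close> is positive for c = 0 and nonpositive for c =
  \<open>cm\<close>, so some intermediate c gives a zero.\<close>

lemma superlinear_piece:
  assumes ab: "0 \<le> a" "a < b" "b \<le> 1" and \<mu>: "\<mu> > 0" "(b - a) * \<mu> < 1" and p: "1 < p"
  obtains c w where "c > 0" "continuous_on UNIV w" "w a = 0" "w b = 0"
    "\<And>t. t \<in> {a<..<b} \<Longrightarrow> 0 < w t" "\<And>t. 0 \<le> w t" "\<And>t. w t \<le> 1"
    "\<And>t. t \<in> {a..b} \<Longrightarrow> w t = 1 * (t - a) - integral {a..b} (\<lambda>s. kern t s * (\<mu> * w s + c * w s powr p))"
proof -
  define h where "h = b - a"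
  have h: "0 < h" "h \<le> 1" using ab by (auto simp: h_def)
  \<comment> \<open>The first two bounds ensure that for c = \<open>cm\<close> the solution still
    reaches t / 2 at a + t; the last one makes the nonlinear term decisive at the midpoint.\<close>
  define t where "t = min (h / 4) (min (1 / (2 * \<mu>)) (h\<^sup>2 / (512 * 4 powr p)))"
  have t: "0 < t" "t \<le> h / 4" "t \<le> 1 / (2 * \<mu>)" "t \<le> h\<^sup>2 / (512 * 4 powr p)"
    using h \<mu> by (auto simp: t_def)
  define cm where "cm = h / (8 * t powr (p + 1))"
  have cm: "cm > 0" using h t by (simp add: cm_def)
  have cmt: "cm * t powr p * t = h / 8"
  proof -
    have "t powr (p + 1) = t powr p * t" using t by (simp add: powr_add)
    then show ?thesis using t by (simp add: cm_def)
  qed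
  obtain W where Wc: "continuous_on UNIV (\<lambda>x. W (fst x) (snd x))"
    and W: "\<And>c t. c \<in> {0..cm} \<Longrightarrow> t \<in> {a..b} \<Longrightarrow>
       W c t = (t - a) - integral {a..b} (\<lambda>s. kern t s * Fc \<mu> p c (W c s))"
    using shooting_family[OF ab \<mu>(1), of p cm] p cm by auto
  have Wc1: "continuous_on UNIV (W c)" for c
    using continuous_on_compose2[OF Wc, of UNIV "\<lambda>t. (c, t)"] by (simp add: continuous_on_Pair)
  have Wc2: "continuous_on UNIV (\<lambda>c. W c t)" for t
    using continuous_on_compose2[OF Wc, of UNIV "\<lambda>c. (c, t)"] by (simp add: continuous_on_Pair)
  have gm[measurable]: "(\<lambda>s. Fc \<mu> p c (W c s)) \<in> borel_measurable borel" for c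
    using borel_measurable_continuous_onI[OF Wc1[of c]] by measurable
  have gb: "0 \<le> Fc \<mu> p c y" "Fc \<mu> p c y \<le> \<mu> + c" "\<bar>Fc \<mu> p c y\<bar> \<le> \<mu> + c" if "c \<in> {0..cm}" for c y
    using Fc_bounds[of \<mu> p c y] that \<mu> p by auto
  have int: "(\<lambda>s. kern t s * Fc \<mu> p c (W c s)) integrable_on {a..b}" if "c \<in> {0..cm}" "t \<in> {a..b}" for c t
    using that ab gb[OF that(1)] by (intro kern_mult_integrable[where B="\<mu> + c"]) auto
  have f0: "0 \<le> kern t s * Fc \<mu> p c (W c s)" if "c \<in> {0..cm}" "t \<in> {a..b}" "s \<in> {a..b}" for c t s
    using that ab gb[OF that(1)] by (intro mult_nonneg_nonneg kern_bounds) auto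
  have Wle: "W c t \<le> t - a" if "c \<in> {0..cm}" "t \<in> {a..b}" for c t
    unfolding W[OF that] using integral_nonneg[OF int[OF that] f0[OF that]] by simp
  have Wa: "W c a = 0" if "c \<in> {0..cm}" for c
  proof -
    have "integral {a..b} (\<lambda>s. kern a s * Fc \<mu> p c (W c s)) = 0"
      by (intro integral_unique has_integral_is_0) (auto simp: kern_eq_0)
    then show ?thesis using W[OF that, of a] ab by simp
  qed
  have conc: "(1 - u) * W c x + u * W c z \<le> W c ((1 - u) * x + u * z)"
    if "c \<in> {0..cm}" "x \<in> {a..b}" "z \<in> {a..b}" "0 \<le> u" "u \<le> 1" for c x z u
    by (rule volterra_concave[OF ab gm[of c] _ _ that(2-5), where \<sigma>=1 and B="\<mu> + c"])
      (use gb[OF that(1)] W[OF that(1)] in auto)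
  have clW: "clamp01 (W c s) \<le> s - a" if "c \<in> {0..cm}" "s \<in> {a..b}" for c s
    using Wle[OF that] that by (auto simp: clamp01_def)
  \<comment> \<open>If the value at \<open>b\<close> were positive, concavity would keep the
    solution above t / 4 up to the midpoint, where the power term then pulls it below zero.\<close>
  have neg: "W cm b \<le> 0"
  proof (rule ccontr)
    assume "\<not> W cm b \<le> 0"
    then have Wb: "W cm b > 0" by simp
    have cmI: "cm \<in> {0..cm}" using cm by simp
    have at: "a + t \<in> {a..b}" using t h by (auto simp: h_def)
    have 1: "t / 2 \<le> W cm (a + t)"
    proof -
      have "integral {a..b} (\<lambda>s. kern (a + t) s * Fc \<mu> p cm (W cm s)) = integral {a..a+t} (\<lambda>s. kern (a + t) s * Fc \<mu> p cm (W cm s))"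
        using at by (intro integral_split_vanishing int cmI) (auto simp: kern_eq_0)
      also have "\<dots> \<le> \<bar>integral {a..a+t} (\<lambda>s. kern (a + t) s * Fc \<mu> p cm (W cm s))\<bar>" by simp
      also have "\<dots> \<le> ((2 * t / h) * (\<mu> * t + cm * t powr p)) * (a + t - a)"
      proof (rule abs_integral_bound)
        show "(\<lambda>s. kern (a + t) s * Fc \<mu> p cm (W cm s)) integrable_on {a..a+t}"
          using int[OF cmI at] at by (auto intro: integrable_on_subinterval)
        fix s assume s: "s \<in> {a..a+t}"
        then have sab: "s \<in> {a..b}" using at by auto
        have "h / 2 \<le> 1 - s" using s t ab h unfolding h_def by auto
        moreover have "(1 - s) * 1 \<le> (1 - s) * (1 + s)" using sab ab by (intro mult_left_mono) auto
        ultimately have d: "h / 2 \<le> 1 - s\<^sup>2" unfolding one_minus_sq by simp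
        have "kern (a + t) s \<le> t / (h / 2)"
          unfolding kern_def using s t h d by (intro frac_le) auto
        moreover have "Fc \<mu> p cm (W cm s) \<le> \<mu> * t + cm * t powr p"
          unfolding Fc_def using clW[OF cmI sab] s \<mu> cm p clamp01[of "W cm s"]
          by (intro add_mono mult_left_mono powr_mono2) auto
        ultimately have "kern (a + t) s * Fc \<mu> p cm (W cm s) \<le> (2 * t / h) * (\<mu> * t + cm * t powr p)"
          using gb(1)[OF cmI, of "W cm s"] t h by (intro mult_mono) (auto simp: mult.commute)
        then show "\<bar>kern (a + t) s * Fc \<mu> p cm (W cm s)\<bar> \<le> (2 * t / h) * (\<mu> * t + cm * t powr p)"
          using f0[OF cmI at sab] by simp
      qed (use t in simp)
      also have "\<dots> = (2 * t / h) * (\<mu> * t * t + cm * t powr p * t)" by (simp add: algebra_simps)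
      also have "\<dots> \<le> (2 * t / h) * (h / 8 + h / 8)"
      proof -
        have "t * \<mu> \<le> 1 / 2" using t(3) \<mu> by (simp add: field_simps)
        then have "\<mu> * t * t \<le> (1/2) * (h / 4)" using t \<mu> by (intro mult_mono) (auto simp: mult.commute)
        then show ?thesis using t h cmt by (intro mult_left_mono add_mono) auto
      qed
      also have "\<dots> = t / 2" using h by simp
      finally show ?thesis using W[OF cmI at] by simp
    qed
    have 2: "t / 4 \<le> W cm s" if s: "s \<in> {a + t..a + h/2}" for s
    proof -
      define u where "u = (s - a - t) / (h - t)"
      have ht: "h - t > 0" using t h by simp
      have u: "0 \<le> u" "u \<le> 1 / 2"
        using s ht t h by (auto simp: u_def pos_divide_le_eq)
      have "(1 - u) * (a + t) + u * b = (a + t) + u * (h - t)" by (simp add: h_def algebra_simps)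
      also have "\<dots> = s" using ht by (simp add: u_def)
      finally have e: "(1 - u) * (a + t) + u * b = s" .
      have "t / 4 \<le> (1 - u) * (t / 2)" using u t mult_right_mono[of "1/2" "1 - u" "t/2"] by simp
      also have "\<dots> \<le> (1 - u) * W cm (a + t) + u * W cm b"
        using 1 Wb u mult_left_mono[OF 1, of "1 - u"] by (simp add: add_increasing2)
      also have "\<dots> \<le> W cm s" using conc[OF cmI at, of b u] u ab e by simp
      finally show ?thesis .
    qed
    define m where "m = a + h / 2"
    have m: "m \<in> {a..b}" "m < 1" using ab by (auto simp: m_def h_def field_simps)
    define G where "G = (h / 8) * (cm * (t / 4) powr p)"
    have "G * (h / 8) = integral {a + h/4..a + 3*h/8} (\<lambda>s. G)"
      using h by (simp add: field_simps)
    also have "\<dots> \<le> integral {a + h/4..a + 3*h/8} (\<lambda>s. kern m s * Fc \<mu> p cm (W cm s))"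
    proof (rule integral_le)
      show "(\<lambda>s. kern m s * Fc \<mu> p cm (W cm s)) integrable_on {a + h/4..a + 3*h/8}"
        by (rule integrable_on_subinterval[OF int[OF cmI m(1)]]) (use h in \<open>auto simp: h_def field_simps\<close>)
      fix s assume s: "s \<in> {a + h/4..a + 3*h/8}"
      then have sab: "s \<in> {a..b}" "s < m" "m - s \<ge> h / 8" using h by (auto simp: m_def h_def field_simps)
      have s1: "0 \<le> s" "s < 1" using sab ab m by auto
      then have "s\<^sup>2 < 1" by (simp add: power_less_one_iff abs_square_less_1)
      then have "m - s \<le> kern m s"
        using sab s1 by (simp add: kern_def pos_le_divide_eq mult_left_le)
      then have "h / 8 \<le> kern m s" using sab by simp
      moreover have "cm * (t / 4) powr p \<le> Fc \<mu> p cm (W cm s)"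
      proof -
        have "t / 4 \<le> W cm s" using s t by (intro 2) auto
        then have "t / 4 \<le> clamp01 (W cm s)" using t h by (auto simp: clamp01_def)
        then have "cm * (t / 4) powr p \<le> cm * clamp01 (W cm s) powr p"
          using cm t p by (intro mult_left_mono powr_mono2) auto
        then show ?thesis using \<mu> clamp01[of "W cm s"] by (simp add: Fc_def add_increasing)
      qed
      ultimately show "G \<le> kern m s * Fc \<mu> p cm (W cm s)"
        unfolding G_def using h cm by (intro mult_mono) auto
    qed (rule integrable_const_ivl)
    also have "\<dots> \<le> integral {a..b} (\<lambda>s. kern m s * Fc \<mu> p cm (W cm s))"
    proof (rule integral_subset_le)
      show "{a + h/4..a + 3*h/8} \<subseteq> {a..b}" using h by (auto simp: h_def field_simps)
      then show "(\<lambda>s. kern m s * Fc \<mu> p cm (W cm s)) integrable_on {a + h/4..a + 3*h/8}"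
        using int[OF cmI m(1)] integrable_on_subinterval by blast
    qed (use int[OF cmI m(1)] f0[OF cmI m(1)] in auto)
    finally have I: "G * (h / 8) \<le> integral {a..b} (\<lambda>s. kern m s * Fc \<mu> p cm (W cm s))" .
    \<comment> \<open>512 is 8 cubed: a window of length h/8, a kernel at least h/8 on it, and
      \<open>cm t^(p+1) = h/8\<close>. The factor \<open>4 powr p\<close> comes from the lower bound
      t / 4.\<close>
    have "t * (512 * 4 powr p) \<le> h\<^sup>2" using t(4) by (simp add: pos_le_divide_eq)
    moreover have "G * (h / 8) * (512 * (4 powr p * t)) = h\<^sup>2 * h"
    proof -
      have "G * (h / 8) * (512 * (4 powr p * t)) = 8 * h * h * (cm * t powr p * t)"
        using t by (simp add: G_def powr_divide field_simps)
      then show ?thesis by (simp add: cmt power2_eq_square)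
    qed
    ultimately have "(t * (512 * 4 powr p)) * h \<le> G * (h / 8) * (512 * (4 powr p * t))"
      using h by (simp add: mult_right_mono)
    then have "(512 * (4 powr p * t)) * h \<le> (512 * (4 powr p * t)) * (G * (h / 8))" by (simp add: mult_ac)
    then have "h \<le> G * (h / 8)" using t by (subst (asm) mult_le_cancel_left_pos) auto
    then have "W cm m \<le> h / 2 - h" using W[OF cmI m(1)] I by (simp add: m_def)
    moreover have "t / 4 \<le> W cm m" using t h by (intro 2) (auto simp: m_def)
    ultimately show False using t h by simp
  qed
  \<comment> \<open>With c = 0 only the linear term remains; as \<open>W \<le> h\<close>, it removes
    at most \<mu> h^2, which is less than h.\<close>
  have pos: "0 < W 0 b"
  proof -
    have c0: "0 \<in> {0..cm}" and bI: "b \<in> {a..b}" using cm ab by auto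
    have "\<bar>integral {a..b} (\<lambda>s. kern b s * Fc \<mu> p 0 (W 0 s))\<bar> \<le> (1 * (\<mu> * h)) * (b - a)"
    proof (rule abs_integral_bound[OF int[OF c0 bI]])
      fix s assume s: "s \<in> {a..b}"
      have "Fc \<mu> p 0 (W 0 s) \<le> \<mu> * h"
        unfolding Fc_def using clW[OF c0 s] s \<mu> by (simp add: h_def)
      then have "kern b s * Fc \<mu> p 0 (W 0 s) \<le> 1 * (\<mu> * h)"
        using gb(1)[OF c0] s ab by (intro mult_mono kern_bounds) auto
      then show "\<bar>kern b s * Fc \<mu> p 0 (W 0 s)\<bar> \<le> 1 * (\<mu> * h)"
        using f0[OF c0 bI s] by simp
    qed (use ab in simp)
    then have "W 0 b \<ge> h - (\<mu> * h) * h" using W[OF c0 bI] by (simp add: h_def)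
    moreover have "(\<mu> * h) * h < 1 * h" using \<mu> h by (intro mult_strict_right_mono) (auto simp: h_def mult.commute)
    ultimately show ?thesis by simp
  qed
  have "\<exists>c\<ge>0. c \<le> cm \<and> W c b = 0"
    using neg pos cm by (intro IVT2' continuous_on_subset[OF Wc2]) auto
  then obtain c where c: "c \<in> {0..cm}" "W c b = 0" by auto
  have "c \<noteq> 0" using pos c by auto
  then have c0: "c > 0" using c by auto
  have nn: "0 \<le> W c s" if "s \<in> {a..b}" for s
  proof -
    define u where "u = (s - a) / h"
    have u: "0 \<le> u" "u \<le> 1" using that h by (auto simp: u_def h_def)
    have "(1 - u) * a + u * b = a + u * h" by (simp add: h_def algebra_simps)
    then have "(1 - u) * a + u * b = s" using h by (simp add: u_def)
    then show ?thesis using conc[OF c(1) _ _ u, of a b] c Wa[OF c(1)] ab by simp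
  qed
  \<comment> \<open>A nonnegative concave function with an interior zero vanishes identically, and
    then the integral equation at \<open>b\<close> would read 0 = b - a.\<close>
  have pos': "0 < W c s" if s: "s \<in> {a<..<b}" for s
  proof (rule ccontr)
    assume "\<not> 0 < W c s"
    then have Ws: "W c s = 0" using nn[of s] s by force
    have z: "W c x = 0" if x: "x \<in> {a..b}" for x
    proof -
      consider "x = s" | "x < s" | "s < x" by linarith
      then have "W c x \<le> 0"
      proof cases
        case 2
        define u where "u = (s - x) / (b - x)"
        have bx: "b - x > 0" using 2 s by auto
        have u: "0 \<le> u" "u < 1" using 2 s bx by (auto simp: u_def)
        have "(1 - u) * x + u * b = x + u * (b - x)" by (simp add: algebra_simps)
        then have "(1 - u) * x + u * b = s" using bx by (simp add: u_def)
        then have "(1 - u) * W c x \<le> 0" using conc[OF c(1) x, of b u] u c Ws ab by simp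
        then show ?thesis using u by (simp add: mult_le_0_iff)
      next
        case 3
        define u where "u = (s - a) / (x - a)"
        have bx: "x - a > 0" using 3 s by auto
        have u: "0 < u" "u \<le> 1" using 3 s bx by (auto simp: u_def)
        have "(1 - u) * a + u * x = a + u * (x - a)" by (simp add: algebra_simps)
        then have "(1 - u) * a + u * x = s" using bx by (simp add: u_def)
        then have "u * W c x \<le> 0" using conc[OF c(1) _ x, of a u] u Wa[OF c(1)] Ws ab by simp
        then show ?thesis using u by (simp add: mult_le_0_iff)
      qed (use Ws in simp)
      then show ?thesis using nn[OF x] by simp
    qed
    have "integral {a..b} (\<lambda>s. kern b s * Fc \<mu> p c (W c s)) = 0"
      using z p by (intro integral_unique has_integral_is_0) (auto simp: Fc_def clamp01_def)
    then show False using W[OF c(1), of b] c ab by simp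
  qed
  \<comment> \<open>Outside the interval this takes the zero end values, so the bounds hold on the
    whole line.\<close>
  define w where "w t = W c (min b (max a t))" for t
  have wW: "w t = W c t" if "t \<in> {a..b}" for t using that by (simp add: w_def)
  have cl: "min b (max a t) \<in> {a..b}" for t using ab by auto
  show thesis
  proof (rule that[OF c0])
    show "continuous_on UNIV w" unfolding w_def
      by (rule continuous_on_compose2[OF Wc1[of c]]) (auto intro!: continuous_intros)
    show "0 \<le> w t" "w t \<le> 1" for t
      using nn[OF cl[of t]] Wle[OF c(1) cl[of t]] cl[of t] ab by (auto simp: w_def)
    show "w t = 1 * (t - a) - integral {a..b} (\<lambda>s. kern t s * (\<mu> * w s + c * w s powr p))" if t: "t \<in> {a..b}" for t
    proof -
      have "integral {a..b} (\<lambda>s. kern t s * Fc \<mu> p c (W c s)) = integral {a..b} (\<lambda>s. kern t s * (\<mu> * w s + c * w s powr p))"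
        using nn Wle[OF c(1)] ab by (intro integral_cong) (force simp: Fc_def wW clamp01_id)
      then show ?thesis using W[OF c(1) t] wW[OF t] by simp
    qed
  qed (use wW c Wa[OF c(1)] pos' ab in auto)
qed

section \<open>Sublinear pieces: monotone iteration\<close>

lemma sublinear_piece:
  assumes ab: "0 \<le> a" "a < b" "b \<le> 1" and \<mu>: "\<mu> > 0" "(b - a) * (\<mu> + 1) \<le> 1" and p: "0 < p" "p < 1"
  obtains \<sigma> w where "continuous_on UNIV w" "w a = 0" "w b = 0"
    "\<And>t. t \<in> {a<..<b} \<Longrightarrow> 0 < w t" "\<And>t. 0 \<le> w t" "\<And>t. w t \<le> 1"
    "\<And>t. t \<in> {a..b} \<Longrightarrow> w t = \<sigma> * (t - a) - integral {a..b} (\<lambda>s. kern t s * (\<mu> * w s + 1 * w s powr p))"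
proof -
  define h where "h = b - a"
  have h: "0 < h" "h \<le> 1" using ab by (auto simp: h_def)
  define ca where "ca t = min b (max a t)" for t
  have ca: "a \<le> ca t" "ca t \<le> b" for t using ab by (auto simp: ca_def)
  have cai: "ca t = t" if "t \<in> {a..b}" for t using that by (simp add: ca_def)
  have cac: "continuous_on UNIV ca" unfolding ca_def by (intro continuous_intros)
  \<comment> \<open>On the interval this is \<open>kern b s\<close>: in the Green function
    \<open>H\<close> the multiple of \<open>q\<close> is the linear correction that produces the
    zero at \<open>b\<close>.\<close>
  define q where "q s = (b - s) / (1 - s\<^sup>2)" for s
  define H where "H t s = (ca t - a) / h * q s - kern (ca t) s" for t s
  define \<phi> where "\<phi> t = (ca t - a) * (b - ca t)" for t
  have \<phi>01: "0 \<le> \<phi> t" "\<phi> t \<le> 1" for t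
    unfolding \<phi>_def using ca[of t] ab by (auto intro!: mult_le_one)
  have q: "0 \<le> q s" "q s \<le> 1" if "s \<in> {a..b}" for s
  proof -
    have "s\<^sup>2 \<le> 1" using that ab by (simp add: power_le_one)
    then show "0 \<le> q s" using that by (simp add: q_def)
    show "q s \<le> 1"
    proof (cases "s = 1")
      case False
      then have s: "0 < 1 - s" using that ab by simp
      have "b - s \<le> (1 - s) * (1 + s)"
        using that ab mult_left_mono[of 1 "1 + s" "1 - s"] by auto
      moreover have "0 < (1 - s) * (1 + s)" using s that ab by simp
      ultimately show ?thesis by (simp add: q_def one_minus_sq)
    qed (simp add: q_def)
  qed
  \<comment> \<open>For s \<le> x the Green function is
    \<open>(s - a) (b - x) / (h (1 - s^2))\<close>, and symmetrically otherwise. Dropping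
    \<open>1 - s^2 \<le> 1\<close> and inserting two factors bounded by h gives the product lower
    bound.\<close>
  have H: "\<phi> t * \<phi> s / h^3 \<le> H t s" "H t s \<le> 1" "0 \<le> H t s" if s: "s \<in> {a..b}" for t s
  proof -
    define x where "x = ca t"
    have x: "a \<le> x" "x \<le> b" using ca by (auto simp: x_def)
    have s0: "0 \<le> s" "s \<le> 1" using s ab by auto
    have "(x - a) / h * q s \<le> 1 * 1" using x h q[OF s] by (intro mult_mono) (auto simp: h_def)
    moreover have "0 \<le> kern x s" using kern_bounds(1)[OF s0] x ab by simp
    ultimately show "H t s \<le> 1" by (simp add: H_def x_def)
    show 1: "\<phi> t * \<phi> s / h^3 \<le> H t s"
    proof (cases "s = 1")
      case True
      then have "b = 1" using s ab by simp
      then show ?thesis using True ab by (simp add: H_def \<phi>_def q_def kern_def ca_def)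
    next
      case False
      define d where "d = 1 - s\<^sup>2"
      have d: "0 < d" "d \<le> 1" using False s0 by (auto simp: d_def power_less_one_iff abs_square_less_1)
      have key: "y * z / h \<le> y * z / (h * d)" if "0 \<le> y" "0 \<le> z" for y z
        using that d h mult_left_le[of d h] by (intro divide_left_mono) (auto simp: mult_le_cancel_left)
      show ?thesis
      proof (cases "s \<le> x")
        case True
        have "(x - a) * (b - s) - h * (x - s) = (s - a) * (b - x)" by (simp add: h_def algebra_simps)
        moreover have "(x - a) / h * ((b - s) / d) - (x - s) / d = ((x - a) * (b - s) - h * (x - s)) / (h * d)"
        proof -
          have "((x - a) * (b - s) - h * (x - s)) / (h * d) = ((x - a) * (b - s)) / (h * d) - (h * (x - s)) / (h * d)"
            by (rule diff_divide_distrib)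
          moreover have "(h * (x - s)) / (h * d) = (x - s) / d" using h by simp
          moreover have "(x - a) / h * ((b - s) / d) = ((x - a) * (b - s)) / (h * d)"
            by (rule times_divide_times_eq)
          ultimately show ?thesis by (simp only:)
        qed
        ultimately have "H t s = (s - a) * (b - x) / (h * d)"
          using True unfolding H_def q_def kern_def x_def[symmetric] d_def[symmetric] by simp
        moreover have "(s - a) * (b - x) / h \<le> (s - a) * (b - x) / (h * d)" using s x by (intro key) auto
        moreover have "\<phi> t * \<phi> s / h^3 \<le> (s - a) * (b - x) / h"
        proof -
          have "(x - a) * (b - s) \<le> h * h" using x s by (intro mult_mono) (auto simp: h_def)
          then have "((s - a) * (b - x)) * ((x - a) * (b - s)) \<le> ((s - a) * (b - x)) * (h * h)"
            using s x by (intro mult_left_mono) auto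
          moreover have "\<phi> t * \<phi> s = Y"
            if "Y = ((s - a) * (b - x)) * ((x - a) * (b - s)) \<or> Y = ((x - a) * (b - s)) * ((s - a) * (b - x))" for Y
            using s that by (auto simp: \<phi>_def x_def[symmetric] cai mult_ac)
          moreover have "Y * (h * h) / h^3 = Y / h" for Y using h by (simp add: power3_eq_cube)
          ultimately show ?thesis using h by (metis divide_right_mono less_imp_le zero_le_power)
        qed
        ultimately show ?thesis by linarith
      next
        case False
        then have "H t s = (x - a) * (b - s) / (h * d)"
          using h d unfolding H_def q_def kern_def x_def[symmetric] d_def[symmetric] by (simp add: field_simps)
        moreover have "(x - a) * (b - s) / h \<le> (x - a) * (b - s) / (h * d)" using s x by (intro key) auto
        moreover have "\<phi> t * \<phi> s / h^3 \<le> (x - a) * (b - s) / h"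
        proof -
          have "(s - a) * (b - x) \<le> h * h" using x s by (intro mult_mono) (auto simp: h_def)
          then have "((x - a) * (b - s)) * ((s - a) * (b - x)) \<le> ((x - a) * (b - s)) * (h * h)"
            using s x by (intro mult_left_mono) auto
          moreover have "\<phi> t * \<phi> s = Y"
            if "Y = ((s - a) * (b - x)) * ((x - a) * (b - s)) \<or> Y = ((x - a) * (b - s)) * ((s - a) * (b - x))" for Y
            using s that by (auto simp: \<phi>_def x_def[symmetric] cai mult_ac)
          moreover have "Y * (h * h) / h^3 = Y / h" for Y using h by (simp add: power3_eq_cube)
          ultimately show ?thesis using h by (metis divide_right_mono less_imp_le zero_le_power)
        qed
        ultimately show ?thesis by linarith
      qed
    qed
    have "0 \<le> \<phi> t * \<phi> s / h^3" using \<phi>01 h by simp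
    then show "0 \<le> H t s" using 1 by linarith
  qed
  have Hm[measurable]: "H t \<in> borel_measurable borel" for t unfolding H_def q_def by measurable
  have Hc: "continuous_on UNIV (\<lambda>t. H t s)" for s
    unfolding H_def divide_inverse
    by (intro continuous_intros cac continuous_on_compose2[OF kern_continuous[of UNIV]]) auto
  define f where "f y = \<mu> * y + 1 * y powr p" for y :: real
  have f01: "0 \<le> f y" "f y \<le> \<mu> + 1" if "0 \<le> y" "y \<le> 1" for y
  proof -
    have 1: "y powr p \<le> 1" using that p by (simp add: powr_le1)
    have 2: "\<mu> * y \<le> \<mu>" using that \<mu> by (simp add: mult_left_le)
    show "0 \<le> f y" using that \<mu> by (simp add: f_def)
    show "f y \<le> \<mu> + 1" unfolding f_def using 1 2 by linarith
  qed
  have fmono: "f x \<le> f y" if "0 \<le> x" "x \<le> y" for x y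
    unfolding f_def using that \<mu> p by (intro add_mono mult_left_mono powr_mono2) auto
  have fm[measurable]: "f \<in> borel_measurable borel" unfolding f_def by measurable
  define S where "S v t = integral {a..b} (\<lambda>s. H t s * f (v s))" for v :: "real \<Rightarrow> real" and t
  define good where "good v \<longleftrightarrow> v \<in> borel_measurable borel \<and> (\<forall>s. 0 \<le> v s \<and> v s \<le> 1)"
    for v :: "real \<Rightarrow> real"
  have Hb: "0 \<le> H t s * f (v s)" "H t s * f (v s) \<le> \<mu> + 1" if "good v" "s \<in> {a..b}" for v t s
  proof -
    have v: "0 \<le> v s" "v s \<le> 1" using that by (auto simp: good_def)
    show "0 \<le> H t s * f (v s)" using H[OF that(2)] f01[OF v] by simp
    have "H t s * f (v s) \<le> 1 * (\<mu> + 1)" using H[OF that(2)] f01[OF v] by (intro mult_mono) auto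
    then show "H t s * f (v s) \<le> \<mu> + 1" by simp
  qed
  have vm: "(\<lambda>s. H t s * f (v s)) \<in> borel_measurable borel" if "good v" for v t
  proof -
    have [measurable]: "v \<in> borel_measurable borel" using that by (simp add: good_def)
    show ?thesis by measurable
  qed
  have Sint: "(\<lambda>s. H t s * f (v s)) integrable_on {a..b}" if "good v" for v t
    using Hb[OF that] by (intro bounded_measurable_integrable_on[where B="\<mu> + 1"] vm[OF that]) (auto simp: abs_le_iff intro: order_trans[of _ 0])
  have Sc: "continuous_on UNIV (S v)" if "good v" for v
    unfolding S_def
  proof (rule continuous_on_parametric_integral)
    show "\<bar>H t s * f (v s)\<bar> \<le> \<mu> + 1" if "s \<in> {a..b}" for t s using Hb[OF \<open>good v\<close> that, of t] by simp
    show "continuous_on UNIV (\<lambda>t. H t s * f (v s))" for s by (intro continuous_intros Hc)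
  qed (rule vm[OF that])
  have Sgood: "good (S v)" if "good v" for v
  proof -
    have "0 \<le> S v t" for t unfolding S_def using Hb[OF that] by (intro integral_nonneg Sint[OF that]) auto
    moreover have "S v t \<le> 1" for t
    proof -
      have "\<bar>S v t\<bar> \<le> (\<mu> + 1) * (b - a)" unfolding S_def
        using Hb[OF that] ab by (intro abs_integral_bound Sint[OF that]) auto
      then show ?thesis using \<mu>(2) by (simp add: mult.commute)
    qed
    ultimately show ?thesis using borel_measurable_continuous_onI[OF Sc[OF that]] by (simp add: good_def)
  qed
  have Smono: "S v t \<le> S v' t" if "good v" "good v'" "\<And>s. v s \<le> v' s" for v v' t
    unfolding S_def
  proof (rule integral_le[OF Sint[OF that(1)] Sint[OF that(2)]])
    fix s assume s: "s \<in> {a..b}"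
    show "H t s * f (v s) \<le> H t s * f (v' s)"
      using H[OF s] that by (intro mult_left_mono fmono) (auto simp: good_def)
  qed
  define k0 where "k0 = integral {a..b} (\<lambda>s. (\<phi> s)\<^sup>2) / h^3"
  have \<phi>c: "continuous_on A \<phi>" for A
    unfolding \<phi>_def by (intro continuous_intros continuous_on_subset[OF cac]) auto
  have k0: "k0 > 0"
  proof -
    have "integral {a..b} (\<lambda>s. (\<phi> s)\<^sup>2) \<ge> 0"
      by (intro integral_nonneg integrable_continuous_interval continuous_intros \<phi>c) auto
    moreover have "integral {a..b} (\<lambda>s. (\<phi> s)\<^sup>2) \<noteq> 0"
    proof
      assume "integral {a..b} (\<lambda>s. (\<phi> s)\<^sup>2) = 0"
      then have "\<forall>s\<in>{a..b}. (\<phi> s)\<^sup>2 = 0"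
        using ab by (subst (asm) integral_eq_0_iff) (auto intro!: continuous_intros \<phi>c)
      then have "\<phi> ((a + b) / 2) = 0" using ab by auto
      then show False using ab cai[of "(a + b) / 2"] by (simp add: \<phi>_def)
    qed
    ultimately show ?thesis using h by (simp add: k0_def)
  qed
  \<comment> \<open>Since p < 1, small \<epsilon> satisfies
    \<open>\<epsilon> powr (1 - p) \<le> k0\<close>, that is
    \<open>\<epsilon> \<le> \<epsilon> powr p * k0\<close>, which makes
    \<open>\<epsilon> * \<phi>\<close> a subsolution.\<close>
  define \<epsilon> where "\<epsilon> = min 1 (k0 powr (1 / (1 - p)))"
  have \<epsilon>: "0 < \<epsilon>" "\<epsilon> \<le> 1" using k0 by (auto simp: \<epsilon>_def)
  have \<epsilon>k: "\<epsilon> \<le> \<epsilon> powr p * k0"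
  proof -
    have "\<epsilon> powr (1 - p) \<le> (k0 powr (1 / (1 - p))) powr (1 - p)"
      using \<epsilon> p by (intro powr_mono2) (auto simp: \<epsilon>_def)
    also have "\<dots> = k0" using k0 p by (simp add: powr_powr)
    finally have "\<epsilon> powr p * \<epsilon> powr (1 - p) \<le> \<epsilon> powr p * k0" by (intro mult_left_mono) auto
    moreover have "\<epsilon> powr p * \<epsilon> powr (1 - p) = \<epsilon>" using \<epsilon> by (simp flip: powr_add)
    ultimately show ?thesis by simp
  qed
  define v where "v n = (S ^^ n) (\<lambda>t. \<epsilon> * \<phi> t)" for n
  have v0: "good (v 0)" unfolding v_def good_def
    using \<phi>01 \<epsilon> borel_measurable_continuous_onI[OF \<phi>c] by (auto intro!: mult_le_one)
  have vS: "v (Suc n) = S (v n)" for n by (simp add: v_def)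
  have vg: "good (v n)" for n by (induction n) (use v0 Sgood vS in auto)
  \<comment> \<open>Only the power term is used: the product lower bound for \<open>H\<close> and
    \<open>\<phi> \<le> \<phi> powr p\<close> reduce the claim to the choice of \<epsilon>.\<close>
  have v01: "v 0 t \<le> v 1 t" for t
  proof -
    have "v 0 t = \<epsilon> * \<phi> t" by (simp add: v_def)
    also have "\<dots> \<le> (\<epsilon> powr p * k0) * \<phi> t" using \<epsilon>k \<phi>01 by (intro mult_right_mono) auto
    also have "\<dots> = integral {a..b} (\<lambda>s. (\<epsilon> powr p * \<phi> t / h^3) * (\<phi> s)\<^sup>2)"
      by (simp add: k0_def mult_ac)
    also have "\<dots> \<le> S (v 0) t" unfolding S_def
    proof (rule integral_le[OF _ Sint[OF v0]])
      show "(\<lambda>s. \<epsilon> powr p * \<phi> t / h ^ 3 * (\<phi> s)\<^sup>2) integrable_on {a..b}"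
        by (intro integrable_continuous_interval continuous_intros \<phi>c)
      fix s assume s: "s \<in> {a..b}"
      have "\<phi> s \<le> \<phi> s powr p" using \<phi>01[of s] p powr_mono'[of p 1 "\<phi> s"] by (cases "\<phi> s = 0") auto
      then have "\<epsilon> powr p * \<phi> s \<le> (\<epsilon> * \<phi> s) powr p" using \<epsilon> \<phi>01 by (simp add: powr_mult mult_left_mono)
      also have "\<dots> \<le> f (v 0 s)" using \<mu> \<epsilon> \<phi>01 by (simp add: f_def v_def)
      finally have "(\<phi> t * \<phi> s / h^3) * (\<epsilon> powr p * \<phi> s) \<le> H t s * f (v 0 s)"
        using H[OF s, of t] \<phi>01 by (intro mult_mono) auto
      then show "\<epsilon> powr p * \<phi> t / h ^ 3 * (\<phi> s)\<^sup>2 \<le> H t s * f (v 0 s)"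
        by (simp add: power2_eq_square mult_ac)
    qed
    also have "\<dots> = v 1 t" using vS[of 0] by simp
    finally show ?thesis .
  qed
  have vinc: "v n t \<le> v (Suc n) t" for n t
  proof (induction n arbitrary: t)
    case (Suc n)
    show ?case unfolding vS[of n] vS[of "Suc n"] by (intro Smono vg Sgood) (use Suc in \<open>simp add: vS\<close>)
  qed (use v01 in simp)
  define w where "w t = (SUP n. v n t)" for t
  have lim: "(\<lambda>n. v n t) \<longlonglongrightarrow> w t" for t
    unfolding w_def
  proof (rule LIMSEQ_incseq_SUP)
    show "bdd_above (range (\<lambda>n. v n t))" using vg by (auto simp: good_def intro!: bdd_aboveI[of _ 1])
    show "incseq (\<lambda>n. v n t)" using vinc by (rule incseq_SucI)
  qed
  have w01: "0 \<le> w t" "w t \<le> 1" for t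
  proof -
    show "0 \<le> w t" by (rule LIMSEQ_le_const[OF lim]) (use vg in \<open>auto simp: good_def\<close>)
    show "w t \<le> 1" by (rule LIMSEQ_le_const2[OF lim]) (use vg in \<open>auto simp: good_def\<close>)
  qed
  have wv: "v n t \<le> w t" for n t
    using incseq_le[OF incseq_SucI lim] vinc by blast
  have wm: "w \<in> borel_measurable borel"
    by (rule borel_measurable_LIMSEQ_real[where u=v]) (use lim vg in \<open>auto simp: good_def\<close>)
  then have wg: "good w" unfolding good_def using w01 by simp
  have wfix: "w t = S w t" for t
  proof (rule LIMSEQ_unique)
    show "(\<lambda>n. v (Suc n) t) \<longlonglongrightarrow> w t" using lim by (rule LIMSEQ_Suc)
    show "(\<lambda>n. v (Suc n) t) \<longlonglongrightarrow> S w t"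
      unfolding vS S_def
    proof (rule dominated_convergence(2)[where h="\<lambda>_. \<mu> + 1"])
      show "norm (H t s * f (v n s)) \<le> \<mu> + 1" if "s \<in> {a..b}" for n s
        using Hb[OF vg that, of t n] by simp
      show "(\<lambda>n. H t s * f (v n s)) \<longlonglongrightarrow> H t s * f (w s)" if "s \<in> {a..b}" for s
        unfolding f_def using p vg
        by (intro tendsto_intros lim tendsto_powr') (auto simp: good_def)
    qed (use Sint[OF vg] in auto)
  qed
  have gm: "(\<lambda>s. f (w s)) \<in> borel_measurable borel" using wm by measurable
  have gb: "\<bar>f (w s)\<bar> \<le> \<mu> + 1" for s using f01[OF w01, of s] by simp
  define \<sigma> where "\<sigma> = integral {a..b} (\<lambda>s. q s / h * f (w s))"
  show thesis
  proof (rule that[of w \<sigma>])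
    show "continuous_on UNIV w" using Sc[OF wg] wfix by (metis (no_types, lifting) ext)
    show "w a = 0"
    proof -
      have "S w a = 0" unfolding S_def
        using ab by (intro integral_unique has_integral_is_0) (auto simp: H_def cai kern_eq_0)
      then show ?thesis using wfix by simp
    qed
    show "w b = 0"
    proof -
      have "S w b = 0" unfolding S_def
        using ab h by (intro integral_unique has_integral_is_0) (auto simp: H_def cai kern_def q_def h_def)
      then show ?thesis using wfix by simp
    qed
    show "0 < w t" if "t \<in> {a<..<b}" for t
    proof -
      have "0 < v 0 t" using that \<epsilon> cai[of t] by (simp add: v_def \<phi>_def)
      then show ?thesis using wv[of 0 t] by simp
    qed
    show "w t = \<sigma> * (t - a) - integral {a..b} (\<lambda>s. kern t s * (\<mu> * w s + 1 * w s powr p))" if t: "t \<in> {a..b}" for t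
    proof -
      have i1: "(\<lambda>s. q s / h * f (w s)) integrable_on {a..b}"
      proof (rule bounded_measurable_integrable_on)
        show "(\<lambda>s. q s / h * f (w s)) \<in> borel_measurable borel" using gm unfolding q_def by measurable
        show "\<bar>q s / h * f (w s)\<bar> \<le> (1 / h) * (\<mu> + 1)" if "s \<in> {a..b}" for s
          unfolding abs_mult using gb q[OF that] h by (intro mult_mono) (auto simp: divide_right_mono)
      qed
      have i2: "(\<lambda>s. kern t s * f (w s)) integrable_on {a..b}"
        using t ab by (intro kern_mult_integrable[where B="\<mu> + 1"] gm gb) auto
      have "S w t = integral {a..b} (\<lambda>s. (t - a) * (q s / h * f (w s)) - kern t s * f (w s))"
        unfolding S_def using t by (intro integral_cong) (simp add: H_def cai algebra_simps)
      also have "\<dots> = integral {a..b} (\<lambda>s. (t - a) * (q s / h * f (w s))) - integral {a..b} (\<lambda>s. kern t s * f (w s))"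
        by (intro integral_diff i2 integrable_on_mult_right i1)
      also have "\<dots> = \<sigma> * (t - a) - integral {a..b} (\<lambda>s. kern t s * f (w s))"
        by (simp add: \<sigma>_def)
      finally show ?thesis using wfix[of t] by (simp add: f_def)
    qed
  qed (use w01 in auto)
qed


section \<open>Gluing pieces at their zeros\<close>

text \<open>At the poles the equation is singular, so only a continuous first derivative is asked
  there. \<kappa> may jump only at zeros of \<open>w\<close>; its upper bound ensures that products
  such as \<kappa> w \<bar>w\<bar>^q still tend to 0 there.\<close>

definition prof :: "real \<Rightarrow> real \<Rightarrow> real \<Rightarrow> real \<Rightarrow> (real \<Rightarrow> real) \<Rightarrow> (real \<Rightarrow> real) \<Rightarrow> (real \<Rightarrow> real) \<Rightarrow> real \<Rightarrow> bool" where
  "prof \<mu> q a b w w1 \<kappa> C \<longleftrightarrow>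
     continuous_on {a..b} w1 \<and>
     (\<forall>t\<in>{a..b}. (w has_real_derivative w1 t) (at t within {a..b})) \<and>
     (\<forall>t\<in>{a..b}. \<bar>t\<bar> < 1 \<longrightarrow> (w1 has_real_derivative - ((\<mu> * w t + \<kappa> t * w t * \<bar>w t\<bar> powr q) / (1 - t\<^sup>2))) (at t within {a..b})) \<and>
     (\<forall>t. 0 < \<kappa> t \<and> \<kappa> t \<le> C) \<and>
     (\<forall>t\<in>{a<..<b}. w t \<noteq> 0 \<longrightarrow> (\<forall>\<^sub>F s in at t. \<kappa> s = \<kappa> t)) \<and>
     w a = 0 \<and> w b = 0 \<and> (\<exists>t\<in>{a<..<b}. w t \<noteq> 0)"

text \<open>With x = 1 - t and y = 1 - s, \<open>min x y \<le> sqrt (x y)\<close> gives up half a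
  power of 1 - s, leaving an integrable singularity, in exchange for half a power of 1 - t.\<close>

lemma kern_diff_bound:
  assumes "0 \<le> s" "s \<le> b" "t \<le> b" "b \<le> 1"
  shows "kern b s - kern t s \<le> sqrt (1 - t) * (1 - s) powr (1/2 - 1)"
proof (cases "s = 1 \<or> t = 1")
  case True
  then show ?thesis using assms by (auto simp: kern_def)
next
  case False
  define x y where "x = 1 - t" and "y = 1 - s"
  have xy: "0 < x" "0 < y" using False assms by (auto simp: x_def y_def)
  have "min x y \<le> sqrt (x * y)"
    using xy by (intro real_le_rsqrt) (auto simp: power2_eq_square intro!: mult_mono)
  moreover have "max 0 (b - s) - max 0 (t - s) \<le> min x y" using assms by (auto simp: x_def y_def)
  moreover have "0 \<le> max 0 (b - s) - max 0 (t - s)" using assms by auto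
  moreover have "y \<le> 1 - s\<^sup>2" unfolding one_minus_sq using xy assms by (simp add: y_def mult_left_le)
  ultimately have "(max 0 (b - s) - max 0 (t - s)) / (1 - s\<^sup>2) \<le> sqrt (x * y) / y"
    using xy by (intro frac_le) auto
  also have "\<dots> = sqrt x * y powr (1/2 - 1)"
    using xy by (simp only: powr_diff powr_half_sqrt real_sqrt_mult) simp
  finally show ?thesis by (simp add: kern_def diff_divide_distrib x_def y_def)
qed

text \<open>Comparing the integral equation at \<open>t\<close> and at the zero \<open>b\<close>
  gives a bound of order \<open>sqrt (1 - t)\<close> for \<open>w\<close>. This is enough decay of
  the right-hand side for \<open>volterra_regularity\<close>, even when b = 1.\<close>

lemma piece_prof:
  assumes ab: "0 \<le> a" "a < b" "b \<le> 1" and \<mu>: "\<mu> > 0" and c: "c > 0" and p: "p > 0"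
    and wc: "continuous_on UNIV w" and w0: "w a = 0" "w b = 0"
    and pos: "\<And>t. t \<in> {a<..<b} \<Longrightarrow> 0 < w t" and w01: "\<And>t. 0 \<le> w t" "\<And>t. w t \<le> 1"
    and w: "\<And>t. t \<in> {a..b} \<Longrightarrow> w t = \<sigma> * (t - a) - integral {a..b} (\<lambda>s. kern t s * (\<mu> * w s + c * w s powr p))"
  shows "\<exists>w1. prof \<mu> (p - 1) a b w w1 (\<lambda>_. c) c \<and> w1 a \<noteq> 0 \<and> (b < 1 \<longrightarrow> w1 b \<noteq> 0)"
proof -
  define g where "g s = \<mu> * w s + c * w s powr p" for s
  have wp: "continuous_on UNIV (\<lambda>s. w s powr p)"
    by (rule continuous_on_powr'[OF wc continuous_on_const]) (use w01 p in auto)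
  have gc: "continuous_on A g" for A
    unfolding g_def using continuous_on_subset[OF wc, of A] continuous_on_subset[OF wp, of A]
    by (intro continuous_on_add continuous_on_mult continuous_on_const) auto
  have gm: "g \<in> borel_measurable borel" by (rule borel_measurable_continuous_onI[OF gc])
  have g0: "0 \<le> g s" "g s \<le> \<mu> + c" for s
  proof -
    show "0 \<le> g s" unfolding g_def using \<mu> c w01 by simp
    have "w s powr p \<le> 1" using w01 p by (simp add: powr_le1)
    then have "\<mu> * w s + c * w s powr p \<le> \<mu> * 1 + c * 1" using w01 \<mu> c by (intro add_mono mult_left_mono) auto
    then show "g s \<le> \<mu> + c" by (simp add: g_def)
  qed
  have int: "(\<lambda>s. kern t s * g s) integrable_on {a..b}" if "t \<in> {a..b}" for t
    using that ab g0 by (intro kern_mult_integrable[where B="\<mu> + c"] gm) auto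
  define I where "I = integral {a..b} (\<lambda>s. (1 - s) powr (1/2 - 1))"
  have Ii: "(\<lambda>s. (1 - s) powr (1/2 - 1)) integrable_on {a..b}"
    using one_minus_powr_integrable[of a b "1/2"] ab by simp
  have I0: "0 \<le> I" unfolding I_def by (intro integral_nonneg Ii) auto
  define K0 where "K0 = \<bar>\<sigma>\<bar> + (\<mu> + c) * I"
  have K0: "0 \<le> K0" using \<mu> c I0 by (simp add: K0_def)
  have wK: "w t \<le> K0 * (1 - t) powr (1/2)" if t: "t \<in> {a..b}" for t
  proof -
    have bI: "b \<in> {a..b}" using ab by simp
    have t1: "0 \<le> 1 - t" "1 - t \<le> 1" using t ab by auto
    have "integral {a..b} (\<lambda>s. kern b s * g s) - integral {a..b} (\<lambda>s. kern t s * g s) =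
        integral {a..b} (\<lambda>s. kern b s * g s - kern t s * g s)"
      by (rule integral_diff[OF int[OF bI] int[OF t], symmetric])
    also have "\<dots> \<le> integral {a..b} (\<lambda>s. (sqrt (1 - t) * (\<mu> + c)) * (1 - s) powr (1/2 - 1))"
    proof (rule integral_le)
      show "(\<lambda>s. kern b s * g s - kern t s * g s) integrable_on {a..b}"
        by (rule integrable_diff[OF int[OF bI] int[OF t]])
      show "(\<lambda>s. (sqrt (1 - t) * (\<mu> + c)) * (1 - s) powr (1/2 - 1)) integrable_on {a..b}"
        by (rule integrable_on_mult_right[OF Ii])
      fix s assume s: "s \<in> {a..b}"
      have "kern b s * g s - kern t s * g s = (kern b s - kern t s) * g s" by (simp add: left_diff_distrib)
      also have "\<dots> \<le> (sqrt (1 - t) * (1 - s) powr (1/2 - 1)) * g s"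
        using s t ab g0 by (intro mult_right_mono kern_diff_bound) auto
      also have "\<dots> \<le> (sqrt (1 - t) * (1 - s) powr (1/2 - 1)) * (\<mu> + c)"
        using g0 t1 by (intro mult_left_mono) auto
      finally show "kern b s * g s - kern t s * g s \<le> (sqrt (1 - t) * (\<mu> + c)) * (1 - s) powr (1/2 - 1)"
        by (simp only: mult_ac)
    qed
    also have "\<dots> = (\<mu> + c) * I * sqrt (1 - t)" by (simp add: I_def mult_ac)
    finally have 1: "integral {a..b} (\<lambda>s. kern b s * g s) - integral {a..b} (\<lambda>s. kern t s * g s) \<le> (\<mu> + c) * I * sqrt (1 - t)" .
    have "w t = w t - w b" using w0 by simp
    also have "\<dots> = \<sigma> * (t - b) + (integral {a..b} (\<lambda>s. kern b s * g s) - integral {a..b} (\<lambda>s. kern t s * g s))"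
      unfolding w[OF t] w[OF bI] g_def by (simp add: algebra_simps)
    also have "\<sigma> * (t - b) \<le> \<bar>\<sigma>\<bar> * sqrt (1 - t)"
    proof -
      have "\<sigma> * (t - b) \<le> \<bar>\<sigma>\<bar> * \<bar>t - b\<bar>" by (metis abs_ge_self abs_mult)
      also have "\<bar>t - b\<bar> \<le> 1 - t" using t ab by auto
      also have "1 - t \<le> sqrt (1 - t)" using t1 by (intro real_le_rsqrt) (simp add: power2_eq_square mult_left_le)
      finally show ?thesis by (simp add: mult_left_mono)
    qed
    finally have "w t \<le> \<bar>\<sigma>\<bar> * sqrt (1 - t) + (\<mu> + c) * I * sqrt (1 - t)" using 1 by linarith
    then show ?thesis using t1 by (simp add: K0_def powr_half_sqrt algebra_simps)
  qed
  \<comment> \<open>At most 1/2 for the linear term and at most p/2 for the power term.\<close>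
  define \<eta> where "\<eta> = min 1 p / 2"
  have \<eta>: "0 < \<eta>" "\<eta> \<le> 1/2" "\<eta> \<le> p / 2" using p by (auto simp: \<eta>_def)
  have gK: "\<bar>g s\<bar> \<le> (\<mu> * K0 + c * K0 powr p) * (1 - s) powr \<eta>" if s: "s \<in> {a..b}" for s
  proof -
    have s1: "0 \<le> 1 - s" "1 - s \<le> 1" using s ab by auto
    have m: "(1 - s) powr y \<le> (1 - s) powr \<eta>" if "\<eta> \<le> y" for y
      using s1 that \<eta> by (intro powr_mono') auto
    have "w s \<le> K0 * (1 - s) powr \<eta>"
      using wK[OF s] mult_left_mono[OF m[OF \<eta>(2)] K0] by linarith
    then have 1: "\<mu> * w s \<le> \<mu> * (K0 * (1 - s) powr \<eta>)" using \<mu> by simp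
    have "w s powr p \<le> (K0 * (1 - s) powr (1/2)) powr p"
      using wK[OF s] w01 p by (intro powr_mono2) auto
    also have "\<dots> = K0 powr p * (1 - s) powr (p / 2)" using K0 by (simp add: powr_mult powr_powr)
    also have "\<dots> \<le> K0 powr p * (1 - s) powr \<eta>" using m[OF \<eta>(3)] by (intro mult_left_mono) auto
    finally have 2: "c * w s powr p \<le> c * (K0 powr p * (1 - s) powr \<eta>)" using c by simp
    have "g s \<le> \<mu> * (K0 * (1 - s) powr \<eta>) + c * (K0 powr p * (1 - s) powr \<eta>)"
      unfolding g_def using 1 2 by linarith
    then show ?thesis using g0[of s] by (simp add: algebra_simps)
  qed
  obtain w1 where w1: "continuous_on {a..b} w1"
    "\<And>t. t \<in> {a..b} \<Longrightarrow> (w has_real_derivative w1 t) (at t within {a..b})"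
    "\<And>t. t \<in> {a..b} \<Longrightarrow> t < 1 \<Longrightarrow> (w1 has_real_derivative - (g t / (1 - t\<^sup>2))) (at t within {a..b})"
    "w1 a = \<sigma>"
    using volterra_regularity[OF ab gc gm \<eta>(1) gK, of w \<sigma>] w unfolding g_def by blast
  have ge: "g t = \<mu> * w t + c * w t * \<bar>w t\<bar> powr (p - 1)" for t
    using w01(1)[of t] powr_mult_base[of "w t" "p - 1"] by (simp add: g_def mult.assoc)
  have P: "prof \<mu> (p - 1) a b w w1 (\<lambda>_. c) c"
    unfolding prof_def
  proof (intro conjI ballI impI allI)
    fix t assume "t \<in> {a..b}" "\<bar>t\<bar> < 1"
    then show "(w1 has_real_derivative - ((\<mu> * w t + c * w t * \<bar>w t\<bar> powr (p - 1)) / (1 - t\<^sup>2))) (at t within {a..b})"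
      using w1(3)[of t] by (simp add: ge)
  next
    show "\<exists>t\<in>{a<..<b}. w t \<noteq> 0"
      using pos[of "(a + b) / 2"] ab by (intro bexI[of _ "(a + b) / 2"]) auto
  qed (use w1 c w0 in auto)
  define m where "m = (a + b) / 2"
  have m: "a < m" "m < b" using ab by (auto simp: m_def)
  have mv: "\<exists>\<xi>. x < \<xi> \<and> \<xi> < y \<and> w y - w x = w1 \<xi> * (y - x)" if "a \<le> x" "x < y" "y \<le> b" for x y
  proof -
    have c: "continuous_on {x..y} w" using wc continuous_on_subset by blast
    have d: "(w has_derivative (\<lambda>h. w1 \<xi> * h)) (at \<xi>)" if "x < \<xi>" "\<xi> < y" for \<xi>
      using w1(2)[of \<xi>] that \<open>a \<le> x\<close> \<open>y \<le> b\<close> at_within_Icc_at[of a \<xi> b]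
      by (simp add: has_field_derivative_def)
    from mvt[OF that(2) c d] show ?thesis by metis
  qed
  \<comment> \<open>The slope is nonincreasing because \<open>g\<close> is nonnegative. It is
    positive somewhere left of the midpoint and negative somewhere to the right, which fixes its
    sign at the ends.\<close>
  have anti: "w1 y \<le> w1 x" if "a \<le> x" "x < y" "y \<le> b" for x y
  proof -
    have c: "continuous_on {x..y} w1" using w1(1) by (rule continuous_on_subset) (use that in auto)
    have d: "(w1 has_derivative (\<lambda>h. - (g \<xi> / (1 - \<xi>\<^sup>2)) * h)) (at \<xi>)" if "x < \<xi>" "\<xi> < y" for \<xi>
    proof -
      have "(w1 has_real_derivative - (g \<xi> / (1 - \<xi>\<^sup>2))) (at \<xi>)"
        using w1(3)[of \<xi>] that \<open>a \<le> x\<close> \<open>y \<le> b\<close> at_within_Icc_at[of a \<xi> b] ab by simp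
      then show ?thesis by (rule has_field_derivative_imp_has_derivative)
    qed
    from mvt[OF that(2) c d] obtain \<xi> where \<xi>: "x < \<xi>" "\<xi> < y" "w1 y - w1 x = - (g \<xi> / (1 - \<xi>\<^sup>2)) * (y - x)" .
    have "\<xi>\<^sup>2 \<le> 1" using \<xi> that ab by (intro power_le_one) auto
    then have "0 \<le> g \<xi> / (1 - \<xi>\<^sup>2) * (y - x)" using g0 that by simp
    then show ?thesis using \<xi>(3) by simp
  qed
  have "w1 a \<noteq> 0"
  proof -
    obtain \<xi> where \<xi>: "a < \<xi>" "\<xi> < m" "w m - w a = w1 \<xi> * (m - a)" using mv[of a m] m by auto
    then have "0 < w1 \<xi> * (m - a)" using pos[of m] m w0 by simp
    then have "0 < w1 \<xi>" using m by (simp add: zero_less_mult_iff)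
    then show ?thesis using anti[of a \<xi>] \<xi> m by auto
  qed
  moreover have "w1 b \<noteq> 0"
  proof -
    obtain \<xi> where \<xi>: "m < \<xi>" "\<xi> < b" "w b - w m = w1 \<xi> * (b - m)" using mv[of m b] m by auto
    then have "w1 \<xi> * (b - m) < 0" using pos[of m] m w0 by simp
    then have "w1 \<xi> < 0" using m by (simp add: mult_less_0_iff)
    then show ?thesis using anti[of \<xi> b] \<xi> m by auto
  qed
  ultimately show ?thesis using P by blast
qed

text \<open>The nonlinearity has degree 1 + q, so a factor \<open>m\<close> is absorbed into
  \<kappa>. A negative \<open>m\<close> is allowed; this is how the sign of \<open>w\<close>
  alternates.\<close>

lemma prof_scale:
  assumes P: "prof \<mu> q a b w w1 \<kappa> C" and m: "m \<noteq> 0"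
  shows "prof \<mu> q a b (\<lambda>t. m * w t) (\<lambda>t. m * w1 t) (\<lambda>t. \<kappa> t * \<bar>m\<bar> powr (-q)) (C * \<bar>m\<bar> powr (-q))"
  unfolding prof_def
proof (intro conjI ballI impI allI)
  show "continuous_on {a..b} (\<lambda>t. m * w1 t)" using P by (intro continuous_intros) (simp add: prof_def)
  show "((\<lambda>t. m * w t) has_real_derivative m * w1 t) (at t within {a..b})" if "t \<in> {a..b}" for t
    using P that by (intro DERIV_cmult) (simp add: prof_def)
  fix t
  show "((\<lambda>t. m * w1 t) has_real_derivative
      - ((\<mu> * (m * w t) + \<kappa> t * \<bar>m\<bar> powr - q * (m * w t) * \<bar>m * w t\<bar> powr q) / (1 - t\<^sup>2))) (at t within {a..b})"
    if "t \<in> {a..b}" "\<bar>t\<bar> < 1"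
  proof -
    have "((\<lambda>t. m * w1 t) has_real_derivative m * - ((\<mu> * w t + \<kappa> t * w t * \<bar>w t\<bar> powr q) / (1 - t\<^sup>2))) (at t within {a..b})"
      using P that by (intro DERIV_cmult) (simp add: prof_def)
    moreover have "m * - ((\<mu> * w t + \<kappa> t * w t * \<bar>w t\<bar> powr q) / (1 - t\<^sup>2)) =
       - ((\<mu> * (m * w t) + \<kappa> t * \<bar>m\<bar> powr - q * (m * w t) * \<bar>m * w t\<bar> powr q) / (1 - t\<^sup>2))"
    proof -
      have "\<bar>m\<bar> powr - q * \<bar>m * w t\<bar> powr q = \<bar>w t\<bar> powr q"
        using m by (simp add: abs_mult powr_mult flip: powr_add mult.assoc)
      moreover have "\<kappa> t * \<bar>m\<bar> powr - q * (m * w t) * \<bar>m * w t\<bar> powr q =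
          \<kappa> t * (m * w t) * (\<bar>m\<bar> powr - q * \<bar>m * w t\<bar> powr q)" by (simp only: mult_ac)
      moreover have "m * (\<mu> * w t + \<kappa> t * w t * \<bar>w t\<bar> powr q) = \<mu> * (m * w t) + \<kappa> t * (m * w t) * \<bar>w t\<bar> powr q"
        by (simp add: algebra_simps)
      moreover have "m * - (X / D) = - ((m * X) / D)" for X D :: real by simp
      ultimately show ?thesis by (simp only:)
    qed
    ultimately show ?thesis by (simp only:)
  qed
  show "0 < \<kappa> t * \<bar>m\<bar> powr - q" "\<kappa> t * \<bar>m\<bar> powr - q \<le> C * \<bar>m\<bar> powr - q"
    using P m by (auto simp: prof_def mult_right_mono)
  show "\<forall>\<^sub>F s in at t. \<kappa> s * \<bar>m\<bar> powr - q = \<kappa> t * \<bar>m\<bar> powr - q" if "t \<in> {a<..<b}" "m * w t \<noteq> 0"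
  proof -
    have "\<forall>\<^sub>F s in at t. \<kappa> s = \<kappa> t" using P that by (simp add: prof_def)
    then show ?thesis by eventually_elim simp
  qed
  show "\<exists>t\<in>{a<..<b}. m * w t \<noteq> 0" using P m by (auto simp: prof_def)
qed (use P in \<open>auto simp: prof_def\<close>)

lemma glue_DERIV:
  fixes f g :: "real \<Rightarrow> real"
  assumes ab: "a < b" "b < d" and x: "x \<in> {a..d}"
    and f: "x \<in> {a..b} \<Longrightarrow> (f has_real_derivative f' x) (at x within {a..b})"
    and g: "x \<in> {b..d} \<Longrightarrow> (g has_real_derivative g' x) (at x within {b..d})"
    and eq: "f b = g b" "f' b = g' b"
  shows "((\<lambda>x. if x \<in> {a..b} then f x else g x) has_real_derivative (if x \<in> {a..b} then f' x else g' x)) (at x within {a..d})"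
  unfolding has_real_derivative_iff_has_vector_derivative
proof (rule has_vector_derivative_If_within_closures[where T="{b..d}"])
  have cl: "closure {a..b} \<inter> closure {b..d} = {b}" using ab by auto
  show "x \<in> {a..b} \<union> {b..d}" "{a..d} = {a..b} \<union> {b..d}" using x ab by auto
  have e: "{a..b} \<union> closure {a..b} \<inter> closure {b..d} = {a..b}" "{b..d} \<union> closure {a..b} \<inter> closure {b..d} = {b..d}"
    using ab cl by auto
  show "(f has_vector_derivative f' x) (at x within {a..b} \<union> closure {a..b} \<inter> closure {b..d})"
    if "x \<in> {a..b} \<union> closure {a..b} \<inter> closure {b..d}"
    using that f unfolding e by (simp add: has_real_derivative_iff_has_vector_derivative)
  show "(g has_vector_derivative g' x) (at x within {b..d} \<union> closure {a..b} \<inter> closure {b..d})"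
    if "x \<in> {b..d} \<union> closure {a..b} \<inter> closure {b..d}"
    using that g unfolding e by (simp add: has_real_derivative_iff_has_vector_derivative)
qed (use eq ab in auto)

text \<open>Both pieces vanish at \<open>b\<close>, so there the right-hand sides of the equation
  are both 0 whatever the values of \<kappa>; equal slopes are the only matching condition.\<close>

lemma prof_glue:
  assumes l: "prof \<mu> q a b l l1 \<kappa> C" and r: "prof \<mu> q b d r r1 \<kappa>' C'"
    and ab: "a < b" "b < d" "\<bar>b\<bar> < 1" and eq: "l1 b = r1 b"
  shows "prof \<mu> q a d (\<lambda>t. if t \<in> {a..b} then l t else r t) (\<lambda>t. if t \<in> {a..b} then l1 t else r1 t)
    (\<lambda>t. if t \<in> {a..b} then \<kappa> t else \<kappa>' t) (max C C')"
    (is "prof _ _ _ _ ?w ?w1 ?k _")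
proof -
  have eq0: "l b = r b" using l r by (simp add: prof_def)
  show ?thesis unfolding prof_def
  proof (intro conjI ballI impI allI)
    have "continuous_on {a..b} l1" "continuous_on {b..d} r1" using l r by (auto simp: prof_def)
    moreover have "\<forall>x. x \<in> {a..b} \<and> x \<notin> {a..b} \<or> x \<in> {b..d} \<and> x \<in> {a..b} \<longrightarrow> l1 x = r1 x"
      using eq by (metis atLeastAtMost_iff order_antisym)
    ultimately have "continuous_on ({a..b} \<union> {b..d}) ?w1"
      by (intro continuous_on_cases) auto
    moreover have "{a..b} \<union> {b..d} = {a..d}" using ab by auto
    ultimately show "continuous_on {a..d} ?w1" by simp
    show "(?w has_real_derivative ?w1 t) (at t within {a..d})" if "t \<in> {a..d}" for t
      by (rule glue_DERIV[OF ab(1,2) that]) (use l r eq eq0 in \<open>auto simp: prof_def\<close>)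
    fix t
    show "(?w1 has_real_derivative - ((\<mu> * ?w t + ?k t * ?w t * \<bar>?w t\<bar> powr q) / (1 - t\<^sup>2))) (at t within {a..d})"
      if t: "t \<in> {a..d}" "\<bar>t\<bar> < 1"
    proof -
      let ?L = "\<lambda>t. - ((\<mu> * l t + \<kappa> t * l t * \<bar>l t\<bar> powr q) / (1 - t\<^sup>2))"
      let ?R = "\<lambda>t. - ((\<mu> * r t + \<kappa>' t * r t * \<bar>r t\<bar> powr q) / (1 - t\<^sup>2))"
      have "(?w1 has_real_derivative (if t \<in> {a..b} then ?L t else ?R t)) (at t within {a..d})"
        by (rule glue_DERIV[OF ab(1,2) t(1)]) (use l r eq t in \<open>auto simp: prof_def\<close>)
      then show ?thesis by (cases "t \<in> {a..b}") auto
    qed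
    show "0 < ?k t" "?k t \<le> max C C'" using l r by (auto simp: prof_def le_max_iff_disj)
    show "\<forall>\<^sub>F s in at t. ?k s = ?k t" if t: "t \<in> {a<..<d}" "?w t \<noteq> 0"
    proof -
      have "t \<noteq> b" using t ab l by (auto simp: prof_def)
      then consider "t \<in> {a<..<b}" | "t \<in> {b<..<d}" using t by force
      then show ?thesis
      proof cases
        case 1
        then have "\<forall>\<^sub>F s in at t. \<kappa> s = \<kappa> t" using l t by (auto simp: prof_def)
        moreover have "\<forall>\<^sub>F s in at t. s \<in> {a<..<b}" using 1 by (intro eventually_at_in_open') auto
        ultimately show ?thesis by eventually_elim (use 1 in auto)
      next
        case 2
        then have "\<forall>\<^sub>F s in at t. \<kappa>' s = \<kappa>' t" using r t by (auto simp: prof_def)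
        moreover have "\<forall>\<^sub>F s in at t. s \<in> {b<..<d}" using 2 by (intro eventually_at_in_open') auto
        ultimately show ?thesis by eventually_elim (use 2 in auto)
      qed
    qed
    show "\<exists>t\<in>{a<..<d}. ?w t \<noteq> 0"
    proof -
      obtain t where "t \<in> {a<..<b}" "l t \<noteq> 0" using l by (auto simp: prof_def)
      then show ?thesis using ab by (intro bexI[of _ t]) auto
    qed
  qed (use l r ab eq0 in \<open>auto simp: prof_def\<close>)
qed

text \<open>Bolzano's subdivision principle: a property that holds on all short intervals around
  each point and survives concatenation holds on [0, 1].\<close>

lemma prof_unit_interval:
  assumes \<mu>: "\<mu> > 0" and q: "q > 0 \<or> (-1 < q \<and> q < 0)"
  shows "\<exists>w w1 \<kappa> C. prof \<mu> q 0 1 w w1 \<kappa> C"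
proof -
  \<comment> \<open>Nonzero end slopes are carried along because gluing rescales by their quotient;
    at 1 nothing is attached.\<close>
  define P where "P a b \<longleftrightarrow> (0 \<le> a \<and> a < b \<and> b \<le> 1 \<longrightarrow>
    (\<exists>w w1 \<kappa> C. prof \<mu> q a b w w1 \<kappa> C \<and> w1 a \<noteq> 0 \<and> (b < 1 \<longrightarrow> w1 b \<noteq> 0)))" for a b
  have "P 0 1"
  proof (rule Bolzano[of 0 "1::real" P])
    fix a b d assume ab: "P a b" and bd: "P b d" and le: "a \<le> b" "b \<le> d"
    show "P a d"
    proof (cases "a = b \<or> b = d")
      case True
      then show ?thesis using ab bd by auto
    next
      case False
      then have lt: "a < b" "b < d" using le by auto
      show ?thesis unfolding P_def
      proof
        assume ad: "0 \<le> a \<and> a < d \<and> d \<le> 1"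
        then have b1: "b < 1" "0 < b" using lt by auto
        obtain l l1 \<kappa> C where l: "prof \<mu> q a b l l1 \<kappa> C" "l1 a \<noteq> 0" "l1 b \<noteq> 0"
          using ab ad lt b1 unfolding P_def by (metis less_imp_le)
        obtain r r1 \<kappa>' C' where r: "prof \<mu> q b d r r1 \<kappa>' C'" "r1 b \<noteq> 0" "d < 1 \<longrightarrow> r1 d \<noteq> 0"
          using bd ad lt b1 unfolding P_def by (metis less_imp_le)
        define m where "m = l1 b / r1 b"
        have m: "m \<noteq> 0" "l1 b = m * r1 b" using l r by (auto simp: m_def)
        have "\<bar>b\<bar> < 1" using b1 by simp
        note G = prof_glue[OF l(1) prof_scale[OF r(1) m(1)] lt this m(2)]
        show "\<exists>w w1 \<kappa> C. prof \<mu> q a d w w1 \<kappa> C \<and> w1 a \<noteq> 0 \<and> (d < 1 \<longrightarrow> w1 d \<noteq> 0)"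
          by (intro exI, rule conjI, rule G) (use l r lt m in auto)
      qed
    qed
  next
    fix x :: real assume "0 \<le> x" "x \<le> 1"
    \<comment> \<open>Shorter intervals satisfy both length conditions,
      \<open>(b - a) \<mu> < 1\<close> and \<open>(b - a) (\<mu> + 1) \<le> 1\<close>.\<close>
    define \<delta> where "\<delta> = 1 / (\<mu> + 1)"
    have "\<delta> > 0" using \<mu> by (simp add: \<delta>_def)
    moreover have "P a b" if "a \<le> x" "x \<le> b" "b - a < \<delta>" for a b
      unfolding P_def
    proof
      assume ab: "0 \<le> a \<and> a < b \<and> b \<le> 1"
      have d: "(b - a) * (\<mu> + 1) < 1" using that \<mu> by (simp add: \<delta>_def field_simps)
      then have d': "(b - a) * \<mu> < 1" using ab by (simp add: algebra_simps)
      show "\<exists>w w1 \<kappa> C. prof \<mu> q a b w w1 \<kappa> C \<and> w1 a \<noteq> 0 \<and> (b < 1 \<longrightarrow> w1 b \<noteq> 0)"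
      proof (cases "q > 0")
        case True
        obtain c w where cw: "c > 0" "continuous_on UNIV w" "w a = 0" "w b = 0"
          "\<And>t. t \<in> {a<..<b} \<Longrightarrow> 0 < w t" "\<And>t. 0 \<le> w t" "\<And>t. w t \<le> 1"
          "\<And>t. t \<in> {a..b} \<Longrightarrow> w t = 1 * (t - a) - integral {a..b} (\<lambda>s. kern t s * (\<mu> * w s + c * w s powr (q + 1)))"
        proof -
          have pre: "0 \<le> a" "a < b" "b \<le> 1" "(b - a) * \<mu> < 1" "1 < q + 1"
            using ab d' True by auto
          show thesis by (rule superlinear_piece[OF pre(1-3) \<mu> pre(4-5)]) (rule that)
        qed
        have "\<exists>w1. prof \<mu> (q + 1 - 1) a b w w1 (\<lambda>_. c) c \<and> w1 a \<noteq> 0 \<and> (b < 1 \<longrightarrow> w1 b \<noteq> 0)"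
          by (rule piece_prof[OF _ _ _ \<mu> cw(1) _ cw(2-8)]) (use ab True in auto)
        then show ?thesis by auto
      next
        case False
        then have q1: "-1 < q" "q < 0" using q by auto
        obtain \<sigma> w where cw: "continuous_on UNIV w" "w a = 0" "w b = 0"
          "\<And>t. t \<in> {a<..<b} \<Longrightarrow> 0 < w t" "\<And>t. 0 \<le> w t" "\<And>t. w t \<le> 1"
          "\<And>t. t \<in> {a..b} \<Longrightarrow> w t = \<sigma> * (t - a) - integral {a..b} (\<lambda>s. kern t s * (\<mu> * w s + 1 * w s powr (q + 1)))"
        proof -
          have pre: "0 \<le> a" "a < b" "b \<le> 1" "(b - a) * (\<mu> + 1) \<le> 1" "0 < q + 1" "q + 1 < 1"
            using ab d q1 by auto
          show thesis by (rule sublinear_piece[OF pre(1-3) \<mu> pre(4-6)]) (rule that)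
        qed
        have "\<exists>w1. prof \<mu> (q + 1 - 1) a b w w1 (\<lambda>_. 1) 1 \<and> w1 a \<noteq> 0 \<and> (b < 1 \<longrightarrow> w1 b \<noteq> 0)"
          by (rule piece_prof[OF _ _ _ \<mu> zero_less_one _ cw]) (use ab q1 in auto)
        then show ?thesis by auto
      qed
    qed
    ultimately show "\<exists>d>0. \<forall>a b. a \<le> x \<and> x \<le> b \<and> b - a < d \<longrightarrow> P a b" by blast
  qed simp
  then show ?thesis unfolding P_def by auto
qed

text \<open>The nonlinearity is odd in \<open>w\<close> and the weight even in \<open>t\<close>, so
  the odd reflection solves the same equation, and its slope at 0 agrees. Thus only the pole t = 1
  had to be treated.\<close>

lemma prof_reflect:
  assumes P: "prof \<mu> q 0 1 w w1 \<kappa> C"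
  shows "prof \<mu> q (-1) 0 (\<lambda>t. - w (- t)) (\<lambda>t. w1 (- t)) (\<lambda>t. \<kappa> (- t)) C"
proof -
  have chain: "((\<lambda>t. f (- t)) has_real_derivative - f') (at t within {-1..0})"
    if "(f has_real_derivative f') (at (- t) within {0..1})" for f f' t
  proof -
    have "uminus ` {-1..0} = {0..1::real}" by auto
    then have "(f has_real_derivative f') (at (- t) within uminus ` {-1..0})" using that by simp
    moreover have "(uminus has_real_derivative -1) (at t within {-1..0})" by (auto intro!: derivative_eq_intros)
    ultimately have "(f \<circ> uminus has_real_derivative f' * -1) (at t within {-1..0})"
      by (rule DERIV_image_chain)
    then show ?thesis by (simp add: o_def)
  qed
  show ?thesis unfolding prof_def
  proof (intro conjI ballI impI allI)
    show "continuous_on {-1..0} (\<lambda>t. w1 (- t))"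
      by (rule continuous_on_compose2[of "{0..1}" w1]) (use P in \<open>auto simp: prof_def intro!: continuous_intros\<close>)
    show "((\<lambda>t. - w (- t)) has_real_derivative w1 (- t)) (at t within {-1..0})" if "t \<in> {-1..0}" for t
      using DERIV_minus[OF chain[of w "w1 (- t)" t]] P that by (auto simp: prof_def)
    fix t
    show "((\<lambda>t. w1 (- t)) has_real_derivative
       - ((\<mu> * - w (- t) + \<kappa> (- t) * - w (- t) * \<bar>- w (- t)\<bar> powr q) / (1 - t\<^sup>2))) (at t within {-1..0})"
      if "t \<in> {-1..0}" "\<bar>t\<bar> < 1"
    proof -
      have "(w1 has_real_derivative - ((\<mu> * w (-t) + \<kappa> (-t) * w (-t) * \<bar>w (-t)\<bar> powr q) / (1 - (-t)\<^sup>2))) (at (-t) within {0..1})"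
      proof -
        have "\<forall>t\<in>{0..1}. \<bar>t\<bar> < 1 \<longrightarrow> (w1 has_real_derivative - ((\<mu> * w t + \<kappa> t * w t * \<bar>w t\<bar> powr q) / (1 - t\<^sup>2))) (at t within {0..1})"
          using P unfolding prof_def by (elim conjE)
        from bspec[OF this, of "- t"] show ?thesis using that by simp
      qed
      from chain[OF this] show ?thesis
        by (rule DERIV_cong) (simp add: add_divide_distrib diff_divide_distrib)
    qed
    show "\<forall>\<^sub>F s in at t. \<kappa> (- s) = \<kappa> (- t)" if "t \<in> {-1<..<0}" "- w (- t) \<noteq> 0"
    proof -
      have "\<forall>\<^sub>F s in at (- t). \<kappa> s = \<kappa> (- t)" using P that by (simp add: prof_def)
      then obtain d where d: "d > 0" "\<And>s. s \<noteq> - t \<Longrightarrow> dist s (- t) < d \<Longrightarrow> \<kappa> s = \<kappa> (- t)"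
        unfolding eventually_at by auto
      have "\<kappa> (- s) = \<kappa> (- t)" if "s \<noteq> t" "dist s t < d" for s
        using that by (intro d(2)) (auto simp: dist_minus)
      then show ?thesis unfolding eventually_at using d(1) by blast
    qed
    show "\<exists>t\<in>{-1<..<0}. - w (- t) \<noteq> 0"
    proof -
      obtain t where "t \<in> {0<..<1}" "w t \<noteq> 0" using P by (auto simp: prof_def)
      then show ?thesis by (intro bexI[of _ "- t"]) auto
    qed
  qed (use P in \<open>auto simp: prof_def\<close>)
qed

theorem profile_exists:
  assumes "\<mu> > 0" "q > 0 \<or> (-1 < q \<and> q < 0)"
  obtains w w1 \<kappa> C where "prof \<mu> q (-1) 1 w w1 \<kappa> C"
proof -
  obtain w w1 \<kappa> C where P: "prof \<mu> q 0 1 w w1 \<kappa> C" using prof_unit_interval[OF assms] by blast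
  have "w1 (- 0) = w1 0" by simp
  from prof_glue[OF prof_reflect[OF P] P _ _ _ this] show thesis using that by simp
qed

section \<open>Functions of the polar angle\<close>

lemma open_punctured: "open (- {0::real^3})" by auto

lemma norm_sq3: "(norm (x::real^3))\<^sup>2 = (x$1)\<^sup>2 + (x$2)\<^sup>2 + (x$3)\<^sup>2"
  unfolding power2_norm_eq_inner inner_vec3 by (simp add: power2_eq_square)

definition tau :: "real^3 \<Rightarrow> real" where "tau x = x$3 / norm x"

definition rsq :: "real^3 \<Rightarrow> real" where "rsq x = (x$1)\<^sup>2 + (x$2)\<^sup>2"

lemma z_axis_rsq: "x \<in> z_axis \<longleftrightarrow> rsq x = 0"
  by (simp add: z_axis_def rsq_def sum_power2_eq_zero_iff)

lemma rsq_nonneg: "0 \<le> rsq x" by (simp add: rsq_def)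

lemma closed_z_axis: "closed z_axis"
proof -
  have "z_axis = {x. rsq x = 0}" using z_axis_rsq by blast
  moreover have "closed {x. rsq x = 0}" unfolding rsq_def by (intro closed_Collect_eq continuous_intros)
  ultimately show ?thesis by simp
qed

lemma open_off_axis: "open (- z_axis)" using closed_z_axis by (simp add: open_Compl)

lemma zero_in_z_axis: "0 \<in> z_axis" by (simp add: z_axis_def)

lemma off_axis_nonzero: "x \<in> - z_axis \<Longrightarrow> x \<noteq> 0" using zero_in_z_axis by auto

lemma one_minus_tau_sq:
  assumes "x \<noteq> 0" shows "1 - (tau x)\<^sup>2 = rsq x / (norm x)\<^sup>2"
proof -
  have "1 - (tau x)\<^sup>2 = ((norm x)\<^sup>2 - (x$3)\<^sup>2) / (norm x)\<^sup>2"
    using assms by (simp add: tau_def power_divide diff_divide_distrib)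
  also have "(norm x)\<^sup>2 - (x$3)\<^sup>2 = rsq x" by (simp add: norm_sq3 rsq_def)
  finally show ?thesis .
qed

lemma tau_bounds:
  assumes "x \<noteq> 0" shows "tau x \<in> {-1..1}"
proof -
  have "0 \<le> 1 - (tau x)\<^sup>2" unfolding one_minus_tau_sq[OF assms] by (simp add: rsq_nonneg)
  then have "\<bar>tau x\<bar> \<le> 1" by (simp add: abs_square_le_1)
  then show ?thesis by auto
qed

lemma tau_off_axis:
  assumes "x \<in> - z_axis" shows "tau x \<in> {-1<..<1}"
proof -
  have "0 < 1 - (tau x)\<^sup>2"
    unfolding one_minus_tau_sq[OF off_axis_nonzero[OF assms]]
    using assms off_axis_nonzero[OF assms] z_axis_rsq[of x] rsq_nonneg[of x] by simp
  then have "\<bar>tau x\<bar> < 1" by (simp add: abs_square_less_1)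
  then show ?thesis by auto
qed

lemma tau_image: "tau ` (-{0}) \<subseteq> {-1..1}"
  using tau_bounds by blast

lemma tau_image_off_axis: "tau ` (- z_axis) \<subseteq> {-1<..<1}"
  using tau_off_axis by blast

lemma tau_on_axis: "x \<in> z_axis \<Longrightarrow> x \<noteq> 0 \<Longrightarrow> 1 - (tau x)\<^sup>2 = 0"
  by (simp add: one_minus_tau_sq z_axis_rsq)

lemma tau_on_axis': "x \<in> z_axis \<Longrightarrow> x \<noteq> 0 \<Longrightarrow> tau x = 1 \<or> tau x = -1"
  using tau_on_axis[of x] by (simp add: power2_eq_1_iff)

definition Dtau :: "real^3 \<Rightarrow> real^3 \<Rightarrow> real" where
  "Dtau x v = v$3 * norm x powr (-1) - x$3 * (norm x powr (-3) * (x \<bullet> v))"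

lemma tau_powr: "tau = (\<lambda>x. x$3 * norm x powr (-1))"
  by (auto simp: tau_def powr_minus divide_inverse)

lemma has_derivative_tau:
  assumes "x \<noteq> 0" shows "(tau has_derivative Dtau x) (at x)"
proof -
  have "(tau has_derivative (\<lambda>v. x$3 * ((-1) * norm x powr (-1 - 2) * (x \<bullet> v)) + v$3 * norm x powr (-1))) (at x)"
    unfolding tau_powr
    by (intro has_derivative_mult has_derivative_norm_powr assms
        bounded_linear.has_derivative[OF bounded_linear_vec_nth has_derivative_ident])
  then show ?thesis by (rule has_derivative_eq_rhs) (simp add: Dtau_def fun_eq_iff)
qed

lemma Ck_tau: "Ck_on k tau (-{0})"
  unfolding tau_powr by (intro Ck_on_mult Ck_on_nth_ident Ck_on_norm_powr open_punctured)

lemma Ck_Dtau: "Ck_on k (\<lambda>x. Dtau x v) (-{0})"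
  unfolding Dtau_def
  by (intro Ck_on_mult Ck_on_diff Ck_on_nth_ident Ck_on_norm_powr open_punctured Ck_on_const Ck_on_inner
      Ck_on_bounded_linear[OF open_punctured bounded_linear_ident])

lemma continuous_tau: "continuous_on (-{0}) tau"
  using Ck_on_imp_continuous_on[OF Ck_tau] .

text \<open>The gradient of \<open>tau\<close> is tangential to the sphere and shrinks towards the
  poles like the distance to the axis; it compensates half of a singular factor
  \<open>1 / (1 - t^2)\<close>.\<close>

lemma Dtau_bound:
  assumes "x \<noteq> 0"
  shows "\<bar>Dtau x v\<bar> \<le> norm v * norm x powr (-1) * sqrt (1 - (tau x)\<^sup>2)"
proof -
  define g where "g = norm x powr (-1) *\<^sub>R axis 3 1 - (x$3 * norm x powr (-3)) *\<^sub>R x"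
  have n3: "norm x powr (-3) = inverse (norm x ^ 3)" using assms by (simp add: powr_minus)
  have n1: "norm x powr (-1) = inverse (norm x)" using assms by (simp add: powr_minus)
  have gv: "Dtau x v = v \<bullet> g"
    by (simp add: Dtau_def g_def inner_diff_right inner_axis inner_commute)
  have "g \<bullet> g = (norm x powr (-1))\<^sup>2 * (1 - (tau x)\<^sup>2)"
  proof -
    have 1: "axis 3 1 \<bullet> (axis 3 1::real^3) = 1" "axis 3 1 \<bullet> x = x$3" "x \<bullet> axis 3 1 = x$3"
      by (simp_all add: inner_vec3 axis_def)
    have 2: "x \<bullet> x = (norm x)\<^sup>2" by (simp add: dot_square_norm)
    show ?thesis unfolding g_def n3 n1 tau_def
      by (simp add: inner_diff_left inner_diff_right 1 2)
        (use assms in \<open>simp add: field_simps power2_eq_square power3_eq_cube\<close>)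
  qed
  then have "norm g = norm x powr (-1) * sqrt (1 - (tau x)\<^sup>2)"
    by (simp add: norm_eq_sqrt_inner real_sqrt_mult)
  then show ?thesis unfolding gv using Cauchy_Schwarz_ineq2[of v g] by (simp add: mult.assoc)
qed

lemma C0_tau:
  assumes "continuous_on {-1..1} G" shows "continuous_on (-{0}) (\<lambda>x. G (tau x))"
  by (rule continuous_on_compose2[OF assms continuous_tau tau_image])

lemma C1_tau_off_axis:
  assumes "\<And>t. t \<in> {-1<..<1} \<Longrightarrow> (G has_real_derivative g t) (at t)" "continuous_on {-1<..<1} g"
  shows "Ck_on 1 (\<lambda>x. G (tau x)) (- z_axis)"
proof (rule C1_compose[where g=G and f=tau, OF open_off_axis _ assms(2) tau_image_off_axis])
  show "(G has_real_derivative g t) (at t within {-1<..<1})" if "t \<in> {-1<..<1}" for t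
    using assms(1)[OF that] by (rule has_field_derivative_at_within)
  show "Ck_on 1 tau (- z_axis)" by (rule Ck_on_subset[OF Ck_tau]) (use zero_in_z_axis in auto)
qed

section \<open>Regularity across the axis\<close>

text \<open>Where \<open>l\<close> vanishes, the increment of \<open>q\<close> only meets an
  increment of \<open>l\<close>, so continuity of \<open>q\<close> suffices. It is applied on the
  axis, where the profile need not have a finite derivative.\<close>

lemma has_derivative_mult_vanishing:
  fixes q l :: "'a::real_normed_vector \<Rightarrow> real"
  assumes q: "isCont q x" and l: "(l has_derivative l') (at x)" and l0: "l x = 0"
  shows "((\<lambda>y. q y * l y) has_derivative (\<lambda>v. q x * l' v)) (at x)"
proof -
  have bl: "bounded_linear l'" using l has_derivative_bounded_linear by blast
  obtain K where K: "\<And>v. norm (l' v) \<le> norm v * K" "K > 0" using bounded_linear.pos_bounded[OF bl] by blast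
  have "((\<lambda>y. norm (l y - l x - l' (y - x)) / norm (y - x)) \<longlongrightarrow> 0) (at x)"
    using l by (simp add: has_derivative_iff_norm)
  note L = this
  have Q: "((\<lambda>y. \<bar>q y\<bar>) \<longlongrightarrow> \<bar>q x\<bar>) (at x)" "((\<lambda>y. \<bar>q y - q x\<bar> * K) \<longlongrightarrow> 0) (at x)"
  proof -
    have 1: "(q \<longlongrightarrow> q x) (at x)" using q by (simp add: isCont_def)
    show "((\<lambda>y. \<bar>q y\<bar>) \<longlongrightarrow> \<bar>q x\<bar>) (at x)" by (rule tendsto_rabs[OF 1])
    have "((\<lambda>y. \<bar>q y - q x\<bar> * K) \<longlongrightarrow> \<bar>q x - q x\<bar> * K) (at x)" by (intro tendsto_intros 1)
    then show "((\<lambda>y. \<bar>q y - q x\<bar> * K) \<longlongrightarrow> 0) (at x)" by simp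
  qed
  have "((\<lambda>y. norm (q y * l y - q x * l x - q x * l' (y - x)) / norm (y - x)) \<longlongrightarrow> 0) (at x)"
  proof (rule Lim_null_comparison)
    show "((\<lambda>y. \<bar>q y\<bar> * (norm (l y - l x - l' (y - x)) / norm (y - x)) + \<bar>q y - q x\<bar> * K) \<longlongrightarrow> 0) (at x)"
      using tendsto_add[OF tendsto_mult[OF Q(1) L] Q(2)] by simp
    have "norm (norm (q y * l y - q x * l x - q x * l' (y - x)) / norm (y - x)) \<le>
        \<bar>q y\<bar> * (norm (l y - l x - l' (y - x)) / norm (y - x)) + \<bar>q y - q x\<bar> * K" if "y \<noteq> x" for y
    proof -
      have "q y * l y - q x * l x - q x * l' (y - x) = q y * (l y - l x - l' (y - x)) + (q y - q x) * l' (y - x)"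
        using l0 by (simp add: algebra_simps)
      then have "norm (q y * l y - q x * l x - q x * l' (y - x)) \<le>
          \<bar>q y\<bar> * norm (l y - l x - l' (y - x)) + \<bar>q y - q x\<bar> * (norm (y - x) * K)"
        using abs_triangle_ineq[of "q y * (l y - l x - l' (y - x))" "(q y - q x) * l' (y - x)"]
          mult_left_mono[OF K(1)[of "y - x"], of "\<bar>q y - q x\<bar>"] by (simp add: abs_mult)
      then show ?thesis using that by (simp add: field_simps)
    qed
    then show "\<forall>\<^sub>F y in at x. norm (norm (q y * l y - q x * l x - q x * l' (y - x)) / norm (y - x)) \<le>
        \<bar>q y\<bar> * (norm (l y - l x - l' (y - x)) / norm (y - x)) + \<bar>q y - q x\<bar> * K"
      by (auto simp: eventually_at_filter)
  qed
  then show ?thesis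
    unfolding has_derivative_iff_norm
    using bounded_linear_compose[OF bounded_linear_mult_right bl] by (simp add: l0)
qed

text \<open>The condition on \<open>h\<close> is what differentiability at the poles requires: along a meridian the
  distance to the axis is of the order \<open>sqrt (1 - t\<^sup>2)\<close>.\<close>
lemma C1_tau_mult_vanishing:
  assumes g: "continuous_on {-1..1} g" "\<And>t. t \<in> {-1<..<1} \<Longrightarrow> (g has_real_derivative h t / (1 - t\<^sup>2)) (at t)"
    and h: "continuous_on {-1..1} h" "h (-1) = 0" "h 1 = 0"
    and l: "Ck_on 1 l (-{0})" "\<And>x. x \<noteq> 0 \<Longrightarrow> \<bar>l x\<bar> \<le> C * norm x powr s * sqrt (1 - (tau x)\<^sup>2)"
  shows "Ck_on 1 (\<lambda>x. g (tau x) * l x) (-{0})"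
proof (rule C1I[OF open_punctured])
  define e where "e v x = (if x \<in> z_axis then 0 else h (tau x) / (1 - (tau x)\<^sup>2) * Dtau x v * l x)" for v x
  have lz: "l x = 0" if "x \<in> z_axis" "x \<noteq> 0" for x
    using l(2)[OF that(2)] tau_on_axis[OF that] by simp
  have cg: "continuous_on (-{0}) (\<lambda>x. g (tau x))" by (rule C0_tau[OF g(1)])
  fix x :: "real^3" assume "x \<in> -{0}"
  then have x: "x \<noteq> 0" by simp
  show "((\<lambda>x. g (tau x) * l x) has_derivative (\<lambda>v. g (tau x) * frechet_derivative l (at x) v + e v x)) (at x)"
  proof (cases "x \<in> z_axis")
    case True
    have "isCont (\<lambda>x. g (tau x)) x"
      using cg x by (simp add: continuous_on_eq_continuous_at[OF open_punctured])
    from has_derivative_mult_vanishing[OF this C1D(1)[OF l(1)] lz[OF True x]]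
    show ?thesis using x True by (simp add: e_def)
  next
    case False
    then have "tau x \<in> {-1<..<1}" using tau_off_axis by simp
    from has_derivative_compose[OF has_derivative_tau[OF x] has_field_derivative_imp_has_derivative[OF g(2)[OF this]]]
    have "((\<lambda>x. g (tau x)) has_derivative (\<lambda>v. h (tau x) / (1 - (tau x)\<^sup>2) * Dtau x v)) (at x)" .
    from has_derivative_mult[OF this C1D(1)[OF l(1)]]
    show ?thesis using x False by (simp add: e_def)
  qed
next
  define e where "e v x = (if x \<in> z_axis then 0 else h (tau x) / (1 - (tau x)\<^sup>2) * Dtau x v * l x)" for v x
  fix v
  have "continuous_on (-{0}) (e v)"
    unfolding continuous_on_eq_continuous_at[OF open_punctured]
  proof
    fix x :: "real^3" assume "x \<in> -{0}"
    then have x: "x \<noteq> 0" by simp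
    show "isCont (e v) x"
    proof (cases "x \<in> z_axis")
      case False
      have c: "continuous_on (- z_axis) (\<lambda>x. h (tau x) / (1 - (tau x)\<^sup>2) * Dtau x v * l x)"
      proof -
        have sub: "- z_axis \<subseteq> - {0}" using zero_in_z_axis by auto
        have "1 - (tau x)\<^sup>2 \<noteq> 0" if "x \<in> - z_axis" for x
          using one_minus_tau_sq[OF off_axis_nonzero[OF that]] that off_axis_nonzero[OF that]
          by (simp add: z_axis_rsq)
        then show ?thesis
          by (intro continuous_intros continuous_on_subset[OF C0_tau[OF h(1)] sub]
              continuous_on_subset[OF continuous_tau sub] continuous_on_subset[OF Ck_on_imp_continuous_on[OF l(1)] sub]
              continuous_on_subset[OF Ck_on_imp_continuous_on[OF Ck_Dtau[of 0]] sub]) auto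
      qed
      have "continuous_on (- z_axis) (e v)"
        by (rule continuous_on_eq[OF c]) (simp add: e_def)
      then show ?thesis using False by (simp add: continuous_on_eq_continuous_at[OF open_off_axis])
    next
      case True
      \<comment> \<open>The factors \<open>sqrt (1 - t^2)\<close> of \<open>Dtau\<close> and of
        \<open>l\<close> cancel the denominator. What remains is the continuous function
        \<open>h\<close>, which is 0 at the poles.\<close>
      define k where "k y = \<bar>h (tau y)\<bar> * (norm v * C) * norm y powr (s - 1)" for y
      have ck: "continuous_on (-{0}) k" unfolding k_def
        by (intro continuous_intros C0_tau[OF h(1)] Ck_on_imp_continuous_on[OF Ck_on_norm_powr[of 0]])
      have "k x = 0" using tau_on_axis'[OF True x] h by (auto simp: k_def)
      moreover have "isCont k x" using ck x by (simp add: continuous_on_eq_continuous_at[OF open_punctured])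
      ultimately have lim: "(k \<longlongrightarrow> 0) (at x)" by (simp add: isCont_def)
      have b: "norm (e v y) \<le> k y" if y: "y \<noteq> 0" for y
      proof (cases "y \<in> z_axis")
        case True
        then show ?thesis using tau_on_axis'[OF True y] h by (auto simp: k_def e_def)
      next
        case False
        define c where "c = 1 - (tau y)\<^sup>2"
        have c: "c > 0" unfolding c_def one_minus_tau_sq[OF y]
          using False y z_axis_rsq[of y] rsq_nonneg[of y] by simp
        have "norm (e v y) = (\<bar>h (tau y)\<bar> / c) * (\<bar>Dtau y v\<bar> * \<bar>l y\<bar>)"
          using False c by (simp add: e_def abs_mult c_def[symmetric])
        also have "\<dots> \<le> (\<bar>h (tau y)\<bar> / c) * ((norm v * norm y powr (-1) * sqrt c) * (C * norm y powr s * sqrt c))"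
          using Dtau_bound[OF y, of v] l(2)[OF y] c unfolding c_def[symmetric]
          by (intro mult_left_mono mult_mono) auto
        also have "\<dots> = \<bar>h (tau y)\<bar> * (norm v * C) * (norm y powr (-1) * norm y powr s) * ((sqrt c * sqrt c) / c)"
          by (simp add: field_simps)
        also have "norm y powr (-1) * norm y powr s = norm y powr (s - 1)"
          using powr_add[of "norm y" "-1" s] by simp
        also have "(sqrt c * sqrt c) / c = 1" using c by simp
        finally show ?thesis by (simp add: k_def)
      qed
      have "(e v \<longlongrightarrow> 0) (at x)"
      proof (rule Lim_null_comparison[OF _ lim])
        have "\<forall>\<^sub>F y in at x. y \<in> -{0}" using x by (intro eventually_at_in_open' open_punctured) auto
        then show "\<forall>\<^sub>F y in at x. norm (e v y) \<le> k y" by eventually_elim (use b in auto)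
      qed
      then show ?thesis using True by (simp add: isCont_def e_def)
    qed
  qed
  then show "continuous_on (-{0}) (\<lambda>x. g (tau x) * frechet_derivative l (at x) v +
      (if x \<in> z_axis then 0 else h (tau x) / (1 - (tau x)\<^sup>2) * Dtau x v * l x))"
    unfolding e_def by (intro continuous_intros C0_tau[OF g(1)] C1D(2)[OF l(1)])
qed

text \<open>The first derivative is \<open>g (tau x) * Dtau x v\<close>, and \<open>Dtau\<close>
  vanishes on the axis at the rate required by \<open>C1_tau_mult_vanishing\<close>.\<close>

lemma C2_tau:
  assumes G: "\<And>t. t \<in> {-1..1} \<Longrightarrow> (G has_real_derivative g t) (at t within {-1..1})"
    and g: "continuous_on {-1..1} g" "\<And>t. t \<in> {-1<..<1} \<Longrightarrow> (g has_real_derivative h t / (1 - t\<^sup>2)) (at t)"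
    and h: "continuous_on {-1..1} h" "h (-1) = 0" "h 1 = 0"
  shows "Ck_on 2 (\<lambda>x. G (tau x)) (-{0})"
proof -
  have "Ck_on (Suc 1) (\<lambda>x. G (tau x)) (-{0})"
  proof (rule Ck_on_SucI[OF open_punctured])
    fix x :: "real^3" assume "x \<in> -{0}"
    then have x: "x \<noteq> 0" by simp
    show "((\<lambda>x. G (tau x)) has_derivative (\<lambda>v. g (tau x) * Dtau x v)) (at x)"
      using has_derivative_in_compose2[of "{-1..1}" G "\<lambda>t. (*) (g t)" tau "-{0}" x "Dtau x"] G tau_bounds x
        has_derivative_tau[OF x]
      by (auto simp: has_field_derivative_def at_within_open[OF _ open_punctured] image_subset_iff)
  next
    fix v
    show "Ck_on 1 (\<lambda>x. g (tau x) * Dtau x v) (-{0})"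
      by (rule C1_tau_mult_vanishing[where C="norm v" and s="-1", OF g h Ck_Dtau]) (assumption, rule Dtau_bound)
  qed
  then show ?thesis by (simp only: Suc_1[symmetric] One_nat_def)
qed

lemma nth_bound:
  assumes "x \<noteq> 0" "i = 1 \<or> i = 2"
  shows "\<bar>x$i\<bar> \<le> 1 * norm x powr 1 * sqrt (1 - (tau x)\<^sup>2)"
proof -
  have "(x$i)\<^sup>2 \<le> rsq x" using assms(2) by (auto simp: rsq_def)
  also have "rsq x = (norm x)\<^sup>2 * (1 - (tau x)\<^sup>2)" unfolding one_minus_tau_sq[OF assms(1)] using assms(1) by simp
  finally have "sqrt ((x$i)\<^sup>2) \<le> sqrt ((norm x)\<^sup>2 * (1 - (tau x)\<^sup>2))" by (rule real_sqrt_le_mono)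
  then show ?thesis by (simp add: real_sqrt_mult)
qed

text \<open>Derivatives of an axisymmetric function in the variables \<open>r\<^sup>2 / 2\<close> and \<open>z\<close>.\<close>
definition axi :: "(real^3 \<Rightarrow> real) \<Rightarrow> real \<Rightarrow> real \<Rightarrow> real^3 \<Rightarrow> bool" where
  "axi f fs fz x \<longleftrightarrow> (f has_derivative (\<lambda>v. fs * (x$1 * v$1 + x$2 * v$2) + fz * v$3)) (at x)"

definition Phi :: "real \<Rightarrow> (real \<Rightarrow> real) \<Rightarrow> real^3 \<Rightarrow> real" where
  "Phi s G x = norm x powr s * G (tau x)"

lemma axi_Phi:
  assumes x: "x \<noteq> 0" and G: "(G has_real_derivative g) (at (tau x))"
  shows "axi (Phi s G) (norm x powr (s - 2) * (s * G (tau x) - tau x * g))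
    (norm x powr (s - 1) * (s * tau x * G (tau x) + (1 - (tau x)\<^sup>2) * g)) x"
proof -
  have "((\<lambda>x. G (tau x)) has_derivative (\<lambda>v. g * Dtau x v)) (at x)"
    using has_derivative_compose[OF has_derivative_tau[OF x] has_field_derivative_imp_has_derivative[OF G]] .
  then have "(Phi s G has_derivative (\<lambda>v. norm x powr s * (g * Dtau x v) + (s * norm x powr (s - 2) * (x \<bullet> v)) * G (tau x))) (at x)"
    unfolding Phi_def by (intro has_derivative_mult has_derivative_norm_powr x)
  moreover have "norm x powr s * (g * Dtau x v) + (s * norm x powr (s - 2) * (x \<bullet> v)) * G (tau x) =
     norm x powr (s - 2) * (s * G (tau x) - tau x * g) * (x$1 * v$1 + x$2 * v$2) +
     norm x powr (s - 1) * (s * tau x * G (tau x) + (1 - (tau x)\<^sup>2) * g) * v$3" for v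
  proof -
    define R where "R = norm x"
    define P where "P = R powr (s - 2)"
    have R: "R > 0" using x by (simp add: R_def)
    have e: "R powr s = P * R\<^sup>2" "R powr (s - 1) = P * R" "R powr (-1) = 1 / R" "R powr (-3) = 1 / R^3"
      using R by (auto simp: P_def powr_diff powr_minus field_simps power2_eq_square)
    have x3: "x$3 = tau x * R" using x by (simp add: tau_def R_def)
    show ?thesis
      unfolding Dtau_def inner_vec3 R_def[symmetric] P_def[symmetric] e x3
      using R by (simp add: field_simps power2_eq_square power3_eq_cube)
  qed
  ultimately show ?thesis unfolding axi_def by simp
qed

section \<open>Poloidal and toroidal fields in Cartesian components\<close>

text \<open>\<open>a\<close> is \<open>u^r / r\<close> and \<open>b\<close> is \<open>u^z\<close>.
  Dividing by r avoids the unit vector \<open>e_r\<close>, which is singular on the axis.\<close>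

definition fieldP :: "(real^3 \<Rightarrow> real) \<Rightarrow> (real^3 \<Rightarrow> real) \<Rightarrow> real^3 \<Rightarrow> real^3" where
  "fieldP a b x = vector [x$1 * a x, x$2 * a x, b x]"

text \<open>\<open>d\<close> is \<open>u^phi / r\<close>.\<close>

definition fieldT :: "(real^3 \<Rightarrow> real) \<Rightarrow> real^3 \<Rightarrow> real^3" where
  "fieldT d x = vector [- (x$2 * d x), x$1 * d x, 0]"

lemma fieldP_nth [simp]: "fieldP a b x $ 1 = x$1 * a x" "fieldP a b x $ 2 = x$2 * a x" "fieldP a b x $ 3 = b x"
  by (simp_all add: fieldP_def)

lemma fieldT_nth [simp]: "fieldT d x $ 1 = - (x$2 * d x)" "fieldT d x $ 2 = x$1 * d x" "fieldT d x $ 3 = 0"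
  by (simp_all add: fieldT_def)

lemma has_derivative_vector3:
  assumes "(f has_derivative f') F" "(g has_derivative g') F" "(h has_derivative h') F"
  shows "((\<lambda>x. vector [f x, g x, h x] :: real^3) has_derivative (\<lambda>v. vector [f' v, g' v, h' v])) F"
  unfolding vector3_eq_sum
  by (intro has_derivative_add has_derivative_scaleR_left assms)

lemma has_derivative_nth_ident: "((\<lambda>x::real^'n. x $ i) has_derivative (\<lambda>v. v $ i)) F"
  by (rule bounded_linear.has_derivative[OF bounded_linear_vec_nth has_derivative_ident])

lemma fieldP_derivative:
  assumes "axi a as az x" "axi b bs bz x"
  shows "(fieldP a b has_derivative (\<lambda>v. vector
     [x$1 * (as * (x$1 * v$1 + x$2 * v$2) + az * v$3) + v$1 * a x,
      x$2 * (as * (x$1 * v$1 + x$2 * v$2) + az * v$3) + v$2 * a x,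
      bs * (x$1 * v$1 + x$2 * v$2) + bz * v$3])) (at x)"
  unfolding fieldP_def
  by (intro has_derivative_vector3 has_derivative_mult has_derivative_nth_ident) (use assms in \<open>auto simp: axi_def\<close>)

lemma fieldT_derivative:
  assumes "axi d ds dz x"
  shows "(fieldT d has_derivative (\<lambda>v. vector
     [- (x$2 * (ds * (x$1 * v$1 + x$2 * v$2) + dz * v$3) + v$2 * d x),
      x$1 * (ds * (x$1 * v$1 + x$2 * v$2) + dz * v$3) + v$1 * d x, 0])) (at x)"
  unfolding fieldT_def
  by (intro has_derivative_vector3 has_derivative_mult has_derivative_nth_ident has_derivative_minus has_derivative_const)
    (use assms in \<open>auto simp: axi_def\<close>)

lemma partial_eqI: "(u has_derivative u') (at x) \<Longrightarrow> partial i u x = u' (axis i 1)"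
  unfolding partial_def using frechet_derivative_at by metis

lemma field_derivatives:
  assumes a: "axi a as az x" and b: "axi b bs bz x" and d: "axi d ds dz x"
  shows "divg (\<lambda>y. fieldP a b y + fieldT d y) x = 2 * a x + rsq x * as + bz"
    and "curl (\<lambda>y. fieldP a b y + fieldT d y) x =
      vector [- (x$1 * dz) - x$2 * (az - bs), - (x$2 * dz) + x$1 * (az - bs), 2 * d x + rsq x * ds]"
proof -
  note D = has_derivative_add[OF fieldP_derivative[OF a b] fieldT_derivative[OF d]]
  note P = partial_eqI[OF D]
  show "divg (\<lambda>y. fieldP a b y + fieldT d y) x = 2 * a x + rsq x * as + bz"
    unfolding divg_def P sum_3 by (simp add: axis_def rsq_def algebra_simps power2_eq_square)
  show "curl (\<lambda>y. fieldP a b y + fieldT d y) x =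
      vector [- (x$1 * dz) - x$2 * (az - bs), - (x$2 * dz) + x$1 * (az - bs), 2 * d x + rsq x * ds]"
    unfolding curl_def P by (simp add: axis_def rsq_def algebra_simps power2_eq_square)
qed

section \<open>Axisymmetric homogeneous fields\<close>

text \<open>A point of the axis is the limit of the points displaced from it in the direction of the
  first coordinate.\<close>

lemma dense_off_axis:
  fixes f :: "real^3 \<Rightarrow> 'b::real_normed_vector"
  assumes c: "continuous_on (-{0}) f" and z: "\<And>y. y \<in> - z_axis \<Longrightarrow> f y = 0" and x: "x \<noteq> 0"
  shows "f x = 0"
proof (cases "x \<in> z_axis")
  case True
  have "isCont f x" using c x by (simp add: continuous_on_eq_continuous_at[OF open_punctured])
  moreover have "((\<lambda>h. x + h *\<^sub>R axis 1 1) \<longlongrightarrow> x) (at_right 0)"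
    by (auto intro!: tendsto_eq_intros)
  ultimately have "((\<lambda>h. f (x + h *\<^sub>R axis 1 1)) \<longlongrightarrow> f x) (at_right 0)"
    by (rule isCont_tendsto_compose)
  moreover have "\<forall>\<^sub>F h in at_right 0. f (x + h *\<^sub>R axis 1 1) = 0"
    using True unfolding eventually_at_right_field
    by (intro exI[of _ 1]) (auto intro!: z simp: z_axis_def axis_def)
  ultimately have "((\<lambda>h. 0) \<longlongrightarrow> f x) (at_right (0::real))"
    using tendsto_cong by force
  then show ?thesis by (simp add: tendsto_const_iff)
qed (use z in auto)

text \<open>\<open>u \<sqdot> \<nabla>u - \<nabla>\<bar>u\<bar>^2 / 2\<close> is
  \<open>curl u\<close> crossed with \<open>u\<close>; here this is read off from
  \<open>cross_curl\<close> with the basis vectors.\<close>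

lemma euler_of_beltrami:
  assumes u: "u differentiable (at x)" and b: "cross3 (curl u x) (u x) = 0"
  shows "advection u x + grad (\<lambda>y. - (u y \<bullet> u y) / 2) x = 0"
proof -
  define J where "J = frechet_derivative u (at x)"
  have J: "(u has_derivative J) (at x)" using u frechet_derivative_works unfolding J_def by blast
  have "((\<lambda>y. - (u y \<bullet> u y) / 2) has_derivative (\<lambda>v. - (u x \<bullet> J v))) (at x)"
    by (rule derivative_eq_intros J refl | simp add: inner_commute)+
  then have "frechet_derivative (\<lambda>y. - (u y \<bullet> u y) / 2) (at x) = (\<lambda>v. - (u x \<bullet> J v))"
    by (rule frechet_derivative_at[symmetric])
  then have g: "grad (\<lambda>y. - (u y \<bullet> u y) / 2) x $ i = - (J (axis i 1) \<bullet> u x)" for i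
    unfolding grad_def partial_def by (simp add: inner_commute)
  have "advection u x = J (u x)"
    unfolding advection_def partial_def sum_3 J_def[symmetric]
    using has_derivative_axis_expand[OF has_derivative_linear[OF J], of "u x"] by simp
  moreover have "J (u x) \<bullet> axis i 1 = J (axis i 1) \<bullet> u x" for i
    using cross_curl[OF u, of "u x" "axis i 1"] b by (simp add: J_def)
  moreover have "J (u x) \<bullet> axis i 1 = J (u x) $ i" for i by (simp add: inner_axis)
  ultimately have "(advection u x + grad (\<lambda>y. - (u y \<bullet> u y) / 2) x) $ i = 0" for i
    unfolding vector_add_component g by simp
  then show ?thesis unfolding vec_eq_iff by simp
qed

lemma Phi_scale:
  assumes "l > 0" shows "Phi s G (l *\<^sub>R x) = l powr s * Phi s G x"
  using assms by (simp add: Phi_def tau_def powr_mult)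

lemma azimuth: "x$1 = sqrt (rsq x) * cos (azimuth x)" "x$2 = sqrt (rsq x) * sin (azimuth x)"
proof -
  let ?z = "Complex (x$1) (x$2)"
  have "?z = of_real (norm ?z) * exp (\<i> * of_real (Arg2pi ?z))" by (rule Arg2pi_eq)
  then have "?z = of_real (norm ?z) * cis (Arg2pi ?z)" by (simp add: cis_conv_exp)
  moreover have "norm ?z = sqrt (rsq x)" by (simp add: cmod_def rsq_def)
  ultimately have e: "?z = of_real (sqrt (rsq x)) * cis (azimuth x)" by (simp add: azimuth_def)
  show "x$1 = sqrt (rsq x) * cos (azimuth x)" using arg_cong[OF e, of Re] by simp
  show "x$2 = sqrt (rsq x) * sin (azimuth x)" using arg_cong[OF e, of Im] by simp
qed

lemma poloidal_toroidal:
  "poloidal (\<lambda>x. fieldP a b x + fieldT d x) = fieldP a b"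
  "toroidal (\<lambda>x. fieldP a b x + fieldT d x) = fieldT d"
proof -
  have "poloidal (\<lambda>x. fieldP a b x + fieldT d x) x = fieldP a b x \<and> toroidal (\<lambda>x. fieldP a b x + fieldT d x) x = fieldT d x" for x
  proof -
    define r \<phi> where "r = sqrt (rsq x)" and "\<phi> = azimuth x"
    have x: "x$1 = r * cos \<phi>" "x$2 = r * sin \<phi>" using azimuth[of x] by (simp_all add: r_def \<phi>_def)
    have cs: "r * (cos \<phi> * (cos \<phi> * y)) + r * (sin \<phi> * (sin \<phi> * y)) = r * y" for y
    proof -
      have "r * (cos \<phi> * (cos \<phi> * y)) + r * (sin \<phi> * (sin \<phi> * y)) = r * (((cos \<phi>)\<^sup>2 + (sin \<phi>)\<^sup>2) * y)"
        by (simp only: power2_eq_square distrib_left distrib_right mult.assoc)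
      then show ?thesis by simp
    qed
    have er: "(fieldP a b x + fieldT d x) \<bullet> e_r \<phi> = r * a x"
      unfolding inner_vec3 e_r_def by (simp add: x algebra_simps cs)
    have ep: "(fieldP a b x + fieldT d x) \<bullet> e_phi \<phi> = r * d x"
      unfolding inner_vec3 e_phi_def by (simp add: x algebra_simps cs)
    have ez: "(fieldP a b x + fieldT d x) \<bullet> e_z = b x"
      unfolding inner_vec3 e_z_def by simp
    show ?thesis
      unfolding poloidal_def toroidal_def \<phi>_def[symmetric] er ep ez
      unfolding vec_eq_iff forall_3 by (simp add: e_r_def e_phi_def e_z_def x)
  qed
  then show "poloidal (\<lambda>x. fieldP a b x + fieldT d x) = fieldP a b"
    "toroidal (\<lambda>x. fieldP a b x + fieldT d x) = fieldT d" by blast+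
qed

lemma Phi_cyl: "Phi s G (cyl r \<phi> z) = sqrt (r\<^sup>2 + z\<^sup>2) powr s * G (z / sqrt (r\<^sup>2 + z\<^sup>2))"
proof -
  have "(norm (cyl r \<phi> z))\<^sup>2 = r\<^sup>2 * ((cos \<phi>)\<^sup>2 + (sin \<phi>)\<^sup>2) + z\<^sup>2"
    unfolding norm_sq3 cyl_def vector_3 power_mult_distrib distrib_left ..
  then have "norm (cyl r \<phi> z) = sqrt (r\<^sup>2 + z\<^sup>2)" by (simp add: real_sqrt_unique)
  then show ?thesis by (simp add: Phi_def tau_def cyl_def)
qed

lemma axisymmetric_fields:
  fixes a b d p :: "real^3 \<Rightarrow> real"
  assumes "\<And>r \<phi> z. a (cyl r \<phi> z) = a (cyl r 0 z)" "\<And>r \<phi> z. b (cyl r \<phi> z) = b (cyl r 0 z)"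
    "\<And>r \<phi> z. d (cyl r \<phi> z) = d (cyl r 0 z)" "\<And>r \<phi> z. p (cyl r \<phi> z) = p (cyl r 0 z)"
  shows "axisymmetric_on S (\<lambda>x. fieldP a b x + fieldT d x) p"
  unfolding axisymmetric_on_def
proof (intro exI allI impI conjI)
  fix r :: real and \<phi> z :: real
  show "fieldP a b (cyl r \<phi> z) + fieldT d (cyl r \<phi> z) =
    (r * a (cyl r 0 z)) *\<^sub>R e_r \<phi> + (r * d (cyl r 0 z)) *\<^sub>R e_phi \<phi> + b (cyl r 0 z) *\<^sub>R e_z"
    unfolding vec_eq_iff forall_3 using assms[of r \<phi> z] by (simp add: e_r_def e_phi_def e_z_def cyl_def)
  show "p (cyl r \<phi> z) = p (cyl r 0 z)" by (rule assms)
qed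

lemma abs_powr_DERIV_nonzero:
  fixes e y :: real
  assumes y: "y \<noteq> 0"
  shows "((\<lambda>y. \<bar>y\<bar> powr e) has_real_derivative (e * \<bar>y\<bar> powr (e - 1)) * sgn y) (at y)"
proof -
  have a: "(abs has_real_derivative sgn y) (at y)"
  proof (cases "y > 0")
    case True
    show ?thesis
      by (rule has_field_derivative_transform_within_open[of "\<lambda>x. x" _ _ "{0<..}"]) (use True in auto)
  next
    case False
    show ?thesis
      by (rule has_field_derivative_transform_within_open[of "\<lambda>x. - x" _ _ "{..<0}"])
        (use False y in \<open>auto intro!: derivative_eq_intros\<close>)
  qed
  show ?thesis using DERIV_chain2[OF has_real_derivative_powr a, of e] y by simp
qed

lemma powr_abs_DERIV:
  fixes e y :: real
  assumes "e > 0"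
  shows "((\<lambda>y. y * \<bar>y\<bar> powr e) has_real_derivative (1 + e) * \<bar>y\<bar> powr e) (at y)"
proof (cases "y = 0")
  case True
  have "((\<lambda>h. \<bar>h\<bar> powr e) \<longlongrightarrow> \<bar>0\<bar> powr e) (at 0)"
    using assms by (intro tendsto_powr' tendsto_rabs tendsto_ident_at tendsto_const) auto
  then have "((\<lambda>h. \<bar>h\<bar> powr e) \<longlongrightarrow> 0) (at 0)" by simp
  then have "((\<lambda>h. (h * \<bar>h\<bar> powr e) / h) \<longlongrightarrow> 0) (at 0)"
    by (rule Lim_transform_eventually) (auto simp: eventually_at_filter)
  then show ?thesis using True by (simp add: DERIV_def)
next
  case False
  have "((\<lambda>y. \<bar>y\<bar> powr e) has_real_derivative (e * \<bar>y\<bar> powr (e - 1)) * sgn y) (at y)"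
    by (rule abs_powr_DERIV_nonzero[OF False])
  from DERIV_mult[OF DERIV_ident this] show ?thesis
  proof (rule DERIV_cong)
    have "\<bar>y\<bar> powr e = \<bar>y\<bar> powr (e - 1) * \<bar>y\<bar>" using False by (simp add: powr_diff)
    moreover have "\<bar>y\<bar> = sgn y * y" by (simp add: abs_sgn mult.commute)
    ultimately show "1 * \<bar>y\<bar> powr e + e * \<bar>y\<bar> powr (e - 1) * sgn y * y = (1 + e) * \<bar>y\<bar> powr e"
      by (simp add: algebra_simps)
  qed
qed

lemma abs_powr_DERIV:
  fixes e y :: real
  assumes "e > 1"
  shows "((\<lambda>y. \<bar>y\<bar> powr e) has_real_derivative e * y * \<bar>y\<bar> powr (e - 2)) (at y)"
proof (cases "y = 0")
  case True
  have "((\<lambda>h. \<bar>h\<bar> powr (e - 1)) \<longlongrightarrow> \<bar>0\<bar> powr (e - 1)) (at 0)"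
    using assms by (intro tendsto_powr' tendsto_rabs tendsto_ident_at tendsto_const) auto
  then have l: "((\<lambda>h. \<bar>h\<bar> powr (e - 1)) \<longlongrightarrow> 0) (at 0)" by simp
  have "((\<lambda>h. \<bar>h\<bar> powr e / h) \<longlongrightarrow> 0) (at 0)"
  proof (rule Lim_null_comparison[OF _ l])
    show "\<forall>\<^sub>F h in at 0. norm (\<bar>h\<bar> powr e / h) \<le> \<bar>h\<bar> powr (e - 1)"
      by (auto simp: eventually_at_filter powr_diff)
  qed
  then show ?thesis using True by (simp add: DERIV_def)
next
  case False
  have "((\<lambda>y. \<bar>y\<bar> powr e) has_real_derivative (e * \<bar>y\<bar> powr (e - 1)) * sgn y) (at y)"
    by (rule abs_powr_DERIV_nonzero[OF False])
  then show ?thesis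
  proof (rule DERIV_cong)
    have "\<bar>y\<bar> powr (e - 1) = \<bar>y\<bar> powr (e - 2) * \<bar>y\<bar>" using False powr_add[of "\<bar>y\<bar>" "e - 2" 1] by simp
    moreover have "\<bar>y\<bar> * sgn y = y" by (simp add: abs_sgn mult.commute[of "\<bar>y\<bar>"] sgn_if)
    ultimately show "e * \<bar>y\<bar> powr (e - 1) * sgn y = e * y * \<bar>y\<bar> powr (e - 2)"
      by (simp add: mult_ac)
  qed
qed

lemma continuous_abs_powr: "e > 0 \<Longrightarrow> continuous_on UNIV (\<lambda>y::real. \<bar>y\<bar> powr e)"
  by (intro continuous_on_powr' continuous_intros) auto

text \<open>A negative exponent occurs in the sublinear case, where the product is still of size
  \<open>\<bar>y\<bar> powr (1 + e)\<close>.\<close>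

lemma continuous_mult_abs_powr:
  assumes "e > -1" shows "continuous_on UNIV (\<lambda>y::real. y * \<bar>y\<bar> powr e)"
proof -
  have "isCont (\<lambda>y::real. y * \<bar>y\<bar> powr e) y" for y
  proof (cases "y = 0")
    case True
    have "((\<lambda>h. \<bar>h\<bar> powr (1 + e)) \<longlongrightarrow> \<bar>0\<bar> powr (1 + e)) (at 0)"
      using assms by (intro tendsto_powr' tendsto_rabs tendsto_ident_at tendsto_const) auto
    then have l: "((\<lambda>h. \<bar>h\<bar> powr (1 + e)) \<longlongrightarrow> 0) (at 0)" by simp
    have "((\<lambda>h. h * \<bar>h\<bar> powr e) \<longlongrightarrow> 0) (at 0)"
      by (rule Lim_null_comparison[OF _ l]) (auto simp: eventually_at_filter powr_add abs_mult)
    then show ?thesis using True by (simp add: isCont_def)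
  next
    case False
    then show ?thesis by (intro continuous_intros) auto
  qed
  then show ?thesis by (simp add: continuous_at_imp_continuous_on)
qed

section \<open>The field generated by a profile\<close>

locale homog_profile =
  fixes \<beta> :: real and w w1 \<kappa> :: "real \<Rightarrow> real" and K :: real
  assumes P: "prof (\<beta> * (\<beta> + 1)) (2 / \<beta>) (-1) 1 w w1 \<kappa> K"
    and \<beta>: "\<beta> > 0 \<or> \<beta> < -2"
begin

definition "\<mu> = \<beta> * (\<beta> + 1)"
definition "q = 2 / \<beta>"
text \<open>Constant of integration in \<gamma> d\<gamma>/dw = n: it makes
  \<open>\<gamma>\<^sup>2 = \<theta> n w\<close>.\<close>

definition "\<theta> = \<beta> / (\<beta> + 1)"
definition "n t = \<kappa> t * (w t * \<bar>w t\<bar> powr q)"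
text \<open>At the poles this is the l'Hopital limit of \<open>w / (1 - t^2)\<close>; there 1 / t =
  t.\<close>

definition "W t = (if \<bar>t\<bar> < 1 then w t / (1 - t\<^sup>2) else - (t * w1 t / 2))"
definition "w2 t = - ((\<mu> * w t + n t) / (1 - t\<^sup>2))"
text \<open>\<open>A\<close> and \<open>B\<close> are the profiles of \<open>u^r / r\<close> and
  \<open>u^z\<close> for the stream function
  \<open>\<bar>x\<bar> powr (- \<beta>) * w (tau x)\<close>, obtained by differentiating it in z and
  in r.\<close>

definition "A t = \<beta> * t * W t - w1 t"
definition "B t = - (\<beta> * w t + t * w1 t)"
text \<open>Profile of \<open>r u^phi\<close>, which has degree - (\<beta> + 1); dividing by
  \<open>1 - t^2\<close> yields the profile \<open>D\<close> of \<open>u^phi / r\<close>.\<close>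

definition "\<gamma> t = sqrt (\<theta> * \<kappa> t) * (w t * \<bar>w t\<bar> powr (1 / \<beta>))"
definition "D t = \<gamma> t / (1 - t\<^sup>2)"
text \<open>Profile of the square of \<open>u^phi\<close>. It is more regular than
  \<open>u^phi\<close> itself, which serves the pressure and the even part of the stress.\<close>

definition "E t = \<theta> * n t * W t"

lemma \<theta>: "\<theta> > 0" "\<theta> * (1 + 1 / \<beta>) = 1" "\<theta> * (\<beta> + 1) = \<beta>"
  using \<beta> by (auto simp: \<theta>_def zero_less_divide_iff field_simps)

lemma \<kappa>: "0 < \<kappa> t" "\<kappa> t \<le> K" using P by (auto simp: prof_def)

lemma w_ends: "w (-1) = 0" "w 1 = 0" using P by (auto simp: prof_def)

lemma interior:
  fixes t :: real
  assumes "t \<in> {-1<..<1}" shows "0 < 1 - t\<^sup>2" "\<bar>t\<bar> < 1"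
proof -
  show t: "\<bar>t\<bar> < 1" using assms by (simp add: abs_less_iff)
  show "0 < 1 - t\<^sup>2" using abs_square_less_1[of t] t by simp
qed

lemma w1_cont: "continuous_on {-1..1} w1" using P by (simp add: prof_def)

lemma w_within: "t \<in> {-1..1} \<Longrightarrow> (w has_real_derivative w1 t) (at t within {-1..1})"
  using P by (simp add: prof_def)

lemma w_cont: "continuous_on {-1..1} w"
  using w_within DERIV_continuous_on by blast

lemma dw: "t \<in> {-1<..<1} \<Longrightarrow> (w has_real_derivative w1 t) (at t)"
  using w_within[of t] at_within_Icc_at[of "-1" t 1] by simp

lemma dw1: "t \<in> {-1<..<1} \<Longrightarrow> (w1 has_real_derivative w2 t) (at t)"
  using P at_within_Icc_at[of "-1" t 1] interior(2)[of t]
  by (auto simp: prof_def w2_def n_def \<mu>_def q_def mult.assoc)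

lemma cW: "t \<in> {-1<..<1} \<Longrightarrow> w t = (1 - t\<^sup>2) * W t"
  using interior[of t] by (simp add: W_def)

lemma dW: "t \<in> {-1<..<1} \<Longrightarrow> (W has_real_derivative (w1 t + 2 * t * W t) / (1 - t\<^sup>2)) (at t)"
proof -
  assume t: "t \<in> {-1<..<1}"
  have c: "1 - t\<^sup>2 \<noteq> 0" using interior[OF t] by simp
  have "((\<lambda>t. w t / (1 - t\<^sup>2)) has_real_derivative (w1 t * (1 - t\<^sup>2) - w t * (- (2 * t))) / ((1 - t\<^sup>2) * (1 - t\<^sup>2))) (at t)"
    using c by (auto intro!: derivative_eq_intros dw[OF t])
  moreover have "(w1 t * (1 - t\<^sup>2) - w t * (- (2 * t))) / ((1 - t\<^sup>2) * (1 - t\<^sup>2)) = (w1 t + 2 * t * W t) / (1 - t\<^sup>2)"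
  proof -
    have "(x * c - (c * y) * (- (2 * t))) / (c * c) = (x + 2 * t * y) / c" if "c \<noteq> 0" for x y c :: real
      using that by (simp add: field_simps)
    then show ?thesis unfolding cW[OF t] using c by blast
  qed
  ultimately have "((\<lambda>t. w t / (1 - t\<^sup>2)) has_real_derivative (w1 t + 2 * t * W t) / (1 - t\<^sup>2)) (at t)" by simp
  then show ?thesis
    by (rule has_field_derivative_transform_within_open[of _ _ _ "{-1<..<1}"])
      (use t interior(2) in \<open>auto simp: W_def\<close>)
qed

text \<open>\<kappa> jumps only at zeros of \<open>w\<close>, where \<zeta>(w) tends to 0 and the
  factor \<open>f (\<kappa> t)\<close> stays bounded; elsewhere it is locally constant.\<close>

lemma \<kappa>_cont:
  assumes z: "continuous_on UNIV \<zeta>" "\<zeta> 0 = 0" and f: "\<And>t. \<bar>f (\<kappa> t)\<bar> \<le> M"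
  shows "continuous_on {-1..1} (\<lambda>t. f (\<kappa> t) * \<zeta> (w t) :: real)"
  unfolding continuous_on
proof
  fix t :: real assume t: "t \<in> {-1..1}"
  have zl: "((\<lambda>s. \<zeta> (w s)) \<longlongrightarrow> \<zeta> (w t)) (at t within {-1..1})"
    using continuous_on_compose2[OF z(1) w_cont] t by (simp add: continuous_on)
  show "((\<lambda>t. f (\<kappa> t) * \<zeta> (w t)) \<longlongrightarrow> f (\<kappa> t) * \<zeta> (w t)) (at t within {-1..1})"
  proof (cases "w t = 0")
    case True
    have "((\<lambda>s. M * \<bar>\<zeta> (w s)\<bar>) \<longlongrightarrow> M * \<bar>\<zeta> (w t)\<bar>) (at t within {-1..1})"
      by (intro tendsto_intros zl)
    then have l: "((\<lambda>s. M * \<bar>\<zeta> (w s)\<bar>) \<longlongrightarrow> 0) (at t within {-1..1})" using True z(2) by simp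
    have "((\<lambda>t. f (\<kappa> t) * \<zeta> (w t)) \<longlongrightarrow> 0) (at t within {-1..1})"
      by (rule Lim_null_comparison[OF _ l]) (use f in \<open>auto simp: abs_mult intro!: always_eventually mult_right_mono\<close>)
    then show ?thesis using True z(2) by simp
  next
    case False
    then have "t \<in> {-1<..<1}" using t w_ends by (cases "t = 1"; cases "t = -1") auto
    then have "\<forall>\<^sub>F s in at t. \<kappa> s = \<kappa> t" using P False by (simp add: prof_def)
    then have e: "\<forall>\<^sub>F s in at t within {-1..1}. \<kappa> s = \<kappa> t"
      by (rule filter_leD[OF at_le[OF subset_UNIV]])
    have "((\<lambda>s. f (\<kappa> t) * \<zeta> (w s)) \<longlongrightarrow> f (\<kappa> t) * \<zeta> (w t)) (at t within {-1..1})"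
      by (intro tendsto_intros zl)
    then show ?thesis
      by (rule Lim_transform_eventually) (use e in \<open>auto elim!: eventually_mono\<close>)
  qed
qed

lemma \<kappa>_DERIV_nonzero:
  assumes z: "(\<zeta> has_real_derivative z') (at (w t))" and t: "t \<in> {-1<..<1}" "w t \<noteq> 0"
  shows "((\<lambda>t. f (\<kappa> t) * \<zeta> (w t) :: real) has_real_derivative f (\<kappa> t) * (z' * w1 t)) (at t)"
proof -
  have e: "\<forall>\<^sub>F s in at t. \<kappa> s = \<kappa> t" using P t by (simp add: prof_def)
  have "((\<lambda>s. f (\<kappa> t) * \<zeta> (w s)) has_real_derivative f (\<kappa> t) * (z' * w1 t)) (at t)"
    by (intro DERIV_cmult DERIV_chain2[OF z dw[OF t(1)]])
  then show ?thesis
    by (rule DERIV_cong_ev[THEN iffD1, rotated -1])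
      (use e in \<open>auto simp: eventually_nhds_conv_at elim!: eventually_mono\<close>)
qed

text \<open>The same one order higher: at a zero of \<open>w\<close> the factor \<zeta>(w) is o(h),
  so a bounded factor in front does no harm.\<close>

lemma \<kappa>_DERIV:
  assumes z: "\<And>y. (\<zeta> has_real_derivative \<zeta>' y) (at y)" "\<zeta> 0 = 0" "\<zeta>' 0 = 0"
    and f: "\<And>t. \<bar>f (\<kappa> t)\<bar> \<le> M" and t: "t \<in> {-1<..<1}"
  shows "((\<lambda>t. f (\<kappa> t) * \<zeta> (w t) :: real) has_real_derivative f (\<kappa> t) * (\<zeta>' (w t) * w1 t)) (at t)"
proof (cases "w t = 0")
  case False
  then show ?thesis by (rule \<kappa>_DERIV_nonzero[OF z(1) t])
next
  case True
  have "((\<lambda>t. \<zeta> (w t)) has_real_derivative 0) (at t)"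
    using DERIV_chain2[OF z(1) dw[OF t]] True z(3) by simp
  then have "((\<lambda>h. \<zeta> (w (t + h)) / h) \<longlongrightarrow> 0) (at 0)" using True z(2) by (simp add: DERIV_def)
  then have "((\<lambda>h. M * \<bar>\<zeta> (w (t + h)) / h\<bar>) \<longlongrightarrow> M * \<bar>0\<bar>) (at 0)" by (intro tendsto_intros)
  then have l: "((\<lambda>h. M * \<bar>\<zeta> (w (t + h)) / h\<bar>) \<longlongrightarrow> 0) (at 0)" by simp
  have "((\<lambda>h. f (\<kappa> (t + h)) * \<zeta> (w (t + h)) / h) \<longlongrightarrow> 0) (at 0)"
  proof (rule Lim_null_comparison[OF _ l])
    have "norm (f (\<kappa> (t + h)) * \<zeta> (w (t + h)) / h) \<le> M * \<bar>\<zeta> (w (t + h)) / h\<bar>" for h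
      using mult_right_mono[OF f[of "t + h"], of "\<bar>\<zeta> (w (t + h)) / h\<bar>"] by (simp add: abs_mult)
    then show "\<forall>\<^sub>F h in at 0. norm (f (\<kappa> (t + h)) * \<zeta> (w (t + h)) / h) \<le> M * \<bar>\<zeta> (w (t + h)) / h\<bar>"
      by simp
  qed
  then show ?thesis using True z(2,3) by (simp add: DERIV_def)
qed

lemma q: "q > -1" using \<beta> by (auto simp: q_def field_simps)

lemma \<kappa>_abs: "\<bar>\<kappa> t\<bar> \<le> K" using \<kappa>[of t] by simp

lemma sqrt_\<kappa>_abs: "\<bar>sqrt (\<theta> * \<kappa> t)\<bar> \<le> sqrt (\<theta> * K)" using \<kappa>[of t] \<theta> by simp

lemma n_cont: "continuous_on {-1..1} n"
  unfolding n_def using \<kappa>_cont[where f="\<lambda>x. x" and M=K and \<zeta>="\<lambda>y. y * \<bar>y\<bar> powr q", OF continuous_mult_abs_powr[OF q] _ \<kappa>_abs] by simp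

text \<open>The product is \<kappa> \<open>\<bar>w\<bar> powr (2 + q)\<close> with exponent greater
  than 1, hence differentiable at the nodes even when \<open>n\<close> alone is not.\<close>

lemma dnw:
  assumes "t \<in> {-1<..<1}"
  shows "((\<lambda>t. n t * w t) has_real_derivative (2 + q) * n t * w1 t) (at t)"
proof -
  have "((\<lambda>t. \<kappa> t * \<bar>w t\<bar> powr (2 + q)) has_real_derivative \<kappa> t * ((2 + q) * w t * \<bar>w t\<bar> powr (2 + q - 2) * w1 t)) (at t)"
    using \<kappa>_DERIV[where f="\<lambda>x. x" and M=K, OF abs_powr_DERIV[of "2 + q"] _ _ \<kappa>_abs assms] q by simp
  moreover have "\<kappa> t * \<bar>w t\<bar> powr (2 + q) = n t * w t" for t
  proof (cases "w t = 0")
    case False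
    have "\<bar>w t\<bar> powr (2 + q) = (w t)\<^sup>2 * \<bar>w t\<bar> powr q" using False by (simp add: powr_add)
    then show ?thesis by (simp add: n_def power2_eq_square)
  qed (simp add: n_def)
  ultimately show ?thesis by (simp add: n_def mult_ac)
qed

lemma \<gamma>_sq: "(\<gamma> t)\<^sup>2 = \<theta> * n t * w t"
proof (cases "w t = 0")
  case False
  have "(\<bar>w t\<bar> powr (1 / \<beta>))\<^sup>2 = \<bar>w t\<bar> powr q"
    using False by (simp add: power2_eq_square q_def flip: powr_add)
  then have "(w t * \<bar>w t\<bar> powr (1 / \<beta>))\<^sup>2 = (w t)\<^sup>2 * \<bar>w t\<bar> powr q" by (simp add: power_mult_distrib)
  moreover have "(sqrt (\<theta> * \<kappa> t))\<^sup>2 = \<theta> * \<kappa> t" using \<theta> \<kappa>[of t] by simp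
  ultimately show ?thesis unfolding \<gamma>_def power_mult_distrib[of "sqrt _"] by (simp add: n_def power2_eq_square)
qed (simp add: \<gamma>_def)

text \<open>The derivative of \<gamma> with respect to \<open>w\<close>. The identity
  \<open>g_\<gamma>\<close> is the relation between swirl and vorticity in the Grad-Shafranov
  equation.\<close>

definition "g t = (1 + 1 / \<beta>) * (sqrt (\<theta> * \<kappa> t) * \<bar>w t\<bar> powr (1 / \<beta>))"

lemma g_w: "g t * w t = (1 + 1 / \<beta>) * \<gamma> t" by (simp add: g_def \<gamma>_def)

lemma g_\<gamma>: "g t * \<gamma> t = n t"
proof (cases "w t = 0")
  case False
  have "(g t * w t) * \<gamma> t = (1 + 1 / \<beta>) * (\<gamma> t)\<^sup>2" by (simp add: g_w power2_eq_square)
  also have "\<dots> = (\<theta> * (1 + 1 / \<beta>)) * n t * w t" by (simp add: \<gamma>_sq)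
  finally show ?thesis using False \<theta>(2) by simp
qed (simp add: \<gamma>_def n_def)

lemma d\<gamma>_nonzero:
  assumes "t \<in> {-1<..<1}" "w t \<noteq> 0"
  shows "(\<gamma> has_real_derivative g t * w1 t) (at t)"
proof -
  let ?y = "w t" and ?e = "1 / \<beta>"
  have "((\<lambda>y. \<bar>y\<bar> powr ?e) has_real_derivative (?e * \<bar>?y\<bar> powr (?e - 1)) * sgn ?y) (at ?y)"
    by (rule abs_powr_DERIV_nonzero[OF assms(2)])
  from DERIV_mult[OF DERIV_ident this]
  have "((\<lambda>y. y * \<bar>y\<bar> powr ?e) has_real_derivative (1 + ?e) * \<bar>?y\<bar> powr ?e) (at ?y)"
  proof (rule DERIV_cong)
    have 1: "\<bar>?y\<bar> powr ?e = \<bar>?y\<bar> powr (?e - 1) * \<bar>?y\<bar>" using assms(2) by (simp add: powr_diff)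
    have 2: "\<bar>?y\<bar> = sgn ?y * ?y" by (simp add: abs_sgn mult.commute)
    have "?e * \<bar>?y\<bar> powr (?e - 1) * sgn ?y * ?y = ?e * (\<bar>?y\<bar> powr (?e - 1) * (sgn ?y * ?y))" by (simp only: mult_ac)
    also have "\<dots> = ?e * \<bar>?y\<bar> powr ?e" by (simp only: 1 2[symmetric])
    finally show "1 * \<bar>?y\<bar> powr ?e + ?e * \<bar>?y\<bar> powr (?e - 1) * sgn ?y * ?y = (1 + ?e) * \<bar>?y\<bar> powr ?e"
      by (simp only: distrib_right)
  qed
  from \<kappa>_DERIV_nonzero[OF this assms, of "\<lambda>x. sqrt (\<theta> * x)"] show ?thesis
    unfolding \<gamma>_def[abs_def] by (rule DERIV_cong) (simp add: g_def mult_ac)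
qed

lemma dA: "t \<in> {-1<..<1} \<Longrightarrow>
    (A has_real_derivative \<beta> * W t + \<beta> * t * ((w1 t + 2 * t * W t) / (1 - t\<^sup>2)) - w2 t) (at t)"
  unfolding A_def by (auto intro!: derivative_eq_intros dW dw1)

lemma dB: "t \<in> {-1<..<1} \<Longrightarrow> (B has_real_derivative - ((\<beta> + 1) * w1 t + t * w2 t)) (at t)"
  unfolding B_def by (auto intro!: derivative_eq_intros dw dw1 simp: algebra_simps)

definition "\<alpha> = \<beta> + 2"
definition "a = Phi (- \<alpha> - 1) A"
definition "b = Phi (- \<alpha>) B"
definition "d = Phi (- \<alpha> - 1) D"
definition "u x = fieldP a b x + fieldT d x"
definition "p x = - (u x \<bullet> u x) / 2"

lemma norm_powr_shift:
  assumes "x \<noteq> 0"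
  shows "norm x powr (- \<alpha> - 1 - 2) = norm x powr (- \<alpha> - 2) / norm x"
    "norm x powr (- \<alpha> - 1 - 1) = norm x powr (- \<alpha> - 2)"
    "norm x powr (- \<alpha> - 1) = norm x powr (- \<alpha> - 2) * norm x"
    "norm x powr (- \<alpha>) = norm x powr (- \<alpha> - 2) * (norm x)\<^sup>2"
proof -
  have "- \<alpha> - 1 - 2 = (- \<alpha> - 2) - 1" "- \<alpha> - 1 - 1 = - \<alpha> - 2" "- \<alpha> - 1 = (- \<alpha> - 2) + 1" "- \<alpha> = (- \<alpha> - 2) + 2"
    by simp_all
  note e = this
  show "norm x powr (- \<alpha> - 1 - 2) = norm x powr (- \<alpha> - 2) / norm x"
    unfolding e(1) powr_diff[of _ "- \<alpha> - 2" 1] using assms by simp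
  show "norm x powr (- \<alpha> - 1 - 1) = norm x powr (- \<alpha> - 2)" unfolding e(2) ..
  show "norm x powr (- \<alpha> - 1) = norm x powr (- \<alpha> - 2) * norm x"
    unfolding e(3) powr_add[of _ "- \<alpha> - 2" 1] using assms by simp
  show "norm x powr (- \<alpha>) = norm x powr (- \<alpha> - 2) * (norm x)\<^sup>2"
    using powr_add[of "norm x" "- \<alpha> - 2" 2] e(4) assms by simp
qed

lemma axi_a:
  assumes x: "x \<in> - z_axis" and t: "t = tau x" and R: "R = norm x powr (- \<alpha> - 2)"
  shows "axi a (R / norm x * ((- \<alpha> - 1) * A t - t * (\<beta> * W t + \<beta> * t * ((w1 t + 2 * t * W t) / (1 - t\<^sup>2)) - w2 t)))
     (R * ((- \<alpha> - 1) * t * A t + (1 - t\<^sup>2) * (\<beta> * W t + \<beta> * t * ((w1 t + 2 * t * W t) / (1 - t\<^sup>2)) - w2 t))) x"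
  using axi_Phi[OF off_axis_nonzero[OF x] dA[OF tau_off_axis[OF x]], of "-\<alpha> - 1"]
  unfolding a_def norm_powr_shift(1,2)[OF off_axis_nonzero[OF x]] t R .

lemma axi_b:
  assumes x: "x \<in> - z_axis" and t: "t = tau x" and R: "R = norm x powr (- \<alpha> - 2)"
  shows "axi b (R * ((- \<alpha>) * B t - t * - ((\<beta> + 1) * w1 t + t * w2 t)))
     (R * norm x * ((- \<alpha>) * t * B t + (1 - t\<^sup>2) * - ((\<beta> + 1) * w1 t + t * w2 t))) x"
  using axi_Phi[OF off_axis_nonzero[OF x] dB[OF tau_off_axis[OF x]], of "-\<alpha>"]
  unfolding b_def norm_powr_shift(3)[OF off_axis_nonzero[OF x]] t R .

lemma axi_d:
  assumes x: "x \<in> - z_axis" and t: "t = tau x" and R: "R = norm x powr (- \<alpha> - 2)"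
    and D: "(\<gamma> has_real_derivative g t * w1 t) (at t)"
  shows "axi d (R / norm x * ((- \<alpha> - 1) * D t - t * ((g t * w1 t + 2 * t * D t) / (1 - t\<^sup>2))))
     (R * ((- \<alpha> - 1) * t * D t + (1 - t\<^sup>2) * ((g t * w1 t + 2 * t * D t) / (1 - t\<^sup>2)))) x"
proof -
  note ti = tau_off_axis[OF x]
  have c: "1 - t\<^sup>2 \<noteq> 0" using interior[OF ti] t by simp
  have "(D has_real_derivative ((g t * w1 t) * (1 - t\<^sup>2) - \<gamma> t * (- (2 * t))) / ((1 - t\<^sup>2) * (1 - t\<^sup>2))) (at t)"
    unfolding D_def[abs_def] using c by (auto intro!: derivative_eq_intros D)
  moreover have "((g t * w1 t) * (1 - t\<^sup>2) - \<gamma> t * (- (2 * t))) / ((1 - t\<^sup>2) * (1 - t\<^sup>2)) = (g t * w1 t + 2 * t * D t) / (1 - t\<^sup>2)"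
  proof -
    have "(z * c - y * (- (2 * t))) / (c * c) = (z + 2 * t * (y / c)) / c" if "c \<noteq> 0" for y z c :: real
      using that by (simp add: field_simps)
    then show ?thesis unfolding D_def using c by blast
  qed
  ultimately have dD: "(D has_real_derivative (g t * w1 t + 2 * t * D t) / (1 - t\<^sup>2)) (at (tau x))" using t by simp
  show ?thesis
    using axi_Phi[OF off_axis_nonzero[OF x] dD, of "-\<alpha> - 1"]
    unfolding d_def norm_powr_shift(1,2)[OF off_axis_nonzero[OF x]] t R .
qed

end


text \<open>\<open>y\<close> stands for W' and the differential equation replaces w''. The first
  identity is the divergence; the second shows that the toroidal vorticity divided by r is the
  nonlinear term \<nu>.\<close>

lemma local_algebra:
  fixes c :: real
  assumes "c = 1 - t\<^sup>2" "c * y = w1 + 2 * t * W"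
  shows "2 * (\<beta> * t * W - w1) + (- (\<beta> + 3) * (c * (\<beta> * t * W - w1)) - t * (c * (\<beta> * W + \<beta> * t * y - - (\<beta> * (\<beta> + 1) * W + \<nu>)))) +
      (- (\<beta> + 2) * t * - (\<beta> * (c * W) + t * w1) + c * - ((\<beta> + 1) * w1 + t * - (\<beta> * (\<beta> + 1) * W + \<nu>))) = 0"
    and "- (\<beta> + 3) * t * (\<beta> * t * W - w1) + c * (\<beta> * W + \<beta> * t * y - - (\<beta> * (\<beta> + 1) * W + \<nu>)) -
      (- (\<beta> + 2) * - (\<beta> * (c * W) + t * w1) - t * - ((\<beta> + 1) * w1 + t * - (\<beta> * (\<beta> + 1) * W + \<nu>))) = \<nu>"
proof -
  have e: "c * (\<beta> * W + \<beta> * t * y - - (\<beta> * (\<beta> + 1) * W + \<nu>)) =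
      \<beta> * (c * W) + \<beta> * t * (w1 + 2 * t * W) + c * (\<beta> * (\<beta> + 1) * W + \<nu>)"
  proof -
    have "c * (\<beta> * W + \<beta> * t * y - - (\<beta> * (\<beta> + 1) * W + \<nu>)) =
        \<beta> * (c * W) + \<beta> * t * (c * y) + c * (\<beta> * (\<beta> + 1) * W + \<nu>)"
      by (simp add: algebra_simps)
    then show ?thesis by (simp only: assms(2))
  qed
  show "2 * (\<beta> * t * W - w1) + (- (\<beta> + 3) * (c * (\<beta> * t * W - w1)) - t * (c * (\<beta> * W + \<beta> * t * y - - (\<beta> * (\<beta> + 1) * W + \<nu>)))) +
      (- (\<beta> + 2) * t * - (\<beta> * (c * W) + t * w1) + c * - ((\<beta> + 1) * w1 + t * - (\<beta> * (\<beta> + 1) * W + \<nu>))) = 0"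
    unfolding e unfolding assms(1) by (simp add: algebra_simps power2_eq_square)
  show "- (\<beta> + 3) * t * (\<beta> * t * W - w1) + c * (\<beta> * W + \<beta> * t * y - - (\<beta> * (\<beta> + 1) * W + \<nu>)) -
      (- (\<beta> + 2) * - (\<beta> * (c * W) + t * w1) - t * - ((\<beta> + 1) * w1 + t * - (\<beta> * (\<beta> + 1) * W + \<nu>))) = \<nu>"
    unfolding e unfolding assms(1) by (simp add: algebra_simps power2_eq_square)
qed

text \<open>The three minors expressing that \<open>curl u\<close> and \<open>u\<close> are
  parallel. Each is a multiple of \<open>(\<beta> + 1) D - \<beta> g W\<close>, which the first part
  of \<open>g\<close> makes zero.\<close>

lemma beltrami_algebra:
  fixes c :: real
  assumes c: "c = 1 - t\<^sup>2" and g: "\<beta> * (g * W) = (\<beta> + 1) * D" "g * D = \<nu>"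
  shows "((\<beta> + 1) * t * D - g * w1) * D - \<nu> * (\<beta> * t * W - w1) = 0"
    "((\<beta> + 1) * t * D - g * w1) * - (\<beta> * (c * W) + t * w1) + ((\<beta> + 1) * (c * D) + t * (g * w1)) * (\<beta> * t * W - w1) = 0"
    "\<nu> * - (\<beta> * (c * W) + t * w1) + ((\<beta> + 1) * (c * D) + t * (g * w1)) * D = 0"
proof -
  have "((\<beta> + 1) * t * D - g * w1) * D - \<nu> * (\<beta> * t * W - w1) = t * D * ((\<beta> + 1) * D - \<beta> * (g * W))"
    unfolding g(2)[symmetric] by (simp add: algebra_simps)
  then show "((\<beta> + 1) * t * D - g * w1) * D - \<nu> * (\<beta> * t * W - w1) = 0" by (simp add: g(1))
  have "((\<beta> + 1) * t * D - g * w1) * - (\<beta> * (c * W) + t * w1) + ((\<beta> + 1) * (c * D) + t * (g * w1)) * (\<beta> * t * W - w1) =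
     w1 * (\<beta> * (g * W) - (\<beta> + 1) * D)"
    unfolding c by (simp add: algebra_simps power2_eq_square)
  then show "((\<beta> + 1) * t * D - g * w1) * - (\<beta> * (c * W) + t * w1) + ((\<beta> + 1) * (c * D) + t * (g * w1)) * (\<beta> * t * W - w1) = 0"
    by (simp add: g(1))
  have "\<nu> * - (\<beta> * (c * W) + t * w1) + ((\<beta> + 1) * (c * D) + t * (g * w1)) * D = c * D * ((\<beta> + 1) * D - \<beta> * (g * W))"
    unfolding g(2)[symmetric] by (simp add: algebra_simps)
  then show "\<nu> * - (\<beta> * (c * W) + t * w1) + ((\<beta> + 1) * (c * D) + t * (g * w1)) * D = 0" by (simp add: g(1))
qed

context homog_profile
begin

lemma field_values:
  assumes "x \<noteq> 0"
  shows "a x = norm x powr (- \<alpha> - 2) * norm x * A (tau x)" "b x = norm x powr (- \<alpha> - 2) * (norm x)\<^sup>2 * B (tau x)"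
    "d x = norm x powr (- \<alpha> - 2) * norm x * D (tau x)"
  unfolding a_def b_def d_def Phi_def norm_powr_shift(3,4)[OF assms] by (rule refl)+

lemma exponents: "- \<alpha> - 1 = - (\<beta> + 3)" "- \<alpha> = - (\<beta> + 2)" by (simp_all add: \<alpha>_def)

lemma components:
  assumes t: "t \<in> {-1<..<1}"
  shows "w2 t = - (\<beta> * (\<beta> + 1) * W t + n t / (1 - t\<^sup>2))"
    "A t = \<beta> * t * W t - w1 t" "B t = - (\<beta> * ((1 - t\<^sup>2) * W t) + t * w1 t)"
  using interior[OF t] unfolding w2_def A_def B_def cW[OF t] \<mu>_def by (simp_all add: add_divide_distrib)

lemma rsq_eq: "x \<noteq> 0 \<Longrightarrow> rsq x = (norm x)\<^sup>2 * (1 - (tau x)\<^sup>2)"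
  using one_minus_tau_sq[of x] by simp

text \<open>Kept apart from the toroidal part, because \<open>a\<close> and \<open>b\<close> are
  differentiable at the nodes even where \<gamma> is not.\<close>

lemma poloidal_axi:
  assumes x: "x \<in> - z_axis"
  obtains as az bs bz where "axi a as az x" "axi b bs bz x" "2 * a x + rsq x * as + bz = 0"
    "az - bs = norm x powr (- \<alpha> - 2) * (n (tau x) / (1 - (tau x)\<^sup>2))"
proof -
  define t R N c where "t = tau x" and "R = norm x powr (- \<alpha> - 2)" and "N = norm x" and "c = 1 - t\<^sup>2"
  have ti: "t \<in> {-1<..<1}" using tau_off_axis[OF x] by (simp add: t_def)
  have x0: "x \<noteq> 0" by (rule off_axis_nonzero[OF x])
  have N: "N > 0" using x0 by (simp add: N_def)
  have c: "c > 0" using interior[OF ti] by (simp add: c_def)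
  have rsq: "rsq x = N\<^sup>2 * c" unfolding c_def t_def N_def by (rule rsq_eq[OF x0])
  define y \<nu> where "y = (w1 t + 2 * t * W t) / c" and "\<nu> = n t / c"
  have cy: "c * y = w1 t + 2 * t * W t" using c by (simp add: y_def)
  note comp = components[OF ti, folded c_def, folded \<nu>_def]
  define as az bs bz where "as = R / N * (- (\<beta> + 3) * A t - t * (\<beta> * W t + \<beta> * t * y - w2 t))"
    and "az = R * (- (\<beta> + 3) * t * A t + c * (\<beta> * W t + \<beta> * t * y - w2 t))"
    and "bs = R * (- (\<beta> + 2) * B t - t * - ((\<beta> + 1) * w1 t + t * w2 t))"
    and "bz = R * N * (- (\<beta> + 2) * t * B t + c * - ((\<beta> + 1) * w1 t + t * w2 t))"
  show thesis
  proof (rule that)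
    show "axi a as az x" "axi b bs bz x"
      using axi_a[OF x t_def R_def, unfolded exponents(1)] axi_b[OF x t_def R_def, unfolded exponents(2)]
      unfolding as_def az_def bs_def bz_def y_def c_def N_def by (simp_all only:)
    have "2 * a x + rsq x * as + bz = R * N * (2 * A t + (- (\<beta> + 3) * (c * A t) - t * (c * (\<beta> * W t + \<beta> * t * y - w2 t))) +
        (- (\<beta> + 2) * t * B t + c * - ((\<beta> + 1) * w1 t + t * w2 t)))"
      unfolding field_values(1)[OF x0, folded R_def N_def t_def] rsq as_def bz_def using N by (simp add: field_simps power2_eq_square)
    also have "\<dots> = 0" unfolding comp local_algebra(1)[OF c_def cy] by simp
    finally show "2 * a x + rsq x * as + bz = 0" .
    show "az - bs = norm x powr (- \<alpha> - 2) * (n (tau x) / (1 - (tau x)\<^sup>2))"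
      unfolding R_def[symmetric] t_def[symmetric] c_def[symmetric] \<nu>_def[symmetric]
      unfolding az_def bs_def right_diff_distrib[symmetric] comp local_algebra(2)[OF c_def cy] ..
  qed
qed

text \<open>The last claim is the transport of \<open>r u^phi\<close>, that is of
  \<open>rsq x * d x\<close>, by the poloidal flow, divided by \<open>rsq x\<close>.\<close>

lemma local_equations:
  assumes x: "x \<in> - z_axis" and dg: "(\<gamma> has_real_derivative g (tau x) * w1 (tau x)) (at (tau x))"
  shows "divg u x = 0" "cross3 (curl u x) (u x) = 0" "n (tau x) \<noteq> 0 \<Longrightarrow> curl u x \<noteq> 0"
    "\<exists>ds dz. axi d ds dz x \<and> a x * (2 * d x + rsq x * ds) + b x * dz = 0"
proof -
  define t R N c where "t = tau x" and "R = norm x powr (- \<alpha> - 2)" and "N = norm x" and "c = 1 - t\<^sup>2"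
  have ti: "t \<in> {-1<..<1}" using tau_off_axis[OF x] by (simp add: t_def)
  have x0: "x \<noteq> 0" by (rule off_axis_nonzero[OF x])
  have N: "N > 0" and R: "R > 0" using x0 by (auto simp: N_def R_def)
  have c: "c > 0" using interior[OF ti] by (simp add: c_def)
  have rsq: "rsq x = N\<^sup>2 * c" unfolding c_def t_def N_def by (rule rsq_eq[OF x0])
  define \<nu> where "\<nu> = n t / c"
  note A = components(2)[OF ti] and B = components(3)[OF ti, folded c_def]
  have w: "w t = c * W t" using cW[OF ti] by (simp add: c_def)
  note av = field_values[OF x0, folded R_def N_def t_def]
  obtain as az bs bz where ab: "axi a as az x" "axi b bs bz x" "2 * a x + rsq x * as + bz = 0" "az - bs = R * \<nu>"
    using poloidal_axi[OF x] unfolding R_def \<nu>_def c_def t_def by blast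
  define h where "h = g t * w1 t"
  define ds dz where "ds = R / N * (- (\<beta> + 3) * D t - t * ((h + 2 * t * D t) / c))"
    and "dz = R * (- (\<beta> + 3) * t * D t + c * ((h + 2 * t * D t) / c))"
  have ax: "axi d ds dz x"
    using axi_d[OF x t_def R_def dg[folded t_def], unfolded exponents(1)]
    unfolding ds_def dz_def c_def N_def h_def by (simp_all only:)
  note F = field_derivatives[OF ab(1,2) ax, folded u_def[abs_def]]
  show "divg u x = 0" using F(1) ab(3) by simp
  have h: "c * ((h + 2 * t * D t) / c) = h + 2 * t * D t" using c by simp
  have cdp: "2 * d x + rsq x * ds = - (R * N * ((\<beta> + 1) * (c * D t) + t * h))"
  proof -
    have "2 * d x + rsq x * ds = R * N * (2 * D t + (- (\<beta> + 3) * (c * D t) - t * (c * ((h + 2 * t * D t) / c))))"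
      unfolding av rsq ds_def using N by (simp add: field_simps power2_eq_square)
    also have "\<dots> = - (R * N * ((\<beta> + 1) * (c * D t) + t * h))"
      unfolding h unfolding c_def by (simp add: algebra_simps power2_eq_square)
    finally show ?thesis .
  qed
  have dz': "dz = - (R * ((\<beta> + 1) * t * D t - h))" unfolding dz_def h by (simp add: algebra_simps)
  \<comment> \<open>The curl has the same shape as \<open>u\<close> with these coefficients, so
    parallelism reduces to three scalar minors.\<close>
  define a' d' b' where "a' = R * ((\<beta> + 1) * t * D t - h)" and "d' = R * \<nu>"
    and "b' = - (R * N * ((\<beta> + 1) * (c * D t) + t * h))"
  have cu: "curl u x = vector [x$1 * a' - x$2 * d', x$2 * a' + x$1 * d', b']"
    unfolding F(2) ab(4) cdp dz' a'_def[symmetric] d'_def[symmetric] b'_def[symmetric] by simp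
  have \<gamma>D: "\<gamma> t = c * D t" using c by (simp add: D_def c_def)
  have "\<beta> \<noteq> 0" using \<beta> by auto
  have g1: "\<beta> * (g t * W t) = (\<beta> + 1) * D t"
  proof -
    have "c * (\<beta> * (g t * W t)) = \<beta> * (g t * w t)" by (simp add: w)
    also have "\<dots> = (\<beta> + 1) * \<gamma> t" unfolding g_w using \<open>\<beta> \<noteq> 0\<close> by (simp add: field_simps)
    also have "\<dots> = c * ((\<beta> + 1) * D t)" by (simp add: \<gamma>D)
    finally show ?thesis using c by simp
  qed
  have g2: "g t * D t = \<nu>" using g_\<gamma>[of t] c by (simp add: \<nu>_def \<gamma>D field_simps)
  note BA = beltrami_algebra[OF c_def g1 g2, where ?w1.0="w1 t", folded h_def, folded A B]
  have 1: "a' * d x - d' * a x = 0"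
  proof -
    have "a' * d x - d' * a x = R * R * N * (((\<beta> + 1) * t * D t - h) * D t - \<nu> * A t)"
      unfolding a'_def d'_def av by (simp add: algebra_simps)
    then show ?thesis unfolding BA(1) by simp
  qed
  have 2: "a' * b x - b' * a x = 0"
  proof -
    have "a' * b x - b' * a x = R * R * N\<^sup>2 * (((\<beta> + 1) * t * D t - h) * B t + ((\<beta> + 1) * (c * D t) + t * h) * A t)"
      unfolding a'_def b'_def av by (simp add: algebra_simps power2_eq_square)
    then show ?thesis unfolding BA(2) by simp
  qed
  have 3: "d' * b x - b' * d x = 0"
  proof -
    have "d' * b x - b' * d x = R * R * N\<^sup>2 * (\<nu> * B t + ((\<beta> + 1) * (c * D t) + t * h) * D t)"
      unfolding d'_def b'_def av by (simp add: algebra_simps power2_eq_square)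
    then show ?thesis unfolding BA(3) by simp
  qed
  have "a x * (2 * d x + rsq x * ds) + b x * dz = 0"
    unfolding cdp dz' using 2 unfolding a'_def b'_def by (simp add: algebra_simps)
  then show "\<exists>ds dz. axi d ds dz x \<and> a x * (2 * d x + rsq x * ds) + b x * dz = 0" using ax by blast
  have ux: "u x = vector [x$1 * a x - x$2 * d x, x$2 * a x + x$1 * d x, b x]"
    unfolding vec_eq_iff forall_3 by (simp add: u_def)
  have "cross3 (curl u x) (u x) = vector [x$2 * (a' * b x - b' * a x) + x$1 * (d' * b x - b' * d x),
     - (x$1 * (a' * b x - b' * a x)) + x$2 * (d' * b x - b' * d x), rsq x * (a' * d x - d' * a x)]"
    unfolding cu ux cross3_def vector_3 vec_eq_iff forall_3 by (simp add: rsq_def algebra_simps power2_eq_square)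
  then show "cross3 (curl u x) (u x) = 0" unfolding 1 2 3 vec_eq_iff forall_3 by simp
  assume "n (tau x) \<noteq> 0"
  then have "d' \<noteq> 0" using R c by (simp add: d'_def \<nu>_def t_def)
  moreover have "x$1 * curl u x $ 2 - x$2 * curl u x $ 1 = rsq x * d'"
    unfolding cu by (simp add: rsq_def algebra_simps power2_eq_square)
  moreover have "rsq x \<noteq> 0" using x z_axis_rsq by auto
  ultimately show "curl u x \<noteq> 0" by auto
qed

text \<open>The common factor \<open>h\<close> in the two derivatives allows denominators that
  vanish to higher order: \<open>h = 1\<close> for \<open>1 - t^2\<close> and
  \<open>h = 1 - t^2\<close> for its square.\<close>

lemma lhopital_ends:
  fixes f F f' F' \<psi> h :: "real \<Rightarrow> real"
  assumes f: "continuous_on {-1..1} f" "f (-1) = 0" "f 1 = 0"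
    and F: "continuous_on {-1..1} F" "F (-1) = 0" "F 1 = 0"
    and d: "\<And>t. t \<in> {-1<..<1} \<Longrightarrow> (f has_real_derivative \<psi> t * h t) (at t)"
      "\<And>t. t \<in> {-1<..<1} \<Longrightarrow> (F has_real_derivative - (k * t * h t)) (at t)"
    and nz: "\<And>t. t \<in> {-1<..<1} \<Longrightarrow> h t \<noteq> 0 \<and> F t \<noteq> 0" "k \<noteq> 0" and \<psi>: "continuous_on {-1..1} \<psi>"
  shows "((\<lambda>t. f t / F t) \<longlongrightarrow> - (\<psi> 1 / k)) (at_left 1)"
    "((\<lambda>t. f t / F t) \<longlongrightarrow> \<psi> (-1) / k) (at_right (-1))"
proof -
  have left: "(\<phi> \<longlongrightarrow> \<phi> 1) (at_left 1)" and right: "(\<phi> \<longlongrightarrow> \<phi> (-1)) (at_right (-1))"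
    if "continuous_on {-1..1} \<phi>" for \<phi> :: "real \<Rightarrow> real"
    using continuous_on_Icc_at_leftD[OF that] continuous_on_Icc_at_rightD[OF that] by simp_all
  have el: "\<forall>\<^sub>F t in at_left 1. t \<in> {-1<..<1} \<and> t \<noteq> (0::real)"
    unfolding eventually_at_left_field by (rule exI[of _ "1/2"]) auto
  have er: "\<forall>\<^sub>F t in at_right (-1). t \<in> {-1<..<1} \<and> t \<noteq> (0::real)"
    unfolding eventually_at_right_field by (rule exI[of _ "-1/2"]) auto
  have q: "\<psi> t * h t / - (k * t * h t) = - (\<psi> t / (k * t))" if "t \<in> {-1<..<1} \<and> t \<noteq> 0" for t
    using nz that by (auto simp: field_simps)
  have "((\<lambda>t. - (\<psi> t / (k * t))) \<longlongrightarrow> - (\<psi> 1 / (k * 1))) (at_left 1)"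
    using nz(2) by (intro tendsto_intros left \<psi>) auto
  then have l: "((\<lambda>t. - (\<psi> t / (k * t))) \<longlongrightarrow> - (\<psi> 1 / k)) (at_left 1)" by simp
  have "\<forall>\<^sub>F t in at_left 1. - (\<psi> t / (k * t)) = \<psi> t * h t / - (k * t * h t)"
    using el by eventually_elim (rule q[symmetric])
  with l have "((\<lambda>t. \<psi> t * h t / - (k * t * h t)) \<longlongrightarrow> - (\<psi> 1 / k)) (at_left 1)"
    by (rule Lim_transform_eventually)
  then show "((\<lambda>t. f t / F t) \<longlongrightarrow> - (\<psi> 1 / k)) (at_left 1)"
  proof (rule lhopital_left[rotated -1])
    show "(f \<longlongrightarrow> 0) (at_left 1)" "(F \<longlongrightarrow> 0) (at_left 1)" using left[OF f(1)] left[OF F(1)] f F by auto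
  qed (use el nz d in \<open>auto elim!: eventually_mono\<close>)
  have "((\<lambda>t. - (\<psi> t / (k * t))) \<longlongrightarrow> - (\<psi> (-1) / (k * (-1)))) (at_right (-1))"
    using nz(2) by (intro tendsto_intros right \<psi>) auto
  then have l: "((\<lambda>t. - (\<psi> t / (k * t))) \<longlongrightarrow> \<psi> (-1) / k) (at_right (-1))" by simp
  have "\<forall>\<^sub>F t in at_right (-1). - (\<psi> t / (k * t)) = \<psi> t * h t / - (k * t * h t)"
    using er by eventually_elim (rule q[symmetric])
  with l have "((\<lambda>t. \<psi> t * h t / - (k * t * h t)) \<longlongrightarrow> \<psi> (-1) / k) (at_right (-1))"
    by (rule Lim_transform_eventually)
  then show "((\<lambda>t. f t / F t) \<longlongrightarrow> \<psi> (-1) / k) (at_right (-1))"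
  proof (rule lhopital_right[rotated -1])
    show "(f \<longlongrightarrow> 0) (at_right (-1))" "(F \<longlongrightarrow> 0) (at_right (-1))" using right[OF f(1)] right[OF F(1)] f F by auto
  qed (use er nz d in \<open>auto elim!: eventually_mono\<close>)
qed

lemma W_cont: "continuous_on {-1..1} W"
proof (rule continuous_on_IccI)
  have nz: "(1::real) \<noteq> 0 \<and> 1 - t\<^sup>2 \<noteq> 0" if "t \<in> {-1<..<1}" for t :: real using interior[OF that] by simp
  have F: "((\<lambda>t. 1 - t\<^sup>2) has_real_derivative - (2 * t * 1)) (at t)" for t :: real
    by (auto intro!: derivative_eq_intros)
  have Fc: "continuous_on {-1..1} (\<lambda>t::real. 1 - t\<^sup>2)" by (intro continuous_intros)
  have dw': "(w has_real_derivative w1 t * 1) (at t)" if "t \<in> {-1<..<1}" for t using dw[OF that] by simp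
  note l = lhopital_ends[where \<psi>=w1 and h="\<lambda>_. 1" and k=2, OF w_cont w_ends Fc _ _ dw' F nz _ w1_cont, simplified]
  have "\<forall>\<^sub>F t in at_left 1. w t / (1 - t\<^sup>2) = W t"
    unfolding eventually_at_left_field by (rule exI[of _ 0]) (auto simp: W_def)
  then show "(W \<longlongrightarrow> W 1) (at_left 1)" using Lim_transform_eventually[OF l(1)] by (simp add: W_def)
  have "\<forall>\<^sub>F t in at_right (-1). w t / (1 - t\<^sup>2) = W t"
    unfolding eventually_at_right_field by (rule exI[of _ 0]) (auto simp: W_def)
  then show "(W \<longlongrightarrow> W (-1)) (at_right (-1))" using Lim_transform_eventually[OF l(2)] by (simp add: W_def)
  show "W \<midarrow>x\<rightarrow> W x" if "-1 < x" "x < 1" for x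
    using DERIV_isCont[OF dW[of x]] that by (simp add: isCont_def)
qed simp

lemma A_cont: "continuous_on {-1..1} A" unfolding A_def by (intro continuous_intros W_cont w1_cont)

lemma B_cont: "continuous_on {-1..1} B" unfolding B_def by (intro continuous_intros w_cont w1_cont)

lemma E_cont: "continuous_on {-1..1} E" unfolding E_def by (intro continuous_intros n_cont W_cont)

lemma quotient_DERIV:
  assumes t: "t \<in> {-1<..<1}" and f: "(f has_real_derivative f') (at t)"
  shows "((\<lambda>t. f t / (1 - t\<^sup>2)) has_real_derivative (f' + 2 * t * (f t / (1 - t\<^sup>2))) / (1 - t\<^sup>2)) (at t)"
proof -
  have c: "1 - t\<^sup>2 \<noteq> 0" using interior[OF t] by simp
  have "((\<lambda>t. f t / (1 - t\<^sup>2)) has_real_derivative (f' * (1 - t\<^sup>2) - f t * (- (2 * t))) / ((1 - t\<^sup>2) * (1 - t\<^sup>2))) (at t)"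
    using c by (auto intro!: derivative_eq_intros f)
  moreover have "(f' * c - y * (- (2 * t))) / (c * c) = (f' + 2 * t * (y / c)) / c" if "c \<noteq> 0" for y c :: real
    using that by (simp add: field_simps)
  note this[OF c, of "f t"]
  ultimately show ?thesis by (simp only:)
qed

lemma rsq_d: "x \<noteq> 0 \<Longrightarrow> rsq x * (d x)\<^sup>2 = Phi (- (2 * \<alpha>)) E x"
proof -
  assume x: "x \<noteq> 0"
  define t N where "t = tau x" and "N = norm x"
  have N: "N > 0" using x by (simp add: N_def)
  have r: "rsq x = N\<^sup>2 * (1 - t\<^sup>2)" unfolding t_def N_def by (rule rsq_eq[OF x])
  have p: "(N powr (- \<alpha> - 1))\<^sup>2 * N\<^sup>2 = N powr (- (2 * \<alpha>))"
  proof -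
    have "(N powr (- \<alpha> - 1))\<^sup>2 * N\<^sup>2 = N powr (- \<alpha> - 1) * N powr (- \<alpha> - 1) * N powr 2"
      using N by (simp add: power2_eq_square)
    also have "\<dots> = N powr (- (2 * \<alpha>))" by (simp only: powr_add[symmetric]) simp
    finally show ?thesis .
  qed
  have "(1 - t\<^sup>2) * (D t)\<^sup>2 = E t"
  proof (cases "t \<in> {-1<..<1}")
    case True
    then have c: "1 - t\<^sup>2 \<noteq> 0" using interior[OF True] by simp
    have "(1 - t\<^sup>2) * (D t)\<^sup>2 = (\<gamma> t)\<^sup>2 / (1 - t\<^sup>2)" using c by (simp add: D_def power2_eq_square)
    also have "\<dots> = E t" unfolding \<gamma>_sq using interior[OF True] by (simp add: E_def W_def)
    finally show ?thesis .
  next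
    case False
    then have "t = 1 \<or> t = -1" using tau_bounds[OF x] by (auto simp: t_def)
    then show ?thesis by (auto simp: E_def n_def w_ends)
  qed
  note e = this
  have "rsq x * (d x)\<^sup>2 = ((N powr (- \<alpha> - 1))\<^sup>2 * N\<^sup>2) * ((1 - t\<^sup>2) * (D t)\<^sup>2)"
    unfolding d_def Phi_def r t_def[symmetric] N_def[symmetric] power_mult_distrib by (simp only: mult_ac)
  then have "rsq x * (d x)\<^sup>2 = ((N powr (- \<alpha> - 1))\<^sup>2 * N\<^sup>2) * E t" by (simp only: e)
  then show ?thesis unfolding p by (simp add: Phi_def t_def N_def)
qed

lemma Phi_C:
  "Ck_on k (\<lambda>x. G (tau x)) S \<Longrightarrow> open S \<Longrightarrow> S \<subseteq> -{0} \<Longrightarrow> Ck_on k (Phi s G) S"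
  unfolding Phi_def by (intro Ck_on_mult Ck_on_subset[OF Ck_on_norm_powr])

lemma nonzero_point: "\<exists>x. x \<in> - z_axis \<and> w (tau x) \<noteq> 0 \<and> norm x = 1"
proof -
  obtain t where t: "t \<in> {-1<..<1}" "w t \<noteq> 0" using P by (auto simp: prof_def)
  define x :: "real^3" where "x = vector [sqrt (1 - t\<^sup>2), 0, t]"
  have c: "0 < 1 - t\<^sup>2" by (rule interior[OF t(1)])
  have "(norm x)\<^sup>2 = 1\<^sup>2" unfolding norm_sq3 using c by (simp add: x_def)
  then have "norm x = 1" by (rule power2_eq_imp_eq) auto
  moreover from this have "tau x = t" by (simp add: tau_def x_def)
  moreover have "x \<in> - z_axis" using c by (simp add: z_axis_def x_def)
  ultimately show ?thesis using t(2) by auto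
qed

lemma n_nonzero: "w t \<noteq> 0 \<Longrightarrow> n t \<noteq> 0"
  using \<kappa>[of t] by (simp add: n_def)

lemma axisymmetric: "axisymmetric_on S u p"
proof -
  have c: "a (cyl r \<phi> z) = a (cyl r 0 z)" "b (cyl r \<phi> z) = b (cyl r 0 z)" "d (cyl r \<phi> z) = d (cyl r 0 z)" for r \<phi> z
    unfolding a_def b_def d_def Phi_cyl by simp_all
  have "u x \<bullet> u x = rsq x * (a x)\<^sup>2 + rsq x * (d x)\<^sup>2 + (b x)\<^sup>2" for x
    unfolding u_def inner_vec3 by (simp add: rsq_def algebra_simps power2_eq_square)
  note e = this
  have "rsq (cyl r \<phi> z) = rsq (cyl r 0 z)" for r \<phi> z
  proof -
    have "rsq (cyl r \<phi> z) = r\<^sup>2 * ((cos \<phi>)\<^sup>2 + (sin \<phi>)\<^sup>2)" for \<phi>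
      unfolding rsq_def cyl_def vector_3 power_mult_distrib distrib_left ..
    then show ?thesis by simp
  qed
  then have "p (cyl r \<phi> z) = p (cyl r 0 z)" for r \<phi> z
    unfolding p_def e c[of r \<phi> z] by (rule arg_cong[of _ _ "\<lambda>y. - (y * _ + y * _ + _) / 2"])
  then show ?thesis unfolding u_def[abs_def] by (intro axisymmetric_fields c)
qed

lemma homogeneous_aux:
  assumes l: "l > 0"
  shows "u x = (l powr \<alpha>) *\<^sub>R u (l *\<^sub>R x)" "p x = (l powr (2 * \<alpha>)) * p (l *\<^sub>R x)"
proof -
  have e: "l powr \<alpha> * (l * l powr (- \<alpha> - 1)) = 1" "l powr \<alpha> * l powr (- \<alpha>) = 1"
  proof -
    show 2: "l powr \<alpha> * l powr (- \<alpha>) = 1" using l by (simp flip: powr_add)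
    have "l * l powr (- \<alpha> - 1) = l powr (- \<alpha>)" using l powr_add[of l 1 "-\<alpha> - 1"] by simp
    then show "l powr \<alpha> * (l * l powr (- \<alpha> - 1)) = 1" by (simp only: 2)
  qed
  have s: "l powr \<alpha> * (l * y * (l powr (- \<alpha> - 1) * z)) = y * z" "l powr \<alpha> * (l powr (- \<alpha>) * y) = y" for y z
  proof -
    have "l powr \<alpha> * (l * y * (l powr (- \<alpha> - 1) * z)) = (l powr \<alpha> * (l * l powr (- \<alpha> - 1))) * (y * z)" by (simp only: mult_ac)
    then show "l powr \<alpha> * (l * y * (l powr (- \<alpha> - 1) * z)) = y * z" unfolding e by simp
    have "l powr \<alpha> * (l powr (- \<alpha>) * y) = (l powr \<alpha> * l powr (- \<alpha>)) * y" by (simp only: mult_ac)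
    then show "l powr \<alpha> * (l powr (- \<alpha>) * y) = y" unfolding e by simp
  qed
  show u: "u x = (l powr \<alpha>) *\<^sub>R u (l *\<^sub>R x)"
    unfolding u_def a_def b_def d_def vec_eq_iff forall_3
    using l by (simp add: Phi_scale s distrib_left right_diff_distrib)
  have "l powr (2 * \<alpha>) = l powr \<alpha> * l powr \<alpha>" by (simp flip: powr_add)
  then show "p x = (l powr (2 * \<alpha>)) * p (l *\<^sub>R x)"
    unfolding p_def by (subst (1 2) u) (simp add: mult_ac)
qed

end

section \<open>Classical regularity for positive \<beta>\<close>

locale homog_profile_pos = homog_profile +
  assumes pos: "\<beta> > 0"
begin

lemma q_pos: "q > 0" using pos by (simp add: q_def)

lemma d\<gamma>: "t \<in> {-1<..<1} \<Longrightarrow> (\<gamma> has_real_derivative g t * w1 t) (at t)"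
  unfolding \<gamma>_def[abs_def]
  by (rule DERIV_cong[OF \<kappa>_DERIV[where f="\<lambda>x. sqrt (\<theta> * x)" and M="sqrt (\<theta> * K)", OF powr_abs_DERIV[of "1 / \<beta>"] _ _ sqrt_\<kappa>_abs]])
    (use pos in \<open>auto simp: g_def mult_ac\<close>)

definition "m t = (1 + q) * (\<kappa> t * \<bar>w t\<bar> powr q)"

lemma dn: "t \<in> {-1<..<1} \<Longrightarrow> (n has_real_derivative m t * w1 t) (at t)"
  unfolding n_def[abs_def]
  by (rule DERIV_cong[OF \<kappa>_DERIV[where f="\<lambda>x. x" and M=K, OF powr_abs_DERIV[of q] _ _ \<kappa>_abs]])
    (use q_pos in \<open>auto simp: m_def mult_ac\<close>)

lemma m_cont: "continuous_on {-1..1} m"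
  unfolding m_def using \<kappa>_cont[where f="\<lambda>x. x" and M=K and \<zeta>="\<lambda>y. \<bar>y\<bar> powr q", OF continuous_abs_powr[OF q_pos] _ \<kappa>_abs]
  by (intro continuous_on_mult[OF continuous_on_const]) simp

lemma m_ends: "m (-1) = 0" "m 1 = 0" by (simp_all add: m_def w_ends)

text \<open>\<open>nn\<close>, \<open>v\<close> and \<open>V\<close> are
  \<open>n / (1 - t^2)\<close>, w'' and W', extended continuously to the poles. The polar value of
  \<open>V\<close> comes from l'Hopital's rule and the equation.\<close>

definition "nn t = W t * (\<kappa> t * \<bar>w t\<bar> powr q)"
definition "v t = - (\<mu> * W t + nn t)"
definition "V t = (if \<bar>t\<bar> < 1 then (w1 t + 2 * t * W t) / (1 - t\<^sup>2) else - (t * ((2 - \<mu>) * W t) / 4))"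

lemma nn_m: "(1 + q) * nn t = m t * W t" by (simp add: nn_def m_def)

lemma nn_cont: "continuous_on {-1..1} nn"
proof -
  have "continuous_on {-1..1} (\<lambda>t. W t * (m t / (1 + q)))"
    using q_pos by (intro continuous_intros W_cont m_cont) auto
  moreover have "W t * (m t / (1 + q)) = nn t" for t using q_pos by (simp add: m_def nn_def)
  ultimately show ?thesis by simp
qed

lemma nn_ends: "nn (-1) = 0" "nn 1 = 0" by (simp_all add: nn_def w_ends)

lemma nn: "t \<in> {-1<..<1} \<Longrightarrow> n t = (1 - t\<^sup>2) * nn t"
  using cW[of t] by (simp add: n_def nn_def mult_ac)

lemma v_cont: "continuous_on {-1..1} v" unfolding v_def by (intro continuous_intros W_cont nn_cont)

lemma v: "t \<in> {-1<..<1} \<Longrightarrow> w2 t = v t"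
proof -
  assume t: "t \<in> {-1<..<1}"
  have "(\<mu> * (c * x) + c * y) / c = \<mu> * x + y" if "c \<noteq> 0" for c x y :: real
    using that by (simp add: field_simps)
  from this[of "1 - t\<^sup>2" "W t" "nn t"] show ?thesis
    unfolding w2_def v_def cW[OF t] nn[OF t] using interior[OF t] by simp
qed

lemma V: "t \<in> {-1<..<1} \<Longrightarrow> w1 t + 2 * t * W t = (1 - t\<^sup>2) * V t"
  using interior[of t] by (simp add: V_def)

lemma dW': "t \<in> {-1<..<1} \<Longrightarrow> (W has_real_derivative V t) (at t)"
  using dW[of t] interior[of t] by (simp add: V_def)

lemma dw1': "t \<in> {-1<..<1} \<Longrightarrow> (w1 has_real_derivative v t) (at t)"
  using dw1[of t] v[of t] by simp

lemma V_cont: "continuous_on {-1..1} V"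
proof (rule continuous_on_IccI)
  \<comment> \<open>Multiplying numerator and denominator of \<open>V\<close> by
    \<open>1 - t^2\<close> replaces W by w, so the numerator can be differentiated without knowing
    W' at the poles.\<close>
  let ?f = "\<lambda>t. (1 - t\<^sup>2) * w1 t + 2 * t * w t" and ?F = "\<lambda>t::real. (1 - t\<^sup>2)\<^sup>2"
  have d: "(?f has_real_derivative (v t + 2 * W t) * (1 - t\<^sup>2)) (at t)" if t: "t \<in> {-1<..<1}" for t
    by (rule derivative_eq_intros dw dw1' t refl | simp)+ (simp add: cW[OF t] algebra_simps)
  have nz: "1 - t\<^sup>2 \<noteq> 0 \<and> (1 - t\<^sup>2)\<^sup>2 \<noteq> 0" if "t \<in> {-1<..<1}" for t :: real using interior[OF that] by simp
  have F: "(?F has_real_derivative - (4 * t * (1 - t\<^sup>2))) (at t)" for t :: real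
    by (auto intro!: derivative_eq_intros)
  have Fc: "continuous_on {-1..1} ?F" by (intro continuous_intros)
  have fc: "continuous_on {-1..1} ?f" by (intro continuous_intros w1_cont w_cont)
  have \<psi>c: "continuous_on {-1..1} (\<lambda>t. v t + 2 * W t)" by (intro continuous_intros v_cont W_cont)
  have z: "?f (-1) = 0" "?f 1 = 0" "?F (-1) = 0" "?F 1 = 0" by (simp_all add: w_ends)
  have k: "(4::real) \<noteq> 0" by simp
  note l = lhopital_ends[where \<psi>="\<lambda>t. v t + 2 * W t" and h="\<lambda>t. 1 - t\<^sup>2" and k=4, OF fc z(1,2) Fc z(3,4) d F nz k \<psi>c]
  have e: "?f t / ?F t = V t" if "t \<in> {-1<..<1}" for t
  proof -
    have "(c * y + 2 * t * (c * z)) / c\<^sup>2 = (y + 2 * t * z) / c" if "c \<noteq> 0" for c y z :: real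
      using that by (simp add: power2_eq_square field_simps)
    from this[of "1 - t\<^sup>2" "w1 t" "W t"] show ?thesis
      unfolding cW[OF that] V_def using interior[OF that] by simp
  qed
  have "\<forall>\<^sub>F t in at_left 1. ?f t / ?F t = V t"
    unfolding eventually_at_left_field by (rule exI[of _ 0]) (use e in auto)
  with l(1) have "(V \<longlongrightarrow> - ((v 1 + 2 * W 1) / 4)) (at_left 1)" by (rule Lim_transform_eventually)
  moreover have "- ((v 1 + 2 * W 1) / 4) = V 1" by (simp add: V_def v_def nn_ends algebra_simps)
  ultimately show "(V \<longlongrightarrow> V 1) (at_left 1)" by (simp only:)
  have "\<forall>\<^sub>F t in at_right (-1). ?f t / ?F t = V t"
    unfolding eventually_at_right_field by (rule exI[of _ 0]) (use e in auto)
  with l(2) have "(V \<longlongrightarrow> (v (-1) + 2 * W (-1)) / 4) (at_right (-1))" by (rule Lim_transform_eventually)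
  moreover have "(v (-1) + 2 * W (-1)) / 4 = V (-1)" by (simp add: V_def v_def nn_ends field_simps)
  ultimately show "(V \<longlongrightarrow> V (-1)) (at_right (-1))" by (simp only:)
  show "V \<midarrow>x\<rightarrow> V x" if x: "-1 < x" "x < 1" for x
  proof -
    have c: "1 - x\<^sup>2 \<noteq> 0" using interior[of x] x by simp
    have "isCont W x" "isCont w1 x" using DERIV_isCont dW[of x] dw1[of x] x by auto
    then have "isCont (\<lambda>t. (w1 t + 2 * t * W t) / (1 - t\<^sup>2)) x" using c by (intro continuous_intros) auto
    moreover have "\<forall>\<^sub>F t in at x. (w1 t + 2 * t * W t) / (1 - t\<^sup>2) = V t"
    proof -
      have "\<forall>\<^sub>F t in at x. t \<in> {-1<..<1}" using x by (intro eventually_at_in_open') auto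
      then show ?thesis by eventually_elim (auto simp: V_def)
    qed
    ultimately show ?thesis using Lim_transform_eventually x by (fastforce simp: isCont_def V_def)
  qed
qed simp

lemma dV: "t \<in> {-1<..<1} \<Longrightarrow> (V has_real_derivative (v t + 4 * t * V t + 2 * W t) / (1 - t\<^sup>2)) (at t)"
proof -
  assume t: "t \<in> {-1<..<1}"
  have "((\<lambda>t. w1 t + 2 * t * W t) has_real_derivative v t + 2 * W t + 2 * t * V t) (at t)"
    by (rule derivative_eq_intros dW' dw1' t refl | simp)+
  from quotient_DERIV[OF t this]
  have "((\<lambda>t. (w1 t + 2 * t * W t) / (1 - t\<^sup>2)) has_real_derivative (v t + 4 * t * V t + 2 * W t) / (1 - t\<^sup>2)) (at t)"
    by (rule DERIV_cong) (use t interior[OF t] in \<open>simp add: V_def algebra_simps\<close>)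
  then show ?thesis
    by (rule has_field_derivative_transform_within_open[of _ _ _ "{-1<..<1}"])
      (use t interior(2) in \<open>auto simp: V_def\<close>)
qed

lemma dnn: "t \<in> {-1<..<1} \<Longrightarrow> (nn has_real_derivative (m t * w1 t + 2 * t * nn t) / (1 - t\<^sup>2)) (at t)"
proof -
  assume t: "t \<in> {-1<..<1}"
  have e: "n t / (1 - t\<^sup>2) = nn t" if "t \<in> {-1<..<1}" for t using nn[OF that] interior[OF that] by simp
  from quotient_DERIV[OF t dn[OF t]]
  have "((\<lambda>t. n t / (1 - t\<^sup>2)) has_real_derivative (m t * w1 t + 2 * t * nn t) / (1 - t\<^sup>2)) (at t)"
    by (simp only: e[OF t])
  then show ?thesis
    by (rule has_field_derivative_transform_within_open[of _ _ _ "{-1<..<1}"]) (use t e in auto)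
qed

lemma dv: "t \<in> {-1<..<1} \<Longrightarrow> (v has_real_derivative - (\<mu> * V t + (m t * w1 t + 2 * t * nn t) / (1 - t\<^sup>2))) (at t)"
  unfolding v_def[abs_def] by (auto intro!: derivative_eq_intros dW' dnn)

text \<open>The numerator of V' vanishes at the poles. This is the endpoint condition on
  \<open>h\<close> in \<open>C2_of_derivatives\<close> for the profile of
  \<open>u^r / r\<close>.\<close>

lemma end_identity: "t\<^sup>2 = 1 \<Longrightarrow> nn t = 0 \<Longrightarrow> v t + 4 * t * V t + 2 * W t = 0"
proof -
  assume t: "t\<^sup>2 = 1" "nn t = 0"
  have "\<not> \<bar>t\<bar> < 1" using t(1) by (simp flip: abs_square_less_1)
  then have "4 * t * V t = - (t\<^sup>2 * ((2 - \<mu>) * W t))" by (simp add: V_def power2_eq_square)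
  then show ?thesis using t by (simp add: v_def algebra_simps)
qed

lemma C2_of_derivatives:
  assumes G: "continuous_on {-1..1} G" "\<And>t. t \<in> {-1<..<1} \<Longrightarrow> (G has_real_derivative G1 t) (at t)"
    and G1: "continuous_on {-1..1} G1" "\<And>t. t \<in> {-1<..<1} \<Longrightarrow> (G1 has_real_derivative h t / (1 - t\<^sup>2)) (at t)"
    and h: "continuous_on {-1..1} h" "h (-1) = 0" "h 1 = 0"
  shows "Ck_on 2 (Phi s G) (-{0})"
  by (intro Phi_C C2_tau[OF has_derivative_at_endpoints[OF G(1) G(2) G1(1)] G1 h]) auto

lemma a_C2: "Ck_on 2 a (-{0})"
  unfolding a_def
proof (rule C2_of_derivatives)
  let ?G1 = "\<lambda>t. \<beta> * W t + \<beta> * t * V t - v t"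
  let ?h = "\<lambda>t. 2 * \<beta> * (1 - t\<^sup>2) * V t + \<beta> * t * (v t + 4 * t * V t + 2 * W t) + \<mu> * (1 - t\<^sup>2) * V t + m t * w1 t + 2 * t * nn t"
  show "continuous_on {-1..1} A" by (rule A_cont)
  show "(A has_real_derivative ?G1 t) (at t)" if t: "t \<in> {-1<..<1}" for t
    unfolding A_def[abs_def] by (rule derivative_eq_intros dW' dw1' t refl | simp)+
  show "continuous_on {-1..1} ?G1" by (intro continuous_intros W_cont V_cont v_cont)
  show "(?G1 has_real_derivative ?h t / (1 - t\<^sup>2)) (at t)" if t: "t \<in> {-1<..<1}" for t
  proof -
    have c: "1 - t\<^sup>2 \<noteq> 0" using interior[OF t] by simp
    have "(?G1 has_real_derivative \<beta> * V t + (\<beta> * V t + \<beta> * t * ((v t + 4 * t * V t + 2 * W t) / (1 - t\<^sup>2))) - - (\<mu> * V t + (m t * w1 t + 2 * t * nn t) / (1 - t\<^sup>2))) (at t)"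
      by (rule derivative_eq_intros dW' dV dv t refl | simp)+
    moreover have "\<beta> * y + (\<beta> * y + \<beta> * t * (z / c)) - - (\<mu> * y + z' / c) = (2 * \<beta> * c * y + \<beta> * t * z + \<mu> * c * y + z') / c"
      if "c \<noteq> 0" for y z z' c :: real using that by (simp add: field_simps)
    note this[OF c, of "V t" "v t + 4 * t * V t + 2 * W t" "m t * w1 t + 2 * t * nn t"]
    ultimately show ?thesis by (simp only: add.assoc)
  qed
  show "continuous_on {-1..1} ?h" by (intro continuous_intros V_cont v_cont W_cont m_cont w1_cont nn_cont)
  show "?h (-1) = 0" "?h 1 = 0" using end_identity[of 1] end_identity[of "-1"] m_ends nn_ends by auto
qed

lemma b_C2: "Ck_on 2 b (-{0})"
  unfolding b_def
proof (rule C2_of_derivatives)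
  let ?G1 = "\<lambda>t. - ((\<beta> + 1) * w1 t + t * v t)"
  let ?h = "\<lambda>t. - ((\<beta> + 2) * (1 - t\<^sup>2) * v t - t * (\<mu> * (1 - t\<^sup>2) * V t + (m t * w1 t + 2 * t * nn t)))"
  show "continuous_on {-1..1} B" by (rule B_cont)
  show "(B has_real_derivative ?G1 t) (at t)" if t: "t \<in> {-1<..<1}" for t
    using dB[OF t] v[OF t] by simp
  show "continuous_on {-1..1} ?G1" by (intro continuous_intros w1_cont v_cont)
  show "(?G1 has_real_derivative ?h t / (1 - t\<^sup>2)) (at t)" if t: "t \<in> {-1<..<1}" for t
  proof -
    have c: "1 - t\<^sup>2 \<noteq> 0" using interior[OF t] by simp
    have "(?G1 has_real_derivative - ((\<beta> + 1) * v t + (v t + t * - (\<mu> * V t + (m t * w1 t + 2 * t * nn t) / (1 - t\<^sup>2))))) (at t)"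
      by (rule derivative_eq_intros dw1' dv t refl | simp)+
    moreover have "- ((\<beta> + 1) * y + (y + t * - (\<mu> * z + z' / c))) = - ((\<beta> + 2) * c * y - t * (\<mu> * c * z + z')) / c"
      if "c \<noteq> 0" for y z z' c :: real using that by (simp add: field_simps)
    note this[OF c, of "v t" "V t" "m t * w1 t + 2 * t * nn t"]
    ultimately show ?thesis by (simp only:)
  qed
  show "continuous_on {-1..1} ?h" by (intro continuous_intros V_cont v_cont m_cont w1_cont nn_cont)
qed (auto simp: m_ends nn_ends)

text \<open>The square of \<open>u^phi\<close> behaves like
  \<open>\<bar>w\<bar> powr (2 + q)\<close> at the nodes, so it is C^2 although \<open>u^phi\<close>
  itself is only shown to be C^1. This gives the extra regularity of the pressure.\<close>

lemma E_C2: "Ck_on 2 (Phi s E) (-{0})"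
proof (rule C2_of_derivatives)
  let ?y = "\<lambda>t. (2 + q) * w1 t + 2 * t * W t"
  let ?G1 = "\<lambda>t. \<theta> * (nn t * ?y t)"
  let ?h = "\<lambda>t. \<theta> * ((m t * w1 t + 2 * t * nn t) * ?y t + (1 - t\<^sup>2) * nn t * ((2 + q) * v t + 2 * W t + 2 * t * V t))"
  show "continuous_on {-1..1} E" by (rule E_cont)
  show "(E has_real_derivative ?G1 t) (at t)" if t: "t \<in> {-1<..<1}" for t
  proof -
    have "(E has_real_derivative \<theta> * n t * V t + \<theta> * (m t * w1 t) * W t) (at t)"
      unfolding E_def[abs_def] by (rule derivative_eq_intros dW' dn t refl | simp)+
    \<comment> \<open>The function \<open>m\<close> need not be differentiable at the nodes;
      \<open>nn_m\<close> eliminates it in favour of \<open>nn\<close>, which is.\<close>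
    moreover have "\<theta> * n t * V t + \<theta> * (m t * w1 t) * W t = \<theta> * (nn t * ((1 - t\<^sup>2) * V t) + w1 t * (m t * W t))"
      unfolding nn[OF t] by (simp add: algebra_simps)
    also have "\<dots> = \<theta> * (nn t * ?y t)"
      unfolding nn_m[symmetric] V[OF t, symmetric] by (simp add: algebra_simps)
    ultimately show ?thesis by simp
  qed
  show "continuous_on {-1..1} ?G1" by (intro continuous_intros nn_cont w1_cont W_cont)
  show "(?G1 has_real_derivative ?h t / (1 - t\<^sup>2)) (at t)" if t: "t \<in> {-1<..<1}" for t
  proof -
    have c: "1 - t\<^sup>2 \<noteq> 0" using interior[OF t] by simp
    have "(?G1 has_real_derivative \<theta> * (nn t * ((2 + q) * v t + (2 * W t + 2 * t * V t)) + (m t * w1 t + 2 * t * nn t) / (1 - t\<^sup>2) * ?y t)) (at t)"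
      by (rule derivative_eq_intros dw1' dW' dnn t refl | simp)+
    moreover have "\<theta> * (x * (y + (z + z')) + s / c * r) = \<theta> * (s * r + c * x * (y + z + z')) / c"
      if "c \<noteq> 0" for x y z z' s r c :: real using that by (simp add: field_simps)
    note this[OF c, of "nn t" "(2 + q) * v t" "2 * W t" "2 * t * V t" "m t * w1 t + 2 * t * nn t" "?y t"]
    ultimately show ?thesis by (simp only:)
  qed
  show "continuous_on {-1..1} ?h" by (intro continuous_intros V_cont v_cont m_cont w1_cont nn_cont W_cont)
qed (auto simp: m_ends nn_ends)

text \<open>\<open>D\<close> has a derivative of the form h / (1 - t^2) with h zero at the poles,
  and the Cartesian factor vanishes on the axis.\<close>

lemma fieldT_C1: "Ck_on 1 (fieldT d) (-{0})"
proof -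
  have gc: "continuous_on {-1..1} (\<lambda>t. sqrt (\<theta> * \<kappa> t) * \<bar>w t\<bar> powr (1 / \<beta>))"
    using \<kappa>_cont[where f="\<lambda>x. sqrt (\<theta> * x)" and M="sqrt (\<theta> * K)" and \<zeta>="\<lambda>y. \<bar>y\<bar> powr (1 / \<beta>)", OF continuous_abs_powr _ sqrt_\<kappa>_abs] pos
    by simp
  have De: "D t = W t * (sqrt (\<theta> * \<kappa> t) * \<bar>w t\<bar> powr (1 / \<beta>))" if "t \<in> {-1..1}" for t
  proof (cases "t \<in> {-1<..<1}")
    case True
    then show ?thesis using interior[OF True] by (simp add: D_def \<gamma>_def W_def)
  next
    case False
    then have "t = 1 \<or> t = -1" using that by auto
    then show ?thesis by (auto simp: D_def \<gamma>_def w_ends)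
  qed
  have Dc: "continuous_on {-1..1} D"
    by (rule continuous_on_eq[of _ "\<lambda>t. W t * (sqrt (\<theta> * \<kappa> t) * \<bar>w t\<bar> powr (1 / \<beta>))"])
      (use De in \<open>auto intro!: continuous_intros W_cont gc[simplified]\<close>)
  have gcont: "continuous_on {-1..1} g" unfolding g_def by (intro continuous_intros gc)
  have C: "Ck_on 1 (\<lambda>x. D (tau x) * x$i) (-{0})" if i: "i = 1 \<or> i = 2" for i
  proof (rule C1_tau_mult_vanishing[where h="\<lambda>t. g t * w1 t + 2 * t * D t" and C=1 and s=1])
    show "(D has_real_derivative (g t * w1 t + 2 * t * D t) / (1 - t\<^sup>2)) (at t)" if "t \<in> {-1<..<1}" for t
      using quotient_DERIV[OF that d\<gamma>[OF that]] by (simp add: D_def[abs_def])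
    show "continuous_on {-1..1} (\<lambda>t. g t * w1 t + 2 * t * D t)" by (intro continuous_intros gcont w1_cont Dc)
    show "\<bar>x $ i\<bar> \<le> 1 * norm x powr 1 * sqrt (1 - (tau x)\<^sup>2)" if "x \<noteq> 0" for x
      by (rule nth_bound[OF that i])
    show "Ck_on 1 (\<lambda>x::real^3. x $ i) (-{0})" by (rule Ck_on_nth_ident[OF open_punctured])
    show "continuous_on {-1..1} D" by (rule Dc)
  qed (simp_all add: D_def \<gamma>_def g_def w_ends)
  have C': "Ck_on 1 (\<lambda>x. x$i * d x) (-{0})" if i: "i = 1 \<or> i = 2" for i
  proof -
    have "Ck_on 1 (\<lambda>x. norm x powr (- \<alpha> - 1) * (D (tau x) * x$i)) (-{0})"
      by (intro Ck_on_mult open_punctured Ck_on_norm_powr C i)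
    then show ?thesis unfolding d_def Phi_def by (simp only: mult_ac)
  qed
  show ?thesis unfolding fieldT_def
    by (intro Ck_on_vector3 Ck_on_uminus Ck_on_const open_punctured C') auto
qed

lemma fieldP_C2: "Ck_on 2 (fieldP a b) (-{0})"
  unfolding fieldP_def by (intro Ck_on_vector3 Ck_on_mult Ck_on_nth_ident open_punctured a_C2 b_C2)

lemma u_C1: "Ck_on 1 u (-{0})"
  unfolding u_def using Ck_on_antimono[OF fieldP_C2, of 1] by (intro Ck_on_add open_punctured fieldT_C1) auto

lemma p_C2: "Ck_on 2 p (-{0})"
proof (rule Ck_on_cong[OF open_punctured])
  show "Ck_on 2 (\<lambda>x. (- (1/2)) * (fieldP a b x \<bullet> fieldP a b x + Phi (- (2 * \<alpha>)) E x)) (-{0})"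
    by (intro Ck_on_mult Ck_on_add Ck_on_inner Ck_on_const open_punctured fieldP_C2 E_C2)
  show "(- (1/2)) * (fieldP a b x \<bullet> fieldP a b x + Phi (- (2 * \<alpha>)) E x) = p x" if "x \<in> -{0}" for x
  proof -
    have "u x \<bullet> u x = fieldP a b x \<bullet> fieldP a b x + rsq x * (d x)\<^sup>2"
      unfolding u_def inner_vec3 by (simp add: rsq_def algebra_simps power2_eq_square)
    then have "u x \<bullet> u x = fieldP a b x \<bullet> fieldP a b x + Phi (- (2 * \<alpha>)) E x"
      using rsq_d[of x] that by simp
    moreover have "- (1 / 2) * y = - y / 2" for y :: real by simp
    ultimately show ?thesis unfolding p_def by (simp only:)
  qed
qed

lemma beltrami: "beltrami_classical u" and divergence_free: "x \<noteq> 0 \<Longrightarrow> divg u x = 0"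
proof -
  have J: "continuous_on (-{0}) (\<lambda>x. partial i u x $ j)" for i j
    unfolding partial_def by (intro continuous_on_component C1D(2)[OF u_C1])
  have uc: "continuous_on (-{0}) (\<lambda>x. u x $ j)" for j
    using Ck_on_imp_continuous_on[OF u_C1] by (intro continuous_on_component)
  have cc: "continuous_on (-{0}) (\<lambda>x. curl u x $ j)" for j
    using continuous_on_curl[OF u_C1] by (intro continuous_on_component)
  have "continuous_on (-{0}) (\<lambda>x. cross3 (curl u x) (u x))"
    unfolding cross3_def vector3_eq_sum
    by (intro continuous_on_add continuous_on_diff continuous_on_mult continuous_on_scaleR continuous_on_const uc cc)
  from dense_off_axis[OF this local_equations(2)] show "beltrami_classical u"
    using d\<gamma> tau_off_axis by (auto simp: beltrami_classical_def)
  have "continuous_on (-{0}) (divg u)" unfolding divg_def by (intro continuous_intros J)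
  from dense_off_axis[OF this local_equations(1)] show "x \<noteq> 0 \<Longrightarrow> divg u x = 0"
    using d\<gamma> tau_off_axis by auto
qed

lemma solution:
  "classical_solution 1 \<alpha> u p" "\<not> irrotational_classical u"
  "Ck_on 2 (poloidal u) (-{0})" "Ck_on 1 (toroidal u) (-{0})"
proof -
  have "advection u x + grad p x = 0" if "x \<noteq> 0" for x
    unfolding p_def[abs_def]
  proof (rule euler_of_beltrami)
    show "u differentiable (at x)" using C1D(1)[OF u_C1] that unfolding differentiable_def by blast
    show "cross3 (curl u x) (u x) = 0" using beltrami that by (simp add: beltrami_classical_def)
  qed
  then have "euler_classical u p" unfolding euler_classical_def using divergence_free by simp
  moreover have "homogeneous_on (-{0}) \<alpha> u p"
    unfolding homogeneous_on_def by (intro ballI allI impI conjI) (erule homogeneous_aux)+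
  moreover have "Ck_on 1 p (-{0})" by (rule Ck_on_antimono[OF p_C2]) simp
  ultimately show "classical_solution 1 \<alpha> u p"
    unfolding classical_solution_def using u_C1 by blast
  obtain x where x: "x \<in> - z_axis" "w (tau x) \<noteq> 0" using nonzero_point by auto
  then have "curl u x \<noteq> 0" using local_equations(3) d\<gamma> tau_off_axis n_nonzero by blast
  then show "\<not> irrotational_classical u"
    using off_axis_nonzero[OF x(1)] by (auto simp: irrotational_classical_def)
  show "Ck_on 2 (poloidal u) (-{0})" "Ck_on 1 (toroidal u) (-{0})"
    unfolding u_def[abs_def] poloidal_toroidal by (rule fieldP_C2, rule fieldT_C1)
qed

end

lemma existence_classical:
  assumes "\<alpha> > 2"
  shows "\<exists>u p. classical_solution 1 \<alpha> u p \<and> beltrami_classical u \<and> \<not> irrotational_classical u \<and>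
    axisymmetric_on (-{0}) u p \<and> Ck_on 2 (poloidal u) (-{0}) \<and> Ck_on 2 p (-{0}) \<and> Ck_on 1 (toroidal u) (-{0})"
proof -
  define \<beta> where "\<beta> = \<alpha> - 2"
  have \<beta>: "\<beta> > 0" using assms by (simp add: \<beta>_def)
  then have "\<beta> * (\<beta> + 1) > 0" "2 / \<beta> > 0 \<or> (-1 < 2 / \<beta> \<and> 2 / \<beta> < 0)" by simp_all
  from profile_exists[OF this]
  obtain w w1 \<kappa> K where P: "prof (\<beta> * (\<beta> + 1)) (2 / \<beta>) (-1) 1 w w1 \<kappa> K" .
  interpret homog_profile_pos \<beta> w w1 \<kappa> K using P \<beta> by unfold_locales auto
  have "homog_profile.\<alpha> \<beta> = \<alpha>" by (simp add: \<alpha>_def) (simp add: \<beta>_def)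
  then show ?thesis using solution beltrami axisymmetric p_C2 by metis
qed

section \<open>Distributional tools\<close>

lemma axi_rsq: "axi rsq 2 0 x"
proof -
  have m: "((\<lambda>x. x$i * x$i) has_derivative (\<lambda>v. x$i * v$i + v$i * x$i)) (at x)" for i
    by (rule has_derivative_mult[OF has_derivative_nth_ident has_derivative_nth_ident])
  show ?thesis
    using has_derivative_add[OF m m]
    unfolding axi_def rsq_def[abs_def] power2_eq_square
    by (rule has_derivative_eq_rhs) (simp add: fun_eq_iff algebra_simps)
qed

lemma continuous_on_dominated:
  fixes f :: "'a::metric_space \<Rightarrow> 'b::real_normed_vector" and g :: "'a \<Rightarrow> real"
  assumes Z: "closed Z" "continuous_on (-Z) f"
    and g: "continuous_on UNIV g" "\<And>x. norm (f x) \<le> g x" "\<And>x. x \<in> Z \<Longrightarrow> g x = 0"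
  shows "continuous_on UNIV f"
proof -
  have "isCont f x" for x
  proof (cases "x \<in> Z")
    case True
    have "(g \<longlongrightarrow> g x) (at x)" using g(1) by (simp add: continuous_on_eq_continuous_at isCont_def)
    then have "(g \<longlongrightarrow> 0) (at x)" using g(3)[OF True] by simp
    then have "(f \<longlongrightarrow> 0) (at x)" by (rule Lim_null_comparison[rotated]) (simp add: g(2))
    moreover have "f x = 0" using g(2)[of x] g(3)[OF True] by simp
    ultimately show ?thesis by (simp add: isCont_def)
  next
    case False
    then show ?thesis using Z by (simp add: continuous_on_eq_continuous_at open_Compl)
  qed
  then show ?thesis by (simp add: continuous_at_imp_continuous_on)
qed

lemma continuous_Phi:
  assumes s: "s > 0" and G: "continuous_on {-1..1} G"
  shows "continuous_on UNIV (Phi s G)"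
proof -
  have "compact (G ` {-1..1})" by (rule compact_continuous_image[OF G compact_Icc])
  from compact_imp_bounded[OF this] obtain M where M: "\<And>t. t \<in> {-1..1} \<Longrightarrow> \<bar>G t\<bar> \<le> M"
    unfolding bounded_iff by (metis imageI real_norm_def)
  show ?thesis
  proof (rule continuous_on_dominated[where Z="{0}" and g="\<lambda>x. norm x powr s * M"])
    show "continuous_on (-{0}) (Phi s G)"
      unfolding Phi_def[abs_def]
      by (intro continuous_on_mult C0_tau[OF G] Ck_on_imp_continuous_on[OF Ck_on_norm_powr[of 0]])
    have "continuous_on UNIV (\<lambda>x::real^3. norm x powr s)"
      by (intro continuous_on_powr' continuous_intros) (use s in auto)
    then show "continuous_on UNIV (\<lambda>x::real^3. norm x powr s * M)"
      by (intro continuous_on_mult continuous_on_const)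
    show "norm (Phi s G x) \<le> norm x powr s * M" for x
      using M[OF tau_bounds[of x]] by (cases "x = 0") (auto simp: Phi_def abs_mult intro!: mult_left_mono)
  qed auto
qed

lemma grad_inner:
  assumes "f differentiable (at x)"
  shows "grad f x \<bullet> v = frechet_derivative f (at x) v"
proof -
  have l: "linear (frechet_derivative f (at x))"
    using assms frechet_derivative_works has_derivative_linear by blast
  have "v = v$1 *\<^sub>R axis 1 1 + v$2 *\<^sub>R axis 2 1 + v$3 *\<^sub>R axis 3 1"
    using vector3_eq_sum[of "v$1" "v$2" "v$3"] vec3_eq[of v] by simp
  then have "frechet_derivative f (at x) v = frechet_derivative f (at x) (v$1 *\<^sub>R axis 1 1 + v$2 *\<^sub>R axis 2 1 + v$3 *\<^sub>R axis 3 1)" by simp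
  then show ?thesis
    unfolding linear_add[OF l] linear_cmul[OF l] inner_vec3 grad_def partial_def by simp
qed

lemma continuous_on_grad: "Ck_on 1 f S \<Longrightarrow> continuous_on S (grad f)"
  unfolding grad_def[abs_def] partial_def by (intro continuous_on_vec_lambda C1D(2))

lemma grad_eq_0:
  assumes "open T" "x \<in> T" "\<And>y. y \<in> T \<Longrightarrow> f y = 0"
  shows "grad f x = 0"
  using frechet_derivative_eq_0[OF assms] by (simp add: grad_def partial_def vec_eq_iff)

lemma z_axis_null: "AE x in lborel. x \<notin> z_axis"
proof -
  have "z_axis \<subseteq> {x::real^3. x$1 = 0}" by (auto simp: z_axis_def)
  then have "negligible z_axis" by (rule negligible_subset[OF negligible_standard_hyperplane_cart])
  moreover have "z_axis \<in> sets lborel" using closed_z_axis by simp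
  ultimately have "z_axis \<in> null_sets lborel"
    by (simp add: negligible_iff_null_sets null_sets_completion_iff)
  then show ?thesis by (rule AE_not_in)
qed

text \<open>The axis is invisible for a bounded divergence-free field: the cutoff \<open>\<rho> (n r\<^sup>2)\<close> has a gradient
  of size \<open>sqrt n\<close> on a set of volume \<open>1 / n\<close>.\<close>
lemma integral_grad_eq_0_off_axis:
  fixes V :: "real^3 \<Rightarrow> real^3" and \<psi> :: "real^3 \<Rightarrow> real"
  assumes V: "continuous_on UNIV V" "Ck_on 1 V (- z_axis)" "\<And>x. x \<in> - z_axis \<Longrightarrow> divg V x = 0"
    and \<psi>: "Ck_on 1 \<psi> UNIV" and K: "compact K" "\<And>x. x \<notin> K \<Longrightarrow> \<psi> x = 0"
  shows "(LINT x|lborel. V x \<bullet> grad \<psi> x) = 0"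
proof -
  \<comment> \<open>A C^1 step made of two squared positive parts: 0 up to t = 1 and 1 from t = 2
    on.\<close>
  define \<rho> where "\<rho> t = sqp (1 - sqp (2 - t))" for t :: real
  define \<rho>' where "\<rho>' t = 4 * (max 0 (1 - sqp (2 - t)) * max 0 (2 - t))" for t :: real
  have \<rho>D: "(\<rho> has_real_derivative \<rho>' t) (at t)" for t
  proof -
    have "((\<lambda>t. 2 - t) has_real_derivative -1) (at t)" by (auto intro!: derivative_eq_intros)
    from DERIV_chain2[OF sqp_DERIV this]
    have "((\<lambda>t. 1 - sqp (2 - t)) has_real_derivative 0 - (2 * max 0 (2 - t) * -1)) (at t)"
      by (intro DERIV_diff DERIV_const)
    from DERIV_chain2[OF sqp_DERIV this] show ?thesis
      unfolding \<rho>_def[abs_def] by (rule DERIV_cong) (simp add: \<rho>'_def)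
  qed
  have small: "\<rho> t = 0 \<and> \<rho>' t = 0" if "t \<le> 1" for t
  proof -
    have "1 \<le> (2 - t)\<^sup>2" using that power_mono[of 1 "2 - t" 2] by simp
    then have "1 - sqp (2 - t) \<le> 0" using that by (simp add: sqp_def)
    then show ?thesis by (simp add: \<rho>_def \<rho>'_def)
  qed
  have large: "\<rho> t = 1 \<and> \<rho>' t = 0" if "2 \<le> t" for t
    using that by (simp add: \<rho>_def \<rho>'_def sqp_def)
  have \<rho>b: "0 \<le> \<rho> t" "\<rho> t \<le> 1" for t
  proof -
    show "0 \<le> \<rho> t" by (simp add: \<rho>_def)
    have "max 0 (1 - sqp (2 - t)) \<le> 1" by simp
    then show "\<rho> t \<le> 1" unfolding \<rho>_def sqp_def[of "1 - sqp (2 - t)"] by (intro power_le_one) auto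
  qed
  have \<rho>'b: "\<bar>\<rho>' t\<bar> \<le> 4" for t
  proof (cases "t \<le> 1")
    case False
    have "max 0 (1 - sqp (2 - t)) * max 0 (2 - t) \<le> 1 * 1"
      by (rule mult_mono) (use False in auto)
    moreover have "0 \<le> max 0 (1 - sqp (2 - t)) * max 0 (2 - t)" by (intro mult_nonneg_nonneg) auto
    ultimately show ?thesis by (simp add: \<rho>'_def)
  qed (use small in auto)
  define \<eta> where "\<eta> n x = \<rho> (real n * rsq x)" for n x
  \<comment> \<open>The error term: \<psi> times V applied to the gradient of the cutoff. The cutoff
    depends on r only, so just the horizontal components of V enter.\<close>
  define G where "G n x = \<psi> x * (\<rho>' (real n * rsq x) * (real n * (2 * (x$1 * V x$1 + x$2 * V x$2))))" for n x
  define F where "F x = V x \<bullet> grad \<psi> x" for x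
  have rsqC: "Ck_on k rsq UNIV" for k
    unfolding rsq_def[abs_def] power2_eq_square by (intro Ck_on_add Ck_on_mult Ck_on_nth_ident open_UNIV)
  have \<eta>C: "Ck_on 1 (\<eta> n) UNIV" for n
    unfolding \<eta>_def \<rho>_def by (intro sqp_C1 Ck_on_diff Ck_on_const Ck_on_mult rsqC open_UNIV)
  have rd: "(rsq has_derivative (\<lambda>v. 2 * (x$1 * v$1 + x$2 * v$2))) (at x)" for x
    using axi_rsq[of x] by (simp add: axi_def)
  have \<eta>d: "(\<eta> n has_derivative (\<lambda>v. \<rho>' (real n * rsq x) * (real n * (2 * (x$1 * v$1 + x$2 * v$2))))) (at x)" for n x
    using has_derivative_compose[OF has_derivative_mult_right[OF rd, where x="real n"] has_field_derivative_imp_has_derivative[OF \<rho>D]]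
    unfolding \<eta>_def[abs_def] .
  have \<psi>d: "\<psi> differentiable (at x)" for x using C1D(1)[OF \<psi>, of x] unfolding differentiable_def by blast
  have oK: "open (- K)" using K(1) by (simp add: compact_imp_closed open_Compl)
  have F: "continuous_on UNIV F" unfolding F_def by (intro continuous_intros V(1) continuous_on_grad \<psi>)
  have F0: "F x = 0" if "x \<notin> K" for x using grad_eq_0[OF oK, of x \<psi>] that K(2) by (simp add: F_def)
  have Fi: "integrable lborel F" by (rule integrable_continuous_compact_support[OF F K(1) F0])
  have \<eta>cont: "continuous_on UNIV (\<eta> n)" for n by (rule Ck_on_imp_continuous_on[OF \<eta>C])
  have G: "continuous_on UNIV (G n)" for n
  proof -
    have "continuous_on UNIV \<rho>'" unfolding \<rho>'_def sqp_def by (intro continuous_intros)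
    then have 1: "continuous_on UNIV (\<lambda>x. \<rho>' (real n * rsq x))"
      by (rule continuous_on_compose2) (auto intro!: continuous_intros Ck_on_imp_continuous_on[OF rsqC[of 0]])
    have 2: "continuous_on UNIV (\<lambda>x::real^3. x $ i)" "continuous_on UNIV (\<lambda>x. V x $ i)" for i
      by (intro continuous_on_component continuous_on_id V(1))+
    show ?thesis unfolding G_def
      by (intro continuous_on_mult continuous_on_add continuous_on_const 1 2 Ck_on_imp_continuous_on[OF \<psi>])
  qed
  have G0: "G n x = 0" if "x \<notin> K" for n x using K(2)[OF that] by (simp add: G_def)
  have Gi: "integrable lborel (G n)" for n by (rule integrable_continuous_compact_support[OF G K(1) G0])
  have \<eta>Fi: "integrable lborel (\<lambda>x. \<eta> n x * F x)" for n
    by (rule integrable_continuous_compact_support[OF continuous_on_mult[OF \<eta>cont F] K(1)]) (simp add: F0)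
  have ibp: "(LINT x|lborel. \<eta> n x * F x) = - (LINT x|lborel. G n x)" for n
  proof -
    define L where "L = K \<inter> {x. 1 \<le> real n * rsq x}"
    have "closed {x. 1 \<le> real n * rsq x}"
      by (intro closed_Collect_le continuous_intros Ck_on_imp_continuous_on[OF rsqC[of 0]])
    then have L: "compact L" unfolding L_def using K(1) by (rule compact_Int_closed[rotated])
    have Lz: "L \<subseteq> - z_axis" by (auto simp: L_def z_axis_rsq)
    have C: "Ck_on 1 (\<lambda>x. \<eta> n x * \<psi> x) UNIV" by (intro Ck_on_mult open_UNIV \<eta>C \<psi>)
    have z: "\<eta> n x * \<psi> x = 0" if "x \<notin> L" for x
      using that K(2)[of x] small[of "real n * rsq x"] by (auto simp: L_def \<eta>_def)
    have e: "grad (\<lambda>x. \<eta> n x * \<psi> x) x \<bullet> V x + \<eta> n x * \<psi> x * divg V x = \<eta> n x * F x + G n x" for x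
    proof -
      have "((\<lambda>x. \<eta> n x * \<psi> x) has_derivative (\<lambda>v. \<eta> n x * frechet_derivative \<psi> (at x) v +
          \<rho>' (real n * rsq x) * (real n * (2 * (x$1 * v$1 + x$2 * v$2))) * \<psi> x)) (at x)" (is "(_ has_derivative ?D) _")
        using has_derivative_mult[OF \<eta>d C1D(1)[OF \<psi> UNIV_I]] .
      then have d: "(\<lambda>x. \<eta> n x * \<psi> x) differentiable (at x)" "frechet_derivative (\<lambda>x. \<eta> n x * \<psi> x) (at x) = ?D"
        using frechet_derivative_at[symmetric] unfolding differentiable_def by blast+
      have "\<eta> n x * \<psi> x * divg V x = 0"
        using V(3)[of x] small[of "real n * rsq x"] by (cases "x \<in> z_axis") (auto simp: \<eta>_def z_axis_rsq)
      moreover have "frechet_derivative \<psi> (at x) (V x) = F x"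
        unfolding F_def inner_commute[of "V x"] grad_inner[OF \<psi>d] ..
      ultimately show ?thesis unfolding grad_inner[OF d(1)] d(2) by (simp add: G_def)
    qed
    have "(LINT x|lborel. \<eta> n x * F x + G n x) = 0"
      using integral_by_parts_divg[OF open_off_axis V(2) C L Lz z] unfolding e .
    then show ?thesis using \<eta>Fi Gi by simp
  qed
  have lim1: "(\<lambda>n. LINT x|lborel. \<eta> n x * F x) \<longlonglongrightarrow> (LINT x|lborel. F x)"
  proof (rule integral_dominated_convergence[where w="\<lambda>x. \<bar>F x\<bar>"])
    show "integrable lborel (\<lambda>x. \<bar>F x\<bar>)" using Fi by simp
    show "AE x in lborel. norm (\<eta> n x * F x) \<le> \<bar>F x\<bar>" for n
      using mult_right_mono[OF \<rho>b(2), of "\<bar>F _\<bar>"] \<rho>b(1) by (simp add: \<eta>_def abs_mult)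
    show "AE x in lborel. (\<lambda>n. \<eta> n x * F x) \<longlonglongrightarrow> F x"
      using z_axis_null
    proof eventually_elim
      case (elim x)
      then have r: "rsq x > 0" using rsq_nonneg[of x] by (auto simp: z_axis_rsq)
      obtain N where N: "2 / rsq x < real N" using reals_Archimedean2 by blast
      have "\<eta> n x * F x = F x" if "n \<ge> N" for n
      proof -
        have "2 / rsq x \<le> real n" using N that by linarith
        then have "2 \<le> real n * rsq x" using r by (simp add: field_simps)
        then show ?thesis using large by (simp add: \<eta>_def)
      qed
      then show ?case by (intro tendsto_eventually) (auto simp: eventually_sequentially)
    qed
  qed (use \<eta>Fi Fi in auto)
  obtain R where R: "\<And>x. x \<in> K \<Longrightarrow> norm x \<le> R" "R > 0"
    using compact_imp_bounded[OF K(1)] unfolding bounded_pos by blast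
  obtain M where M: "\<And>x. x \<in> K \<Longrightarrow> \<bar>\<psi> x * norm (V x)\<bar> \<le> M" "M > 0"
  proof -
    have "continuous_on K (\<lambda>x. \<psi> x * norm (V x))"
      by (rule continuous_on_subset[OF _ subset_UNIV]) (intro continuous_intros V(1) Ck_on_imp_continuous_on[OF \<psi>])
    from compact_imp_bounded[OF compact_continuous_image[OF this K(1)]] show thesis
      using that unfolding bounded_pos by auto
  qed
  \<comment> \<open>On the support \<open>rsq x \<le> s^2\<close>, with \<open>n s^2 = 2\<close>.
    The integrand is at most 8 M n s on a box of volume 8 s^2 R, in total 128 M R s.\<close>
  have bound: "\<bar>LINT x|lborel. G n x\<bar> \<le> 128 * M * R * sqrt (2 / real n)" if n: "n > 0" for n
  proof -
    define s where "s = sqrt (2 / real n)"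
    have s: "s > 0" "s\<^sup>2 = 2 / real n" using n by (simp_all add: s_def)
    define Q where "Q = cbox (vector [-s, -s, -R] :: real^3) (vector [s, s, R])"
    have Gb: "\<bar>G n x\<bar> \<le> indicator Q x * (8 * M * real n * s)" for x
    proof (cases "x \<in> K \<and> rsq x \<le> s\<^sup>2")
      case True
      have r: "sqrt (rsq x) \<le> s" using real_sqrt_le_mono[of "rsq x" "s\<^sup>2"] True s(1) by simp
      have "(x$1)\<^sup>2 \<le> s\<^sup>2" "(x$2)\<^sup>2 \<le> s\<^sup>2" using True by (auto simp: rsq_def intro: order_trans[rotated])
      then have "\<bar>x$1\<bar> \<le> s" "\<bar>x$2\<bar> \<le> s" using s(1) abs_le_square_iff[of _ s] by auto
      moreover have "\<bar>x$3\<bar> \<le> R" using R(1) True component_le_norm_cart[of x 3] by force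
      ultimately have "x \<in> Q" unfolding Q_def mem_box_cart forall_3 by auto
      have "(x$1 * V x$1 + x$2 * V x$2)\<^sup>2 \<le> rsq x * (norm (V x))\<^sup>2"
      proof -
        have "(p * p' + r * r')\<^sup>2 \<le> (p\<^sup>2 + r\<^sup>2) * (p'\<^sup>2 + r'\<^sup>2 + k\<^sup>2)" for p p' r r' k :: real
        proof -
          have "(p\<^sup>2 + r\<^sup>2) * (p'\<^sup>2 + r'\<^sup>2 + k\<^sup>2) - (p * p' + r * r')\<^sup>2 = (p * r' - r * p')\<^sup>2 + (p\<^sup>2 + r\<^sup>2) * k\<^sup>2"
            by (simp add: power2_eq_square algebra_simps)
          moreover have "0 \<le> (p * r' - r * p')\<^sup>2 + (p\<^sup>2 + r\<^sup>2) * k\<^sup>2" by simp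
          ultimately show ?thesis by linarith
        qed
        then show ?thesis unfolding norm_sq3 rsq_def .
      qed
      from real_sqrt_le_mono[OF this] have "\<bar>x$1 * V x$1 + x$2 * V x$2\<bar> \<le> sqrt (rsq x) * norm (V x)"
        by (simp add: real_sqrt_mult)
      also have "\<dots> \<le> s * norm (V x)" by (rule mult_right_mono[OF r]) simp
      finally have c: "\<bar>x$1 * V x$1 + x$2 * V x$2\<bar> \<le> s * norm (V x)" .
      have "\<bar>G n x\<bar> = \<bar>\<psi> x\<bar> * (\<bar>\<rho>' (real n * rsq x)\<bar> * (2 * real n * \<bar>x$1 * V x$1 + x$2 * V x$2\<bar>))"
        unfolding G_def by (simp add: abs_mult del: distrib_left_numeral)
      also have "\<dots> \<le> \<bar>\<psi> x\<bar> * (4 * (2 * real n * (s * norm (V x))))"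
        using \<rho>'b c by (intro mult_left_mono mult_mono) auto
      also have "\<dots> = \<bar>\<psi> x * norm (V x)\<bar> * (8 * real n * s)" by (simp add: abs_mult)
      also have "\<dots> \<le> M * (8 * real n * s)" using M(1) True s(1) by (intro mult_right_mono) auto
      finally show ?thesis using \<open>x \<in> Q\<close> by (simp add: mult_ac)
    next
      case False
      have "G n x = 0"
      proof (cases "x \<in> K")
        case True
        then have "2 / real n < rsq x" using False s(2) by simp
        then have "2 \<le> real n * rsq x" using n by (simp add: field_simps)
        then show ?thesis using large by (simp add: G_def)
      qed (use G0 in auto)
      then show ?thesis using M(2) s(1) by (simp add: indicator_def)
    qed
    have Qi: "integrable lborel (\<lambda>x. indicator Q x * (8 * M * real n * s) :: real)"
      unfolding Q_def by (intro integrable_mult_left integrable_real_indicator emeasure_lborel_cbox_finite) auto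
    have "\<bar>LINT x|lborel. G n x\<bar> \<le> (LINT x|lborel. \<bar>G n x\<bar>)"
      using integral_norm_bound[of lborel "G n"] by simp
    also have "\<dots> \<le> (LINT x|lborel. indicator Q x * (8 * M * real n * s))"
      by (rule integral_mono) (use Gi Qi Gb in auto)
    also have "\<dots> = measure lborel Q * (8 * M * real n * s)" unfolding Q_def by simp
    also have "measure lborel Q = 2 * s * (2 * s) * (2 * R)"
    proof -
      have "(0::real^3) \<in> Q" unfolding Q_def mem_box_cart forall_3 using s(1) R(2) by auto
      then have "Q \<noteq> {}" by auto
      have prod3: "prod f UNIV = f 1 * f 2 * f 3" for f :: "3 \<Rightarrow> real"
        unfolding UNIV_3 by (simp add: mult.assoc)
      show ?thesis
        using content_cbox_cart[OF \<open>Q \<noteq> {}\<close>[unfolded Q_def]]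
        unfolding Q_def[symmetric] prod3 vector_3 by simp
    qed
    also have "2 * s * (2 * s) * (2 * R) * (8 * M * real n * s) = 64 * M * R * s * (real n * s\<^sup>2)"
      by (simp add: power2_eq_square)
    also have "real n * s\<^sup>2 = 2" using s(2) n by simp
    finally show ?thesis by (simp add: s_def)
  qed
  have "(\<lambda>n. LINT x|lborel. G n x) \<longlonglongrightarrow> 0"
  proof (rule Lim_null_comparison)
    show "\<forall>\<^sub>F n in sequentially. norm (LINT x|lborel. G n x) \<le> 128 * M * R * sqrt (2 * inverse (real n))"
      using eventually_gt_at_top[of 0] by eventually_elim (use bound in \<open>auto simp: divide_inverse\<close>)
    have "(\<lambda>n. 128 * M * R * sqrt (2 * inverse (real n))) \<longlonglongrightarrow> 128 * M * R * sqrt (2 * 0)"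
      by (intro tendsto_intros lim_inverse_n)
    then show "(\<lambda>n. 128 * M * R * sqrt (2 * inverse (real n))) \<longlonglongrightarrow> 0" by simp
  qed
  then have "(\<lambda>n. - (LINT x|lborel. G n x)) \<longlonglongrightarrow> - 0" by (rule tendsto_minus)
  with lim1 have "(LINT x|lborel. F x) = - 0" unfolding ibp by (rule LIMSEQ_unique)
  then show ?thesis by (simp add: F_def)
qed

text \<open>The damping factor tends to 1 where \<open>s\<close> is nonzero, and V vanishes
  elsewhere; dominated convergence removes the cutoff from the identity for the damped
  field.\<close>

lemma integral_grad_eq_0_regularized:
  fixes V :: "real^3 \<Rightarrow> real^3" and \<psi> s :: "real^3 \<Rightarrow> real"
  assumes V: "continuous_on UNIV V" and s: "continuous_on UNIV s" "\<And>x. s x = 0 \<Longrightarrow> V x = 0"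
    and C: "\<And>e. e > 0 \<Longrightarrow> Ck_on 1 (\<lambda>x. ((s x)\<^sup>2 / ((s x)\<^sup>2 + e)) *\<^sub>R V x) (- z_axis)"
    and div: "\<And>e x. e > 0 \<Longrightarrow> x \<in> - z_axis \<Longrightarrow> divg (\<lambda>x. ((s x)\<^sup>2 / ((s x)\<^sup>2 + e)) *\<^sub>R V x) x = 0"
    and \<psi>: "Ck_on 1 \<psi> UNIV" and K: "compact K" "\<And>x. x \<notin> K \<Longrightarrow> \<psi> x = 0"
  shows "(LINT x|lborel. V x \<bullet> grad \<psi> x) = 0"
proof -
  define k where "k e x = (s x)\<^sup>2 / ((s x)\<^sup>2 + e)" for e x
  define F where "F x = V x \<bullet> grad \<psi> x" for x
  define e where "e n = inverse (real (Suc n))" for n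
  have e: "e n > 0" for n by (simp add: e_def)
  have oK: "open (- K)" using K(1) by (simp add: compact_imp_closed open_Compl)
  have F: "continuous_on UNIV F" unfolding F_def by (intro continuous_intros V(1) continuous_on_grad \<psi>)
  have F0: "F x = 0" if "x \<notin> K" for x using grad_eq_0[OF oK, of x \<psi>] that K(2) by (simp add: F_def)
  have Fi: "integrable lborel F" by (rule integrable_continuous_compact_support[OF F K(1) F0])
  have pos: "(s x)\<^sup>2 + e n > 0" for n x using e[of n] by (simp add: add_nonneg_pos)
  have kc: "continuous_on UNIV (k (e n))" for n
    unfolding k_def by (intro continuous_intros s(1)) (use pos less_imp_neq in \<open>metis UNIV_I\<close>)
  have kb: "0 \<le> k (e n) x" "k (e n) x \<le> 1" for n x
    using pos[of x n] e[of n] by (simp_all add: k_def)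
  have kFi: "integrable lborel (\<lambda>x. k (e n) x * F x)" for n
    by (rule integrable_continuous_compact_support[OF continuous_on_mult[OF kc F] K(1)]) (simp add: F0)
  have "(LINT x|lborel. k (e n) x * F x) = 0" for n
    using integral_grad_eq_0_off_axis[OF continuous_on_scaleR[OF kc V] C[OF e, folded k_def] div[OF e, folded k_def] \<psi> K]
    by (simp add: F_def)
  moreover have "(\<lambda>n. LINT x|lborel. k (e n) x * F x) \<longlonglongrightarrow> (LINT x|lborel. F x)"
  proof (rule integral_dominated_convergence[where w="\<lambda>x. \<bar>F x\<bar>"])
    show "integrable lborel (\<lambda>x. \<bar>F x\<bar>)" using Fi by simp
    show "AE x in lborel. norm (k (e n) x * F x) \<le> \<bar>F x\<bar>" for n
      using mult_right_mono[OF kb(2), of "\<bar>F _\<bar>"] kb(1) by (simp add: abs_mult)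
    have "(\<lambda>n. k (e n) x * F x) \<longlonglongrightarrow> F x" for x
    proof (cases "s x = 0")
      case True
      then show ?thesis using s(2) by (simp add: F_def)
    next
      case False
      have "(\<lambda>n. k (e n) x * F x) \<longlonglongrightarrow> (s x)\<^sup>2 / ((s x)\<^sup>2 + 0) * F x"
        unfolding k_def e_def by (intro tendsto_intros LIMSEQ_inverse_real_of_nat) (use False in auto)
      then show ?thesis using False by simp
    qed
    then show "AE x in lborel. (\<lambda>n. k (e n) x * F x) \<longlonglongrightarrow> F x" by simp
  qed (use kFi Fi in auto)
  ultimately show ?thesis by (simp add: F_def LIMSEQ_const_iff)
qed

section \<open>Smooth bumps and the detection of vorticity\<close>

text \<open>The classical function exp (-1/t) with powers of 1/t in front: differentiation stays
  within the linear span of this family.\<close>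

definition flat :: "nat \<Rightarrow> real \<Rightarrow> real" where
  "flat k t = (if t > 0 then inverse t ^ k * exp (- inverse t) else 0)"

lemma flat_tendsto_0: "(flat k \<longlongrightarrow> 0) (at 0)"
proof -
  have "((\<lambda>y::real. y ^ k / exp y) \<longlongrightarrow> 0) at_top" by (rule tendsto_power_div_exp_0)
  from filterlim_compose[OF this filterlim_inverse_at_top_right]
  have "((\<lambda>t::real. inverse t ^ k / exp (inverse t)) \<longlongrightarrow> 0) (at_right 0)" .
  moreover have "\<forall>\<^sub>F t in at_right 0. inverse t ^ k / exp (inverse t) = flat k t"
    unfolding eventually_at_right_field by (intro exI[of _ 1]) (auto simp: flat_def exp_minus divide_inverse)
  ultimately have r: "(flat k \<longlongrightarrow> 0) (at_right 0)" by (rule Lim_transform_eventually)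
  have "\<forall>\<^sub>F t in at_left 0. 0 = flat k t"
    unfolding eventually_at_left_field by (intro exI[of _ "-1"]) (auto simp: flat_def)
  with tendsto_const have "(flat k \<longlongrightarrow> 0) (at_left 0)" by (rule Lim_transform_eventually)
  then show ?thesis using r filterlim_split_at_real by blast
qed

lemma flat_DERIV: "(flat k has_real_derivative - real k * flat (Suc k) t + flat (Suc (Suc k)) t) (at t)"
proof -
  consider "t > 0" | "t < 0" | "t = 0" by linarith
  then show ?thesis
  proof cases
    case 1
    have i: "(inverse has_real_derivative - (inverse t * inverse t)) (at t)"
      using DERIV_inverse[of t] 1 by (simp add: power2_eq_square power_Suc)
    have "((\<lambda>t. inverse t ^ k * exp (- inverse t)) has_real_derivative
        - real k * (inverse t ^ Suc k * exp (- inverse t)) + inverse t ^ Suc (Suc k) * exp (- inverse t)) (at t)"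
    proof (rule DERIV_cong)
      show "((\<lambda>t. inverse t ^ k * exp (- inverse t)) has_real_derivative
        (real k * (- (inverse t * inverse t) * inverse t ^ (k - Suc 0))) * exp (- inverse t) +
        (exp (- inverse t) * - (- (inverse t * inverse t))) * inverse t ^ k) (at t)"
        by (intro DERIV_mult DERIV_power i DERIV_fun_exp DERIV_minus)
      show "(real k * (- (inverse t * inverse t) * inverse t ^ (k - Suc 0))) * exp (- inverse t) +
        (exp (- inverse t) * - (- (inverse t * inverse t))) * inverse t ^ k =
        - real k * (inverse t ^ Suc k * exp (- inverse t)) + inverse t ^ Suc (Suc k) * exp (- inverse t)"
        by (cases k) (simp_all add: algebra_simps)
    qed
    then have "((\<lambda>t. inverse t ^ k * exp (- inverse t)) has_real_derivative
        - real k * flat (Suc k) t + flat (Suc (Suc k)) t) (at t)" using 1 by (simp add: flat_def)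
    then show ?thesis
      by (rule has_field_derivative_transform_within_open[of _ _ _ "{0<..}"]) (use 1 in \<open>auto simp: flat_def\<close>)
  next
    case 2
    show ?thesis
      by (rule has_field_derivative_transform_within_open[of "\<lambda>_. 0" _ _ "{..<0}"]) (use 2 in \<open>auto simp: flat_def\<close>)
  next
    case 3
    have "flat (Suc k) h = flat k h / h" for h by (simp add: flat_def divide_inverse)
    then have "flat (Suc k) = (\<lambda>h. flat k h / h)" by blast
    then have "((\<lambda>h. flat k h / h) \<longlongrightarrow> 0) (at 0)" using flat_tendsto_0[of "Suc k"] by simp
    then show ?thesis using 3 by (simp add: DERIV_def flat_def)
  qed
qed

lemma Ck_on_flat:
  fixes f :: "'a::real_normed_vector \<Rightarrow> real"
  assumes S: "open S" and f: "\<And>j. Ck_on j f S"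
  shows "Ck_on j (\<lambda>x. flat k (f x)) S"
proof (induction j arbitrary: k)
  case 0
  have "continuous_on UNIV (flat k)" using flat_DERIV DERIV_isCont continuous_at_imp_continuous_on by blast
  then show ?case using Ck_on_imp_continuous_on[OF f] continuous_on_compose2 by fastforce
next
  case (Suc j)
  show ?case
  proof (rule Ck_on_SucI[OF S])
    show "((\<lambda>x. flat k (f x)) has_derivative
        (\<lambda>v. (- real k * flat (Suc k) (f x) + flat (Suc (Suc k)) (f x)) * frechet_derivative f (at x) v)) (at x)"
      if "x \<in> S" for x
      using has_derivative_compose[OF Ck_on_SucD(1)[OF f that] has_field_derivative_imp_has_derivative[OF flat_DERIV]] .
    show "Ck_on j (\<lambda>x. (- real k * flat (Suc k) (f x) + flat (Suc (Suc k)) (f x)) * frechet_derivative f (at x) v) S" for v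
      by (intro Ck_on_mult Ck_on_add Ck_on_const S Suc.IH Ck_on_SucD(2)[OF f])
  qed
qed

lemma bump_exists:
  fixes x0 :: "'a::euclidean_space"
  assumes "r > 0"
  obtains \<eta> :: "'a \<Rightarrow> real" where "\<And>j. Ck_on j \<eta> UNIV" "\<And>x. 0 \<le> \<eta> x" "\<And>x. x \<notin> cball x0 r \<Longrightarrow> \<eta> x = 0" "\<eta> x0 > 0"
proof -
  define \<eta> where "\<eta> x = flat 0 (r\<^sup>2 - (x - x0) \<bullet> (x - x0))" for x
  have C: "Ck_on j (\<lambda>x. r\<^sup>2 - (x - x0) \<bullet> (x - x0)) UNIV" for j
    by (intro Ck_on_diff Ck_on_const Ck_on_inner Ck_on_bounded_linear bounded_linear_ident open_UNIV)
  show thesis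
  proof (rule that)
    show "Ck_on j \<eta> UNIV" for j unfolding \<eta>_def[abs_def] by (rule Ck_on_flat[OF open_UNIV C])
    show "0 \<le> \<eta> x" for x by (simp add: \<eta>_def flat_def)
    show "\<eta> x = 0" if "x \<notin> cball x0 r" for x
    proof -
      have "r < norm (x - x0)" using that by (simp add: dist_norm norm_minus_commute)
      then have "r\<^sup>2 \<le> (norm (x - x0))\<^sup>2" using assms by (intro power_mono) auto
      then show ?thesis by (simp add: \<eta>_def flat_def dot_square_norm)
    qed
    show "\<eta> x0 > 0" using assms by (simp add: \<eta>_def flat_def)
  qed
qed

text \<open>Test with a bump times the constant vector \<open>c = curl u x0\<close>. Since
  \<open>div (c \<times> u) = - c \<sqdot> curl u\<close>, integration by parts makes the integral
  of the bump times \<open>c \<sqdot> curl u\<close> zero, but near \<open>x0\<close> this integrand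
  is positive.\<close>

lemma rotational_weak:
  assumes S: "open S" "x0 \<in> S" and u: "Ck_on 1 u S" and c: "curl u x0 \<noteq> 0"
  shows "\<not> irrotational_weak u"
proof
  assume irr: "irrotational_weak u"
  define c where "c = curl u x0"
  define f where "f x = c \<bullet> curl u x" for x
  have fc: "continuous_on S f" unfolding f_def by (intro continuous_intros continuous_on_curl u)
  have "f x0 > 0" using assms(4) by (simp add: f_def c_def)
  then have "\<exists>r>0. cball x0 r \<subseteq> S \<and> (\<forall>x\<in>cball x0 r. f x > 0)"
  proof -
    have "open (S \<inter> f -` {0<..})" by (rule continuous_open_preimage[OF fc S(1)]) simp
    moreover have "x0 \<in> S \<inter> f -` {0<..}" using S(2) \<open>f x0 > 0\<close> by simp
    ultimately obtain r where "r > 0" "cball x0 r \<subseteq> S \<inter> f -` {0<..}" using open_contains_cball by blast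
    then show ?thesis by (intro exI[of _ r]) auto
  qed
  then obtain r where r: "r > 0" "cball x0 r \<subseteq> S" "\<And>x. x \<in> cball x0 r \<Longrightarrow> f x > 0" by blast
  obtain \<eta> :: "real^3 \<Rightarrow> real" where \<eta>: "\<And>j. Ck_on j \<eta> UNIV" "\<And>x. 0 \<le> \<eta> x" "\<And>x. x \<notin> cball x0 r \<Longrightarrow> \<eta> x = 0" "\<eta> x0 > 0"
    using bump_exists[OF r(1), of x0] by blast
  have \<eta>d: "\<eta> differentiable (at x)" for x using C1D(1)[OF \<eta>(1) UNIV_I] unfolding differentiable_def by blast
  have "test_function (\<lambda>x. \<eta> x *\<^sub>R c)"
    unfolding test_function_def
  proof
    show "\<forall>k. Ck_on k (\<lambda>x. \<eta> x *\<^sub>R c) UNIV" by (intro allI Ck_on_scaleR Ck_on_const open_UNIV \<eta>(1))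
    have "closure {x. \<eta> x *\<^sub>R c \<noteq> 0} \<subseteq> cball x0 r"
      by (rule closure_minimal) (use \<eta>(3) in fastforce)+
    then show "compact (closure {x. \<eta> x *\<^sub>R c \<noteq> 0})"
      using bounded_subset[OF bounded_cball] by (simp add: compact_eq_bounded_closed)
  qed
  then have "(LINT x|lborel. u x \<bullet> curl (\<lambda>x. \<eta> x *\<^sub>R c) x) = 0" using irr by (simp add: irrotational_weak_def)
  moreover have "u x \<bullet> curl (\<lambda>x. \<eta> x *\<^sub>R c) x = grad \<eta> x \<bullet> cross3 c (u x)" for x
  proof -
    have "((\<lambda>x. \<eta> x *\<^sub>R c) has_derivative (\<lambda>v. frechet_derivative \<eta> (at x) v *\<^sub>R c)) (at x)"
      by (intro has_derivative_scaleR_left C1D(1)[OF \<eta>(1) UNIV_I])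
    from partial_eqI[OF this] have "partial i (\<lambda>x. \<eta> x *\<^sub>R c) x $ j = grad \<eta> x $ i * c $ j" for i j
      by (simp add: grad_def partial_def)
    then show ?thesis unfolding curl_def inner_vec3 cross3_def by (simp add: algebra_simps)
  qed
  ultimately have 1: "(LINT x|lborel. grad \<eta> x \<bullet> cross3 c (u x)) = 0" by simp
  have V: "Ck_on 1 (\<lambda>x. cross3 c (u x)) S"
    unfolding cross3_def
    by (intro Ck_on_vector3 Ck_on_diff Ck_on_mult Ck_on_const Ck_on_nth S u)
  have dV: "divg (\<lambda>x. cross3 c (u x)) x = - f x" if "x \<in> S" for x
  proof -
    have d: "(u has_derivative frechet_derivative u (at x)) (at x)" by (rule C1D(1)[OF u that])
    have "bounded_linear (cross3 c)"
      using bilinear_cross unfolding bilinear_def by (auto simp: linear_conv_bounded_linear)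
    from partial_eqI[OF bounded_linear.has_derivative[OF this d]]
    have "partial i (\<lambda>x. cross3 c (u x)) x = cross3 c (partial i u x)" for i by (simp add: partial_def)
    then show ?thesis unfolding divg_def sum_3 f_def inner_vec3 curl_def cross3_def by (simp add: algebra_simps)
  qed
  have 2: "(LINT x|lborel. grad \<eta> x \<bullet> cross3 c (u x) + \<eta> x * divg (\<lambda>x. cross3 c (u x)) x) = 0"
    by (rule integral_by_parts_divg[OF S(1) V \<eta>(1) compact_cball r(2) \<eta>(3)])
  define h where "h x = (if x \<in> S then \<eta> x * f x else 0)" for x
  have h0: "h x = 0" if "x \<notin> cball x0 r" for x using \<eta>(3)[OF that] by (simp add: h_def)
  have hc: "continuous_on UNIV h"
  proof -
    have "continuous_on S h"
      by (rule continuous_on_eq[of _ "\<lambda>x. \<eta> x * f x"])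
        (auto simp: h_def intro!: continuous_on_mult fc continuous_on_subset[OF Ck_on_imp_continuous_on[OF \<eta>(1)[of 0]]])
    moreover have "continuous_on (- cball x0 r) h"
      by (rule continuous_on_eq[of _ "\<lambda>x. 0"]) (use h0 in auto)
    ultimately have "continuous_on (S \<union> - cball x0 r) h"
      by (intro continuous_on_open_Un S) auto
    moreover have "S \<union> - cball x0 r = UNIV" using r(2) by auto
    ultimately show ?thesis by simp
  qed
  have hi: "integrable lborel h" by (rule integrable_continuous_compact_support[OF hc compact_cball h0])
  have e: "\<eta> x * divg (\<lambda>x. cross3 c (u x)) x = - h x" for x
  proof (cases "x \<in> S")
    case False
    then have "x \<notin> cball x0 r" using r(2) by blast
    from \<eta>(3)[OF this] show ?thesis using False by (simp add: h_def)
  qed (simp add: h_def dV)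
  have gi: "integrable lborel (\<lambda>x. grad \<eta> x \<bullet> cross3 c (u x))"
  proof -
    have o: "open (- cball x0 r)" by auto
    have "grad \<eta> x = 0" if "x \<notin> cball x0 r" for x using grad_eq_0[OF o, of x \<eta>] that \<eta>(3) by simp
    then have z: "grad \<eta> x \<bullet> cross3 c (u x) = 0" if "x \<notin> cball x0 r" for x using that by simp
    have "continuous_on S (\<lambda>x. grad \<eta> x \<bullet> cross3 c (u x))"
      by (intro continuous_intros continuous_on_subset[OF continuous_on_grad[OF \<eta>(1)]] Ck_on_imp_continuous_on[OF V]) auto
    moreover have "continuous_on (- cball x0 r) (\<lambda>x. grad \<eta> x \<bullet> cross3 c (u x))"
      by (rule continuous_on_eq[of _ "\<lambda>x. 0"]) (use z in auto)
    ultimately have "continuous_on (S \<union> - cball x0 r) (\<lambda>x. grad \<eta> x \<bullet> cross3 c (u x))"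
      by (intro continuous_on_open_Un S) auto
    moreover have "S \<union> - cball x0 r = UNIV" using r(2) by auto
    ultimately show ?thesis using integrable_continuous_compact_support[OF _ compact_cball z] by simp
  qed
  have "(LINT x|lborel. h x) = 0" using 1 2 gi hi unfolding e by simp
  moreover have "0 \<le> h x" for x using \<eta>(2,3)[of x] r(3)[of x] by (cases "x \<in> cball x0 r") (auto simp: h_def)
  ultimately have "h x0 = 0" using integral_eq_0_imp_eq_0[OF hc compact_cball h0] by blast
  then show False using \<eta>(4) \<open>f x0 > 0\<close> S(2) by (simp add: h_def)
qed

section \<open>Distributional solutions\<close>

lemma axi_mult:
  assumes "axi f fs fz x" "axi g gs gz x"
  shows "axi (\<lambda>x. f x * g x) (f x * gs + fs * g x) (f x * gz + fz * g x) x"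
  using has_derivative_mult[OF assms[unfolded axi_def]] unfolding axi_def
  by (rule has_derivative_eq_rhs) (simp add: fun_eq_iff algebra_simps)

lemma axi_add:
  assumes "axi f fs fz x" "axi g gs gz x"
  shows "axi (\<lambda>x. f x + g x) (fs + gs) (fz + gz) x"
  using has_derivative_add[OF assms[unfolded axi_def]] unfolding axi_def
  by (rule has_derivative_eq_rhs) (simp add: fun_eq_iff algebra_simps)

lemma axi_cmult:
  assumes "axi f fs fz x"
  shows "axi (\<lambda>x. c * f x) (c * fs) (c * fz) x"
  using has_derivative_mult_right[OF assms[unfolded axi_def], of c] unfolding axi_def
  by (rule has_derivative_eq_rhs) (simp add: fun_eq_iff algebra_simps)

lemma axi_compose:
  assumes "axi f fs fz x" "(G has_real_derivative g) (at (f x))"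
  shows "axi (\<lambda>x. G (f x)) (g * fs) (g * fz) x"
  using has_derivative_compose[OF assms(1)[unfolded axi_def] has_field_derivative_imp_has_derivative[OF assms(2)]]
  unfolding axi_def by (rule has_derivative_eq_rhs) (simp add: fun_eq_iff algebra_simps)

lemma axi_cong:
  assumes "axi f fs fz x" "x \<in> - z_axis" "\<And>y. y \<in> - z_axis \<Longrightarrow> f y = g y"
  shows "axi g fs fz x"
  using assms(1) unfolding axi_def
  by (rule has_derivative_transform_within_open[OF _ open_off_axis]) (use assms(2,3) in auto)

lemma divg_vector3:
  assumes "(f has_derivative f') (at x)" "(g has_derivative g') (at x)" "(h has_derivative h') (at x)"
  shows "divg (\<lambda>y. vector [f y, g y, h y]) x = f' (axis 1 1) + g' (axis 2 1) + h' (axis 3 1)"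
  unfolding divg_def sum_3 partial_eqI[OF has_derivative_vector3[OF assms]] by simp

lemma divg_fieldP: "axi a as az x \<Longrightarrow> axi b bs bz x \<Longrightarrow> divg (fieldP a b) x = 2 * a x + rsq x * as + bz"
  unfolding divg_def sum_3 partial_eqI[OF fieldP_derivative]
  by (simp add: axis_def rsq_def algebra_simps power2_eq_square)

lemma divg_fieldT: "axi d ds dz x \<Longrightarrow> divg (fieldT d) x = 0"
  unfolding divg_def sum_3 partial_eqI[OF fieldT_derivative]
  by (simp add: axis_def algebra_simps)

text \<open>For M = a^2, Q = a b, B = b^2, S = d^2 and pressure P, these are the rows of the part of
  the momentum tensor that is even in \<open>u^phi\<close>.\<close>

lemma divg_stress:
  assumes M: "axi M Ms Mz x" and Q: "axi Q Qs Qz x" and B: "axi B Bs Bz x" and S: "axi S Ss Sz x" and P: "axi P Ps Pz x"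
  shows "divg (\<lambda>y. vector [y$1 * y$1 * M y + y$2 * y$2 * S y + P y, y$1 * y$2 * (M y - S y), y$1 * Q y]) x =
      x$1 * (3 * M x - S x + rsq x * Ms + Ps + Qz)" (is ?A)
    "divg (\<lambda>y. vector [y$1 * y$2 * (M y - S y), y$2 * y$2 * M y + y$1 * y$1 * S y + P y, y$2 * Q y]) x =
      x$2 * (3 * M x - S x + rsq x * Ms + Ps + Qz)" (is ?B)
    "divg (\<lambda>y. vector [y$1 * Q y, y$2 * Q y, B y + P y]) x = 2 * Q x + rsq x * Qs + Bz + Pz" (is ?C)
proof -
  note m = has_derivative_mult and n = has_derivative_nth_ident and D = assms[unfolded axi_def]
  note MS = m[OF m[OF n n] has_derivative_diff[OF D(1,4)]]
  note d = has_derivative_add[OF has_derivative_add[OF m[OF m[OF n n] D(1)] m[OF m[OF n n] D(4)]] D(5)]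
  show ?A unfolding divg_vector3[OF d MS m[OF n D(2)]] by (simp add: axis_def rsq_def algebra_simps power2_eq_square)
  show ?B unfolding divg_vector3[OF MS d m[OF n D(2)]] by (simp add: axis_def rsq_def algebra_simps power2_eq_square)
  show ?C unfolding divg_vector3[OF m[OF n D(2)] m[OF n D(2)] has_derivative_add[OF D(3,5)]]
    by (simp add: axis_def rsq_def algebra_simps power2_eq_square)
qed

text \<open>With E = \<delta> a and H = \<delta> b, the rows of the symmetrised product of the
  poloidal field and the toroidal field \<delta>.\<close>

lemma divg_mixed:
  assumes E: "axi E Es Ez x" and H: "axi H Hs Hz x"
  shows "divg (\<lambda>y. vector [- (2 * (y$1 * y$2 * E y)), (y$1 * y$1 - y$2 * y$2) * E y, - (y$2 * H y)]) x =
      - (x$2 * (4 * E x + rsq x * Es + Hz))" (is ?A)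
    "divg (\<lambda>y. vector [(y$1 * y$1 - y$2 * y$2) * E y, 2 * (y$1 * y$2 * E y), y$1 * H y]) x =
      x$1 * (4 * E x + rsq x * Es + Hz)" (is ?B)
    "divg (\<lambda>y. vector [- (y$2 * H y), y$1 * H y, 0]) x = 0" (is ?C)
proof -
  note m = has_derivative_mult and n = has_derivative_nth_ident and D = assms[unfolded axi_def]
  note e = has_derivative_mult_right[OF m[OF m[OF n n] D(1)], where x=2]
  note f = m[OF has_derivative_diff[OF m[OF n n] m[OF n n]] D(1)]
  show ?A unfolding divg_vector3[OF has_derivative_minus[OF e] f has_derivative_minus[OF m[OF n D(2)]]]
    by (simp add: axis_def rsq_def algebra_simps power2_eq_square)
  show ?B unfolding divg_vector3[OF f e m[OF n D(2)]] by (simp add: axis_def rsq_def algebra_simps power2_eq_square)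
  show ?C unfolding divg_vector3[OF has_derivative_minus[OF m[OF n D(2)]] m[OF n D(2)] has_derivative_const]
    by (simp add: axis_def)
qed

text \<open>Both relations come down to \<theta> (\<beta> + 1) = \<beta>. The number - 2 \<beta> - 6
  is the degree of d^2.\<close>

lemma pressure_algebra:
  fixes \<theta> \<beta> :: real
  assumes \<theta>: "\<theta> * (\<beta> + 1) = \<beta>" and c: "c = 1 - t\<^sup>2"
  shows "\<nu> * - (\<beta> * (c * W) + t * w1) =
      2 * (\<theta> * \<nu> * W) + (c * ((- 2 * \<beta> - 6) * (\<theta> * \<nu> * W)) - t * (\<nu> * (2 * w1 + 4 * t * (\<theta> * W)))) / 2"
    and "\<nu> * (\<beta> * t * W - w1) + ((- 2 * \<beta> - 6) * t * (\<theta> * \<nu> * W) + \<nu> * (2 * w1 + 4 * t * (\<theta> * W))) / 2 = 0"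
proof -
  have "\<nu> * - (\<beta> * (c * W) + t * w1) -
      (2 * (\<theta> * \<nu> * W) + (c * ((- 2 * \<beta> - 6) * (\<theta> * \<nu> * W)) - t * (\<nu> * (2 * w1 + 4 * t * (\<theta> * W)))) / 2) =
      \<nu> * W * c * (\<theta> * (\<beta> + 1) - \<beta>)"
    unfolding c by (simp add: field_simps power2_eq_square)
  then show "\<nu> * - (\<beta> * (c * W) + t * w1) =
      2 * (\<theta> * \<nu> * W) + (c * ((- 2 * \<beta> - 6) * (\<theta> * \<nu> * W)) - t * (\<nu> * (2 * w1 + 4 * t * (\<theta> * W)))) / 2"
    unfolding \<theta> by simp
  have "\<nu> * (\<beta> * t * W - w1) + ((- 2 * \<beta> - 6) * t * (\<theta> * \<nu> * W) + \<nu> * (2 * w1 + 4 * t * (\<theta> * W))) / 2 =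
      \<nu> * t * W * (\<beta> - \<theta> * (\<beta> + 1))"
    by (simp add: field_simps)
  then show "\<nu> * (\<beta> * t * W - w1) + ((- 2 * \<beta> - 6) * t * (\<theta> * \<nu> * W) + \<nu> * (2 * w1 + 4 * t * (\<theta> * W))) / 2 = 0"
    unfolding \<theta> by simp
qed

text \<open>Separates the terms quadratic in the toroidal part, which are differentiable across the
  nodes, from the mixed terms, which are linear in it and need a cutoff.\<close>

lemma tensor_split:
  fixes U T :: "real^3" and G :: "3 \<Rightarrow> real^3"
  shows "(\<Sum>i\<in>UNIV. \<Sum>j\<in>UNIV. (U + T) $ i * (U + T) $ j * G j $ i) + P * (\<Sum>i\<in>UNIV. G i $ i) =
    (\<Sum>i\<in>UNIV. (U$i *\<^sub>R U + T$i *\<^sub>R T + P *\<^sub>R axis i 1) \<bullet> (\<chi> j. G j $ i) + (U$i *\<^sub>R T + T$i *\<^sub>R U) \<bullet> (\<chi> j. G j $ i))"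
  unfolding sum_3 inner_vec3 by (simp add: axis_def algebra_simps)

section \<open>The distributional solution for \<beta> < -2\<close>

locale homog_profile_neg = homog_profile +
  assumes neg: "\<beta> < -2"
begin

lemma \<alpha>_neg: "\<alpha> < 0" using neg by (simp add: \<alpha>_def)

lemma interior_subset: "{-1<..<1} \<subseteq> {-1..1::real}" by auto

lemma sub: "continuous_on {-1..1} f \<Longrightarrow> continuous_on {-1<..<1::real} f"
  by (rule continuous_on_subset[OF _ interior_subset])

lemma nz: "\<forall>t\<in>{-1<..<1::real}. 1 - t\<^sup>2 \<noteq> 0"
  using interior by fastforce

lemma \<gamma>_cont: "continuous_on {-1..1} \<gamma>"
proof -
  have "1 / \<beta> > -1" using neg by (simp add: field_simps)
  from \<kappa>_cont[where f="\<lambda>x. sqrt (\<theta> * x)", OF continuous_mult_abs_powr[OF this] _ sqrt_\<kappa>_abs]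
  show ?thesis unfolding \<gamma>_def[abs_def] by simp
qed

lemma D_cont: "continuous_on {-1<..<1} D"
  unfolding D_def[abs_def] by (intro continuous_on_divide sub[OF \<gamma>_cont] nz continuous_intros)

lemma Phi_C1:
  assumes "\<And>t. t \<in> {-1<..<1} \<Longrightarrow> (G has_real_derivative G' t) (at t)" "continuous_on {-1<..<1} G'"
  shows "Ck_on 1 (Phi s G) (- z_axis)"
  by (rule Phi_C[OF C1_tau_off_axis[OF assms] open_off_axis]) (use zero_in_z_axis in auto)

lemma a_C1: "Ck_on 1 a (- z_axis)"
  unfolding a_def
proof (rule Phi_C1[OF dA])
  show "continuous_on {-1<..<1} (\<lambda>t. \<beta> * W t + \<beta> * t * ((w1 t + 2 * t * W t) / (1 - t\<^sup>2)) - w2 t)"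
    unfolding w2_def
    by (intro continuous_on_divide nz continuous_on_add continuous_on_diff continuous_on_mult continuous_on_minus
        continuous_on_const continuous_on_id continuous_on_power sub[OF W_cont] sub[OF w1_cont] sub[OF w_cont] sub[OF n_cont])
qed

lemma b_C1: "Ck_on 1 b (- z_axis)"
  unfolding b_def
proof (rule Phi_C1[OF dB])
  show "continuous_on {-1<..<1} (\<lambda>t. - ((\<beta> + 1) * w1 t + t * w2 t))"
    unfolding w2_def
    by (intro continuous_on_divide nz continuous_on_add continuous_on_diff continuous_on_mult continuous_on_minus
        continuous_on_const continuous_on_id continuous_on_power sub[OF w1_cont] sub[OF w_cont] sub[OF n_cont])
qed

text \<open>Differentiated through the product \<open>n w\<close>, because \<open>n\<close> alone
  need not be differentiable at the nodes.\<close>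

lemma dE: "t \<in> {-1<..<1} \<Longrightarrow> (E has_real_derivative (\<theta> * ((2 + q) * n t * w1 t) + 2 * t * E t) / (1 - t\<^sup>2)) (at t)"
proof -
  assume t: "t \<in> {-1<..<1}"
  have e: "\<theta> * (n t * w t) / (1 - t\<^sup>2) = E t" if "t \<in> {-1<..<1}" for t
    using interior[OF that] unfolding E_def cW[OF that] by simp
  have "((\<lambda>t. \<theta> * (n t * w t) / (1 - t\<^sup>2)) has_real_derivative (\<theta> * ((2 + q) * n t * w1 t) + 2 * t * E t) / (1 - t\<^sup>2)) (at t)"
    using quotient_DERIV[OF t DERIV_cmult[OF dnw[OF t], of \<theta>]] unfolding e[OF t] .
  then show ?thesis
    by (rule has_field_derivative_transform_within_open[of _ _ _ "{-1<..<1}"]) (use t e in auto)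
qed

lemma dE_cont: "continuous_on {-1<..<1} (\<lambda>t. (\<theta> * ((2 + q) * n t * w1 t) + 2 * t * E t) / (1 - t\<^sup>2))"
  by (intro continuous_on_divide nz continuous_on_add continuous_on_diff continuous_on_mult
        continuous_on_const continuous_on_id continuous_on_power sub[OF w1_cont] sub[OF E_cont] sub[OF n_cont])

definition "str = Phi (- \<beta>) w"

lemma str_cont: "continuous_on UNIV str"
  unfolding str_def by (rule continuous_Phi[OF _ w_cont]) (use neg in simp)

lemma str_C1: "Ck_on 1 str (- z_axis)"
  unfolding str_def by (rule Phi_C1[OF dw sub[OF w1_cont]])

text \<open>\<open>str\<close> is the stream function: in the variables r^2 / 2 and z its gradient
  is the poloidal flow turned by a right angle, so it is constant along that flow.\<close>

lemma axi_str:
  assumes x: "x \<in> - z_axis"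
  shows "axi str (b x) (- (rsq x * a x)) x"
proof -
  define t R N c where "t = tau x" and "R = norm x powr (- \<alpha> - 2)" and "N = norm x" and "c = 1 - t\<^sup>2"
  have ti: "t \<in> {-1<..<1}" using tau_off_axis[OF x] by (simp add: t_def)
  have x0: "x \<noteq> 0" by (rule off_axis_nonzero[OF x])
  note av = field_values[OF x0, folded R_def N_def t_def]
  have N: "N > 0" using x0 by (simp add: N_def)
  have p: "N powr (- \<beta> - 2) = R * N\<^sup>2" "N powr (- \<beta> - 1) = R * N\<^sup>2 * N"
  proof -
    have "- \<beta> - 2 = (- \<alpha> - 2) + 2" by (simp add: \<alpha>_def)
    then have "N powr (- \<beta> - 2) = N powr ((- \<alpha> - 2) + 2)" by (simp only:)
    then show 1: "N powr (- \<beta> - 2) = R * N\<^sup>2" unfolding powr_add R_def N_def[symmetric] using N by simp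
    have "- \<beta> - 1 = (- \<beta> - 2) + 1" by simp
    then have "N powr (- \<beta> - 1) = N powr ((- \<beta> - 2) + 1)" by (simp only:)
    then show "N powr (- \<beta> - 1) = R * N\<^sup>2 * N" unfolding powr_add 1 using N by simp
  qed
  have w: "w t = c * W t" using cW[OF ti] by (simp add: c_def)
  have "axi str (N powr (- \<beta> - 2) * (- \<beta> * w t - t * w1 t)) (N powr (- \<beta> - 1) * (- \<beta> * t * w t + c * w1 t)) x"
    using axi_Phi[OF x0 dw[OF tau_off_axis[OF x]], of "- \<beta>"] unfolding str_def N_def t_def c_def .
  moreover have "N powr (- \<beta> - 2) * (- \<beta> * w t - t * w1 t) = b x" unfolding p av B_def by (simp add: algebra_simps)
  moreover have "N powr (- \<beta> - 1) * (- \<beta> * t * w t + c * w1 t) = - (rsq x * a x)"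
    unfolding p av A_def w rsq_eq[OF x0, folded t_def N_def, folded c_def] by (simp add: algebra_simps)
  ultimately show ?thesis by simp
qed

definition "H t = E t / (1 - t\<^sup>2)"

lemma sq_d_eq: "x \<in> - z_axis \<Longrightarrow> Phi (- 2 * \<alpha> - 2) H x = (d x)\<^sup>2"
proof -
  assume x: "x \<in> - z_axis"
  have x0: "x \<noteq> 0" by (rule off_axis_nonzero[OF x])
  have "norm x powr (- 2 * \<alpha> - 2) * (norm x)\<^sup>2 = norm x powr (- (2 * \<alpha>))"
    using x0 powr_add[of "norm x" "- 2 * \<alpha> - 2" 2] by simp
  then have "rsq x * Phi (- 2 * \<alpha> - 2) H x = Phi (- (2 * \<alpha>)) E x"
    using interior[OF tau_off_axis[OF x]] unfolding rsq_eq[OF x0] Phi_def H_def by (simp add: field_simps)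
  then have "rsq x * Phi (- 2 * \<alpha> - 2) H x = rsq x * (d x)\<^sup>2" unfolding rsq_d[OF x0] .
  moreover have "rsq x \<noteq> 0" using x z_axis_rsq by auto
  ultimately show ?thesis by simp
qed

lemma dH:
  assumes t: "t \<in> {-1<..<1}"
  shows "(H has_real_derivative ((\<theta> * ((2 + q) * n t * w1 t) + 2 * t * E t) / (1 - t\<^sup>2) + 2 * t * (E t / (1 - t\<^sup>2))) / (1 - t\<^sup>2)) (at t)"
  unfolding H_def[abs_def] by (rule quotient_DERIV[OF t dE[OF t]])

lemma sq_d_C1: "Ck_on 1 (\<lambda>x. (d x)\<^sup>2) (- z_axis)"
proof (rule Ck_on_cong[OF open_off_axis sq_d_eq], assumption)
  show "Ck_on 1 (Phi (- 2 * \<alpha> - 2) H) (- z_axis)"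
    by (rule Phi_C1[OF dH], assumption)
      (intro continuous_on_divide nz continuous_on_add continuous_on_diff continuous_on_mult dE_cont
        continuous_on_const continuous_on_id continuous_on_power sub[OF E_cont])
qed

text \<open>With \<omega> the toroidal vorticity divided by r, the two equations say that \<omega>
  times the gradient of the stream function is the gradient of \<open>(r u^phi)^2 / 2\<close>,
  divided by r^2. In terms of squares this holds at the nodes as well.\<close>

lemma sq_d_axi:
  assumes x: "x \<in> - z_axis"
  obtains Ss Sz where "axi (\<lambda>x. (d x)\<^sup>2) Ss Sz x"
    "b x * (norm x powr (- \<alpha> - 2) * (n (tau x) / (1 - (tau x)\<^sup>2))) = 2 * (d x)\<^sup>2 + rsq x * Ss / 2"
    "a x * (norm x powr (- \<alpha> - 2) * (n (tau x) / (1 - (tau x)\<^sup>2))) + Sz / 2 = 0"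
proof -
  define t R N c where "t = tau x" and "R = norm x powr (- \<alpha> - 2)" and "N = norm x" and "c = 1 - t\<^sup>2"
  have ti: "t \<in> {-1<..<1}" using tau_off_axis[OF x] by (simp add: t_def)
  have x0: "x \<noteq> 0" by (rule off_axis_nonzero[OF x])
  have N: "N > 0" using x0 by (simp add: N_def)
  have c: "c > 0" using interior[OF ti] by (simp add: c_def)
  note av = field_values[OF x0, folded R_def N_def t_def]
  note comp = components[OF ti, folded c_def]
  define \<nu> s where "\<nu> = n t / c" and "s = - 2 * \<alpha> - 2"
  define k where "k = \<nu> * (2 * w1 t + 4 * t * (\<theta> * W t))"
  have s: "s = - 2 * \<beta> - 6" by (simp add: s_def \<alpha>_def)
  have Ht: "H t = \<theta> * \<nu> * W t" by (simp add: H_def E_def \<nu>_def c_def)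
  have \<theta>2: "\<theta> * (2 + q) = 2"
  proof -
    have "\<theta> * (2 + q) = 2 * (\<theta> * (1 + 1 / \<beta>))" by (simp add: q_def algebra_simps)
    then show ?thesis by (simp only: \<theta>(2))
  qed
  have h: "((\<theta> * ((2 + q) * n t * w1 t) + 2 * t * E t) / c + 2 * t * (E t / c)) / c = k / c"
  proof -
    have "\<theta> * ((2 + q) * n t * w1 t) = (\<theta> * (2 + q)) * (n t * w1 t)" by (simp only: mult_ac)
    then show ?thesis unfolding k_def \<nu>_def E_def \<theta>2 using c by (simp add: field_simps)
  qed
  have p: "N powr (s - 2) = R\<^sup>2" "N powr (s - 1) = R\<^sup>2 * N" "N powr s = R\<^sup>2 * N\<^sup>2"
  proof -
    have "s - 2 = (- \<alpha> - 2) + (- \<alpha> - 2)" by (simp add: s_def)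
    then have "N powr (s - 2) = N powr ((- \<alpha> - 2) + (- \<alpha> - 2))" by (simp only:)
    then show 1: "N powr (s - 2) = R\<^sup>2" unfolding powr_add R_def N_def[symmetric] by (simp add: power2_eq_square)
    have "N powr (s - 1) = N powr ((s - 2) + 1)" "N powr s = N powr ((s - 2) + 2)" by simp_all
    then show "N powr (s - 1) = R\<^sup>2 * N" "N powr s = R\<^sup>2 * N\<^sup>2" unfolding powr_add 1 using N by simp_all
  qed
  define Ss Sz where "Ss = R\<^sup>2 * (s * H t - t * (k / c))" and "Sz = R\<^sup>2 * N * (s * t * H t + c * (k / c))"
  have "axi (Phi s H) Ss Sz x"
    using axi_Phi[OF x0 dH[OF tau_off_axis[OF x]], of s, folded t_def N_def, folded c_def]
    unfolding h p Ss_def Sz_def .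
  then have 1: "axi (\<lambda>x. (d x)\<^sup>2) Ss Sz x" by (rule axi_cong[OF _ x]) (unfold s_def, rule sq_d_eq)
  have S: "(d x)\<^sup>2 = R\<^sup>2 * N\<^sup>2 * (\<theta> * \<nu> * W t)"
    unfolding sq_d_eq[OF x, symmetric] Phi_def s_def[symmetric] N_def[symmetric] t_def[symmetric] p Ht ..
  note alg = pressure_algebra[OF \<theta>(3) c_def, of \<nu> "W t" "w1 t", folded comp(2,3)]
  have "b x * (R * \<nu>) = R\<^sup>2 * N\<^sup>2 * (\<nu> * B t)" unfolding av by (simp add: power2_eq_square)
  also have "\<dots> = R\<^sup>2 * N\<^sup>2 * (2 * (\<theta> * \<nu> * W t) + (c * (s * (\<theta> * \<nu> * W t)) - t * k) / 2)"
    unfolding alg(1) k_def s ..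
  also have "\<dots> = 2 * (d x)\<^sup>2 + rsq x * Ss / 2"
    unfolding S Ss_def Ht rsq_eq[OF x0, folded t_def N_def, folded c_def] using c by (simp add: field_simps)
  finally have 2: "b x * (R * \<nu>) = 2 * (d x)\<^sup>2 + rsq x * Ss / 2" .
  have "a x * (R * \<nu>) + Sz / 2 = R\<^sup>2 * N * (\<nu> * A t + (s * t * (\<theta> * \<nu> * W t) + k) / 2)"
    unfolding av Sz_def Ht using c by (simp add: power2_eq_square algebra_simps)
  also have "\<dots> = 0" unfolding k_def s alg(2) by simp
  finally have 3: "a x * (R * \<nu>) + Sz / 2 = 0" .
  show thesis using that[OF 1] 2 3 unfolding R_def \<nu>_def c_def t_def by blast
qed

lemma p_expand: "p x = - (1 / 2) * (rsq x * (a x * a x) + rsq x * (d x)\<^sup>2 + b x * b x)"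
proof -
  have "u x \<bullet> u x = rsq x * (a x * a x) + rsq x * (d x)\<^sup>2 + b x * b x"
    unfolding u_def inner_vec3 by (simp add: rsq_def algebra_simps power2_eq_square)
  moreover have "- y / 2 = - (1 / 2) * y" for y :: real by simp
  ultimately show ?thesis unfolding p_def by (simp only:)
qed

lemma rsq_C1: "Ck_on k rsq (- z_axis)"
  unfolding rsq_def[abs_def] power2_eq_square by (intro Ck_on_add Ck_on_mult Ck_on_nth_ident open_off_axis)

lemma p_C1: "Ck_on 1 p (- z_axis)"
  unfolding p_expand[abs_def]
  by (intro Ck_on_mult Ck_on_add Ck_on_const open_off_axis a_C1 b_C1 sq_d_C1 rsq_C1)

lemma fieldP_C1: "Ck_on 1 (fieldP a b) (- z_axis)"
  unfolding fieldP_def[abs_def] by (intro Ck_on_vector3 Ck_on_mult Ck_on_nth_ident open_off_axis a_C1 b_C1)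

lemma Phi_C0: "continuous_on {-1..1} G \<Longrightarrow> continuous_on (-{0}) (Phi s G)"
  using Phi_C[of 0 G "-{0}" s] C0_tau[of G] open_punctured by simp

lemma fieldP_cont: "continuous_on UNIV (fieldP a b)"
proof -
  have x: "continuous_on S (\<lambda>x::real^3. x $ i)" for S i by (intro continuous_on_component continuous_on_id)
  have c: "continuous_on UNIV (\<lambda>x. x$i * a x)" for i
  proof (rule continuous_on_dominated[where Z="{0}" and g="\<lambda>x. \<bar>Phi (- \<alpha>) A x\<bar>"])
    show "continuous_on (-{0}) (\<lambda>x. x$i * a x)" unfolding a_def by (intro continuous_on_mult x Phi_C0 A_cont)
    show "continuous_on UNIV (\<lambda>x. \<bar>Phi (- \<alpha>) A x\<bar>)"
      by (intro continuous_on_rabs continuous_Phi A_cont) (use \<alpha>_neg in simp)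
    fix x :: "real^3"
    show "norm (x$i * a x) \<le> \<bar>Phi (- \<alpha>) A x\<bar>"
    proof (cases "x = 0")
      case False
      have "Phi (- \<alpha>) A x = norm x * a x"
        unfolding Phi_def field_values(1)[OF False] norm_powr_shift(4)[OF False] by (simp add: power2_eq_square)
      then show ?thesis using mult_right_mono[OF component_le_norm_cart[of x i], of "\<bar>a x\<bar>"] by (simp add: abs_mult)
    qed simp
  qed (auto simp: Phi_def)
  have "continuous_on UNIV b" unfolding b_def by (rule continuous_Phi[OF _ B_cont]) (use \<alpha>_neg in simp)
  then show ?thesis
    unfolding fieldP_def[abs_def] vector3_eq_sum by (intro continuous_on_add continuous_on_scaleR continuous_on_const c)
qed

text \<open>\<open>D\<close> itself may be unbounded at the poles, but the components are dominated
  by \<bar>\<open>u^phi\<close>\<bar>, whose square has the continuous profile \<open>E\<close> with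
  zero end values.\<close>

lemma fieldT_cont: "continuous_on UNIV (fieldT d)"
proof -
  have x: "continuous_on S (\<lambda>x::real^3. x $ i)" for S i by (intro continuous_on_component continuous_on_id)
  have c: "continuous_on UNIV (\<lambda>x. x$i * d x)" if i: "i = 1 \<or> i = 2" for i
  proof (rule continuous_on_dominated[OF closed_z_axis, where g="\<lambda>x. sqrt (Phi (- (2 * \<alpha>)) E x)"])
    have s: "- z_axis \<subseteq> - {0}" using zero_in_z_axis by auto
    have "continuous_on (- z_axis) (\<lambda>x. D (tau x))"
      by (rule continuous_on_compose2[OF D_cont continuous_on_subset[OF continuous_tau s] tau_image_off_axis])
    then have "continuous_on (- z_axis) d"
      unfolding d_def Phi_def[abs_def]
      by (intro continuous_on_mult continuous_on_subset[OF Ck_on_imp_continuous_on[OF Ck_on_norm_powr[of 0]] s])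
    then show "continuous_on (- z_axis) (\<lambda>x. x$i * d x)" by (intro continuous_on_mult x)
    show "continuous_on UNIV (\<lambda>x. sqrt (Phi (- (2 * \<alpha>)) E x))"
      by (intro continuous_on_real_sqrt continuous_Phi E_cont) (use \<alpha>_neg in simp)
    show "norm (x$i * d x) \<le> sqrt (Phi (- (2 * \<alpha>)) E x)" for x
    proof (cases "x = 0")
      case False
      have "(x$i * d x)\<^sup>2 \<le> rsq x * (d x)\<^sup>2"
        unfolding power_mult_distrib by (rule mult_right_mono) (use i in \<open>auto simp: rsq_def\<close>)
      from real_sqrt_le_mono[OF this] show ?thesis unfolding rsq_d[OF False] by simp
    qed (simp add: Phi_def)
    show "sqrt (Phi (- (2 * \<alpha>)) E x) = 0" if "x \<in> z_axis" for x
      using tau_on_axis'[OF that] by (cases "x = 0") (auto simp: Phi_def E_def n_def w_ends)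
  qed
  show ?thesis
    unfolding fieldT_def[abs_def] vector3_eq_sum
    by (intro continuous_on_add continuous_on_scaleR continuous_on_const continuous_on_minus c) auto
qed

lemma u_cont: "continuous_on UNIV u"
  unfolding u_def[abs_def] by (intro continuous_on_add fieldP_cont fieldT_cont)

lemma p_cont: "continuous_on UNIV p"
  unfolding p_def[abs_def] by (intro continuous_intros u_cont) auto

definition "damp e x = (str x)\<^sup>2 / ((str x)\<^sup>2 + e)"

lemma damp_DERIV:
  fixes e y :: real
  assumes "e > 0"
  shows "((\<lambda>y. y\<^sup>2 / (y\<^sup>2 + e)) has_real_derivative (2 * y * (y\<^sup>2 + e) - y\<^sup>2 * (2 * y)) / ((y\<^sup>2 + e) * (y\<^sup>2 + e))) (at y)"
    "((\<lambda>y. 1 / (y\<^sup>2 + e)) has_real_derivative - (2 * y) / ((y\<^sup>2 + e) * (y\<^sup>2 + e))) (at y)"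
proof -
  have "y\<^sup>2 + e \<noteq> 0" using assms by (smt (verit) zero_le_power2)
  then show "((\<lambda>y. y\<^sup>2 / (y\<^sup>2 + e)) has_real_derivative (2 * y * (y\<^sup>2 + e) - y\<^sup>2 * (2 * y)) / ((y\<^sup>2 + e) * (y\<^sup>2 + e))) (at y)"
    "((\<lambda>y. 1 / (y\<^sup>2 + e)) has_real_derivative - (2 * y) / ((y\<^sup>2 + e) * (y\<^sup>2 + e))) (at y)"
    by (auto intro!: derivative_eq_intros)
qed

text \<open>Two extra factors \<open>w\<close> turn \<gamma> into a multiple of
  \<open>w \<bar>w\<bar> powr (2 + 1 / \<beta>)\<close>, which is C^1 across the nodes; the damping
  factor supplies them.\<close>

definition "J t = \<gamma> t * (w t)\<^sup>2"

lemma dJ: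
  assumes t: "t \<in> {-1<..<1}"
  shows "(J has_real_derivative sqrt (\<theta> * \<kappa> t) * ((1 + (2 + 1 / \<beta>)) * \<bar>w t\<bar> powr (2 + 1 / \<beta>) * w1 t)) (at t)"
proof -
  have e: "2 + 1 / \<beta> > 0" using neg by (simp add: field_simps)
  have "J t = sqrt (\<theta> * \<kappa> t) * (w t * \<bar>w t\<bar> powr (2 + 1 / \<beta>))" for t
  proof (cases "w t = 0")
    case False
    then have "\<bar>w t\<bar> powr (2 + 1 / \<beta>) = (w t)\<^sup>2 * \<bar>w t\<bar> powr (1 / \<beta>)" by (simp add: powr_add)
    then show ?thesis by (simp add: J_def \<gamma>_def)
  qed (simp add: J_def)
  then have "J = (\<lambda>t. sqrt (\<theta> * \<kappa> t) * (w t * \<bar>w t\<bar> powr (2 + 1 / \<beta>)))" by blast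
  then show ?thesis
    using \<kappa>_DERIV[where f="\<lambda>x. sqrt (\<theta> * x)" and M="sqrt (\<theta> * K)", OF powr_abs_DERIV[OF e] _ _ sqrt_\<kappa>_abs t] by simp
qed

lemma dJ_cont: "continuous_on {-1..1} (\<lambda>t. sqrt (\<theta> * \<kappa> t) * ((1 + (2 + 1 / \<beta>)) * \<bar>w t\<bar> powr (2 + 1 / \<beta>) * w1 t))"
proof -
  have e: "2 + 1 / \<beta> > 0" using neg by (simp add: field_simps)
  have "continuous_on {-1..1} (\<lambda>t. sqrt (\<theta> * \<kappa> t) * \<bar>w t\<bar> powr (2 + 1 / \<beta>))"
    using \<kappa>_cont[where f="\<lambda>x. sqrt (\<theta> * x)" and M="sqrt (\<theta> * K)" and \<zeta>="\<lambda>y. \<bar>y\<bar> powr (2 + 1 / \<beta>)", OF continuous_abs_powr[OF e] _ sqrt_\<kappa>_abs]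
    by simp
  from continuous_on_mult[OF continuous_on_mult[OF this w1_cont] continuous_on_const[of _ "1 + (2 + 1 / \<beta>)"]]
  show ?thesis by (simp only: mult_ac)
qed

lemma damp_d_eq:
  assumes x: "x \<in> - z_axis"
  shows "Phi (- \<alpha> - 1 - 2 * \<beta>) (\<lambda>t. J t / (1 - t\<^sup>2)) x * (1 / ((str x)\<^sup>2 + e)) = damp e x * d x"
proof -
  have "norm x powr (- \<alpha> - 1 - 2 * \<beta>) = norm x powr ((- \<alpha> - 1) + - \<beta> + - \<beta>)" by simp
  then have "norm x powr (- \<alpha> - 1 - 2 * \<beta>) = norm x powr (- \<alpha> - 1) * (norm x powr (- \<beta>))\<^sup>2"
    unfolding powr_add by (simp add: power2_eq_square)
  then have "Phi (- \<alpha> - 1 - 2 * \<beta>) (\<lambda>t. J t / (1 - t\<^sup>2)) x = d x * (str x)\<^sup>2"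
    unfolding d_def str_def Phi_def J_def D_def power_mult_distrib by (simp add: mult_ac)
  then show ?thesis by (simp add: damp_def)
qed

lemma dJ_quot: "t \<in> {-1<..<1} \<Longrightarrow> ((\<lambda>t. J t / (1 - t\<^sup>2)) has_real_derivative
    (sqrt (\<theta> * \<kappa> t) * ((1 + (2 + 1 / \<beta>)) * \<bar>w t\<bar> powr (2 + 1 / \<beta>) * w1 t) + 2 * t * (J t / (1 - t\<^sup>2))) / (1 - t\<^sup>2)) (at t)"
  by (rule quotient_DERIV[OF _ dJ])

lemma damp_d_C1:
  assumes e: "e > 0"
  shows "Ck_on 1 (\<lambda>x. damp e x * d x) (- z_axis)"
proof (rule Ck_on_cong[OF open_off_axis damp_d_eq], assumption)
  have J: "continuous_on {-1..1} J" unfolding J_def by (intro continuous_intros \<gamma>_cont w_cont)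
  have "Ck_on 1 (Phi s (\<lambda>t. J t / (1 - t\<^sup>2))) (- z_axis)" for s
    by (rule Phi_C1[OF dJ_quot], assumption)
      (intro continuous_on_divide nz continuous_on_add continuous_on_diff continuous_on_mult[OF continuous_on_mult]
        continuous_on_const continuous_on_id continuous_on_power sub[OF dJ_cont] sub[OF J])
  moreover have "Ck_on 1 (\<lambda>x. 1 / ((str x)\<^sup>2 + e)) (- z_axis)"
  proof (rule C1_compose[where g="\<lambda>y. 1 / (y\<^sup>2 + e)", OF open_off_axis damp_DERIV(2)[OF e] _ subset_UNIV str_C1])
    have "y\<^sup>2 + e \<noteq> 0" for y using e by (smt (verit) zero_le_power2)
    then show "continuous_on UNIV (\<lambda>y. - (2 * y) / ((y\<^sup>2 + e) * (y\<^sup>2 + e)))" by (intro continuous_intros) auto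
  qed
  ultimately show "Ck_on 1 (\<lambda>x. Phi (- \<alpha> - 1 - 2 * \<beta>) (\<lambda>t. J t / (1 - t\<^sup>2)) x * (1 / ((str x)\<^sup>2 + e))) (- z_axis)"
    by (intro Ck_on_mult open_off_axis)
qed

text \<open>Off the nodal set \<open>r u\<^sup>\<phi>\<close> is a function of the stream function, which is constant along the poloidal
  flow; on the nodal set the cutoff makes everything vanish to first order.\<close>
lemma damp_d_axi:
  assumes x: "x \<in> - z_axis" and e: "e > 0"
  obtains \<delta>s \<delta>z where "axi (\<lambda>x. damp e x * d x) \<delta>s \<delta>z x" "a x * (2 * (damp e x * d x) + rsq x * \<delta>s) + b x * \<delta>z = 0"
proof (cases "w (tau x) = 0")
  case True
  have x0: "x \<noteq> 0" by (rule off_axis_nonzero[OF x])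
  let ?G = "\<lambda>t. J t / (1 - t\<^sup>2)" and ?s = "- \<alpha> - 1 - 2 * \<beta>"
  have "(?G has_real_derivative 0) (at (tau x))"
    using dJ_quot[OF tau_off_axis[OF x]] True by (simp add: J_def)
  from axi_Phi[OF x0 this, of ?s] have 1: "axi (Phi ?s ?G) 0 0 x" using True by (simp add: J_def)
  have 0: "Phi ?s ?G x = 0" using True by (simp add: Phi_def J_def)
  have "axi (\<lambda>x. Phi ?s ?G x * (1 / ((str x)\<^sup>2 + e))) 0 0 x"
    using axi_mult[OF 1 axi_compose[OF axi_str[OF x] damp_DERIV(2)[OF e]]] 0 by simp
  then have "axi (\<lambda>x. damp e x * d x) 0 0 x" by (rule axi_cong[OF _ x damp_d_eq])
  then show thesis by (rule that) (use True in \<open>simp add: damp_def str_def Phi_def\<close>)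
next
  case False
  note t = tau_off_axis[OF x]
  obtain ds dz where d: "axi d ds dz x" "a x * (2 * d x + rsq x * ds) + b x * dz = 0"
    using local_equations(4)[OF x d\<gamma>_nonzero[OF t False]] by blast
  obtain g where "((\<lambda>y. y\<^sup>2 / (y\<^sup>2 + e)) has_real_derivative g) (at (str x))" using damp_DERIV(1)[OF e] by blast
  from axi_mult[OF axi_compose[OF axi_str[OF x] this] d(1)]
  have 1: "axi (\<lambda>x. damp e x * d x) (damp e x * ds + g * b x * d x) (damp e x * dz + g * - (rsq x * a x) * d x) x"
    unfolding damp_def .
  \<comment> \<open>The two terms containing \<open>g\<close> cancel: the cutoff is a function of
    \<open>str\<close>, whose derivative along the poloidal flow is 0.\<close>
  have "a x * (2 * (damp e x * d x) + rsq x * (damp e x * ds + g * b x * d x)) + b x * (damp e x * dz + g * - (rsq x * a x) * d x) =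
      damp e x * (a x * (2 * d x + rsq x * ds) + b x * dz)"
    by (simp add: algebra_simps)
  then show thesis using that[OF 1] d(2) by simp
qed

definition "stress i x = fieldP a b x $ i *\<^sub>R fieldP a b x + fieldT d x $ i *\<^sub>R fieldT d x + p x *\<^sub>R axis i 1"

text \<open>The toroidal coefficient is a parameter, so the damped coefficient can take the place of
  \<open>d\<close>.\<close>

definition "mixed \<delta> i x = fieldP a b x $ i *\<^sub>R fieldT \<delta> x + fieldT \<delta> x $ i *\<^sub>R fieldP a b x"

lemma stress_eq:
  "stress 1 = (\<lambda>y. vector [y$1 * y$1 * (a y * a y) + y$2 * y$2 * (d y)\<^sup>2 + p y, y$1 * y$2 * (a y * a y - (d y)\<^sup>2), y$1 * (a y * b y)])"
  "stress 2 = (\<lambda>y. vector [y$1 * y$2 * (a y * a y - (d y)\<^sup>2), y$2 * y$2 * (a y * a y) + y$1 * y$1 * (d y)\<^sup>2 + p y, y$2 * (a y * b y)])"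
  "stress 3 = (\<lambda>y. vector [y$1 * (a y * b y), y$2 * (a y * b y), b y * b y + p y])"
  unfolding fun_eq_iff vec_eq_iff forall_3 stress_def
  by (simp_all add: axis_def algebra_simps power2_eq_square)

lemma mixed_eq:
  "mixed \<delta> 1 = (\<lambda>y. vector [- (2 * (y$1 * y$2 * (\<delta> y * a y))), (y$1 * y$1 - y$2 * y$2) * (\<delta> y * a y), - (y$2 * (\<delta> y * b y))])"
  "mixed \<delta> 2 = (\<lambda>y. vector [(y$1 * y$1 - y$2 * y$2) * (\<delta> y * a y), 2 * (y$1 * y$2 * (\<delta> y * a y)), y$1 * (\<delta> y * b y)])"
  "mixed \<delta> 3 = (\<lambda>y. vector [- (y$2 * (\<delta> y * b y)), y$1 * (\<delta> y * b y), 0])"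
  unfolding fun_eq_iff vec_eq_iff forall_3 mixed_def by (simp_all add: algebra_simps)

lemma stress_cont: "continuous_on UNIV (stress i)"
  unfolding stress_def[abs_def]
  by (intro continuous_on_add continuous_on_scaleR continuous_on_component fieldP_cont fieldT_cont p_cont continuous_on_const)

lemma mixed_cont: "continuous_on UNIV (mixed d i)"
  unfolding mixed_def[abs_def]
  by (intro continuous_on_add continuous_on_scaleR continuous_on_component fieldP_cont fieldT_cont)

lemma stress_C1: "Ck_on 1 (stress i) (- z_axis)"
proof -
  have "Ck_on 1 (stress 1) (- z_axis)" "Ck_on 1 (stress 2) (- z_axis)" "Ck_on 1 (stress 3) (- z_axis)"
    unfolding stress_eq
    by (intro Ck_on_vector3 Ck_on_add Ck_on_diff Ck_on_mult Ck_on_nth_ident open_off_axis a_C1 b_C1 p_C1 sq_d_C1)+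
  then show ?thesis using exhaust_3[of i] by auto
qed

lemma mixed_C1:
  assumes "Ck_on 1 \<delta> (- z_axis)" shows "Ck_on 1 (mixed \<delta> i) (- z_axis)"
proof -
  have "Ck_on 1 (mixed \<delta> 1) (- z_axis)" "Ck_on 1 (mixed \<delta> 2) (- z_axis)" "Ck_on 1 (mixed \<delta> 3) (- z_axis)"
    unfolding mixed_eq
    by (intro Ck_on_vector3 Ck_on_add Ck_on_diff Ck_on_mult Ck_on_uminus Ck_on_const Ck_on_nth_ident open_off_axis a_C1 b_C1 assms)+
  then show ?thesis using exhaust_3[of i] by auto
qed

lemma stress_divg:
  assumes x: "x \<in> - z_axis" shows "divg (stress i) x = 0"
proof -
  obtain as az bs bz where ab: "axi a as az x" "axi b bs bz x" "2 * a x + rsq x * as + bz = 0"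
    "az - bs = norm x powr (- \<alpha> - 2) * (n (tau x) / (1 - (tau x)\<^sup>2))" by (rule poloidal_axi[OF x])
  obtain Ss Sz where S: "axi (\<lambda>x. (d x)\<^sup>2) Ss Sz x" "b x * (az - bs) = 2 * (d x)\<^sup>2 + rsq x * Ss / 2" "a x * (az - bs) + Sz / 2 = 0"
    unfolding ab(4) by (rule sq_d_axi[OF x])
  note aa = axi_mult[OF ab(1,1)] and ab' = axi_mult[OF ab(1,2)] and bb = axi_mult[OF ab(2,2)]
  have P: "axi p (- (1 / 2) * ((rsq x * (a x * as + as * a x) + 2 * (a x * a x)) + (rsq x * Ss + 2 * (d x)\<^sup>2) + (b x * bs + bs * b x)))
      (- (1 / 2) * ((rsq x * (a x * az + az * a x) + 0 * (a x * a x)) + (rsq x * Sz + 0 * (d x)\<^sup>2) + (b x * bz + bz * b x))) x"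
    unfolding p_expand[abs_def]
    by (rule axi_cmult[OF axi_add[OF axi_add[OF axi_mult[OF axi_rsq aa] axi_mult[OF axi_rsq S(1)]] bb]])
  note div = divg_stress[OF aa ab' bb S(1) P]
  have bz: "bz = - (2 * a x + rsq x * as)" using ab(3) by simp
  \<comment> \<open>After inserting the pressure and the divergence condition, the horizontal rows
    reduce to the first relation of \<open>sq_d_axi\<close> and the vertical row to the
    second.\<close>
  have 1: "3 * (a x * a x) - (d x)\<^sup>2 + rsq x * (a x * as + as * a x) +
      - (1 / 2) * ((rsq x * (a x * as + as * a x) + 2 * (a x * a x)) + (rsq x * Ss + 2 * (d x)\<^sup>2) + (b x * bs + bs * b x)) +
      (a x * bz + az * b x) = b x * (az - bs) - (2 * (d x)\<^sup>2 + rsq x * Ss / 2)"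
    unfolding bz by (simp add: field_simps)
  have 3: "2 * (a x * b x) + rsq x * (a x * bs + as * b x) + (b x * bz + bz * b x) +
      - (1 / 2) * ((rsq x * (a x * az + az * a x) + 0 * (a x * a x)) + (rsq x * Sz + 0 * (d x)\<^sup>2) + (b x * bz + bz * b x)) =
      - (rsq x * (a x * (az - bs) + Sz / 2))"
    unfolding bz by (simp add: field_simps)
  have "divg (stress 1) x = 0" "divg (stress 2) x = 0" "divg (stress 3) x = 0"
    unfolding stress_eq div 1 3 using S(2,3) by simp_all
  then show ?thesis using exhaust_3[of i] by auto
qed

lemma mixed_divg:
  assumes x: "x \<in> - z_axis" and d: "axi \<delta> \<delta>s \<delta>z x" "a x * (2 * \<delta> x + rsq x * \<delta>s) + b x * \<delta>z = 0"
  shows "divg (mixed \<delta> i) x = 0"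
proof -
  obtain as az bs bz where ab: "axi a as az x" "axi b bs bz x" "2 * a x + rsq x * as + bz = 0"
    "az - bs = norm x powr (- \<alpha> - 2) * (n (tau x) / (1 - (tau x)\<^sup>2))" by (rule poloidal_axi[OF x])
  note div = divg_mixed[OF axi_mult[OF d(1) ab(1)] axi_mult[OF d(1) ab(2)]]
  have "4 * (\<delta> x * a x) + rsq x * (\<delta> x * as + \<delta>s * a x) + (\<delta> x * bz + \<delta>z * b x) =
      (a x * (2 * \<delta> x + rsq x * \<delta>s) + b x * \<delta>z) + \<delta> x * (2 * a x + rsq x * as + bz)"
    by (simp add: algebra_simps)
  also have "\<dots> = 0" unfolding d(2) ab(3) by simp
  finally have 0: "4 * (\<delta> x * a x) + rsq x * (\<delta> x * as + \<delta>s * a x) + (\<delta> x * bz + \<delta>z * b x) = 0" .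
  have "divg (mixed \<delta> 1) x = 0" "divg (mixed \<delta> 2) x = 0" "divg (mixed \<delta> 3) x = 0"
    unfolding mixed_eq div 0 by simp_all
  then show ?thesis using exhaust_3[of i] by auto
qed

lemma d_zero:
  assumes "str x = 0" shows "x$1 * d x = 0" "x$2 * d x = 0"
proof -
  have "d x = 0" if "x \<noteq> 0"
  proof -
    have "w (tau x) = 0" using assms that by (simp add: str_def Phi_def)
    then show ?thesis by (simp add: d_def Phi_def D_def \<gamma>_def)
  qed
  then show "x$1 * d x = 0" "x$2 * d x = 0" by (cases "x = 0"; simp)+
qed

lemma fieldT_zero: "str x = 0 \<Longrightarrow> fieldT d x = 0"
  using d_zero[of x] unfolding vec_eq_iff forall_3 by simp

lemma fieldT_damp: "damp e x *\<^sub>R fieldT d x = fieldT (\<lambda>x. damp e x * d x) x"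
  unfolding vec_eq_iff forall_3 by simp

lemma mixed_damp: "damp e x *\<^sub>R mixed d i x = mixed (\<lambda>x. damp e x * d x) i x"
  unfolding mixed_def fieldT_damp[symmetric] by (simp add: scaleR_add_right mult_ac)

text \<open>The stress rows and the poloidal field are C^1 off the axis, so only the axis is cut
  out. The mixed rows and the toroidal field are first damped at the nodes.\<close>

lemma weak_divergence:
  assumes \<psi>: "Ck_on 1 \<psi> UNIV" and L: "compact L" "\<And>x. x \<notin> L \<Longrightarrow> \<psi> x = 0"
  shows "(LINT x|lborel. stress i x \<bullet> grad \<psi> x) = 0" "(LINT x|lborel. mixed d i x \<bullet> grad \<psi> x) = 0"
    "(LINT x|lborel. fieldP a b x \<bullet> grad \<psi> x) = 0" "(LINT x|lborel. fieldT d x \<bullet> grad \<psi> x) = 0"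
proof -
  show "(LINT x|lborel. stress i x \<bullet> grad \<psi> x) = 0"
    by (rule integral_grad_eq_0_off_axis[OF stress_cont stress_C1 stress_divg \<psi> L])
  show "(LINT x|lborel. fieldP a b x \<bullet> grad \<psi> x) = 0"
  proof (rule integral_grad_eq_0_off_axis[OF fieldP_cont fieldP_C1 _ \<psi> L])
    fix x assume "x \<in> - z_axis"
    then show "divg (fieldP a b) x = 0" by (rule poloidal_axi) (simp add: divg_fieldP)
  qed
  show "(LINT x|lborel. fieldT d x \<bullet> grad \<psi> x) = 0"
  proof (rule integral_grad_eq_0_regularized[OF fieldT_cont str_cont fieldT_zero _ _ \<psi> L, folded damp_def])
    show "Ck_on 1 (\<lambda>x. damp e x *\<^sub>R fieldT d x) (- z_axis)" if "e > 0" for e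
      unfolding fieldT_damp unfolding fieldT_def
      by (intro Ck_on_vector3 Ck_on_uminus Ck_on_mult[OF open_off_axis Ck_on_nth_ident[OF open_off_axis]] Ck_on_const open_off_axis damp_d_C1 that)
    show "divg (\<lambda>x. damp e x *\<^sub>R fieldT d x) x = 0" if "e > 0" "x \<in> - z_axis" for e x
      unfolding fieldT_damp by (rule damp_d_axi[OF that(2,1)]) (rule divg_fieldT)
  qed
  show "(LINT x|lborel. mixed d i x \<bullet> grad \<psi> x) = 0"
  proof (rule integral_grad_eq_0_regularized[OF mixed_cont str_cont _ _ _ \<psi> L, folded damp_def])
    show "mixed d i x = 0" if "str x = 0" for x unfolding mixed_def fieldT_zero[OF that] by simp
    show "Ck_on 1 (\<lambda>x. damp e x *\<^sub>R mixed d i x) (- z_axis)" if "e > 0" for e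
      unfolding mixed_damp by (rule mixed_C1[OF damp_d_C1[OF that]])
    show "divg (\<lambda>x. damp e x *\<^sub>R mixed d i x) x = 0" if "e > 0" "x \<in> - z_axis" for e x
      unfolding mixed_damp by (rule damp_d_axi[OF that(2,1)]) (rule mixed_divg[OF that(2)])
  qed
qed

lemma weak_euler: "euler_weak u p"
  unfolding euler_weak_def
proof (intro conjI allI impI)
  fix \<psi> :: "real^3 \<Rightarrow> real" assume T: "test_function \<psi>"
  define L where "L = closure {x. \<psi> x \<noteq> 0}"
  have \<psi>: "Ck_on 1 \<psi> UNIV" and L: "compact L" using T by (auto simp: test_function_def L_def)
  have L0: "\<psi> x = 0" if "x \<notin> L" for x using that closure_subset[of "{x. \<psi> x \<noteq> 0}"] by (auto simp: L_def)
  have oK: "open (- L)" using L by (simp add: compact_imp_closed open_Compl)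
  have z: "grad \<psi> x = 0" if "x \<notin> L" for x using grad_eq_0[OF oK, of x \<psi>] that L0 by simp
  have "integrable lborel (\<lambda>x. fieldP a b x \<bullet> grad \<psi> x)" "integrable lborel (\<lambda>x. fieldT d x \<bullet> grad \<psi> x)"
    by (rule integrable_continuous_compact_support[OF _ L];
        (intro continuous_on_inner fieldP_cont fieldT_cont continuous_on_grad \<psi>)?; simp add: z)+
  then show "(LINT x|lborel. u x \<bullet> grad \<psi> x) = 0"
    unfolding u_def inner_add_left using weak_divergence(3,4)[OF \<psi> L L0] by simp
next
  fix \<phi> :: "real^3 \<Rightarrow> real^3" assume T: "test_function \<phi>"
  define L where "L = closure {x. \<phi> x \<noteq> 0}"
  have \<phi>: "Ck_on 1 \<phi> UNIV" and L: "compact L" using T by (auto simp: test_function_def L_def)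
  \<comment> \<open>Each component of the test field serves as a scalar test function for the
    corresponding row of the tensor.\<close>
  define f where "f i x = \<phi> x $ i" for i x
  have f: "Ck_on 1 (f i) UNIV" for i unfolding f_def by (rule Ck_on_nth[OF open_UNIV \<phi>])
  have "\<phi> x = 0" if "x \<notin> L" for x using that closure_subset[of "{x. \<phi> x \<noteq> 0}"] by (auto simp: L_def)
  then have L0: "f i x = 0" if "x \<notin> L" for i x using that by (simp add: f_def)
  have oK: "open (- L)" using L by (simp add: compact_imp_closed open_Compl)
  have z: "grad (f i) x = 0" if "x \<notin> L" for i x using grad_eq_0[OF oK, of x "f i"] that L0 by simp
  have "\<phi> differentiable (at x)" for x using C1D(1)[OF \<phi> UNIV_I] unfolding differentiable_def by blast
  then have g: "grad (f i) x = (\<chi> j. partial j \<phi> x $ i)" for i x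
    by (simp add: grad_def partial_def f_def[abs_def] frechet_derivative_nth)
  have I: "integrable lborel (\<lambda>x. stress i x \<bullet> grad (f i) x)" "integrable lborel (\<lambda>x. mixed d i x \<bullet> grad (f i) x)" for i
    by (rule integrable_continuous_compact_support[OF _ L];
        (intro continuous_on_inner stress_cont mixed_cont continuous_on_grad f)?; simp add: z)+
  have "(\<Sum>i\<in>UNIV. \<Sum>j\<in>UNIV. u x $ i * u x $ j * partial j \<phi> x $ i) + p x * divg \<phi> x =
      (\<Sum>i\<in>UNIV. stress i x \<bullet> grad (f i) x + mixed d i x \<bullet> grad (f i) x)" for x
    unfolding u_def divg_def g stress_def mixed_def by (rule tensor_split)
  then show "(LINT x|lborel. (\<Sum>i\<in>UNIV. \<Sum>j\<in>UNIV. u x $ i * u x $ j * partial j \<phi> x $ i) + p x * divg \<phi> x) = 0"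
    using I weak_divergence(1,2)[OF f L L0] by simp
qed

text \<open>On the open set off the axis where the stream function is nonzero, \<gamma> is C^1, so
  \<open>u\<close> is classical there, and its curl is nonzero because \<open>n\<close> is.\<close>

lemma rotational: "\<not> irrotational_weak u"
proof -
  define S where "S = - z_axis \<inter> (\<lambda>x. w (tau x)) -` (- {0})"
  define T where "T = {-1<..<1} \<inter> w -` (- {0})"
  have s: "- z_axis \<subseteq> - {0}" using zero_in_z_axis by auto
  have "open S" unfolding S_def
    by (rule continuous_open_preimage[OF continuous_on_subset[OF C0_tau[OF w_cont] s] open_off_axis]) auto
  obtain x0 where x0: "x0 \<in> - z_axis" "w (tau x0) \<noteq> 0" using nonzero_point by blast
  have g: "continuous_on T g"
  proof (rule continuous_on_eq)
    show "continuous_on T (\<lambda>t. (1 + 1 / \<beta>) * \<gamma> t / w t)"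
      by (intro continuous_on_divide continuous_on_mult continuous_on_const continuous_on_subset[OF \<gamma>_cont] continuous_on_subset[OF w_cont])
        (auto simp: T_def)
    show "(1 + 1 / \<beta>) * \<gamma> t / w t = g t" if "t \<in> T" for t
      using that g_w[of t] by (simp add: T_def field_simps)
  qed
  have "Ck_on 1 (\<lambda>x. D (tau x)) S"
  proof (rule C1_compose[where T=T and g=D and g'="\<lambda>t. (g t * w1 t + 2 * t * (\<gamma> t / (1 - t\<^sup>2))) / (1 - t\<^sup>2)", OF \<open>open S\<close>])
    show "(D has_real_derivative (g t * w1 t + 2 * t * (\<gamma> t / (1 - t\<^sup>2))) / (1 - t\<^sup>2)) (at t within T)" if "t \<in> T" for t
    proof -
      have t: "t \<in> {-1<..<1}" "w t \<noteq> 0" using that by (auto simp: T_def)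
      show ?thesis
        using has_field_derivative_at_within[OF quotient_DERIV[OF t(1) d\<gamma>_nonzero[OF t]]] unfolding D_def[abs_def] .
    qed
    show "continuous_on T (\<lambda>t. (g t * w1 t + 2 * t * (\<gamma> t / (1 - t\<^sup>2))) / (1 - t\<^sup>2))"
      by (intro continuous_on_divide continuous_on_add continuous_on_mult continuous_on_diff continuous_on_power continuous_on_const
          continuous_on_id g continuous_on_subset[OF \<gamma>_cont] continuous_on_subset[OF w1_cont])
        (use nz in \<open>auto simp: T_def\<close>)
    show "tau ` S \<subseteq> T" using tau_off_axis unfolding S_def T_def by blast
    show "Ck_on 1 tau S" by (rule Ck_on_subset[OF Ck_tau]) (use s in \<open>auto simp: S_def\<close>)
  qed
  then have "Ck_on 1 d S" unfolding d_def by (rule Phi_C[OF _ \<open>open S\<close>]) (use s in \<open>auto simp: S_def\<close>)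
  then have "Ck_on 1 (fieldT d) S"
    unfolding fieldT_def[abs_def] by (intro Ck_on_vector3 Ck_on_uminus Ck_on_mult Ck_on_nth_ident Ck_on_const \<open>open S\<close>)
  moreover have "Ck_on 1 (fieldP a b) S" by (rule Ck_on_subset[OF fieldP_C1]) (auto simp: S_def)
  ultimately have "Ck_on 1 u S" unfolding u_def[abs_def] by (intro Ck_on_add \<open>open S\<close>)
  moreover have "curl u x0 \<noteq> 0"
    using local_equations(3)[OF x0(1) d\<gamma>_nonzero[OF tau_off_axis[OF x0(1)] x0(2)] n_nonzero[OF x0(2)]] .
  moreover have "x0 \<in> S" using x0 by (simp add: S_def)
  ultimately show ?thesis using rotational_weak[OF \<open>open S\<close>] by blast
qed

lemma weak_solution: "weak_solution \<alpha> u p" "beltrami_weak u p"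
  "poloidal u = fieldP a b" "toroidal u = fieldT d"
proof -
  have "homogeneous_on UNIV \<alpha> u p"
    unfolding homogeneous_on_def by (intro ballI allI impI conjI) (erule homogeneous_aux)+
  then show "weak_solution \<alpha> u p"
    unfolding weak_solution_def using u_cont p_cont weak_euler by blast
  show "beltrami_weak u p" by (simp add: beltrami_weak_def bernoulli_def p_def power2_norm_eq_inner)
  show "poloidal u = fieldP a b" "toroidal u = fieldT d" unfolding u_def[abs_def] poloidal_toroidal by (rule refl)+
qed

end

lemma existence_weak:
  assumes "\<alpha> < 0"
  shows "\<exists>u p. weak_solution \<alpha> u p \<and> beltrami_weak u p \<and> \<not> irrotational_weak u \<and>
    axisymmetric_on UNIV u p \<and> Ck_on 1 (poloidal u) (-z_axis) \<and> continuous_on UNIV (poloidal u) \<and>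
    Ck_on 1 p (-z_axis) \<and> continuous_on UNIV p \<and> continuous_on UNIV (toroidal u)"
proof -
  define \<beta> where "\<beta> = \<alpha> - 2"
  have \<beta>: "\<beta> < -2" using assms by (simp add: \<beta>_def)
  have "\<beta> * (\<beta> + 1) > 0" by (rule mult_neg_neg) (use \<beta> in auto)
  moreover have "2 / \<beta> > 0 \<or> (-1 < 2 / \<beta> \<and> 2 / \<beta> < 0)" using \<beta> by (auto simp: field_simps)
  ultimately
  obtain w w1 \<kappa> K where P: "prof (\<beta> * (\<beta> + 1)) (2 / \<beta>) (-1) 1 w w1 \<kappa> K"
    by (rule profile_exists)
  interpret homog_profile_neg \<beta> w w1 \<kappa> K using P \<beta> by unfold_locales auto
  have "homog_profile.\<alpha> \<beta> = \<alpha>" by (simp add: \<alpha>_def) (simp add: \<beta>_def)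
  then show ?thesis
    using weak_solution(1,2) rotational axisymmetric fieldP_C1 fieldP_cont p_C1 p_cont fieldT_cont
    unfolding weak_solution(3,4)[symmetric] by metis
qed

theorem theorem1p1:
  shows
    "(\<forall>\<alpha>::real. 1 \<le> \<alpha> \<and> \<alpha> \<le> 2 \<longrightarrow>
        \<not> (\<exists>u p. classical_solution 1 \<alpha> u p \<and> beltrami_classical u \<and> \<not> irrotational_classical u))
   \<and> (\<forall>\<alpha>::real. \<alpha> < 1 \<longrightarrow>
        \<not> (\<exists>u p. classical_solution 2 \<alpha> u p \<and> beltrami_classical u \<and> \<not> irrotational_classical u))
   \<and> (\<forall>\<alpha>::real. \<alpha> > 2 \<longrightarrow>
        (\<exists>u p. classical_solution 1 \<alpha> u p \<and> beltrami_classical u \<and> \<not> irrotational_classical u \<and>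
               axisymmetric_on (-{0}) u p \<and>
               Ck_on 2 (poloidal u) (-{0}) \<and> Ck_on 2 p (-{0}) \<and> Ck_on 1 (toroidal u) (-{0})))
   \<and> (\<forall>\<alpha>::real. \<alpha> < 0 \<longrightarrow>
        (\<exists>u p. weak_solution \<alpha> u p \<and> beltrami_weak u p \<and> \<not> irrotational_weak u \<and>
               axisymmetric_on UNIV u p \<and>
               Ck_on 1 (poloidal u) (-z_axis) \<and> continuous_on UNIV (poloidal u) \<and>
               Ck_on 1 p (-z_axis) \<and> continuous_on UNIV p \<and>
               continuous_on UNIV (toroidal u)))"
  using nonexistence_low nonexistence_C2 existence_classical existence_weak by blast

end
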